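(* Let $f:\Sigma\to\mathcal{Z}$ be an umbilic-free Legendre map and $\mathfrak{q}_\infty\in\mathbb{R}^{4,2}$ a non-zero lightlike vector. (i) If $f$ is a special $\Omega$-surface of type $1$ whose middle pencil admits a polynomial conserved quantity $p(t)=p_0+tp_1$ of degree $1$ with $p(0)=\mathfrak{q}_\infty$ and $(p(t),p(t))=0$ for all $t$, then $f$ projects to an $L$-isothermic surface in the Laguerre geometry defined by $\mathfrak{q}_\infty$ (for any choice of point sphere complex $\mathfrak{p}\perp\mathfrak{q}_\infty$ with $(\mathfrak{p},\mathfrak{p})=-1$). (ii) Conversely, if $f$ projects to an $L$-isothermic surface in the Laguerre geometry defined by $\mathfrak{q}_\infty$, then $f$ is a special $\Omega$-surface of type $1$ (with respect to some gauge potential) whose middle pencil admits a degree $1$ polynomial conserved quantity $p$ with $p(0)=\mathfrak{q}_\infty$ and $(p(t),p(t))=0$ for all $t$.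
   Context: $\mathbb{R}^{4,2}$ is a 6-dimensional real vector space with a non-degenerate symmetric bilinear form $(\,,\,)$ of signature $(4,2)$, $\mathcal{L}$ its lightcone; $\wedge^2\mathbb{R}^{4,2}\cong\mathfrak{o}(4,2)$ via $a\wedge b\,(c)=(a,c)b-(b,c)a$. $\Sigma$ is a smooth 2-manifold, $\underline{\mathbb{R}}^{4,2}=\Sigma\times\mathbb{R}^{4,2}$, $d$ its trivial connection; $W^{(1)}$ is spanned by sections of a subbundle $W$ and their derivatives. $\mathcal{Z}$ is the Grassmannian of isotropic 2-dimensional subspaces; a smooth $f:\Sigma\to\mathcal{Z}$ (a rank 2 subbundle) is a Legendre map if $f^{(1)}\le f^\perp$ and no non-zero $X\in T\Sigma$ satisfies $d_X\sigma\in f$ for all $\sigma\in\Gamma f$. A curvature sphere at $p$ is a line $s(p)\le f(p)$ killed by $\sigma\mapsto d_X\sigma\bmod f$ for all $X$ in some non-zero (maximal) subspace $T_{s(p)}\le T_p\Sigma$. $f$ is umbilic-free if there are exactly two curvature spheres at each point, forming rank 1 bundles $s_1,s_2$ with curvature subbundles $T_1,T_2$. A gauge potential is a closed $\eta\in\Omega^1(f\wedge f^\perp)$ with $[\eta\wedge\eta]=0$ such that $q(X,Y)=\mathrm{tr}(\sigma\mapsto\eta(X)d_Y\sigma:f\to f)$ is non-zero; $f$ is an $\Omega$-surface if $q$ is non-degenerate on a dense open set. Standing assumption: $q$ has constant signature. The gauge orbit is $\{\eta-d\tau:\tau\in\Gamma(\wedge^2f)\}$. With $S_1=\langle\sigma_1,d_Y\sigma_1,d_Yd_Y\sigma_1\rangle$,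 $S_2=\langle\sigma_2,d_X\sigma_2,d_Xd_X\sigma_2\rangle$ ($\sigma_i\in\Gamma s_i$, $X\in\Gamma T_1$, $Y\in\Gamma T_2$), the middle potential $\eta^{mid}$ is the unique member of the gauge orbit whose $S_1\wedge S_2$-component takes values in $\wedge^2f$; the middle pencil is $\{d+t\eta^{mid}\}_{t\in\mathbb{R}}$. A polynomial conserved quantity is a non-zero polynomial $p(t)=\sum_kp_kt^k$, $p_k\in\Gamma\underline{\mathbb{R}}^{4,2}$, with $(d+t\eta^{mid})p(t)=0$ for all $t$. A special $\Omega$-surface of type $d$ is an umbilic-free $\Omega$-surface whose middle pencil admits a polynomial conserved quantity of degree $d$. Laguerre geometry: given $\mathfrak{q}_\infty$, choose $\mathfrak{q}_0\in\mathcal{L}$ with $(\mathfrak{q}_0,\mathfrak{q}_\infty)=-1$ and $\mathfrak{p}\in\langle\mathfrak{q}_0,\mathfrak{q}_\infty\rangle^\perp$ with $(\mathfrak{p},\mathfrak{p})=-1$; then $\langle\mathfrak{q}_0,\mathfrak{q}_\infty,\mathfrak{p}\rangle^\perp\cong\mathbb{R}^3$. $f$ projects to a surface $x:\Sigma\to\mathbb{R}^3$ with unit normal $n:\Sigma\to S^2$ if $f=\langle\mathfrak{f},\mathfrak{t}\rangle$ with $\mathfrak{f}=x+\mathfrak{q}_0+\frac12(x,x)\mathfrak{q}_\infty$ (the section of $f$ with $(\mathfrak{f},\mathfrak{q}_\infty)=-1$, $(\mathfrak{f},\mathfrak{p})=0$) and $\mathfrak{t}=n+\mathfrak{p}+(n,x)\mathfrak{q}_\infty$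 (the section with $(\mathfrak{t},\mathfrak{q}_\infty)=0$, $(\mathfrak{t},\mathfrak{p})=-1$). $x$ is $L$-isothermic if its third fundamental form $I\!I\!I=(dn,dn)$ is non-degenerate and there is a non-zero quadratic differential $q$, holomorphic with respect to the complex structure of $I\!I\!I$ (i.e. $q$ is real, trace-free with respect to $I\!I\!I$ and $q^{2,0}$ is holomorphic), commuting with the second fundamental form $I\!I=-(dx,dn)$, i.e. $I\!I^{2,0}=\mu\,q^{2,0}$ for a real function $\mu$; equivalently $x$ admits curvature line coordinates that are conformal for $I\!I\!I$. *)

theory Defs
  imports "HOL-Analysis.Analysis"
begin

section \<open>Smooth maps and smooth surfaces\<close>

primrec Ck_on :: "nat \<Rightarrow> 'a::euclidean_space set \<Rightarrow> ('a \<Rightarrow> 'b::real_normed_vector) \<Rightarrow> bool" where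
  "Ck_on 0 S g \<longleftrightarrow> continuous_on S g"
| "Ck_on (Suc k) S g \<longleftrightarrow> (\<forall>x\<in>S. g differentiable at x) \<and>
     (\<forall>v. Ck_on k S (\<lambda>x. frechet_derivative g (at x) v))"

text \<open>This is used for open \<open>S\<close> only.\<close>

definition smooth_on :: "'a::euclidean_space set \<Rightarrow> ('a \<Rightarrow> 'b::real_normed_vector) \<Rightarrow> bool" where
  "smooth_on S g \<longleftrightarrow> (\<forall>k. Ck_on k S g)"

text \<open>The surface is a whole type \<open>'m\<close>, Hausdorff and second countable by its sort, with an
  atlas. A chart is a pair of its domain and its coordinate map.\<close>

type_synonym 'm chart = "'m set \<times> ('m \<Rightarrow> real ^ 2)"

definition chart_inv :: "'m chart \<Rightarrow> real ^ 2 \<Rightarrow> 'm" where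
  "chart_inv c = inv_into (fst c) (snd c)"

definition is_chart :: "'m::topological_space chart \<Rightarrow> bool" where
  "is_chart c \<longleftrightarrow> open (fst c) \<and> open (snd c ` fst c) \<and>
     homeomorphism (fst c) (snd c ` fst c) (snd c) (chart_inv c)"

definition compatible :: "'m chart \<Rightarrow> 'm chart \<Rightarrow> bool" where
  "compatible c c' \<longleftrightarrow>
     smooth_on (snd c ` (fst c \<inter> fst c')) (snd c' \<circ> chart_inv c) \<and>
     smooth_on (snd c' ` (fst c \<inter> fst c')) (snd c \<circ> chart_inv c')"

definition smooth_surface ::
  "'m::{t2_space, second_countable_topology} chart set \<Rightarrow> bool" where
  "smooth_surface A \<longleftrightarrow> (\<forall>c\<in>A. is_chart c) \<and> (\<Union>c\<in>A. fst c) = UNIV \<and>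
     (\<forall>c\<in>A. \<forall>c'\<in>A. compatible c c')"

text \<open>The charts of the maximal atlas containing \<open>A\<close>.\<close>

definition admissible_chart :: "'m::topological_space chart set \<Rightarrow> 'm chart \<Rightarrow> bool" where
  "admissible_chart A c \<longleftrightarrow> is_chart c \<and> (\<forall>c'\<in>A. compatible c c')"

definition smooth_map ::
  "'m::topological_space chart set \<Rightarrow> 'm set \<Rightarrow> ('m \<Rightarrow> 'w::real_normed_vector) \<Rightarrow> bool" where
  "smooth_map A U g \<longleftrightarrow> (\<forall>c\<in>A. smooth_on (snd c ` (fst c \<inter> U)) (g \<circ> chart_inv c))"

text \<open>A tangent vector at \<open>x\<close> is given by its components in one chart \<open>chart_at A x\<close> around
  \<open>x\<close>, chosen once and for all. Every tangent space is thus the type \<^typ>\<open>real ^ 2\<close>, but this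
  identification need not depend continuously on \<open>x\<close>: smoothness of vector fields and forms is
  expressed with the components in the charts of the atlas.\<close>

definition chart_at :: "'m chart set \<Rightarrow> 'm \<Rightarrow> 'm chart" where
  "chart_at A x = (SOME c. c \<in> A \<and> x \<in> fst c)"

text \<open>\<open>dif A g x X\<close> is \<open>d\<^sub>X g\<close> at \<open>x\<close>.\<close>

definition dif ::
  "'m chart set \<Rightarrow> ('m \<Rightarrow> 'w::real_normed_vector) \<Rightarrow> 'm \<Rightarrow> real ^ 2 \<Rightarrow> 'w" where
  "dif A g x X =
     frechet_derivative (g \<circ> chart_inv (chart_at A x)) (at (snd (chart_at A x) x)) X"

text \<open>The tangent vector at \<open>x\<close> with components \<open>v\<close> in the chart \<open>c\<close>.\<close>

definition coord_vec :: "'m chart set \<Rightarrow> 'm chart \<Rightarrow> real ^ 2 \<Rightarrow> 'm \<Rightarrow> real ^ 2" where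
  "coord_vec A c v x =
     frechet_derivative (snd (chart_at A x) \<circ> chart_inv c) (at (snd c x)) v"

text \<open>\<open>dif A (snd c) x (X x)\<close> are the components of \<open>X x\<close> in the chart \<open>c\<close>.\<close>

definition smooth_vector_field ::
  "'m::topological_space chart set \<Rightarrow> 'm set \<Rightarrow> ('m \<Rightarrow> real ^ 2) \<Rightarrow> bool" where
  "smooth_vector_field A U X \<longleftrightarrow>
     (\<forall>c\<in>A. smooth_map A (U \<inter> fst c) (\<lambda>x. dif A (snd c) x (X x)))"

definition smooth_one_form ::
  "'m::topological_space chart set \<Rightarrow> ('m \<Rightarrow> real ^ 2 \<Rightarrow> 'w::real_normed_vector) \<Rightarrow> bool" where
  "smooth_one_form A \<eta> \<longleftrightarrow> (\<forall>x. linear (\<eta> x)) \<and>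
     (\<forall>c\<in>A. \<forall>v. smooth_map A (fst c) (\<lambda>x. \<eta> x (coord_vec A c v x)))"

text \<open>\<open>d\<eta>(V, W) = d\<^sub>V(\<eta> W) - d\<^sub>W(\<eta> V) - \<eta>[V, W]\<close>, for coordinate vector fields, which commute.\<close>

definition closed_one_form ::
  "'m chart set \<Rightarrow> ('m \<Rightarrow> real ^ 2 \<Rightarrow> 'w::real_normed_vector) \<Rightarrow> bool" where
  "closed_one_form A \<eta> \<longleftrightarrow> (\<forall>c\<in>A. \<forall>x\<in>fst c. \<forall>v w.
     dif A (\<lambda>y. \<eta> y (coord_vec A c w y)) x (coord_vec A c v x) =
     dif A (\<lambda>y. \<eta> y (coord_vec A c v y)) x (coord_vec A c w x))"

definition sections ::
  "'m::topological_space chart set \<Rightarrow> ('m \<Rightarrow> 'v::real_normed_vector set) \<Rightarrow> 'm set \<Rightarrow> ('m \<Rightarrow> 'v) set"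
  where "sections A W U = {\<sigma>. smooth_map A U \<sigma> \<and> (\<forall>x\<in>U. \<sigma> x \<in> W x)}"

definition local_sections ::
  "'m::topological_space chart set \<Rightarrow> ('m \<Rightarrow> 'v::real_normed_vector set) \<Rightarrow> 'm \<Rightarrow> ('m \<Rightarrow> 'v) set"
  where "local_sections A W x = {\<sigma>. \<exists>U. open U \<and> x \<in> U \<and> \<sigma> \<in> sections A W U}"

definition subbundle ::
  "'m::topological_space chart set \<Rightarrow> nat \<Rightarrow> ('m \<Rightarrow> 'v::real_normed_vector set) \<Rightarrow> bool" where
  "subbundle A r W \<longleftrightarrow> (\<forall>x. subspace (W x) \<and> dim (W x) = r) \<and>
     (\<forall>x. \<exists>U s. open U \<and> x \<in> U \<and> (\<forall>i<r. smooth_map A U (s i)) \<and>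
        (\<forall>y\<in>U. W y = span ((\<lambda>i. s i y) ` {..<r})))"

definition derived_bundle ::
  "'m::topological_space chart set \<Rightarrow> ('m \<Rightarrow> 'v::real_normed_vector set) \<Rightarrow> 'm \<Rightarrow> 'v set" where
  "derived_bundle A W x =
     span {v. \<exists>\<sigma>\<in>local_sections A W x. v = \<sigma> x \<or> (\<exists>X. v = dif A \<sigma> x X)}"


section \<open>Bilinear forms and the exterior square\<close>

definition symmetric_bilinear :: "('a::real_vector \<Rightarrow> 'a \<Rightarrow> real) \<Rightarrow> bool" where
  "symmetric_bilinear b \<longleftrightarrow>
     (\<forall>x. linear (b x)) \<and> (\<forall>y. linear (\<lambda>x. b x y)) \<and> (\<forall>x y. b x y = b y x)"

text \<open>The form may be degenerate; \<open>Z\<close> spans its radical.\<close>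

definition has_signature :: "('a::euclidean_space \<Rightarrow> 'a \<Rightarrow> real) \<Rightarrow> nat \<Rightarrow> nat \<Rightarrow> bool" where
  "has_signature b r s \<longleftrightarrow> symmetric_bilinear b \<and>
     (\<exists>P N Z. card P = r \<and> card N = s \<and>
        P \<inter> N = {} \<and> P \<inter> Z = {} \<and> N \<inter> Z = {} \<and>
        independent (P \<union> N \<union> Z) \<and> span (P \<union> N \<union> Z) = UNIV \<and>
        pairwise (\<lambda>x y. b x y = 0) (P \<union> N \<union> Z) \<and>
        (\<forall>x\<in>P. b x x = 1) \<and> (\<forall>x\<in>N. b x x = -1) \<and> (\<forall>x\<in>Z. b x x = 0))"

definition nondegenerate :: "('a::real_vector \<Rightarrow> 'a \<Rightarrow> real) \<Rightarrow> bool" where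
  "nondegenerate b \<longleftrightarrow> (\<forall>x. (\<forall>y. b x y = 0) \<longrightarrow> x = 0)"

text \<open>The norm of \<open>'v\<close> only provides the topology; the geometry is that of \<open>B\<close>.\<close>

definition lie_sphere_form :: "('v::euclidean_space \<Rightarrow> 'v \<Rightarrow> real) \<Rightarrow> bool" where
  "lie_sphere_form B \<longleftrightarrow> DIM('v) = 6 \<and> nondegenerate B \<and> has_signature B 4 2"

definition perp :: "('v \<Rightarrow> 'v \<Rightarrow> real) \<Rightarrow> 'v set \<Rightarrow> 'v set" where
  "perp B W = {v. \<forall>w\<in>W. B v w = 0}"

text \<open>Elements of the exterior square are skew endomorphisms of \<open>'v\<close>.\<close>

definition wedge :: "('v::euclidean_space \<Rightarrow> 'v \<Rightarrow> real) \<Rightarrow> 'v \<Rightarrow> 'v \<Rightarrow> 'v \<Rightarrow>\<^sub>L 'v" where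
  "wedge B a b = Blinfun (\<lambda>c. B a c *\<^sub>R b - B b c *\<^sub>R a)"

lemma wedge_apply:
  assumes "symmetric_bilinear B"
  shows "blinfun_apply (wedge B a b) c = B a c *\<^sub>R b - B b c *\<^sub>R a"
proof -
  have l: "linear (B x)" for x
    using assms by (simp add: symmetric_bilinear_def)
  have "linear (\<lambda>c. B a c *\<^sub>R b - B b c *\<^sub>R a)"
    by (rule linearI) (simp_all add: linear_add[OF l] linear_cmul[OF l] algebra_simps)
  then have "bounded_linear (\<lambda>c. B a c *\<^sub>R b - B b c *\<^sub>R a)"
    by (simp add: linear_conv_bounded_linear)
  then show ?thesis
    by (simp add: wedge_def bounded_linear_Blinfun_apply)
qed

definition wedge_space ::
  "('v::euclidean_space \<Rightarrow> 'v \<Rightarrow> real) \<Rightarrow> 'v set \<Rightarrow> 'v set \<Rightarrow> ('v \<Rightarrow>\<^sub>L 'v) set" where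
  "wedge_space B V W = span {wedge B a b | a b. a \<in> V \<and> b \<in> W}"

definition trace_on :: "'v::real_vector set \<Rightarrow> ('v \<Rightarrow> 'v) \<Rightarrow> real" where
  "trace_on W T =
     (let E = (SOME E. independent E \<and> span E = W) in \<Sum>e\<in>E. representation E (T e) e)"


section \<open>Legendre maps and curvature spheres\<close>

definition legendre_map ::
  "'m::topological_space chart set \<Rightarrow> ('v::euclidean_space \<Rightarrow> 'v \<Rightarrow> real) \<Rightarrow> ('m \<Rightarrow> 'v set) \<Rightarrow> bool"
  where "legendre_map A B f \<longleftrightarrow> subbundle A 2 f \<and>
     (\<forall>x. \<forall>v\<in>f x. \<forall>w\<in>f x. B v w = 0) \<and>
     (\<forall>x. derived_bundle A f x \<subseteq> perp B (f x)) \<and>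
     (\<forall>x X. (\<forall>\<sigma>\<in>local_sections A f x. dif A \<sigma> x X \<in> f x) \<longrightarrow> X = 0)"

text \<open>The maximal space of tangent vectors \<open>X\<close> for which \<open>\<sigma> \<mapsto> d\<^sub>X \<sigma> mod f\<close>, which is tensorial
  on \<open>f\<close>, kills \<open>L \<le> f x\<close>.\<close>

definition curvature_space ::
  "'m::topological_space chart set \<Rightarrow> ('m \<Rightarrow> 'v::real_normed_vector set) \<Rightarrow> 'm \<Rightarrow> 'v set \<Rightarrow> (real ^ 2) set"
  where "curvature_space A f x L =
     {X. \<forall>\<sigma>\<in>local_sections A f x. \<sigma> x \<in> L \<longrightarrow> dif A \<sigma> x X \<in> f x}"

definition curvature_sphere ::
  "'m::topological_space chart set \<Rightarrow> ('m \<Rightarrow> 'v::real_normed_vector set) \<Rightarrow> 'm \<Rightarrow> 'v set \<Rightarrow> bool" where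
  "curvature_sphere A f x L \<longleftrightarrow> subspace L \<and> dim L = 1 \<and> L \<subseteq> f x \<and>
     (\<exists>X\<in>curvature_space A f x L. X \<noteq> 0)"

definition curvature_sphere_bundles ::
  "'m::topological_space chart set \<Rightarrow> ('m \<Rightarrow> 'v::real_normed_vector set) \<Rightarrow>
     ('m \<Rightarrow> 'v set) \<Rightarrow> ('m \<Rightarrow> 'v set) \<Rightarrow> bool" where
  "curvature_sphere_bundles A f s1 s2 \<longleftrightarrow> subbundle A 1 s1 \<and> subbundle A 1 s2 \<and>
     (\<forall>x. s1 x \<noteq> s2 x \<and> {L. curvature_sphere A f x L} = {s1 x, s2 x})"

definition umbilic_free ::
  "'m::topological_space chart set \<Rightarrow> ('m \<Rightarrow> 'v::real_normed_vector set) \<Rightarrow> bool" where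
  "umbilic_free A f \<longleftrightarrow> (\<exists>s1 s2. curvature_sphere_bundles A f s1 s2)"


section \<open>Gauge potentials and \<open>\<Omega>\<close>-surfaces\<close>

text \<open>\<open>q(X, Y) = tr (\<sigma> \<mapsto> \<eta>(X) d\<^sub>Y \<sigma> : f \<rightarrow> f)\<close>. Since \<open>\<eta>(X)\<close> kills \<open>f\<close>, the value at
  \<open>v \<in> f x\<close> does not depend on the section \<open>\<sigma>\<close> through \<open>v\<close>.\<close>

definition gauge_quadratic ::
  "'m::topological_space chart set \<Rightarrow> ('m \<Rightarrow> 'v::euclidean_space set) \<Rightarrow>
     ('m \<Rightarrow> real ^ 2 \<Rightarrow> ('v \<Rightarrow>\<^sub>L 'v)) \<Rightarrow> 'm \<Rightarrow> real ^ 2 \<Rightarrow> real ^ 2 \<Rightarrow> real" where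
  "gauge_quadratic A f \<eta> x X Y = trace_on (f x)
     (\<lambda>v. blinfun_apply (\<eta> x X) (dif A (SOME \<sigma>. \<sigma> \<in> local_sections A f x \<and> \<sigma> x = v) x Y))"

text \<open>\<open>[\<eta> \<and> \<eta>](X, Y) = 2 [\<eta>(X), \<eta>(Y)]\<close>.\<close>

definition gauge_potential ::
  "'m::topological_space chart set \<Rightarrow> ('v::euclidean_space \<Rightarrow> 'v \<Rightarrow> real) \<Rightarrow> ('m \<Rightarrow> 'v set) \<Rightarrow>
     ('m \<Rightarrow> real ^ 2 \<Rightarrow> ('v \<Rightarrow>\<^sub>L 'v)) \<Rightarrow> bool" where
  "gauge_potential A B f \<eta> \<longleftrightarrow> smooth_one_form A \<eta> \<and>
     (\<forall>x X. \<eta> x X \<in> wedge_space B (f x) (perp B (f x))) \<and>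
     closed_one_form A \<eta> \<and>
     (\<forall>x X Y. \<eta> x X o\<^sub>L \<eta> x Y - \<eta> x Y o\<^sub>L \<eta> x X = 0) \<and>
     (\<exists>x X Y. gauge_quadratic A f \<eta> x X Y \<noteq> 0)"

text \<open>The last clause is the standing assumption that \<open>q\<close> has constant signature.\<close>

definition Omega_surface ::
  "'m::topological_space chart set \<Rightarrow> ('v::euclidean_space \<Rightarrow> 'v \<Rightarrow> real) \<Rightarrow> ('m \<Rightarrow> 'v set) \<Rightarrow>
     ('m \<Rightarrow> real ^ 2 \<Rightarrow> ('v \<Rightarrow>\<^sub>L 'v)) \<Rightarrow> bool" where
  "Omega_surface A B f \<eta> \<longleftrightarrow> legendre_map A B f \<and> gauge_potential A B f \<eta> \<and>
     (\<exists>D. open D \<and> closure D = UNIV \<and> (\<forall>x\<in>D. nondegenerate (gauge_quadratic A f \<eta> x))) \<and>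
     (\<exists>r s. \<forall>x. has_signature (gauge_quadratic A f \<eta> x) r s)"

definition gauge_orbit ::
  "'m::topological_space chart set \<Rightarrow> ('v::euclidean_space \<Rightarrow> 'v \<Rightarrow> real) \<Rightarrow> ('m \<Rightarrow> 'v set) \<Rightarrow>
     ('m \<Rightarrow> real ^ 2 \<Rightarrow> ('v \<Rightarrow>\<^sub>L 'v)) \<Rightarrow> ('m \<Rightarrow> real ^ 2 \<Rightarrow> ('v \<Rightarrow>\<^sub>L 'v)) set" where
  "gauge_orbit A B f \<eta> =
     {(\<lambda>x X. \<eta> x X - dif A \<tau> x X) | \<tau>. \<tau> \<in> sections A (\<lambda>x. wedge_space B (f x) (f x)) UNIV}"

text \<open>By the Leibniz rule all nonvanishing \<open>\<sigma> \<in> \<Gamma>s\<close> and \<open>Y \<in> \<Gamma>T\<close> give the same span of \<open>\<sigma>\<close>,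
  \<open>d\<^sub>Y \<sigma>\<close> and \<open>d\<^sub>Y d\<^sub>Y \<sigma>\<close>.\<close>

definition lie_cyclide ::
  "'m::topological_space chart set \<Rightarrow> ('m \<Rightarrow> 'v::real_normed_vector set) \<Rightarrow> ('m \<Rightarrow> (real ^ 2) set) \<Rightarrow>
     'm \<Rightarrow> 'v set" where
  "lie_cyclide A s T x = span {v. \<exists>U \<sigma> Y. open U \<and> x \<in> U \<and> \<sigma> \<in> sections A s U \<and>
     smooth_vector_field A U Y \<and> (\<forall>y\<in>U. Y y \<in> T y) \<and>
     (v = \<sigma> x \<or> v = dif A \<sigma> x (Y x) \<or> v = dif A (\<lambda>y. dif A \<sigma> y (Y y)) x (Y x))}"

text \<open>\<open>\<beta>\<close> is the component in \<open>S\<^sub>1 \<and> S\<^sub>2\<close> of \<open>\<zeta> x X\<close>, with respect to the splitting of the exterior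
  square induced by \<open>S\<^sub>1 \<oplus> S\<^sub>2 = 'v\<close>. The condition is symmetric in \<open>s1\<close> and \<open>s2\<close>.\<close>

definition middle_potential ::
  "'m::topological_space chart set \<Rightarrow> ('v::euclidean_space \<Rightarrow> 'v \<Rightarrow> real) \<Rightarrow> ('m \<Rightarrow> 'v set) \<Rightarrow>
     ('m \<Rightarrow> real ^ 2 \<Rightarrow> ('v \<Rightarrow>\<^sub>L 'v)) \<Rightarrow> ('m \<Rightarrow> real ^ 2 \<Rightarrow> ('v \<Rightarrow>\<^sub>L 'v)) \<Rightarrow> bool" where
  "middle_potential A B f \<eta> \<zeta> \<longleftrightarrow> \<zeta> \<in> gauge_orbit A B f \<eta> \<and>
     (\<exists>s1 s2. curvature_sphere_bundles A f s1 s2 \<and>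
       (\<forall>x X.
         let S1 = lie_cyclide A s1 (\<lambda>y. curvature_space A f y (s2 y)) x;
             S2 = lie_cyclide A s2 (\<lambda>y. curvature_space A f y (s1 y)) x
         in \<exists>\<alpha>1 \<alpha>2 \<beta>. \<zeta> x X = \<alpha>1 + \<alpha>2 + \<beta> \<and>
              \<alpha>1 \<in> wedge_space B S1 S1 \<and> \<alpha>2 \<in> wedge_space B S2 S2 \<and>
              \<beta> \<in> wedge_space B S1 S2 \<and> \<beta> \<in> wedge_space B (f x) (f x)))"

text \<open>A polynomial \<open>p(t) = \<Sum>\<^sub>k t\<^sup>k p\<^sub>k\<close> is given by its coefficients \<open>p\<^sub>k\<close>.\<close>

definition poly_section :: "(nat \<Rightarrow> 'm \<Rightarrow> 'v::real_vector) \<Rightarrow> nat \<Rightarrow> real \<Rightarrow> 'm \<Rightarrow> 'v" where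
  "poly_section p d t x = (\<Sum>k\<le>d. t ^ k *\<^sub>R p k x)"

definition conserved_quantity ::
  "'m::topological_space chart set \<Rightarrow> ('m \<Rightarrow> real ^ 2 \<Rightarrow> ('v::euclidean_space \<Rightarrow>\<^sub>L 'v)) \<Rightarrow> nat \<Rightarrow>
     (nat \<Rightarrow> 'm \<Rightarrow> 'v) \<Rightarrow> bool" where
  "conserved_quantity A \<zeta> d p \<longleftrightarrow> (\<forall>k. smooth_map A UNIV (p k)) \<and>
     p d \<noteq> (\<lambda>_. 0) \<and> (\<forall>k>d. p k = (\<lambda>_. 0)) \<and>
     (\<forall>t x X. dif A (poly_section p d t) x X +
        t *\<^sub>R blinfun_apply (\<zeta> x X) (poly_section p d t x) = 0)"

definition middle_conserved_quantity ::
  "'m::topological_space chart set \<Rightarrow> ('v::euclidean_space \<Rightarrow> 'v \<Rightarrow> real) \<Rightarrow> ('m \<Rightarrow> 'v set) \<Rightarrow>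
     ('m \<Rightarrow> real ^ 2 \<Rightarrow> ('v \<Rightarrow>\<^sub>L 'v)) \<Rightarrow> nat \<Rightarrow> (nat \<Rightarrow> 'm \<Rightarrow> 'v) \<Rightarrow> bool" where
  "middle_conserved_quantity A B f \<eta> d p \<longleftrightarrow>
     (\<exists>\<zeta>. middle_potential A B f \<eta> \<zeta> \<and> conserved_quantity A \<zeta> d p)"

definition special_Omega_surface ::
  "'m::topological_space chart set \<Rightarrow> ('v::euclidean_space \<Rightarrow> 'v \<Rightarrow> real) \<Rightarrow> ('m \<Rightarrow> 'v set) \<Rightarrow>
     ('m \<Rightarrow> real ^ 2 \<Rightarrow> ('v \<Rightarrow>\<^sub>L 'v)) \<Rightarrow> nat \<Rightarrow> bool" where
  "special_Omega_surface A B f \<eta> d \<longleftrightarrow> umbilic_free A f \<and> Omega_surface A B f \<eta> \<and>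
     (\<exists>p. middle_conserved_quantity A B f \<eta> d p)"


section \<open>Laguerre geometry and \<open>L\<close>-isothermic surfaces\<close>

definition laguerre_frame ::
  "('v::real_vector \<Rightarrow> 'v \<Rightarrow> real) \<Rightarrow> 'v \<Rightarrow> 'v \<Rightarrow> 'v \<Rightarrow> bool" where
  "laguerre_frame B qinf q0 pp \<longleftrightarrow> B q0 q0 = 0 \<and> B q0 qinf = -1 \<and>
     B pp q0 = 0 \<and> B pp qinf = 0 \<and> B pp pp = -1"

text \<open>Euclidean 3-space is \<open>perp B {q0, qinf, pp}\<close> with the restriction of \<open>B\<close>. The point map
  \<open>x\<close> is not required to be an immersion.\<close>

definition projects_to ::
  "'m::topological_space chart set \<Rightarrow> ('v::real_normed_vector \<Rightarrow> 'v \<Rightarrow> real) \<Rightarrow> 'v \<Rightarrow> 'v \<Rightarrow> 'v \<Rightarrow>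
     ('m \<Rightarrow> 'v set) \<Rightarrow> ('m \<Rightarrow> 'v) \<Rightarrow> ('m \<Rightarrow> 'v) \<Rightarrow> bool" where
  "projects_to A B qinf q0 pp f x n \<longleftrightarrow> smooth_map A UNIV x \<and> smooth_map A UNIV n \<and>
     (\<forall>m. x m \<in> perp B {q0, qinf, pp} \<and> n m \<in> perp B {q0, qinf, pp} \<and> B (n m) (n m) = 1) \<and>
     (\<forall>m X. B (dif A x m X) (n m) = 0) \<and>
     (\<forall>m. f m = span {x m + q0 + (B (x m) (x m) / 2) *\<^sub>R qinf, n m + pp + B (n m) (x m) *\<^sub>R qinf})"

definition second_ff ::
  "'m chart set \<Rightarrow> ('v::real_normed_vector \<Rightarrow> 'v \<Rightarrow> real) \<Rightarrow> ('m \<Rightarrow> 'v) \<Rightarrow> ('m \<Rightarrow> 'v) \<Rightarrow>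
     'm \<Rightarrow> real ^ 2 \<Rightarrow> real ^ 2 \<Rightarrow> real" where
  "second_ff A B x n m X Y = - B (dif A x m X) (dif A n m Y)"

definition third_ff ::
  "'m chart set \<Rightarrow> ('v::real_normed_vector \<Rightarrow> 'v \<Rightarrow> real) \<Rightarrow> ('m \<Rightarrow> 'v) \<Rightarrow>
     'm \<Rightarrow> real ^ 2 \<Rightarrow> real ^ 2 \<Rightarrow> real" where
  "third_ff A B n m X Y = B (dif A n m X) (dif A n m Y)"

text \<open>For the semi-definite forms \<open>g\<close> considered here, \<open>e1\<close> and \<open>e2\<close> are orthonormal up to a
  common scale, that is, \<open>e2 = J e1\<close> for one of the two complex structures \<open>J\<close> of \<open>g\<close>.\<close>

definition conformal_frame ::
  "(real ^ 2 \<Rightarrow> real ^ 2 \<Rightarrow> real) \<Rightarrow> real ^ 2 \<Rightarrow> real ^ 2 \<Rightarrow> bool" where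
  "conformal_frame g e1 e2 \<longleftrightarrow> g e1 e2 = 0 \<and> g e1 e1 = g e2 e2 \<and> g e1 e1 \<noteq> 0"

definition trace_free ::
  "(real ^ 2 \<Rightarrow> real ^ 2 \<Rightarrow> real) \<Rightarrow> (real ^ 2 \<Rightarrow> real ^ 2 \<Rightarrow> real) \<Rightarrow> bool" where
  "trace_free g b \<longleftrightarrow> (\<forall>e1 e2. conformal_frame g e1 e2 \<longrightarrow> b e1 e1 + b e2 e2 = 0)"

text \<open>The value of (the complex bilinear extension of) the symmetric form \<open>b\<close> on the vector
  \<open>(e1 - \<i> e2) / 2\<close>. For \<open>e1, e2\<close> the coordinate vector fields of \<open>z = u + \<i> v\<close> this is
  \<open>b(\<partial>\<^sub>z, \<partial>\<^sub>z)\<close>, the coefficient of \<open>dz\<^sup>2\<close> in the (2,0)-part of \<open>b\<close>. Replacing \<open>J\<close> by \<open>-J\<close>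
  conjugates it, so no orientation is needed below.\<close>

definition part20 ::
  "(real ^ 2 \<Rightarrow> real ^ 2 \<Rightarrow> real) \<Rightarrow> real ^ 2 \<Rightarrow> real ^ 2 \<Rightarrow> complex" where
  "part20 b e1 e2 = Complex ((b e1 e1 - b e2 e2) / 4) (- (b e1 e2) / 2)"

definition to_complex :: "real ^ 2 \<Rightarrow> complex" where
  "to_complex v = Complex (v $ 1) (v $ 2)"

definition of_complex_vec :: "complex \<Rightarrow> real ^ 2" where
  "of_complex_vec z = vector [Re z, Im z]"

definition conformal_chart ::
  "'m::topological_space chart set \<Rightarrow> ('m \<Rightarrow> real ^ 2 \<Rightarrow> real ^ 2 \<Rightarrow> real) \<Rightarrow> 'm chart \<Rightarrow> bool" where
  "conformal_chart A g c \<longleftrightarrow> admissible_chart A c \<and>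
     (\<forall>m\<in>fst c. conformal_frame (g m) (coord_vec A c (axis 1 1) m) (coord_vec A c (axis 2 1) m))"

text \<open>Conformal charts of \<open>g\<close> are the complex coordinates of its complex structure. Those around a
  point differ by holomorphic or antiholomorphic changes of coordinates, so that it suffices to
  test one of them.\<close>

definition holomorphic_quadratic_differential ::
  "'m::topological_space chart set \<Rightarrow> ('m \<Rightarrow> real ^ 2 \<Rightarrow> real ^ 2 \<Rightarrow> real) \<Rightarrow>
     ('m \<Rightarrow> real ^ 2 \<Rightarrow> real ^ 2 \<Rightarrow> real) \<Rightarrow> bool" where
  "holomorphic_quadratic_differential A g q \<longleftrightarrow>
     (\<forall>m. symmetric_bilinear (q m) \<and> trace_free (g m) (q m)) \<and>
     (\<forall>m. \<exists>c. m \<in> fst c \<and> conformal_chart A g c \<and>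
        (\<lambda>z. let y = chart_inv c (of_complex_vec z)
              in part20 (q y) (coord_vec A c (axis 1 1) y) (coord_vec A c (axis 2 1) y))
          holomorphic_on to_complex ` snd c ` fst c)"

definition L_isothermic ::
  "'m::topological_space chart set \<Rightarrow> ('v::real_normed_vector \<Rightarrow> 'v \<Rightarrow> real) \<Rightarrow> ('m \<Rightarrow> 'v) \<Rightarrow>
     ('m \<Rightarrow> 'v) \<Rightarrow> bool" where
  "L_isothermic A B x n \<longleftrightarrow> (\<forall>m. nondegenerate (third_ff A B n m)) \<and>
     (\<exists>q. holomorphic_quadratic_differential A (third_ff A B n) q \<and> (\<exists>m X Y. q m X Y \<noteq> 0) \<and>
       (\<exists>\<mu>::'m \<Rightarrow> real. \<forall>m e1 e2. conformal_frame (third_ff A B n m) e1 e2 \<longrightarrow>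
          part20 (second_ff A B x n m) e1 e2 = of_real (\<mu> m) * part20 (q m) e1 e2))"

end

theory Submission
  imports Defs "HOL-Complex_Analysis.Cauchy_Integral_Formula"
begin

text \<open>Write \<open>F, t\<close> for the sections \<open>\<ff>, \<tt>\<close> of \<open>f\<close>, and \<open>r\<^sub>1, r\<^sub>2\<close> for the principal radii, so that
  \<open>\<sigma>\<^sub>i \<sim> F + r\<^sub>i t\<close>. A potential killing \<open>f\<close> is middle if and only if it has the form
  \<open>\<zeta> = a \<sigma>\<^sub>1 \<and> d\<sigma>\<^sub>1 + b \<sigma>\<^sub>2 \<and> d\<sigma>\<^sub>2 + c \<sigma>\<^sub>1 \<and> \<sigma>\<^sub>2\<close> with one-forms \<open>a, b, c\<close>, where \<open>d\<sigma>\<^sub>1, d\<sigma>\<^sub>2\<close> are the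
  derivatives along \<open>T\<^sub>2, T\<^sub>1\<close>.

  If \<open>qinf + s p1\<close> is conserved and null, then \<open>\<zeta> p1 = 0\<close> forces \<open>p1\<close> into \<open>f\<close>, so \<open>p1 = \<lambda> t\<close>. A second order
  argument excludes \<open>qinf \<in> f\<close>, and \<open>\<lambda>\<close> has no zeros because the gauge quadratic is non-degenerate. The form
  \<open>\<Psi> = (d(\<lambda> F) - \<zeta> pp) / 2 = \<lambda> (dF + H dt)\<close>, with \<open>2 H = r\<^sub>1 + r\<^sub>2\<close>, is closed. Since \<open>q = (\<Psi>, dt)\<close> is symmetric and
  trace-free, closedness of \<open>\<Psi>\<close> is in conformal coordinates of \<open>(dt, dt)\<close> the system of Cauchy-Riemann equations
  for \<open>q\<close>, and \<open>II = H III - q / \<lambda>\<close> commutes with \<open>q\<close>.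

  Conversely \<open>\<lambda> = 1 / \<mu>\<close> makes \<open>\<Psi>\<close> closed, hence so is \<open>\<zeta> = F \<and> dp1 - p1 \<and> dF + 2 t \<and> \<Psi>\<close> with \<open>p1 = \<lambda> t\<close>; it is
  its own middle potential.\<close>

section \<open>Smooth maps between Euclidean spaces\<close>

text \<open>Signature (4,2) enters through one fact: a vector of f^perp with non-positive square
  lies in f. So \<open>B\<close> is positive definite on f^perp modulo f, derivatives of sections
  are tensorial modulo f, and a null p1 orthogonal to f lies in f. That q is non-degenerate at every
  point, not only densely, comes from its constant signature. Excluding qinf from f takes second
  derivatives because p1 and dp1 both vanish where qinf lies in f: the first-order equations say
  nothing there. The form \<Psi> arises by evaluating \<zeta> on the constant vector pp, which gives
  a closed form; subtracting it from the exact form d(\<lambda> F) cancels the component in F and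
  leaves values in the plane spanned by dt. Conformal charts come from no general existence theorem:
  III is the pull-back of the round metric by n, so stereographic projection supplies them. They
  belong to the maximal atlas but not necessarily to \<open>A\<close>, so smoothness and closedness
  must be carried between charts. In the converse \<mu> is just a real function. It has no zeros
  because there are no umbilics, and \<lambda> is smooth as a quotient of the coefficients of q and
  II.\<close>

lemma frechet_derivative_worksI:
  "g differentiable at x \<Longrightarrow> (g has_derivative frechet_derivative g (at x)) (at x)"
  by (simp add: frechet_derivative_works)

lemma Ck_on_subset: "Ck_on k S g \<Longrightarrow> T \<subseteq> S \<Longrightarrow> Ck_on k T g"
  by (induction k arbitrary: g) (auto intro: continuous_on_subset)

lemma smooth_on_subset: "smooth_on S g \<Longrightarrow> T \<subseteq> S \<Longrightarrow> smooth_on T g"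
  by (auto simp: smooth_on_def intro: Ck_on_subset)

lemma frechet_derivative_cong_open:
  assumes "open S" "x \<in> S" "\<And>y. y \<in> S \<Longrightarrow> g y = h y"
  shows "frechet_derivative g (at x) = frechet_derivative h (at x)"
    and "g differentiable at x \<longleftrightarrow> h differentiable at x"
proof -
  have "(g has_derivative D) (at x) \<longleftrightarrow> (h has_derivative D) (at x)" for D
    using assms has_derivative_transform_within_open[of g D x UNIV S h]
      has_derivative_transform_within_open[of h D x UNIV S g] by auto
  then show "frechet_derivative g (at x) = frechet_derivative h (at x)"
    "g differentiable at x \<longleftrightarrow> h differentiable at x"
    by (simp_all add: frechet_derivative_def differentiable_def)
qed

lemma Ck_on_cong:
  assumes "open S" "\<And>x. x \<in> S \<Longrightarrow> g x = h x"
  shows "Ck_on k S g \<longleftrightarrow> Ck_on k S h"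
  using assms(2)
proof (induction k arbitrary: g h)
  case 0
  then show ?case by (simp cong: continuous_on_cong_simp)
next
  case (Suc k)
  note d = frechet_derivative_cong_open[OF assms(1) _ Suc.prems]
  have "Ck_on k S (\<lambda>x. frechet_derivative g (at x) v) \<longleftrightarrow>
      Ck_on k S (\<lambda>x. frechet_derivative h (at x) v)" for v
    by (rule Suc.IH) (simp add: d(1))
  then show ?case using d(2) by auto
qed

lemma smooth_on_cong:
  "open S \<Longrightarrow> (\<And>x. x \<in> S \<Longrightarrow> g x = h x) \<Longrightarrow> smooth_on S g \<longleftrightarrow> smooth_on S h"
  unfolding smooth_on_def using Ck_on_cong by blast

lemma Ck_on_local:
  assumes "\<And>x. x \<in> S \<Longrightarrow> \<exists>T. open T \<and> x \<in> T \<and> Ck_on k T g"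
  shows "Ck_on k S g"
  using assms
proof (induction k arbitrary: g)
  case 0
  then show ?case
    by (simp add: continuous_at_imp_continuous_on continuous_on_eq_continuous_at)
      (meson continuous_at_imp_continuous_on continuous_on_eq_continuous_at)
next
  case (Suc k)
  show ?case
  proof (simp, intro conjI ballI allI)
    show "g differentiable at x" if "x \<in> S" for x
      using Suc.prems[OF that] by auto
    show "Ck_on k S (\<lambda>x. frechet_derivative g (at x) v)" for v
    proof (rule Suc.IH)
      show "\<exists>T. open T \<and> x \<in> T \<and> Ck_on k T (\<lambda>x. frechet_derivative g (at x) v)" if "x \<in> S" for x
        using Suc.prems[OF that] by auto
    qed
  qed
qed

lemma smooth_on_local:
  assumes "\<And>x. x \<in> S \<Longrightarrow> \<exists>T. open T \<and> x \<in> T \<and> smooth_on T g"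
  shows "smooth_on S g"
  using assms unfolding smooth_on_def by (meson Ck_on_local)

lemma Ck_on_SucD: "Ck_on (Suc k) S g \<Longrightarrow> Ck_on k S g"
proof (induction k arbitrary: g)
  case 0
  then show ?case
    by (auto intro!: continuous_at_imp_continuous_on differentiable_imp_continuous_within)
next
  case (Suc k)
  then show ?case by (metis Ck_on.simps(2))
qed

lemma smooth_on_differentiable: "smooth_on S g \<Longrightarrow> x \<in> S \<Longrightarrow> g differentiable at x"
  unfolding smooth_on_def by (metis Ck_on.simps(2))

lemma smooth_on_continuous: "smooth_on S g \<Longrightarrow> continuous_on S g"
  unfolding smooth_on_def by (metis Ck_on.simps(1))

lemma smooth_on_frechet_derivative:
  "smooth_on S g \<Longrightarrow> smooth_on S (\<lambda>x. frechet_derivative g (at x) v)"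
  unfolding smooth_on_def by (metis Ck_on.simps(2))

lemma Ck_on_const: "Ck_on k S (\<lambda>x. c)"
  by (induction k arbitrary: c) (auto simp: continuous_on_const)

lemma smooth_on_const: "smooth_on S (\<lambda>x. c)"
  by (simp add: smooth_on_def Ck_on_const)

lemma frechet_derivative_bounded_linear_compose:
  assumes "bounded_linear L" "g differentiable at x"
  shows "frechet_derivative (\<lambda>y. L (g y)) (at x) = (\<lambda>v. L (frechet_derivative g (at x) v))"
    and "(\<lambda>y. L (g y)) differentiable at x"
  using bounded_linear.has_derivative[OF assms(1) frechet_derivative_worksI[OF assms(2)]]
  by (auto simp: frechet_derivative_at[symmetric] intro: differentiableI)

lemma Ck_on_bounded_linear:
  assumes "open S" "bounded_linear L" "Ck_on k S g"
  shows "Ck_on k S (\<lambda>x. L (g x))"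
  using assms(3)
proof (induction k arbitrary: g)
  case 0
  then show ?case using assms(2) by (simp add: bounded_linear.continuous_on)
next
  case (Suc k)
  have "Ck_on k S (\<lambda>x. frechet_derivative (\<lambda>y. L (g y)) (at x) v) \<longleftrightarrow>
      Ck_on k S (\<lambda>x. L (frechet_derivative g (at x) v))" for v
    using Suc.prems
    by (intro Ck_on_cong[OF assms(1)]) (auto simp: frechet_derivative_bounded_linear_compose[OF assms(2)])
  with Suc show ?case
    by (auto simp: frechet_derivative_bounded_linear_compose(2)[OF assms(2)])
qed

lemma Ck_on_add:
  assumes "open S" "Ck_on k S g" "Ck_on k S h"
  shows "Ck_on k S (\<lambda>x. g x + h x)"
  using assms(2,3)
proof (induction k arbitrary: g h)
  case 0
  then show ?case by (simp add: continuous_on_add)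
next
  case (Suc k)
  have d: "((\<lambda>x. g x + h x) has_derivative
      (\<lambda>v. frechet_derivative g (at x) v + frechet_derivative h (at x) v)) (at x)" if "x \<in> S" for x
    using Suc.prems that by (intro has_derivative_add frechet_derivative_worksI) auto
  have "Ck_on k S (\<lambda>x. frechet_derivative (\<lambda>x. g x + h x) (at x) v) \<longleftrightarrow>
      Ck_on k S (\<lambda>x. frechet_derivative g (at x) v + frechet_derivative h (at x) v)" for v
    by (rule Ck_on_cong[OF assms(1)]) (simp add: frechet_derivative_at[OF d, symmetric])
  with Suc show ?case using d by (auto intro: differentiableI)
qed

lemma frechet_derivative_bilinear:
  assumes "bounded_bilinear p" "g differentiable at x" "h differentiable at x"
  shows "frechet_derivative (\<lambda>y. p (g y) (h y)) (at x) =
      (\<lambda>v. p (g x) (frechet_derivative h (at x) v) + p (frechet_derivative g (at x) v) (h x))"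
    and "(\<lambda>y. p (g y) (h y)) differentiable at x"
  using bounded_bilinear.FDERIV[OF assms(1) frechet_derivative_worksI[OF assms(2)]
      frechet_derivative_worksI[OF assms(3)]]
  by (auto simp: frechet_derivative_at[symmetric] intro: differentiableI)

lemma Ck_on_bilinear:
  assumes "open S" "bounded_bilinear p" "Ck_on k S g" "Ck_on k S h"
  shows "Ck_on k S (\<lambda>x. p (g x) (h x))"
  using assms(3,4)
proof (induction k arbitrary: g h)
  case 0
  then show ?case by (simp add: bounded_bilinear.continuous_on[OF assms(2)])
next
  case (Suc k)
  note d = frechet_derivative_bilinear[OF assms(2)]
  have "Ck_on k S (\<lambda>x. frechet_derivative (\<lambda>x. p (g x) (h x)) (at x) v) \<longleftrightarrow>
      Ck_on k S (\<lambda>x. p (g x) (frechet_derivative h (at x) v) + p (frechet_derivative g (at x) v) (h x))"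
    for v
    using Suc.prems by (intro Ck_on_cong[OF assms(1)]) (auto simp: d(1))
  moreover have "Ck_on k S g" "Ck_on k S h"
    using Suc.prems Ck_on_SucD by blast+
  moreover have "(\<lambda>x. p (g x) (h x)) differentiable at x" if "x \<in> S" for x
    using Suc.prems that by (intro d(2)) auto
  ultimately show ?case
    using Suc by (auto intro!: Ck_on_add[OF assms(1)])
qed

lemma smooth_on_add:
  "open S \<Longrightarrow> smooth_on S g \<Longrightarrow> smooth_on S h \<Longrightarrow> smooth_on S (\<lambda>x. g x + h x)"
  by (simp add: smooth_on_def Ck_on_add)

lemma smooth_on_bounded_linear:
  "open S \<Longrightarrow> bounded_linear L \<Longrightarrow> smooth_on S g \<Longrightarrow> smooth_on S (\<lambda>x. L (g x))"
  by (simp add: smooth_on_def Ck_on_bounded_linear)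

lemma smooth_on_bilinear:
  "open S \<Longrightarrow> bounded_bilinear p \<Longrightarrow> smooth_on S g \<Longrightarrow> smooth_on S h \<Longrightarrow>
    smooth_on S (\<lambda>x. p (g x) (h x))"
  by (simp add: smooth_on_def Ck_on_bilinear)

lemma Ck_on_sum:
  assumes "open S" "finite I" "\<And>i. i \<in> I \<Longrightarrow> Ck_on k S (g i)"
  shows "Ck_on k S (\<lambda>x. \<Sum>i\<in>I. g i x)"
  using assms(2,3) by induction (auto intro: Ck_on_const Ck_on_add[OF assms(1)])

lemma Ck_on_linear: "open S \<Longrightarrow> bounded_linear L \<Longrightarrow> Ck_on k S L"
proof (induction k)
  case 0
  then show ?case by (simp add: linear_continuous_on)
next
  case (Suc k)
  have "(L has_derivative L) (at x)" for x
    using Suc.prems(2) by (rule bounded_linear_imp_has_derivative)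
  then have "L differentiable at x" "frechet_derivative L (at x) = L" for x
    by (auto intro: differentiableI simp: frechet_derivative_at[symmetric])
  then show ?case by (simp add: Ck_on_const)
qed

lemma smooth_on_linear: "open S \<Longrightarrow> bounded_linear L \<Longrightarrow> smooth_on S L"
  by (simp add: smooth_on_def Ck_on_linear)

text \<open>\<open>Ck_on\<close> speaks of derivatives in fixed directions, whereas the chain rule
  produces a direction that varies with the point. The expansion moves this variation into scalar
  coefficients.\<close>

lemma frechet_derivative_basis_expansion:
  fixes g :: "'a::euclidean_space \<Rightarrow> 'b::real_normed_vector"
  assumes "g differentiable at x"
  shows "frechet_derivative g (at x) v = (\<Sum>b\<in>Basis. (v \<bullet> b) *\<^sub>R frechet_derivative g (at x) b)"
proof -
  have l: "linear (frechet_derivative g (at x))"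
    by (rule linear_frechet_derivative[OF assms])
  have "frechet_derivative g (at x) v = frechet_derivative g (at x) (\<Sum>b\<in>Basis. (v \<bullet> b) *\<^sub>R b)"
    by (simp add: euclidean_representation)
  also have "\<dots> = (\<Sum>b\<in>Basis. (v \<bullet> b) *\<^sub>R frechet_derivative g (at x) b)"
    by (simp add: linear_sum[OF l] linear_cmul[OF l])
  finally show ?thesis .
qed

text \<open>Induction with \<open>g\<close> arbitrary: a derivative of the composite is a sum of
  products of a component of the derivative of \<open>h\<close> with a directional derivative of
  \<open>g\<close> composed with the same \<open>h\<close>, and the latter is one class
  lower.\<close>

lemma Ck_on_compose:
  fixes g :: "'b::euclidean_space \<Rightarrow> 'c::real_normed_vector" and h :: "'a::euclidean_space \<Rightarrow> 'b"
  assumes "open S" "h ` S \<subseteq> T" "Ck_on k T g" "Ck_on k S h"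
  shows "Ck_on k S (\<lambda>x. g (h x))"
  using assms(3,4)
proof (induction k arbitrary: g)
  case 0
  then show ?case using assms(2) by (auto intro: continuous_on_compose2)
next
  case (Suc k)
  have T: "h x \<in> T" if "x \<in> S" for x using that assms(2) by auto
  have d: "((\<lambda>x. g (h x)) has_derivative
      (\<lambda>v. frechet_derivative g (at (h x)) (frechet_derivative h (at x) v))) (at x)" if "x \<in> S" for x
  proof -
    have "h differentiable at x" "g differentiable at (h x)"
      using Suc.prems that T[OF that] by simp_all
    from diff_chain_at[OF this[THEN frechet_derivative_worksI]] show ?thesis
      by (simp add: o_def)
  qed
  have "Ck_on k S (\<lambda>x. frechet_derivative (\<lambda>x. g (h x)) (at x) v) \<longleftrightarrow>
      Ck_on k S (\<lambda>x. \<Sum>b\<in>Basis. (frechet_derivative h (at x) v \<bullet> b) *\<^sub>R frechet_derivative g (at (h x)) b)"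
    for v
  proof (rule Ck_on_cong[OF assms(1)])
    fix x assume x: "x \<in> S"
    have "g differentiable at (h x)" using Suc.prems T[OF x] by auto
    then show "frechet_derivative (\<lambda>x. g (h x)) (at x) v =
      (\<Sum>b\<in>Basis. (frechet_derivative h (at x) v \<bullet> b) *\<^sub>R frechet_derivative g (at (h x)) b)"
      by (subst frechet_derivative_at[OF d[OF x], symmetric]) (rule frechet_derivative_basis_expansion)
  qed
  moreover have "Ck_on k S (\<lambda>x. frechet_derivative g (at (h x)) b)" for b
    using Suc.prems Ck_on_SucD[OF Suc.prems(2)] by (intro Suc.IH) auto
  moreover have "Ck_on k S (\<lambda>x. frechet_derivative h (at x) v)" for v
    using Suc.prems by simp
  ultimately have "Ck_on k S (\<lambda>x. frechet_derivative (\<lambda>x. g (h x)) (at x) v)" for v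
    by (simp add: Ck_on_sum[OF assms(1)] Ck_on_bilinear[OF assms(1) bounded_bilinear_scaleR]
        Ck_on_bounded_linear[OF assms(1) bounded_linear_inner_left])
  moreover have "(\<lambda>x. g (h x)) differentiable at x" if "x \<in> S" for x
    using d[OF that] by (rule differentiableI)
  ultimately show ?case by simp
qed

lemma smooth_on_compose:
  fixes g :: "'b::euclidean_space \<Rightarrow> 'c::real_normed_vector" and h :: "'a::euclidean_space \<Rightarrow> 'b"
  shows "open S \<Longrightarrow> h ` S \<subseteq> T \<Longrightarrow> smooth_on T g \<Longrightarrow> smooth_on S h \<Longrightarrow> smooth_on S (\<lambda>x. g (h x))"
  by (simp add: smooth_on_def Ck_on_compose)

text \<open>The derivative of 1/g is minus the product of the derivative of \<open>g\<close> with
  two factors 1/g, so the induction closes on products alone.\<close>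

lemma Ck_on_inverse:
  fixes g :: "'a::euclidean_space \<Rightarrow> real"
  assumes "open S" "Ck_on k S g" "\<And>x. x \<in> S \<Longrightarrow> g x \<noteq> 0"
  shows "Ck_on k S (\<lambda>x. inverse (g x))"
  using assms(2)
proof (induction k)
  case 0
  then show ?case using assms(3) by (simp add: continuous_on_inverse)
next
  case (Suc k)
  have d: "((\<lambda>x. inverse (g x)) has_derivative
     (\<lambda>v. - (inverse (g x) * frechet_derivative g (at x) v * inverse (g x)))) (at x)" if "x \<in> S" for x
    using Suc.prems that assms(3) by (intro Deriv.has_derivative_inverse frechet_derivative_worksI) auto
  have "Ck_on k S (\<lambda>x. frechet_derivative (\<lambda>x. inverse (g x)) (at x) v) \<longleftrightarrow>
      Ck_on k S (\<lambda>x. (- 1) * ((inverse (g x) * frechet_derivative g (at x) v) * inverse (g x)))" for v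
    by (rule Ck_on_cong[OF assms(1)]) (simp add: frechet_derivative_at[OF d, symmetric])
  moreover have "Ck_on k S (\<lambda>x. inverse (g x))"
    using Suc Ck_on_SucD by blast
  moreover have "Ck_on k S (\<lambda>x. frechet_derivative g (at x) v)" for v
    using Suc.prems by simp
  ultimately have "Ck_on k S (\<lambda>x. frechet_derivative (\<lambda>x. inverse (g x)) (at x) v)" for v
    by (simp only:) (intro Ck_on_bilinear[OF assms(1) bounded_bilinear_mult] Ck_on_const; simp)
  moreover have "(\<lambda>x. inverse (g x)) differentiable at x" if "x \<in> S" for x
    using d[OF that] by (rule differentiableI)
  ultimately show ?case by simp
qed

lemma smooth_on_inverse:
  fixes g :: "'a::euclidean_space \<Rightarrow> real"
  shows "open S \<Longrightarrow> smooth_on S g \<Longrightarrow> (\<And>x. x \<in> S \<Longrightarrow> g x \<noteq> 0) \<Longrightarrow> smooth_on S (\<lambda>x. inverse (g x))"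
  by (simp add: smooth_on_def Ck_on_inverse)

text \<open>The second difference over a parallelogram of side \<open>h\<close> is, by the mean value theorem,
  \<open>h\<^sup>2\<close> times either mixed derivative at some point of it.\<close>

lemma mixed_derivatives_mean_value:
  fixes g :: "'a::euclidean_space \<Rightarrow> real"
  assumes h: "h > 0" and S: "\<And>s t. 0 \<le> s \<Longrightarrow> s \<le> h \<Longrightarrow> 0 \<le> t \<Longrightarrow> t \<le> h \<Longrightarrow> x + s *\<^sub>R v + t *\<^sub>R w \<in> S"
    and g: "\<And>x. x \<in> S \<Longrightarrow> g differentiable at x"
    and gv: "\<And>x. x \<in> S \<Longrightarrow> (\<lambda>x. frechet_derivative g (at x) v) differentiable at x"
  shows "\<exists>s t. 0 \<le> s \<and> s \<le> h \<and> 0 \<le> t \<and> t \<le> h \<and>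
    g (x + h *\<^sub>R v + h *\<^sub>R w) - g (x + h *\<^sub>R v) - g (x + h *\<^sub>R w) + g x =
    h * h * frechet_derivative (\<lambda>x. frechet_derivative g (at x) v) (at (x + s *\<^sub>R v + t *\<^sub>R w)) w"
proof -
  have line: "((\<lambda>s. G (y + s *\<^sub>R u)) has_real_derivative frechet_derivative G (at (y + s *\<^sub>R u)) u) (at s)"
    if "G differentiable at (y + s *\<^sub>R u)" for G :: "'a \<Rightarrow> real" and y u s
  proof -
    have "((\<lambda>s. y + s *\<^sub>R u) has_derivative (\<lambda>r. r *\<^sub>R u)) (at s)"
      by (auto intro!: derivative_eq_intros)
    from diff_chain_at[OF this frechet_derivative_worksI[OF that]]
    have "((\<lambda>s. G (y + s *\<^sub>R u)) has_derivative
       (\<lambda>r. frechet_derivative G (at (y + s *\<^sub>R u)) (r *\<^sub>R u))) (at s)"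
      by (simp add: o_def)
    then show ?thesis
      by (simp add: has_field_derivative_def linear_cmul[OF linear_frechet_derivative[OF that]]
        mult.commute[of _ "frechet_derivative G _ u"])
  qed
  let ?G = "\<lambda>s. g ((x + h *\<^sub>R w) + s *\<^sub>R v) - g (x + s *\<^sub>R v)"
  let ?G' = "\<lambda>s. frechet_derivative g (at ((x + h *\<^sub>R w) + s *\<^sub>R v)) v - frechet_derivative g (at (x + s *\<^sub>R v)) v"
  have S': "x + h *\<^sub>R w + s *\<^sub>R v \<in> S" "x + s *\<^sub>R v \<in> S" if "0 \<le> s" "s \<le> h" for s
    using S[of s h] S[of s 0] that h by (simp_all add: algebra_simps)
  have "\<exists>s. 0 < s \<and> s < h \<and> ?G h - ?G 0 = (h - 0) * ?G' s"
    using h S' by (intro MVT2 DERIV_diff line g) auto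
  then obtain s where s: "0 < s" "s < h" "?G h - ?G 0 = h * ?G' s" by auto
  let ?H = "\<lambda>t. frechet_derivative g (at ((x + s *\<^sub>R v) + t *\<^sub>R w)) v"
  have "\<exists>t. 0 < t \<and> t < h \<and> ?H h - ?H 0 =
      (h - 0) * frechet_derivative (\<lambda>x. frechet_derivative g (at x) v) (at ((x + s *\<^sub>R v) + t *\<^sub>R w)) w"
    using h s S by (intro MVT2 line[of "\<lambda>x. frechet_derivative g (at x) v"] gv) auto
  then obtain t where t: "0 < t" "t < h" "?H h - ?H 0 =
      h * frechet_derivative (\<lambda>x. frechet_derivative g (at x) v) (at ((x + s *\<^sub>R v) + t *\<^sub>R w)) w" by auto
  have "?G' s = ?H h - ?H 0" by (simp add: algebra_simps)
  with s t show ?thesis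
    by (intro exI[of _ s] exI[of _ t]) (simp add: algebra_simps)
qed

text \<open>The second difference over a parallelogram is symmetric in \<open>v\<close> and
  \<open>w\<close>. If the two mixed derivatives differed at \<open>x\<close>, continuity would keep
  them apart on a ball, and a parallelogram inside it gives a contradiction.\<close>

lemma mixed_derivatives_commute_real:
  fixes g :: "'a::euclidean_space \<Rightarrow> real"
  assumes "open S" "x \<in> S" "smooth_on S g"
  shows "frechet_derivative (\<lambda>x. frechet_derivative g (at x) v) (at x) w =
    frechet_derivative (\<lambda>x. frechet_derivative g (at x) w) (at x) v"
proof (rule ccontr)
  let ?P = "\<lambda>y. frechet_derivative (\<lambda>x. frechet_derivative g (at x) v) (at y) w"
  let ?Q = "\<lambda>y. frechet_derivative (\<lambda>x. frechet_derivative g (at x) w) (at y) v"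
  assume ne: "?P x \<noteq> ?Q x"
  \<comment> \<open>Half the gap: two quantities that each move by less than this cannot
    meet.\<close>
  define e where "e = \<bar>?P x - ?Q x\<bar> / 2"
  have e: "e > 0" using ne by (simp add: e_def)
  have "continuous (at x) ?P" "continuous (at x) ?Q"
    using smooth_on_continuous[OF smooth_on_frechet_derivative[OF smooth_on_frechet_derivative[OF assms(3)]]]
      assms(1,2) by (simp_all add: continuous_on_eq_continuous_at)
  then obtain d1 d2 where d1: "d1 > 0" "\<And>y. dist y x < d1 \<Longrightarrow> dist (?P y) (?P x) < e"
    and d2: "d2 > 0" "\<And>y. dist y x < d2 \<Longrightarrow> dist (?Q y) (?Q x) < e"
    using e unfolding continuous_at_eps_delta by metis
  obtain d3 where d3: "d3 > 0" "ball x d3 \<subseteq> S" using assms(1,2) open_contains_ball by blast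
  define d where "d = min d1 (min d2 d3)"
  have d: "d > 0" using d1 d2 d3 by (simp add: d_def)
  \<comment> \<open>The summand 1 keeps the denominator positive when \<open>v\<close> and
    \<open>w\<close> vanish; the factor 2 leaves the parallelogram strictly inside the ball of
    radius \<open>d\<close>.\<close>
  define h where "h = d / (2 * (norm v + norm w + 1))"
  have h: "h > 0" using d by (simp add: h_def add_nonneg_pos)
  have near: "dist (x + s *\<^sub>R v + t *\<^sub>R w) x < d" if "0 \<le> s" "s \<le> h" "0 \<le> t" "t \<le> h" for s t
  proof -
    have "dist (x + s *\<^sub>R v + t *\<^sub>R w) x = norm (s *\<^sub>R v + t *\<^sub>R w)" by (simp add: dist_norm algebra_simps)
    also have "\<dots> \<le> s * norm v + t * norm w"
      using norm_triangle_ineq[of "s *\<^sub>R v" "t *\<^sub>R w"] that by simp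
    also have "\<dots> \<le> h * norm v + h * norm w"
      using that by (intro add_mono mult_right_mono) auto
    also have "\<dots> \<le> h * (norm v + norm w + 1)" using h by (simp add: algebra_simps)
    also have "\<dots> = d / 2" unfolding h_def
      using add_nonneg_pos[of "norm v + norm w" 1] by (simp add: field_simps)
    also have "\<dots> < d" using d by simp
    finally show ?thesis .
  qed
  have inS: "x + s *\<^sub>R v + t *\<^sub>R w \<in> S" if "0 \<le> s" "s \<le> h" "0 \<le> t" "t \<le> h" for s t
    using near[OF that] d3 by (auto simp: d_def dist_commute)
  have inS': "x + s *\<^sub>R w + t *\<^sub>R v \<in> S" if "0 \<le> s" "s \<le> h" "0 \<le> t" "t \<le> h" for s t
    using inS[of t s] that by (simp add: algebra_simps)
  note df = smooth_on_differentiable[OF assms(3)]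
    smooth_on_differentiable[OF smooth_on_frechet_derivative[OF assms(3)]]
  obtain s t where st: "0 \<le> s" "s \<le> h" "0 \<le> t" "t \<le> h"
    "g (x + h *\<^sub>R v + h *\<^sub>R w) - g (x + h *\<^sub>R v) - g (x + h *\<^sub>R w) + g x = h * h * ?P (x + s *\<^sub>R v + t *\<^sub>R w)"
    using mixed_derivatives_mean_value[OF h inS df(1) df(2)] by blast
  obtain s' t' where st': "0 \<le> s'" "s' \<le> h" "0 \<le> t'" "t' \<le> h"
    "g (x + h *\<^sub>R w + h *\<^sub>R v) - g (x + h *\<^sub>R w) - g (x + h *\<^sub>R v) + g x = h * h * ?Q (x + s' *\<^sub>R w + t' *\<^sub>R v)"
    using mixed_derivatives_mean_value[OF h inS' df(1) df(2)] by blast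
  have "h * h * ?P (x + s *\<^sub>R v + t *\<^sub>R w) = h * h * ?Q (x + t' *\<^sub>R v + s' *\<^sub>R w)"
    using st(5) st'(5) by (simp add: algebra_simps)
  then have "?P (x + s *\<^sub>R v + t *\<^sub>R w) = ?Q (x + t' *\<^sub>R v + s' *\<^sub>R w)" using h by simp
  moreover have "dist (?P (x + s *\<^sub>R v + t *\<^sub>R w)) (?P x) < e"
    using near st by (intro d1(2)) (simp add: d_def)
  moreover have "dist (?Q (x + t' *\<^sub>R v + s' *\<^sub>R w)) (?Q x) < e"
    using near st' by (intro d2(2)) (simp add: d_def)
  ultimately show False by (simp add: e_def dist_real_def abs_if split: if_splits)
qed

lemma mixed_derivatives_commute:
  fixes g :: "'a::euclidean_space \<Rightarrow> 'b::euclidean_space"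
  assumes "open S" "x \<in> S" "smooth_on S g"
  shows "frechet_derivative (\<lambda>x. frechet_derivative g (at x) v) (at x) w =
    frechet_derivative (\<lambda>x. frechet_derivative g (at x) w) (at x) v"
proof (rule euclidean_eqI)
  fix b :: 'b assume b: "b \<in> Basis"
  note bl = bounded_linear_inner_left[of b]
  have 1: "frechet_derivative (\<lambda>x. frechet_derivative (\<lambda>x. g x \<bullet> b) (at x) v) (at x) w =
     frechet_derivative (\<lambda>x. frechet_derivative g (at x) v) (at x) w \<bullet> b" for v w
  proof -
    have "frechet_derivative (\<lambda>x. frechet_derivative (\<lambda>x. g x \<bullet> b) (at x) v) (at x) w =
       frechet_derivative (\<lambda>x. frechet_derivative g (at x) v \<bullet> b) (at x) w"
      using smooth_on_differentiable[OF assms(3)]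
      by (subst frechet_derivative_cong_open(1)[OF assms(1,2)])
        (auto simp: frechet_derivative_bounded_linear_compose(1)[OF bl])
    also have "\<dots> = frechet_derivative (\<lambda>x. frechet_derivative g (at x) v) (at x) w \<bullet> b"
      using smooth_on_differentiable[OF smooth_on_frechet_derivative[OF assms(3)] assms(2)]
      by (simp add: frechet_derivative_bounded_linear_compose(1)[OF bl])
    finally show ?thesis .
  qed
  show "frechet_derivative (\<lambda>x. frechet_derivative g (at x) v) (at x) w \<bullet> b =
      frechet_derivative (\<lambda>x. frechet_derivative g (at x) w) (at x) v \<bullet> b"
    using mixed_derivatives_commute_real[OF assms(1,2)
        smooth_on_bounded_linear[OF assms(1) bl assms(3)]] unfolding 1 .
qed

section \<open>Smooth inverses and holomorphic functions\<close>

text \<open>Cramer's rule. The explicit formula exhibits the inverse as a rational function of the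
  entries, from which \<open>smooth_inverse_function\<close> reads off its smoothness.\<close>

lemma inverse_real2:
  fixes L :: "real ^ 2 \<Rightarrow> real ^ 2"
  assumes "linear L" "bij L"
  defines "d \<equiv> L (axis 1 1) $ 1 * L (axis 2 1) $ 2 - L (axis 2 1) $ 1 * L (axis 1 1) $ 2"
  shows "d \<noteq> 0"
    and "inv L v = ((L (axis 2 1) $ 2 * v $ 1 - L (axis 2 1) $ 1 * v $ 2) * inverse d) *\<^sub>R axis 1 1 +
      ((L (axis 1 1) $ 1 * v $ 2 - L (axis 1 1) $ 2 * v $ 1) * inverse d) *\<^sub>R axis 2 1"
proof -
  have L: "L u = u $ 1 *\<^sub>R L (axis 1 1) + u $ 2 *\<^sub>R L (axis 2 1)" for u
  proof -
    have "L u = L (u $ 1 *\<^sub>R axis 1 1 + u $ 2 *\<^sub>R axis 2 1)"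
      by (rule arg_cong[of _ _ L]) (simp add: vec_eq_iff forall_2 axis_def)
    then show ?thesis
      by (simp add: linear_add[OF assms(1)] linear_cmul[OF assms(1)])
  qed
  show d: "d \<noteq> 0"
  proof
    assume d0: "d = 0"
    \<comment> \<open>Up to sign, \<open>u\<close> and \<open>w\<close> are the columns of the
      adjugate matrix, so \<open>L u\<close> and \<open>L w\<close> are coordinate vectors
      multiplied by \<plusminus>\<open>d\<close>.\<close>
    define u :: "real^2" where "u = vector [L (axis 2 1) $ 2, - L (axis 1 1) $ 2]"
    define w :: "real^2" where "w = vector [L (axis 2 1) $ 1, - L (axis 1 1) $ 1]"
    have "L u = L (axis 2 1) $ 2 *\<^sub>R L (axis 1 1) - L (axis 1 1) $ 2 *\<^sub>R L (axis 2 1)"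
      "L w = L (axis 2 1) $ 1 *\<^sub>R L (axis 1 1) - L (axis 1 1) $ 1 *\<^sub>R L (axis 2 1)"
      by (simp_all add: L[of u] L[of w]) (simp_all add: u_def w_def)
    then have "L u = 0" "L w = 0"
      using d0 by (simp_all add: vec_eq_iff forall_2 d_def algebra_simps)
    then have "u = 0" "w = 0"
      using assms(1,2) by (metis bij_is_inj linear_injective_0)+
    then have "L (axis 1 1) = 0"
      by (simp add: u_def w_def vec_eq_iff forall_2)
    then have "axis 1 1 = (0::real^2)"
      using assms(1,2) by (metis bij_is_inj linear_injective_0)
    then show False by (simp add: vec_eq_iff forall_2 axis_def)
  qed
  let ?u = "((L (axis 2 1) $ 2 * v $ 1 - L (axis 2 1) $ 1 * v $ 2) * inverse d) *\<^sub>R axis 1 1 +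
      ((L (axis 1 1) $ 1 * v $ 2 - L (axis 1 1) $ 2 * v $ 1) * inverse d) *\<^sub>R axis 2 (1::real)"
  have c: "L (p *\<^sub>R axis 1 1 + q *\<^sub>R axis 2 1) = p *\<^sub>R L (axis 1 1) + q *\<^sub>R L (axis 2 1)" for p q
    by (simp add: linear_add[OF assms(1)] linear_cmul[OF assms(1)])
  have "L ?u $ 1 = v $ 1 * (d * inverse d)" "L ?u $ 2 = v $ 2 * (d * inverse d)"
    unfolding c d_def vector_add_component vector_scaleR_component by (simp_all add: algebra_simps)
  then have "L ?u = v" using d by (simp add: vec_eq_iff forall_2)
  then show "inv L v = ?u" using assms(2) by (metis bij_inv_eq_iff)
qed

lemma smooth_on_vec_nth: "open S \<Longrightarrow> smooth_on S g \<Longrightarrow> smooth_on S (\<lambda>x. g x $ i)"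
  by (rule smooth_on_bounded_linear[OF _ bounded_linear_vec_nth])

lemma smooth_on_uminus: "open S \<Longrightarrow> smooth_on S g \<Longrightarrow> smooth_on S (\<lambda>x. - g x)"
  by (rule smooth_on_bounded_linear[OF _ bounded_linear_minus[OF bounded_linear_ident]])

lemma smooth_on_diff:
  "open S \<Longrightarrow> smooth_on S g \<Longrightarrow> smooth_on S h \<Longrightarrow> smooth_on S (\<lambda>x. g x - h x)"
  using smooth_on_add[OF _ _ smooth_on_uminus, of S g h] by simp

lemmas smooth_on_mult = smooth_on_bilinear[OF _ bounded_bilinear_mult]
lemmas smooth_on_scaleR = smooth_on_bilinear[OF _ bounded_bilinear_scaleR]

text \<open>Bootstrapping: the inverse function theorem gives a differentiable inverse
  \<open>g\<close> whose derivative in direction \<open>v\<close> is \<open>J v\<close> composed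
  with \<open>g\<close>, where \<open>J v\<close> is smooth. So if \<open>g\<close> is of class C^k,
  its derivative is too, and \<open>g\<close> is of class C^(k+1).\<close>

lemma smooth_inverse_function:
  fixes h :: "real ^ 2 \<Rightarrow> real ^ 2"
  assumes S: "open S" "x0 \<in> S" and h: "smooth_on S h"
    and inj: "\<And>v. frechet_derivative h (at x0) v = 0 \<Longrightarrow> v = 0"
  obtains U V g where "open U" "U \<subseteq> S" "x0 \<in> U" "open V" "homeomorphism U V h g" "smooth_on V g"
proof -
  define h' where "h' x = Blinfun (frechet_derivative h (at x))" for x
  have bl: "bounded_linear (frechet_derivative h (at x))" if "x \<in> S" for x
    using smooth_on_differentiable[OF h that] by (metis frechet_derivative_works has_derivative_bounded_linear)
  have h'[simp]: "blinfun_apply (h' x) = frechet_derivative h (at x)" if "x \<in> S" for x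
    using bl[OF that] by (simp add: h'_def bounded_linear_Blinfun_apply)
  have lin0: "linear (frechet_derivative h (at x0))"
    using bl[OF S(2)] by (simp add: bounded_linear.linear)
  then have "inj (frechet_derivative h (at x0))"
    using inj by (simp add: linear_injective_0)
  with lin0 obtain k where k: "linear k" "k \<circ> frechet_derivative h (at x0) = id"
    using linear_injective_left_inverse by blast
  have kb: "bounded_linear k" using k(1) by (simp add: linear_conv_bounded_linear)
  have i: "Blinfun k o\<^sub>L h' x0 = id_blinfun"
    using k(2) S(2) by (intro blinfun_eqI) (simp add: bounded_linear_Blinfun_apply[OF kb] fun_eq_iff)
  have c: "continuous_on S h'"
  proof (rule continuous_on_blinfun_componentwise)
    fix b :: "real^2"
    show "continuous_on S (\<lambda>x. blinfun_apply (h' x) b)"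
      using smooth_on_continuous[OF smooth_on_frechet_derivative[OF h, of b]]
      by (simp cong: continuous_on_cong_simp)
  qed
  have dh: "(h has_derivative blinfun_apply (h' x)) (at x)" if "x \<in> S" for x
    using smooth_on_differentiable[OF h that] that by (simp add: frechet_derivative_works)
  obtain U V g g' where g: "open U" "U \<subseteq> S" "x0 \<in> U" "open V" "h x0 \<in> V" "homeomorphism U V h g"
    "\<And>y. y \<in> V \<Longrightarrow> (g has_derivative (g' y)) (at y)"
    "\<And>y. y \<in> V \<Longrightarrow> g' y = inv (blinfun_apply (h' (g y)))"
    "\<And>y. y \<in> V \<Longrightarrow> bij (blinfun_apply (h' (g y)))"
    by (rule inverse_function_theorem[OF S(1) dh c S(2) i]) (assumption, (rule that; assumption))
  have gU: "g y \<in> U" if "y \<in> V" for y using g(6) that by (auto simp: homeomorphism_def)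
  define D where "D x b = frechet_derivative h (at x) b" for x b
  define d where "d x = D x (axis 1 1) $ 1 * D x (axis 2 1) $ 2 - D x (axis 2 1) $ 1 * D x (axis 1 1) $ 2" for x
  have Ds: "smooth_on S (\<lambda>x. D x b)" for b
    unfolding D_def by (rule smooth_on_frechet_derivative[OF h])
  have dS: "smooth_on S d" unfolding d_def
    by (intro smooth_on_diff smooth_on_mult smooth_on_vec_nth Ds S)
  \<comment> \<open>\<open>J\<close> is smooth where the Jacobian determinant does not vanish, and
    \<open>g\<close> takes its values there.\<close>
  define W where "W = {x\<in>S. d x \<noteq> 0}"
  have W: "open W"
    using continuous_open_preimage[OF smooth_on_continuous[OF dS] S(1), of "-{0}"]
      open_Compl[OF closed_singleton[of "0::real"]]
    by (simp add: W_def vimage_def Int_def)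
  define J :: "real ^ 2 \<Rightarrow> real ^ 2 \<Rightarrow> real ^ 2" where "J v x = ((D x (axis 2 1) $ 2 * v $ 1 - D x (axis 2 1) $ 1 * v $ 2) * inverse (d x)) *\<^sub>R axis 1 1 +
      ((D x (axis 1 1) $ 1 * v $ 2 - D x (axis 1 1) $ 2 * v $ 1) * inverse (d x)) *\<^sub>R axis 2 (1::real)"
    for v :: "real ^ 2" and x
  have WS: "W \<subseteq> S" by (auto simp: W_def)
  have J: "smooth_on W (J v)" for v
    unfolding J_def
    by (intro smooth_on_add smooth_on_scaleR smooth_on_mult smooth_on_diff smooth_on_vec_nth
        smooth_on_const smooth_on_inverse smooth_on_subset[OF Ds WS] smooth_on_subset[OF dS WS] W)
      (auto simp: W_def)
  have gW: "g y \<in> W" and gJ: "frechet_derivative g (at y) v = J v (g y)" if "y \<in> V" for y v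
  proof -
    have gS: "g y \<in> S" using gU[OF that] g(2) by auto
    have b: "bij (D (g y))" using g(9)[OF that] gS by (simp add: D_def[abs_def])
    have l: "linear (D (g y))" using bl[OF gS] by (simp add: D_def[abs_def] bounded_linear.linear)
    show "g y \<in> W" using inverse_real2(1)[OF l b] gS by (simp add: W_def d_def)
    have "frechet_derivative g (at y) = inv (D (g y))"
      using frechet_derivative_at[OF g(7)[OF that]] g(8)[OF that] gS by (simp add: D_def[abs_def])
    then show "frechet_derivative g (at y) v = J v (g y)"
      unfolding J_def d_def by (simp only: inverse_real2(2)[OF l b, of v])
  qed
  have gd: "g differentiable at y" if "y \<in> V" for y using g(7)[OF that] by (rule differentiableI)
  have "Ck_on k V g" for k
  proof (induction k)
    case 0
    show ?case using homeomorphism_cont2[OF g(6)] by simp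
  next
    case (Suc k)
    have "Ck_on k V (\<lambda>y. frechet_derivative g (at y) v) \<longleftrightarrow> Ck_on k V (\<lambda>y. J v (g y))" for v
      by (rule Ck_on_cong[OF g(4)]) (rule gJ)
    moreover have "Ck_on k V (\<lambda>y. J v (g y))" for v
      by (rule Ck_on_compose[OF g(4), where T=W and g="J v" and h=g]) (use J gW Suc in \<open>auto simp: smooth_on_def\<close>)
    ultimately show ?case by (simp add: gd)
  qed
  then have "smooth_on V g" by (simp add: smooth_on_def)
  then show ?thesis by (rule that[OF g(1-4) g(6)])
qed

section \<open>Real and complex coordinates of the plane\<close>

lemma to_complex_of_complex_vec [simp]: "to_complex (of_complex_vec z) = z"
  by (simp add: to_complex_def of_complex_vec_def)

lemma of_complex_vec_to_complex [simp]: "of_complex_vec (to_complex v) = v"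
  by (simp add: to_complex_def of_complex_vec_def vec_eq_iff forall_2)

lemma bounded_linear_to_complex: "bounded_linear to_complex"
  by (auto intro!: linearI simp: linear_conv_bounded_linear[symmetric] to_complex_def complex_eq_iff)

lemma bounded_linear_of_complex_vec: "bounded_linear of_complex_vec"
  by (auto intro!: linearI simp: linear_conv_bounded_linear[symmetric] of_complex_vec_def vec_eq_iff forall_2)

lemma open_to_complex_image: "open S \<Longrightarrow> open (to_complex ` S)"
proof -
  assume "open S"
  then have "open (of_complex_vec -` S)"
    by (rule open_vimage) (rule linear_continuous_on[OF bounded_linear_of_complex_vec])
  moreover have "of_complex_vec -` S = to_complex ` S"
    by (force simp: image_iff)
  ultimately show ?thesis by simp
qed

text \<open>A directional derivative is the complex derivative times a constant and hence again
  holomorphic, so the induction runs with \<phi> arbitrary.\<close>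

lemma smooth_on_holomorphic:
  assumes "open S" "\<phi> holomorphic_on to_complex ` S"
  shows "smooth_on S (\<lambda>v. \<phi> (to_complex v))"
proof -
  note oS = open_to_complex_image[OF assms(1)]
  have "Ck_on k S (\<lambda>v. \<phi> (to_complex v))" for k
    using assms(2)
  proof (induction k arbitrary: \<phi>)
    case 0
    show ?case using holomorphic_on_imp_continuous_on[OF 0] 
      by (simp add: continuous_on_compose2[of "to_complex ` S" \<phi>] linear_continuous_on[OF bounded_linear_to_complex])
  next
    case (Suc k)
    have d: "((\<lambda>v. \<phi> (to_complex v)) has_derivative (\<lambda>w. deriv \<phi> (to_complex v) * to_complex w)) (at v)"
      if "v \<in> S" for v
    proof -
      have "(\<phi> has_field_derivative deriv \<phi> (to_complex v)) (at (to_complex v))"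
        using Suc.prems oS that by (intro holomorphic_derivI) auto
      from diff_chain_at[OF bounded_linear_imp_has_derivative[OF bounded_linear_to_complex]
          this[unfolded has_field_derivative_def]]
      show ?thesis by (simp add: o_def)
    qed
    have "Ck_on k S (\<lambda>v. frechet_derivative (\<lambda>v. \<phi> (to_complex v)) (at v) w) \<longleftrightarrow>
        Ck_on k S (\<lambda>v. deriv \<phi> (to_complex v) * to_complex w)" for w
      by (rule Ck_on_cong[OF assms(1)]) (simp add: frechet_derivative_at[OF d, symmetric])
    moreover have "Ck_on k S (\<lambda>v. deriv \<phi> (to_complex v) * to_complex w)" for w
      using holomorphic_deriv[OF Suc.prems oS]
      by (intro Ck_on_bilinear[OF assms(1) bounded_bilinear_mult] Suc.IH Ck_on_const)
    ultimately show ?case using d by (auto intro: differentiableI)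
  qed
  then show ?thesis by (simp add: smooth_on_def)
qed

lemma to_complex_linear_CR:
  assumes "linear D" "D (axis 2 1) = \<i> * D (axis 1 1)"
  shows "D w = D (axis 1 1) * to_complex w"
proof -
  have "D w = D (w $ 1 *\<^sub>R axis 1 1 + w $ 2 *\<^sub>R axis 2 1)"
    by (rule arg_cong[of _ _ D]) (simp add: vec_eq_iff forall_2 axis_def)
  then have "D w = w $ 1 *\<^sub>R D (axis 1 1) + w $ 2 *\<^sub>R D (axis 2 1)"
    by (simp add: linear_add[OF assms(1)] linear_cmul[OF assms(1)])
  then show ?thesis
    unfolding assms(2) by (simp add: to_complex_def complex_eq_iff algebra_simps)
qed

text \<open>The Cauchy-Riemann equation makes the real derivative complex linear, that is,
  multiplication by its value at the first unit vector.\<close>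

lemma holomorphic_on_CauchyRiemann:
  fixes h :: "real ^ 2 \<Rightarrow> complex"
  assumes "open S" "\<And>v. v \<in> S \<Longrightarrow> h differentiable at v"
    and CR: "\<And>v. v \<in> S \<Longrightarrow>
      frechet_derivative h (at v) (axis 2 1) = \<i> * frechet_derivative h (at v) (axis 1 1)"
  shows "(\<lambda>z. h (of_complex_vec z)) holomorphic_on to_complex ` S"
proof (subst holomorphic_on_open[OF open_to_complex_image[OF assms(1)]], intro ballI)
  fix z assume "z \<in> to_complex ` S"
  then obtain v where v: "v \<in> S" "z = to_complex v" by auto
  let ?D = "frechet_derivative h (at v)"
  have D: "(h has_derivative ?D) (at v)" using assms(2)[OF v(1)] by (simp add: frechet_derivative_works)
  have v': "of_complex_vec z = v" using v by simp
  from diff_chain_at[OF bounded_linear_imp_has_derivative[OF bounded_linear_of_complex_vec], where x=z and g=h and g'="?D"] D v'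
  have "((\<lambda>z. h (of_complex_vec z)) has_derivative (\<lambda>w. ?D (of_complex_vec w))) (at z)"
    by (simp add: o_def)
  moreover have "(\<lambda>w. ?D (of_complex_vec w)) = (*) (?D (axis 1 1))"
    by (rule ext, subst to_complex_linear_CR[OF linear_frechet_derivative[OF assms(2)[OF v(1)]] CR[OF v(1)]])
      simp
  ultimately have "((\<lambda>z. h (of_complex_vec z)) has_field_derivative ?D (axis 1 1)) (at z)"
    by (simp add: has_field_derivative_def)
  then show "\<exists>f'. ((\<lambda>z. h (of_complex_vec z)) has_field_derivative f') (at z)" by blast
qed

section \<open>Calculus on a smooth surface\<close>

text \<open>Unlike \<open>dif\<close>, which uses the chart selected at each point and may jump from
  point to point, this keeps the chart \<open>c\<close> fixed. It can therefore be iterated, and all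
  second derivatives below are taken with it.\<close>

definition pd :: "'m chart \<Rightarrow> real ^ 2 \<Rightarrow> ('m \<Rightarrow> 'w::real_normed_vector) \<Rightarrow> 'm \<Rightarrow> 'w" where
  "pd c v g x = frechet_derivative (g \<circ> chart_inv c) (at (snd c x)) v"

definition smooth_at ::
  "'m::topological_space chart set \<Rightarrow> ('m \<Rightarrow> 'w::real_normed_vector) \<Rightarrow> 'm \<Rightarrow> bool" where
  "smooth_at A g x \<longleftrightarrow> (\<exists>U. open U \<and> x \<in> U \<and> smooth_map A U g)"

lemma smooth_map_subset: "smooth_map A U g \<Longrightarrow> V \<subseteq> U \<Longrightarrow> smooth_map A V g"
  unfolding smooth_map_def by (meson Int_mono image_mono order_refl smooth_on_subset)

lemma chart_inv_left: "is_chart c \<Longrightarrow> x \<in> fst c \<Longrightarrow> chart_inv c (snd c x) = x"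
  by (simp add: is_chart_def homeomorphism_def)

lemma chart_image_open:
  assumes "is_chart c" "open U" shows "open (snd c ` (fst c \<inter> U))"
proof -
  have "openin (top_of_set (fst c)) (fst c \<inter> U)" using assms(2) by auto
  from homeomorphism_imp_open_map[OF _ this] assms(1)
  have "openin (top_of_set (snd c ` fst c)) (snd c ` (fst c \<inter> U))"
    unfolding is_chart_def by blast
  then show ?thesis using assms(1) unfolding is_chart_def by (meson openin_open_eq)
qed

lemma smooth_at_eventually: "smooth_at A g x \<Longrightarrow> eventually (smooth_at A g) (nhds x)"
proof -
  assume "smooth_at A g x"
  then obtain U where U: "open U" "x \<in> U" "smooth_map A U g" unfolding smooth_at_def by auto
  then have "\<forall>y\<in>U. smooth_at A g y" unfolding smooth_at_def by auto
  with U(1,2) show ?thesis unfolding eventually_nhds by auto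
qed

lemma smooth_atI: "open U \<Longrightarrow> x \<in> U \<Longrightarrow> smooth_map A U g \<Longrightarrow> smooth_at A g x"
  unfolding smooth_at_def by auto

locale surface =
  fixes A :: "'m::{t2_space, second_countable_topology} chart set"
  assumes smooth_surface: "smooth_surface A"
begin

lemma admissible_atlas: "c \<in> A \<Longrightarrow> admissible_chart A c"
  using smooth_surface by (auto simp: smooth_surface_def admissible_chart_def)

lemma admissible_is_chart: "admissible_chart A c \<Longrightarrow> is_chart c"
  by (simp add: admissible_chart_def)

lemma admissible_open: "admissible_chart A c \<Longrightarrow> open (fst c)"
  by (simp add: admissible_chart_def is_chart_def)

lemma atlas_cover: obtains c where "c \<in> A" "x \<in> fst c"
proof -
  have "x \<in> (\<Union>c\<in>A. fst c)"
    using smooth_surface by (simp only: smooth_surface_def) simp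
  then show ?thesis using that by blast
qed

lemma chart_at: "chart_at A x \<in> A" "x \<in> fst (chart_at A x)"
proof -
  have "\<exists>c. c \<in> A \<and> x \<in> fst c" using atlas_cover by blast
  from someI_ex[OF this] show "chart_at A x \<in> A" "x \<in> fst (chart_at A x)"
    by (auto simp: chart_at_def)
qed

lemma admissible_chart_at: "admissible_chart A (chart_at A x)"
  by (rule admissible_atlas[OF chart_at(1)])

text \<open>\<open>smooth_map\<close> tests only the charts of \<open>A\<close>. The conformal
  charts are merely compatible with these, so smoothness in them is obtained through the transition
  maps.\<close>

lemma smooth_map_imp_chart:
  assumes c: "admissible_chart A c" and U: "open U" and g: "smooth_map A U g"
  shows "smooth_on (snd c ` (fst c \<inter> U)) (g \<circ> chart_inv c)"
proof (rule smooth_on_local)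
  fix y assume "y \<in> snd c ` (fst c \<inter> U)"
  then obtain x where x: "x \<in> fst c" "x \<in> U" "y = snd c x" by auto
  obtain c' where c': "c' \<in> A" "x \<in> fst c'" by (rule atlas_cover)
  note ic = admissible_is_chart[OF c] and ic' = admissible_is_chart[OF admissible_atlas[OF c'(1)]]
  have o': "open (fst c')" using ic' by (simp add: is_chart_def)
  let ?T = "snd c ` (fst c \<inter> (fst c' \<inter> U))"
  have T: "open ?T" using o' U by (intro chart_image_open[OF ic]) auto
  have tr: "smooth_on ?T (snd c' \<circ> chart_inv c)"
    using c c'(1) unfolding admissible_chart_def compatible_def
    by (auto intro: smooth_on_subset)
  have sg: "smooth_on (snd c' ` (fst c' \<inter> U)) (g \<circ> chart_inv c')"
    using g c'(1) by (simp add: smooth_map_def)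
  have "smooth_on ?T (\<lambda>y. (g \<circ> chart_inv c') ((snd c' \<circ> chart_inv c) y))"
    by (rule smooth_on_compose[OF T _ sg tr]) (auto simp: chart_inv_left[OF ic])
  moreover have "(g \<circ> chart_inv c') ((snd c' \<circ> chart_inv c) y) = (g \<circ> chart_inv c) y" if "y \<in> ?T" for y
    using that by (auto simp: chart_inv_left[OF ic] chart_inv_left[OF ic'])
  ultimately have "smooth_on ?T (g \<circ> chart_inv c)"
    using smooth_on_cong[OF T] by metis
  then show "\<exists>T. open T \<and> y \<in> T \<and> smooth_on T (g \<circ> chart_inv c)"
    using T x c' by blast
qed

lemma chart_imp_smooth_map:
  assumes c: "admissible_chart A c" and U: "open U" "U \<subseteq> fst c"
    and g: "smooth_on (snd c ` U) (g \<circ> chart_inv c)"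
  shows "smooth_map A U g"
  unfolding smooth_map_def
proof
  fix c' assume c': "c' \<in> A"
  note ic = admissible_is_chart[OF c] and ic' = admissible_is_chart[OF admissible_atlas[OF c']]
  let ?T = "snd c' ` (fst c' \<inter> U)"
  have T: "open ?T" by (rule chart_image_open[OF ic' U(1)])
  have tr: "smooth_on ?T (snd c \<circ> chart_inv c')"
    using c c' U(2) unfolding admissible_chart_def compatible_def
    by (auto intro: smooth_on_subset)
  have "smooth_on ?T (\<lambda>y. (g \<circ> chart_inv c) ((snd c \<circ> chart_inv c') y))"
    by (rule smooth_on_compose[OF T _ g tr]) (auto simp: chart_inv_left[OF ic'])
  moreover have "(g \<circ> chart_inv c) ((snd c \<circ> chart_inv c') y) = (g \<circ> chart_inv c') y" if "y \<in> ?T" for y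
    using that U(2) by (auto simp: chart_inv_left[OF ic] chart_inv_left[OF ic'] subset_iff)
  ultimately show "smooth_on ?T (g \<circ> chart_inv c')"
    using smooth_on_cong[OF T] by metis
qed

lemma smooth_at_chart:
  assumes "smooth_at A g x" "admissible_chart A c" "x \<in> fst c"
  shows "\<exists>T. open T \<and> snd c x \<in> T \<and> T \<subseteq> snd c ` fst c \<and> smooth_on T (g \<circ> chart_inv c)"
proof -
  obtain U where U: "open U" "x \<in> U" "smooth_map A U g" using assms(1) by (auto simp: smooth_at_def)
  show ?thesis
  proof (intro exI conjI)
    show "open (snd c ` (fst c \<inter> U))"
      by (rule chart_image_open[OF admissible_is_chart[OF assms(2)] U(1)])
    show "smooth_on (snd c ` (fst c \<inter> U)) (g \<circ> chart_inv c)"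
      by (rule smooth_map_imp_chart[OF assms(2) U(1,3)])
  qed (use assms U in auto)
qed

lemma smooth_atI_chart:
  assumes "admissible_chart A c" "open U" "x \<in> U" "U \<subseteq> fst c" "smooth_on (snd c ` U) (g \<circ> chart_inv c)"
  shows "smooth_at A g x"
  using assms by (intro smooth_atI[OF assms(2,3)] chart_imp_smooth_map[OF assms(1,2,4,5)])

lemma smooth_map_iff_smooth_at:
  assumes "open U" shows "smooth_map A U g \<longleftrightarrow> (\<forall>x\<in>U. smooth_at A g x)"
proof
  show "smooth_map A U g \<Longrightarrow> \<forall>x\<in>U. smooth_at A g x"
    using assms by (auto intro: smooth_atI)
  assume g: "\<forall>x\<in>U. smooth_at A g x"
  show "smooth_map A U g"
    unfolding smooth_map_def
  proof (intro ballI smooth_on_local)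
    fix c y assume c: "c \<in> A" and "y \<in> snd c ` (fst c \<inter> U)"
    then obtain x where x: "x \<in> fst c" "x \<in> U" "y = snd c x" by auto
    from smooth_at_chart[OF g[rule_format, OF x(2)] admissible_atlas[OF c] x(1)] x(3) show "\<exists>T. open T \<and> y \<in> T \<and> smooth_on T (g \<circ> chart_inv c)" by blast
  qed
qed

section \<open>Smoothness near a point and its closure properties\<close>

lemma smooth_at_cong:
  assumes "eventually (\<lambda>y. g y = h y) (nhds x)"
  shows "smooth_at A g x \<longleftrightarrow> smooth_at A h x"
proof -
  have imp: "smooth_at A h x" if e: "eventually (\<lambda>y. g y = h y) (nhds x)" and g: "smooth_at A g x"
      for g h :: "'m \<Rightarrow> 'w::real_normed_vector"
  proof -
    obtain U where U: "open U" "x \<in> U" "smooth_map A U g" using g(1) by (auto simp: smooth_at_def)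
    obtain V where V: "open V" "x \<in> V" "\<And>y. y \<in> V \<Longrightarrow> g y = h y"
      using e by (auto simp: eventually_nhds)
    have "smooth_map A (U \<inter> V) h"
      unfolding smooth_map_def
    proof
      fix c assume c: "c \<in> A"
      note ic = admissible_is_chart[OF admissible_atlas[OF c]]
      have "smooth_on (snd c ` (fst c \<inter> (U \<inter> V))) (g \<circ> chart_inv c)"
        using smooth_map_subset[OF U(3), of "U \<inter> V"] c by (simp add: smooth_map_def)
      moreover have "open (snd c ` (fst c \<inter> (U \<inter> V)))"
        using U(1) V(1) by (intro chart_image_open[OF ic]) auto
      moreover have "(g \<circ> chart_inv c) y = (h \<circ> chart_inv c) y" if "y \<in> snd c ` (fst c \<inter> (U \<inter> V))" for y
        using that V(3) by (auto simp: chart_inv_left[OF ic])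
      ultimately show "smooth_on (snd c ` (fst c \<inter> (U \<inter> V))) (h \<circ> chart_inv c)"
        by (simp add: smooth_on_cong[of _ "g \<circ> chart_inv c" "h \<circ> chart_inv c"])
    qed
    moreover have "open (U \<inter> V)" "x \<in> U \<inter> V" using U V by auto
    ultimately show ?thesis unfolding smooth_at_def by blast
  qed
  moreover have "eventually (\<lambda>y. h y = g y) (nhds x)"
    using assms by (rule eventually_mono) simp
  ultimately show ?thesis using assms by blast
qed

lemma smooth_at_lift1:
  assumes "\<And>(S :: (real ^ 2) set) g. open S \<Longrightarrow> smooth_on S g \<Longrightarrow> smooth_on S (\<lambda>y. F (g y))"
    "smooth_at A g x"
  shows "smooth_at A (\<lambda>y. F (g y)) x"
proof -
  obtain U where U: "open U" "x \<in> U" "smooth_map A U g" using assms(2) by (auto simp: smooth_at_def)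
  have "smooth_map A U (\<lambda>y. F (g y))"
    unfolding smooth_map_def o_def
  proof
    fix c assume "c \<in> A"
    then have "open (snd c ` (fst c \<inter> U))" "smooth_on (snd c ` (fst c \<inter> U)) (\<lambda>y. g (chart_inv c y))"
      using U chart_image_open[OF admissible_is_chart[OF admissible_atlas]]
      by (simp_all add: smooth_map_def o_def)
    then show "smooth_on (snd c ` (fst c \<inter> U)) (\<lambda>y. F (g (chart_inv c y)))"
      by (rule assms(1)[where g="\<lambda>y. g (chart_inv c y)"])
  qed
  then show ?thesis using U by (auto simp: smooth_at_def)
qed

lemma smooth_at_lift2:
  assumes "\<And>(S :: (real ^ 2) set) g h. open S \<Longrightarrow> smooth_on S g \<Longrightarrow> smooth_on S h \<Longrightarrow> smooth_on S (\<lambda>y. F (g y) (h y))"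
    "smooth_at A g x" "smooth_at A h x"
  shows "smooth_at A (\<lambda>y. F (g y) (h y)) x"
proof -
  obtain U where U: "open U" "x \<in> U" "smooth_map A U g" using assms(2) by (auto simp: smooth_at_def)
  obtain V where V: "open V" "x \<in> V" "smooth_map A V h" using assms(3) by (auto simp: smooth_at_def)
  have gh: "smooth_map A (U \<inter> V) g" "smooth_map A (U \<inter> V) h"
    using U V by (auto intro: smooth_map_subset)
  have o: "open (U \<inter> V)" using U V by auto
  have "smooth_map A (U \<inter> V) (\<lambda>y. F (g y) (h y))"
    unfolding smooth_map_def o_def
  proof
    fix c assume "c \<in> A"
    then have "open (snd c ` (fst c \<inter> (U \<inter> V)))"
      "smooth_on (snd c ` (fst c \<inter> (U \<inter> V))) (\<lambda>y. g (chart_inv c y))"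
      "smooth_on (snd c ` (fst c \<inter> (U \<inter> V))) (\<lambda>y. h (chart_inv c y))"
      using o gh chart_image_open[OF admissible_is_chart[OF admissible_atlas]]
      by (simp_all add: smooth_map_def o_def)
    then show "smooth_on (snd c ` (fst c \<inter> (U \<inter> V))) (\<lambda>y. F (g (chart_inv c y)) (h (chart_inv c y)))"
      by (rule assms(1)[where g="\<lambda>y. g (chart_inv c y)" and h="\<lambda>y. h (chart_inv c y)"])
  qed
  then show ?thesis using U V o by (auto simp: smooth_at_def)
qed

lemma smooth_at_const: "smooth_at A (\<lambda>x. c) x"
  unfolding smooth_at_def smooth_map_def by (intro exI[of _ UNIV]) (auto simp: o_def smooth_on_const)

lemma smooth_at_bounded_linear:
  "bounded_linear L \<Longrightarrow> smooth_at A g x \<Longrightarrow> smooth_at A (\<lambda>y. L (g y)) x"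
  by (rule smooth_at_lift1[where F=L]) (rule smooth_on_bounded_linear)

lemma smooth_at_uminus: "smooth_at A g x \<Longrightarrow> smooth_at A (\<lambda>y. - g y) x"
  by (rule smooth_at_lift1[where F=uminus, OF smooth_on_uminus])

lemma smooth_at_vec_nth: "smooth_at A g x \<Longrightarrow> smooth_at A (\<lambda>y. g y $ i) x"
  by (rule smooth_at_lift1[where F="\<lambda>v. v $ i", OF smooth_on_vec_nth])

lemma smooth_at_add: "smooth_at A g x \<Longrightarrow> smooth_at A h x \<Longrightarrow> smooth_at A (\<lambda>y. g y + h y) x"
  by (rule smooth_at_lift2[where F="(+)", OF smooth_on_add])

lemma smooth_at_diff: "smooth_at A g x \<Longrightarrow> smooth_at A h x \<Longrightarrow> smooth_at A (\<lambda>y. g y - h y) x"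
  by (rule smooth_at_lift2[where F="(-)", OF smooth_on_diff])

lemma smooth_at_bilinear:
  "bounded_bilinear p \<Longrightarrow> smooth_at A g x \<Longrightarrow> smooth_at A h x \<Longrightarrow> smooth_at A (\<lambda>y. p (g y) (h y)) x"
  by (rule smooth_at_lift2[where F=p]) (rule smooth_on_bilinear)

lemmas smooth_at_mult = smooth_at_bilinear[OF bounded_bilinear_mult]
lemmas smooth_at_scaleR = smooth_at_bilinear[OF bounded_bilinear_scaleR]

lemma smooth_at_isCont:
  assumes "smooth_at A g x" shows "isCont g x"
proof -
  obtain c where c: "c \<in> A" "x \<in> fst c" by (rule atlas_cover)
  obtain T where T: "open T" "snd c x \<in> T" "T \<subseteq> snd c ` fst c" "smooth_on T (g \<circ> chart_inv c)"
    using smooth_at_chart[OF assms admissible_atlas[OF c(1)] c(2)] by blast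
  note ic = admissible_is_chart[OF admissible_atlas[OF c(1)]]
  have "isCont (g \<circ> chart_inv c) (snd c x)"
    using smooth_on_continuous[OF T(4)] T(1,2) continuous_on_eq_continuous_at by blast
  moreover have "isCont (snd c) x"
    using ic c(2) by (auto simp: is_chart_def homeomorphism_def continuous_on_eq_continuous_at)
  ultimately have "isCont (\<lambda>y. (g \<circ> chart_inv c) (snd c y)) x"
    using isCont_o2[of x "snd c" "g \<circ> chart_inv c"] by simp
  moreover have "eventually (\<lambda>y. (g \<circ> chart_inv c) (snd c y) = g y) (nhds x)"
    using eventually_nhds_in_open[OF admissible_open[OF admissible_atlas[OF c(1)]] c(2)]
    by (rule eventually_mono) (simp add: chart_inv_left[OF ic])
  ultimately show ?thesis by (simp add: isCont_cong)
qed

lemma smooth_at_nonzero: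
  assumes "smooth_at A g x" "g x \<noteq> 0" shows "eventually (\<lambda>y. g y \<noteq> 0) (nhds x)"
proof -
  have "(g \<longlongrightarrow> g x) (nhds x)"
    using smooth_at_isCont[OF assms(1)] by (simp add: isCont_def tendsto_at_iff_tendsto_nhds)
  then have "eventually (\<lambda>y. g y \<in> - {0}) (nhds x)"
    by (rule topological_tendstoD) (use assms in auto)
  then show ?thesis by simp
qed

lemma smooth_at_inverse:
  fixes g :: "'m \<Rightarrow> real"
  assumes g: "smooth_at A g x" and nz: "g x \<noteq> 0"
  shows "smooth_at A (\<lambda>y. inverse (g y)) x"
proof -
  obtain U where U: "open U" "x \<in> U" "smooth_map A U g" using g by (auto simp: smooth_at_def)
  obtain V where V: "open V" "x \<in> V" "\<And>y. y \<in> V \<Longrightarrow> g y \<noteq> 0"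
    using smooth_at_nonzero[OF g nz] by (auto simp: eventually_nhds)
  have o: "open (U \<inter> V)" using U V by auto
  have "smooth_map A (U \<inter> V) (\<lambda>y. inverse (g y))"
    unfolding smooth_map_def o_def
  proof
    fix c assume c: "c \<in> A"
    note ic = admissible_is_chart[OF admissible_atlas[OF c]]
    have "smooth_on (snd c ` (fst c \<inter> (U \<inter> V))) (g \<circ> chart_inv c)"
      using smooth_map_subset[OF U(3), of "U \<inter> V"] c by (simp add: smooth_map_def)
    then show "smooth_on (snd c ` (fst c \<inter> (U \<inter> V))) (\<lambda>x. inverse (g (chart_inv c x)))"
      by (intro smooth_on_inverse[OF chart_image_open[OF ic o]])
        (use V(3) in \<open>auto simp: chart_inv_left[OF ic] o_def\<close>)
  qed
  then show ?thesis using U V o by (auto simp: smooth_at_def)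
qed

lemma smooth_at_differentiable:
  assumes "smooth_at A g x" "admissible_chart A c" "x \<in> fst c"
  shows "(g \<circ> chart_inv c) differentiable at (snd c x)"
proof -
  obtain T where "open T" "snd c x \<in> T" "T \<subseteq> snd c ` fst c" "smooth_on T (g \<circ> chart_inv c)"
    using smooth_at_chart[OF assms] by blast
  then show ?thesis by (auto intro: smooth_on_differentiable)
qed

section \<open>Derivatives in a fixed chart\<close>

lemma pd_linear:
  assumes "smooth_at A g x" "admissible_chart A c" "x \<in> fst c"
  shows "linear (\<lambda>v. pd c v g x)"
  using linear_frechet_derivative[OF smooth_at_differentiable[OF assms]] by (simp add: pd_def[abs_def])

lemma pd_cong:
  assumes "eventually (\<lambda>y. g y = h y) (nhds x)" "admissible_chart A c" "x \<in> fst c"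
  shows "pd c v g x = pd c v h x"
proof -
  obtain V where V: "open V" "x \<in> V" "\<And>y. y \<in> V \<Longrightarrow> g y = h y"
    using assms(1) by (auto simp: eventually_nhds)
  note ic = admissible_is_chart[OF assms(2)]
  have "frechet_derivative (g \<circ> chart_inv c) (at (snd c x)) =
      frechet_derivative (h \<circ> chart_inv c) (at (snd c x))"
    by (rule frechet_derivative_cong_open(1)[OF chart_image_open[OF ic V(1)]])
      (use V assms(3) in \<open>auto simp: chart_inv_left[OF ic]\<close>)
  then show ?thesis by (simp add: pd_def)
qed

lemma smooth_at_pd:
  assumes "smooth_at A g x" "admissible_chart A c" "x \<in> fst c"
  shows "smooth_at A (pd c v g) x"
proof -
  obtain U where U: "open U" "x \<in> U" "smooth_map A U g" using assms(1) by (auto simp: smooth_at_def)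
  note ic = admissible_is_chart[OF assms(2)]
  have o: "open (fst c \<inter> U)" using U admissible_open[OF assms(2)] by auto
  note os = chart_image_open[OF ic U(1)]
  have "smooth_on (snd c ` (fst c \<inter> U)) (\<lambda>y. frechet_derivative (g \<circ> chart_inv c) (at y) v)"
    by (rule smooth_on_frechet_derivative[OF smooth_map_imp_chart[OF assms(2) U(1,3)]])
  then have "smooth_on (snd c ` (fst c \<inter> U)) (pd c v g \<circ> chart_inv c)"
    by (rule smooth_on_cong[OF os, THEN iffD1, rotated]) (auto simp: pd_def chart_inv_left[OF ic])
  then show ?thesis
    using U assms(3) by (intro smooth_atI_chart[OF assms(2) o]) auto
qed

lemma pd_const: "pd c v (\<lambda>x. k) x = 0"
  by (simp add: pd_def o_def)

lemma pd_bounded_linear: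
  assumes "bounded_linear L" "smooth_at A g x" "admissible_chart A c" "x \<in> fst c"
  shows "pd c v (\<lambda>y. L (g y)) x = L (pd c v g x)"
  using frechet_derivative_bounded_linear_compose(1)[OF assms(1) smooth_at_differentiable[OF assms(2-)]]
  by (simp add: pd_def o_def)

lemma pd_bilinear:
  assumes "bounded_bilinear p" "smooth_at A g x" "smooth_at A h x" "admissible_chart A c" "x \<in> fst c"
  shows "pd c v (\<lambda>y. p (g y) (h y)) x = p (g x) (pd c v h x) + p (pd c v g x) (h x)"
  using frechet_derivative_bilinear(1)[OF assms(1) smooth_at_differentiable[OF assms(2,4,5)]
      smooth_at_differentiable[OF assms(3,4,5)]]
    chart_inv_left[OF admissible_is_chart[OF assms(4)] assms(5)]
  by (simp add: pd_def o_def)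

lemmas pd_scaleR = pd_bilinear[OF bounded_bilinear_scaleR]
lemmas pd_mult = pd_bilinear[OF bounded_bilinear_mult]

lemma pd_add:
  assumes "smooth_at A g x" "smooth_at A h x" "admissible_chart A c" "x \<in> fst c"
  shows "pd c v (\<lambda>y. g y + h y) x = pd c v g x + pd c v h x"
proof -
  have "((\<lambda>y. (g \<circ> chart_inv c) y + (h \<circ> chart_inv c) y) has_derivative
    (\<lambda>v. frechet_derivative (g \<circ> chart_inv c) (at (snd c x)) v +
      frechet_derivative (h \<circ> chart_inv c) (at (snd c x)) v)) (at (snd c x))"
    by (intro has_derivative_add frechet_derivative_worksI smooth_at_differentiable assms)
  from frechet_derivative_at[OF this, symmetric] show ?thesis by (simp add: pd_def o_def)
qed

lemma pd_uminus:
  assumes "smooth_at A g x" "admissible_chart A c" "x \<in> fst c"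
  shows "pd c v (\<lambda>y. - g y) x = - pd c v g x"
  using pd_bounded_linear[OF bounded_linear_minus[OF bounded_linear_ident] assms] by simp

lemma pd_diff:
  assumes "smooth_at A g x" "smooth_at A h x" "admissible_chart A c" "x \<in> fst c"
  shows "pd c v (\<lambda>y. g y - h y) x = pd c v g x - pd c v h x"
  using pd_add[OF assms(1) smooth_at_uminus[OF assms(2)] assms(3,4)] pd_uminus[OF assms(2-4)] by simp

lemma pd_commute:
  fixes g :: "'m \<Rightarrow> 'w::euclidean_space"
  assumes "smooth_at A g x" "admissible_chart A c" "x \<in> fst c"
  shows "pd c v (pd c w g) x = pd c w (pd c v g) x"
proof -
  obtain T where T: "open T" "snd c x \<in> T" "T \<subseteq> snd c ` fst c" "smooth_on T (g \<circ> chart_inv c)"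
    using smooth_at_chart[OF assms] by blast
  note ic = admissible_is_chart[OF assms(2)]
  have "pd c v (pd c w g) x =
      frechet_derivative (\<lambda>y. frechet_derivative (g \<circ> chart_inv c) (at y) w) (at (snd c x)) v" for v w
    unfolding pd_def[of c v]
    by (subst frechet_derivative_cong_open(1)[OF T(1,2)])
      (use T(3) in \<open>auto simp: pd_def chart_inv_left[OF ic] subset_iff image_iff\<close>)
  then show ?thesis using mixed_derivatives_commute[OF T(1,2,4)] by simp
qed

lemma smooth_at_snd_chart:
  assumes "admissible_chart A c" "x \<in> fst c" shows "smooth_at A (snd c) x"
proof -
  note ic = admissible_is_chart[OF assms(1)]
  have o: "open (snd c ` fst c)" using ic by (simp add: is_chart_def)
  then have "smooth_on (snd c ` fst c) (\<lambda>y. y)"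
    by (intro smooth_on_linear bounded_linear_ident)
  moreover have "y = (snd c \<circ> chart_inv c) y" if "y \<in> snd c ` fst c" for y
    using that by (auto simp: chart_inv_left[OF ic])
  ultimately have "smooth_on (snd c ` fst c) (snd c \<circ> chart_inv c)"
    using smooth_on_cong[OF o, of "\<lambda>y. y" "snd c \<circ> chart_inv c"] by blast
  then show ?thesis
    by (intro smooth_atI_chart[OF assms(1) admissible_open[OF assms(1)] assms(2)]) auto
qed

lemma smooth_at_compose_chart:
  assumes c: "admissible_chart A c" "x \<in> fst c" and T: "open T" "snd c x \<in> T" and \<psi>: "smooth_on T \<psi>"
  shows "smooth_at A (\<lambda>y. \<psi> (snd c y)) x"
    and "pd c v (\<lambda>y. \<psi> (snd c y)) x = frechet_derivative \<psi> (at (snd c x)) v"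
proof -
  note ic = admissible_is_chart[OF c(1)]
  have oi: "open (snd c ` fst c \<inter> T)" using ic T by (auto simp: is_chart_def)
  let ?U = "{y \<in> fst c. snd c y \<in> T}"
  have "continuous_on (fst c) (snd c)" using ic by (simp add: is_chart_def homeomorphism_def)
  then have "open (snd c -` T \<inter> fst c)"
    using admissible_open[OF c(1)] T(1) by (simp add: continuous_on_open_vimage)
  moreover have "snd c -` T \<inter> fst c = ?U" by auto
  ultimately have U: "open ?U" by simp
  have im: "snd c ` ?U = snd c ` fst c \<inter> T" by auto
  have eq: "\<psi> y = ((\<lambda>y. \<psi> (snd c y)) \<circ> chart_inv c) y" if "y \<in> snd c ` fst c \<inter> T" for y
    using that by (auto simp: chart_inv_left[OF ic])
  have "smooth_on (snd c ` ?U) ((\<lambda>y. \<psi> (snd c y)) \<circ> chart_inv c)"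
    unfolding im using smooth_on_cong[OF oi, of \<psi> "(\<lambda>y. \<psi> (snd c y)) \<circ> chart_inv c", OF eq]
      smooth_on_subset[OF \<psi>, of "snd c ` fst c \<inter> T"] by blast
  then show "smooth_at A (\<lambda>y. \<psi> (snd c y)) x"
    using c T by (intro smooth_atI_chart[OF c(1) U]) auto
  show "pd c v (\<lambda>y. \<psi> (snd c y)) x = frechet_derivative \<psi> (at (snd c x)) v"
    unfolding pd_def
    by (subst frechet_derivative_cong_open(1)[OF oi _ eq, symmetric]) (use c T in auto)
qed

lemma pd_snd_chart:
  assumes "admissible_chart A c" "x \<in> fst c" shows "pd c v (snd c) x = v"
  using smooth_at_compose_chart(2)[OF assms open_UNIV, of "\<lambda>y. y"]
  by (simp add: smooth_on_linear bounded_linear_ident)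

lemma pd_chain:
  assumes g: "smooth_at A g x" and c: "admissible_chart A c" "x \<in> fst c"
    and c': "admissible_chart A c'" "x \<in> fst c'"
  shows "pd c v g x = pd c' (pd c v (snd c') x) g x"
proof -
  note ic = admissible_is_chart[OF c(1)] and ic' = admissible_is_chart[OF c'(1)]
  have "((snd c' \<circ> chart_inv c) has_derivative frechet_derivative (snd c' \<circ> chart_inv c) (at (snd c x)))
      (at (snd c x))"
    by (intro frechet_derivative_worksI smooth_at_differentiable smooth_at_snd_chart c c')
  moreover have "((g \<circ> chart_inv c') has_derivative frechet_derivative (g \<circ> chart_inv c') (at (snd c' x)))
      (at ((snd c' \<circ> chart_inv c) (snd c x)))"
    using frechet_derivative_worksI[OF smooth_at_differentiable[OF g c']]
    by (simp add: chart_inv_left[OF ic c(2)])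
  ultimately have d: "((g \<circ> chart_inv c') \<circ> (snd c' \<circ> chart_inv c) has_derivative
     frechet_derivative (g \<circ> chart_inv c') (at (snd c' x)) \<circ>
     frechet_derivative (snd c' \<circ> chart_inv c) (at (snd c x))) (at (snd c x))"
    by (rule diff_chain_at)
  have "frechet_derivative (g \<circ> chart_inv c) (at (snd c x)) =
      frechet_derivative ((g \<circ> chart_inv c') \<circ> (snd c' \<circ> chart_inv c)) (at (snd c x))"
  proof (rule frechet_derivative_cong_open(1)[OF chart_image_open[OF ic admissible_open[OF c'(1)]]])
    show "snd c x \<in> snd c ` (fst c \<inter> fst c')" using c c' by auto
    show "(g \<circ> chart_inv c) y = (g \<circ> chart_inv c' \<circ> (snd c' \<circ> chart_inv c)) y"
      if "y \<in> snd c ` (fst c \<inter> fst c')" for y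
      using that by (auto simp: chart_inv_left[OF ic] chart_inv_left[OF ic'])
  qed
  then show ?thesis using frechet_derivative_at[OF d, symmetric] by (simp add: pd_def)
qed

section \<open>Tangent vectors and their components in a chart\<close>

lemma dif_eq_pd: "dif A g x X = pd (chart_at A x) X g x"
  by (simp add: dif_def pd_def)

lemma coord_vec_eq_pd: "coord_vec A c v x = pd c v (snd (chart_at A x)) x"
  by (simp add: coord_vec_def pd_def)

lemma dif_coord_vec:
  assumes "smooth_at A g x" "admissible_chart A c" "x \<in> fst c"
  shows "dif A g x (coord_vec A c v x) = pd c v g x"
  using pd_chain[OF assms admissible_chart_at chart_at(2)] by (simp add: dif_eq_pd coord_vec_eq_pd)

lemma coord_vec_linear:
  assumes "admissible_chart A c" "x \<in> fst c" shows "linear (\<lambda>v. coord_vec A c v x)"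
  unfolding coord_vec_eq_pd
  by (rule pd_linear[OF smooth_at_snd_chart[OF admissible_chart_at chart_at(2)] assms])

lemma dif_snd_coord_vec:
  assumes "admissible_chart A c" "x \<in> fst c" shows "dif A (snd c) x (coord_vec A c v x) = v"
  by (simp add: dif_coord_vec[OF smooth_at_snd_chart[OF assms] assms] pd_snd_chart[OF assms])

lemma coord_vec_dif_snd:
  assumes "admissible_chart A c" "x \<in> fst c" shows "coord_vec A c (dif A (snd c) x X) x = X"
proof -
  have "pd (chart_at A x) X (snd (chart_at A x)) x =
      pd c (pd (chart_at A x) X (snd c) x) (snd (chart_at A x)) x"
    by (intro pd_chain smooth_at_snd_chart admissible_chart_at chart_at(2) assms)
  then show ?thesis
    by (simp add: coord_vec_eq_pd dif_eq_pd pd_snd_chart[OF admissible_chart_at chart_at(2)])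
qed

lemma coord_vec_eq_0_iff:
  assumes "admissible_chart A c" "x \<in> fst c" shows "coord_vec A c v x = 0 \<longleftrightarrow> v = 0"
  using dif_snd_coord_vec[OF assms, of v] coord_vec_linear[OF assms]
    pd_linear[OF smooth_at_snd_chart[OF assms] admissible_chart_at chart_at(2)]
  by (metis dif_eq_pd linear_0)

lemma dif_linear: "smooth_at A g x \<Longrightarrow> linear (dif A g x)"
  using pd_linear[OF _ admissible_chart_at chart_at(2)] by (simp add: dif_eq_pd[abs_def])

lemma dif_cong: "eventually (\<lambda>y. g y = h y) (nhds x) \<Longrightarrow> dif A g x X = dif A h x X"
  unfolding dif_eq_pd by (rule pd_cong[OF _ admissible_chart_at chart_at(2)])

lemma dif_const: "dif A (\<lambda>x. k) x X = 0"
  by (simp add: dif_eq_pd pd_const)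

lemma dif_bilinear:
  "bounded_bilinear p \<Longrightarrow> smooth_at A g x \<Longrightarrow> smooth_at A h x \<Longrightarrow>
    dif A (\<lambda>y. p (g y) (h y)) x X = p (g x) (dif A h x X) + p (dif A g x X) (h x)"
  unfolding dif_eq_pd by (rule pd_bilinear[OF _ _ _ admissible_chart_at chart_at(2)])

lemmas dif_scaleR = dif_bilinear[OF bounded_bilinear_scaleR]

lemma dif_bounded_linear:
  "bounded_linear L \<Longrightarrow> smooth_at A g x \<Longrightarrow> dif A (\<lambda>y. L (g y)) x X = L (dif A g x X)"
  unfolding dif_eq_pd by (rule pd_bounded_linear[OF _ _ admissible_chart_at chart_at(2)])

lemma dif_add:
  "smooth_at A g x \<Longrightarrow> smooth_at A h x \<Longrightarrow> dif A (\<lambda>y. g y + h y) x X = dif A g x X + dif A h x X"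
  unfolding dif_eq_pd by (rule pd_add[OF _ _ admissible_chart_at chart_at(2)])

lemma dif_diff:
  "smooth_at A g x \<Longrightarrow> smooth_at A h x \<Longrightarrow> dif A (\<lambda>y. g y - h y) x X = dif A g x X - dif A h x X"
  unfolding dif_eq_pd by (rule pd_diff[OF _ _ admissible_chart_at chart_at(2)])

lemma eventually_chart:
  "admissible_chart A c \<Longrightarrow> x \<in> fst c \<Longrightarrow> eventually (\<lambda>y. y \<in> fst c) (nhds x)"
  by (rule eventually_nhds_in_open[OF admissible_open])

end

section \<open>The Lie sphere form\<close>

lemma span_2: "span {a, b :: 'a::real_vector} = {p *\<^sub>R a + q *\<^sub>R b | p q. True}"
proof (intro set_eqI iffI)
  fix x assume "x \<in> span {a, b}"
  then obtain p where "x - p *\<^sub>R a \<in> span {b}" unfolding span_insert[of a] by auto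
  then obtain q where "x - p *\<^sub>R a = q *\<^sub>R b" unfolding span_singleton by auto
  then have "x = p *\<^sub>R a + q *\<^sub>R b" by (simp add: algebra_simps)
  then show "x \<in> {p *\<^sub>R a + q *\<^sub>R b | p q. True}" by auto
qed (auto intro: span_add span_scale span_base)

lemma span_3:
  "span {a, b, c :: 'a::real_vector} = {p *\<^sub>R a + q *\<^sub>R b + r *\<^sub>R c | p q r. True}"
proof (intro set_eqI iffI)
  fix x assume "x \<in> span {a, b, c}"
  then obtain p where "x - p *\<^sub>R a \<in> span {b, c}" unfolding span_insert[of a] by auto
  then obtain q r where "x - p *\<^sub>R a = q *\<^sub>R b + r *\<^sub>R c" unfolding span_2 by auto
  then have "x = p *\<^sub>R a + q *\<^sub>R b + r *\<^sub>R c" by (simp add: algebra_simps)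
  then show "x \<in> {p *\<^sub>R a + q *\<^sub>R b + r *\<^sub>R c | p q r. True}" by auto
qed (auto intro!: span_add span_scale intro: span_base)

locale lie_form =
  fixes B :: "'v::euclidean_space \<Rightarrow> 'v \<Rightarrow> real"
  assumes form: "lie_sphere_form B"
begin

lemma symmetric: "symmetric_bilinear B"
  using form by (simp add: lie_sphere_form_def has_signature_def)

lemma sym: "B x y = B y x"
  using symmetric by (simp add: symmetric_bilinear_def)

sublocale B: bounded_bilinear B
  using symmetric by (simp add: bilinear_conv_bounded_bilinear[symmetric] bilinear_def symmetric_bilinear_def)

lemma nondegenerate: "(\<And>y. B x y = 0) \<Longrightarrow> x = 0"
  using form by (auto simp: lie_sphere_form_def nondegenerate_def)

lemmas expand = B.add_left B.add_right B.diff_left B.diff_right B.scaleR_left B.scaleR_right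
  B.minus_left B.minus_right B.zero_left B.zero_right

lemma wedge_app: "blinfun_apply (wedge B a b) c = B a c *\<^sub>R b - B b c *\<^sub>R a"
  by (rule wedge_apply[OF symmetric])

lemma bounded_bilinear_wedge: "bounded_bilinear (wedge B)"
proof -
  have "linear (wedge B a)" for a
    by (rule linearI; rule blinfun_eqI)
      (simp_all add: wedge_app expand blinfun.add_left blinfun.scaleR_left algebra_simps)
  moreover have "linear (\<lambda>a. wedge B a b)" for b
    by (rule linearI; rule blinfun_eqI)
      (simp_all add: wedge_app expand blinfun.add_left blinfun.scaleR_left algebra_simps)
  ultimately show ?thesis
    by (simp add: bilinear_conv_bounded_bilinear[symmetric] bilinear_def)
qed

sublocale wedge: bounded_bilinear "wedge B"
  by (rule bounded_bilinear_wedge)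

lemma wedge_self: "wedge B a a = 0"
  by (rule blinfun_eqI) (simp add: wedge_app)

lemma wedge_swap: "wedge B a b = - wedge B b a"
  by (rule blinfun_eqI) (simp add: wedge_app blinfun.minus_left)

lemma wedge_skew: "B (blinfun_apply (wedge B a b) u) w = - B u (blinfun_apply (wedge B a b) w)"
  by (simp add: wedge_app expand sym)

lemma wedge_space_memI: "a \<in> V \<Longrightarrow> b \<in> W \<Longrightarrow> wedge B a b \<in> wedge_space B V W"
  unfolding wedge_space_def by (rule span_base) blast

lemma subspace_wedge_space: "subspace (wedge_space B V W)"
  by (simp add: wedge_space_def)

lemma subspace_perp: "subspace (perp B W)"
  by (auto simp: subspace_def perp_def expand)

lemma positive_on_span:
  assumes "pairwise (\<lambda>x y. B x y = 0) P" "finite P" "\<And>x. x \<in> P \<Longrightarrow> B x x = 1" "v \<in> span P" "v \<noteq> 0"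
  shows "B v v > 0"
proof -
  obtain u where u: "v = (\<Sum>p\<in>P. u p *\<^sub>R p)"
    using assms(4) unfolding span_finite[OF assms(2)] by auto
  have "B v v = (\<Sum>p\<in>P. \<Sum>q\<in>P. u p * u q * B p q)"
    unfolding u by (simp add: B.sum_left B.sum_right expand mult.assoc sum_distrib_left)
      (intro sum.cong refl, simp add: sym)
  also have "\<dots> = (\<Sum>p\<in>P. \<Sum>q\<in>P. if q = p then u p ^ 2 else 0)"
    using assms(1,3) by (intro sum.cong refl) (auto simp: pairwise_def power2_eq_square)
  also have "\<dots> = (\<Sum>p\<in>P. u p ^ 2)"
    using assms(2) by (simp add: sum.delta)
  finally have s: "B v v = (\<Sum>p\<in>P. u p ^ 2)" .
  have "(\<Sum>p\<in>P. u p ^ 2) \<noteq> 0"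
  proof
    assume "(\<Sum>p\<in>P. u p ^ 2) = 0"
    then have "\<forall>p\<in>P. u p = 0" using assms(2) by (simp add: sum_nonneg_eq_0_iff)
    then have "v = 0" unfolding u by simp
    with assms(5) show False by simp
  qed
  then show ?thesis unfolding s by (simp add: less_le sum_nonneg)
qed

text \<open>\<open>W\<close> meets the span of the four positive vectors of an orthogonal basis only
  in 0, so dim W + 4 is at most 6.\<close>

lemma dim_nonpositive_le_2:
  assumes W: "subspace W" "\<And>w. w \<in> W \<Longrightarrow> B w w \<le> 0"
  shows "dim W \<le> 2"
proof -
  obtain P N Z where c: "card P = 4" and i: "independent (P \<union> N \<union> Z)"
    and p: "pairwise (\<lambda>x y. B x y = 0) (P \<union> N \<union> Z)" and 1: "\<forall>x\<in>P. B x x = 1"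
    using form unfolding lie_sphere_form_def has_signature_def by blast
  have iP: "independent P" using i independent_mono by blast
  have fP: "finite P" using c card.infinite by fastforce
  have "pairwise (\<lambda>x y. B x y = 0) P" using p by (rule pairwise_mono) auto
  then have pos: "B v v > 0" if "v \<in> span P" "v \<noteq> 0" for v
    using positive_on_span[OF _ fP] 1 that by blast
  have "W \<inter> span P = {0}"
    using W pos by (auto simp: subspace_0 span_zero) (metis not_less)
  then have "dim (W \<inter> span P) = 0" by (metis dim_eq_0 order_refl)
  then have "dim {x + y |x y. x \<in> W \<and> y \<in> span P} = dim W + 4"
    using dim_sums_Int[OF W(1) subspace_span[of P]] dim_eq_card_independent[OF iP] c
    unfolding dim_span by linarith
  moreover have "dim {x + y |x y. x \<in> W \<and> y \<in> span P} \<le> 6"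
    using dim_subset_UNIV[of "{x + y |x y. x \<in> W \<and> y \<in> span P}"] form
    by (simp add: lie_sphere_form_def)
  ultimately show ?thesis by simp
qed

text \<open>Otherwise \<open>f\<close> and \<open>v\<close> would span a three-dimensional subspace
  on which the form is non-positive. This is the only way in which the signature reaches the
  geometry of Legendre maps below.\<close>

lemma isotropic_plane_maximal:
  assumes f: "subspace f" "dim f = 2" "\<And>v w. v \<in> f \<Longrightarrow> w \<in> f \<Longrightarrow> B v w = 0"
    and v: "v \<in> perp B f" "B v v \<le> 0"
  shows "v \<in> f"
proof (rule ccontr)
  assume nv: "v \<notin> f"
  have "B w w \<le> 0" if "w \<in> span (insert v f)" for w
  proof -
    obtain k where "w - k *\<^sub>R v \<in> span f" using \<open>w \<in> span (insert v f)\<close> by (auto simp: span_insert)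
    then obtain u where u: "u \<in> f" "w = u + k *\<^sub>R v" using f(1) by (metis diff_add_cancel span_eq_iff)
    have "B v u = 0" using v(1) u(1) by (auto simp: perp_def)
    then have "B w w = k ^ 2 * B v v"
      using u f(3) by (simp add: expand sym[of u v] power2_eq_square)
    then show ?thesis using v(2) by (simp add: mult_nonneg_nonpos)
  qed
  then have "dim (span (insert v f)) \<le> 2" by (intro dim_nonpositive_le_2) auto
  moreover have "dim (insert v f) = 3"
    using nv f(2) unfolding dim_insert span_eq_iff[THEN iffD2, OF f(1)] by simp
  ultimately show False by simp
qed

text \<open>Otherwise \<open>p\<close>, \<open>v\<close>, \<open>q\<close> would span three
  dimensions on which the form is minus the square of the coefficient of \<open>p\<close>. With
  \<open>q\<close> = qinf and \<open>p\<close> = pp, a vector of f orthogonal to both is thus a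
  multiple of qinf.\<close>

lemma lightlike_in_span:
  assumes "B v v = 0" "B v q = 0" "B v p = 0" "B p p = -1" "B q q = 0" "B q p = 0" "q \<noteq> 0"
  shows "v \<in> span {q}"
proof (rule ccontr)
  assume nv: "v \<notin> span {q}"
  have np: "p \<notin> span {v, q}"
  proof
    assume "p \<in> span {v, q}"
    then obtain a b where "p = a *\<^sub>R v + b *\<^sub>R q" unfolding span_2 by auto
    then have "B p p = 0" using assms by (simp add: expand sym[of q v])
    then show False using assms(4) by simp
  qed
  have "B w w \<le> 0" if w: "w \<in> span {p, v, q}" for w
  proof -
    obtain a b c where "w = a *\<^sub>R p + b *\<^sub>R v + c *\<^sub>R q"
      using w unfolding span_3 by auto
    then have "B w w = - (a ^ 2)"
      using assms by (simp add: expand sym[of q v] sym[of p v] sym[of p q] power2_eq_square)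
    then show ?thesis by simp
  qed
  then have "dim (span {p, v, q}) \<le> 2" by (intro dim_nonpositive_le_2) auto
  moreover have "dim {p, v, q} = 3"
    using nv np assms(7) by (simp add: dim_insert)
  ultimately show False by simp
qed

lemma dim_perp:
  assumes "subspace W" shows "dim (perp B W) + dim W = 6"
proof -
  define J where "J v = (\<Sum>b\<in>Basis. B v b *\<^sub>R b)" for v :: 'v
  have J: "J v \<bullet> w = B v w" for v w
  proof -
    have "J v \<bullet> w = (\<Sum>b\<in>Basis. B v b * (b \<bullet> w))" by (simp add: J_def inner_sum_left)
    also have "\<dots> = B v (\<Sum>b\<in>Basis. (w \<bullet> b) *\<^sub>R b)"
      by (simp add: B.sum_right expand inner_commute mult.commute)
    finally show ?thesis by (simp add: euclidean_representation)
  qed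
  have lin: "linear J" unfolding J_def
    by (rule linearI) (simp_all add: expand algebra_simps sum.distrib scaleR_sum_right)
  have inj: "inj J"
  proof (subst linear_injective_0[OF lin], intro allI impI)
    fix v assume "J v = 0"
    then show "v = 0" using J[of v] by (intro nondegenerate) simp
  qed
  have "perp B W = {v\<in>UNIV. \<forall>w\<in>J ` W. orthogonal w v}"
    by (auto simp: perp_def orthogonal_def J sym)
  then have "dim (perp B W) = dim {v\<in>UNIV. \<forall>w\<in>J ` W. orthogonal w v}" by simp
  moreover have "dim {v\<in>UNIV. \<forall>w\<in>J ` W. orthogonal w v} + dim (J ` W) = dim (UNIV :: 'v set)"
    using assms lin by (intro dim_subspace_orthogonal_to_vectors) (auto intro: linear_subspace_image)
  ultimately show ?thesis
    using form assms dim_image_eq[OF lin, of W] inj inj_on_subset[OF inj]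
    by (simp add: lie_sphere_form_def)
qed

text \<open>f^perp has dimension 4 and contains f, so two vectors independent modulo f complete a
  basis of f to one of f^perp.\<close>

lemma perp_eq_span:
  assumes f: "f = span {u, w}" "dim f = 2" and a: "a \<in> perp B f" "b \<in> perp B f"
    and ind: "\<And>p q. p *\<^sub>R a + q *\<^sub>R b \<in> f \<Longrightarrow> p = 0 \<and> q = 0"
    and iso: "\<And>v w. v \<in> f \<Longrightarrow> w \<in> f \<Longrightarrow> B v w = 0" and z: "z \<in> perp B f"
  obtains k l p q where "z = k *\<^sub>R u + l *\<^sub>R w + p *\<^sub>R a + q *\<^sub>R b"
proof -
  have sf: "subspace f" by (simp add: f)
  have spf: "span f = f" using span_eq_iff[THEN iffD2, OF sf] .
  have nb: "b \<notin> span f" using ind[of 0 1] unfolding spf by auto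
  have na: "a \<notin> span (insert b f)"
  proof
    assume "a \<in> span (insert b f)"
    then obtain k where "a - k *\<^sub>R b \<in> span f" by (auto simp: span_insert)
    then show False using ind[of 1 "-k"] unfolding spf by simp
  qed
  have "dim (insert a (insert b f)) = 4"
    using na nb f(2) by (simp add: dim_insert)
  moreover have "insert a (insert b f) \<subseteq> perp B f"
    using a iso by (auto simp: perp_def)
  moreover have "dim (perp B f) = 4" using dim_perp[OF sf] f(2) by simp
  ultimately have "span (insert a (insert b f)) = perp B f"
    using dim_eq_span[of "insert a (insert b f)" "perp B f"] subspace_perp by (simp add: span_eq_iff)
  then have "z \<in> span (insert a (insert b f))" using z by simp
  then obtain p where "z - p *\<^sub>R a \<in> span (insert b f)" unfolding span_insert[of a] by blast
  then obtain q where "z - p *\<^sub>R a - q *\<^sub>R b \<in> span f" unfolding span_insert[of b] by blast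
  then have "z - p *\<^sub>R a - q *\<^sub>R b \<in> span {u, w}" by (simp add: f span_span)
  then obtain k where "z - p *\<^sub>R a - q *\<^sub>R b - k *\<^sub>R u \<in> span {w}" unfolding span_insert[of u] by blast
  then obtain l where "z - p *\<^sub>R a - q *\<^sub>R b - k *\<^sub>R u = l *\<^sub>R w" by (auto simp: span_singleton)
  then have "z = k *\<^sub>R u + l *\<^sub>R w + p *\<^sub>R a + q *\<^sub>R b" by (simp add: algebra_simps)
  then show ?thesis by (rule that)
qed

end

section \<open>Bilinear forms on the plane\<close>

lemma symmetric_bilinear_expand:
  assumes "symmetric_bilinear b"
  shows "b (p *\<^sub>R x + q *\<^sub>R y) (r *\<^sub>R x + s *\<^sub>R y) =
    p * r * b x x + (p * s + q * r) * b x y + q * s * b y y"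
proof -
  have l: "linear (b x)" "linear (\<lambda>x. b x y)" for x y
    using assms by (auto simp: symmetric_bilinear_def)
  have "b y x = b x y" using assms by (simp add: symmetric_bilinear_def)
  then show ?thesis
    by (simp add: linear_add[OF l(1)] linear_add[OF l(2)] linear_cmul[OF l(1)] linear_cmul[OF l(2)]
      algebra_simps)
qed

lemma real2_basis:
  fixes X Y :: "real ^ 2"
  assumes "\<And>p q. p *\<^sub>R X + q *\<^sub>R Y = 0 \<Longrightarrow> p = 0 \<and> q = 0"
  obtains p q where "Z = p *\<^sub>R X + q *\<^sub>R Y"
proof -
  have "X \<noteq> Y" using assms[of 1 "-1"] by auto
  moreover have "Y \<noteq> 0" using assms[of 0 1] by auto
  moreover have "X \<notin> span {Y}"
    using assms[of 1 "- k" for k] by (auto simp: span_singleton)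
  ultimately have "dim {X, Y} = 2" by (simp add: dim_insert)
  then have "span {X, Y} = UNIV"
    by (intro dim_eq_full[THEN iffD1]) simp
  then have "Z \<in> span {X, Y}" by simp
  then show ?thesis using that by (auto simp: span_2)
qed

lemma signature_1_1:
  fixes b :: "real ^ 2 \<Rightarrow> real ^ 2 \<Rightarrow> real"
  assumes b: "symmetric_bilinear b" and 0: "b X Y = 0" and n: "b X X * b Y Y < 0"
  shows "has_signature b 1 1"
proof -
  have main: "has_signature b 1 1" if 0: "b X Y = 0" and n: "b X X > 0" "b Y Y < 0" for X Y
  proof -
    note e = symmetric_bilinear_expand[OF b]
    have l: "linear (b x)" "linear (\<lambda>x. b x y)" for x y
      using b by (auto simp: symmetric_bilinear_def)
    define P where "P = (1 / sqrt (b X X)) *\<^sub>R X"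
    define N where "N = (1 / sqrt (- b Y Y)) *\<^sub>R Y"
    have PP: "b P P = 1"
      using n by (simp add: P_def linear_cmul[OF l(1)] linear_cmul[OF l(2)] divide_simps)
    have NN: "b N N = -1"
      using n by (simp add: N_def linear_cmul[OF l(1)] linear_cmul[OF l(2)] divide_simps)
    have PN: "b P N = 0" "b N P = 0"
      using 0 b by (simp_all add: P_def N_def linear_cmul[OF l(1)] linear_cmul[OF l(2)] symmetric_bilinear_def)
    have i: "p = 0 \<and> q = 0" if "p *\<^sub>R P + q *\<^sub>R N = 0" for p q
    proof -
      have "b (p *\<^sub>R P + q *\<^sub>R N) P = 0" "b (p *\<^sub>R P + q *\<^sub>R N) N = 0"
        unfolding that using linear_0[OF l(2)] by auto
      then show ?thesis
        using PP NN PN by (simp add: linear_add[OF l(2)] linear_cmul[OF l(2)])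
    qed
    have ne: "P \<noteq> N" using PP NN by auto
    have "N \<notin> span {}" using i[of 0 1] by auto
    moreover have "P \<notin> span {N}"
      using i[of 1 "- k" for k] by (auto simp: span_singleton)
    ultimately have ind: "independent {P, N}" using ne by (simp add: independent_insert)
    have sp: "span {P, N} = UNIV"
    proof -
      have "Z \<in> span {P, N}" for Z
        by (rule real2_basis[OF i, where Z=Z]) (auto simp: span_2)
      then show ?thesis by auto
    qed
    show ?thesis
      unfolding has_signature_def
      by (intro conjI b exI[of _ "{P}"] exI[of _ "{N}"] exI[of _ "{}"])
        (use PP NN PN ne ind sp in \<open>auto simp: pairwise_def insert_commute\<close>)
  qed
  have "b Y X = 0" using 0 b by (simp add: symmetric_bilinear_def)
  then show ?thesis using main[of X Y] main[of Y X] 0 n by (auto simp: mult_less_0_iff)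
qed

text \<open>\<open>Z\<close> spans the radical, so non-degeneracy means that \<open>Z\<close> is
  empty, and the dimension of the plane is then r + s. For forms of constant signature this spreads
  non-degeneracy from one point to all.\<close>

lemma nondegenerate_iff_no_null:
  fixes b :: "real ^ 2 \<Rightarrow> real ^ 2 \<Rightarrow> real"
  assumes "has_signature b r s"
  shows "nondegenerate b \<longleftrightarrow> r + s = 2"
proof -
  obtain P N Z where h: "card P = r" "card N = s" "P \<inter> N = {}" "P \<inter> Z = {}" "N \<inter> Z = {}"
    "independent (P \<union> N \<union> Z)" "span (P \<union> N \<union> Z) = UNIV"
    "pairwise (\<lambda>x y. b x y = 0) (P \<union> N \<union> Z)"
    "\<forall>x\<in>P. b x x = 1" "\<forall>x\<in>N. b x x = -1" "\<forall>x\<in>Z. b x x = 0" and sb: "symmetric_bilinear b"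
    using assms unfolding has_signature_def by blast
  have fin: "finite (P \<union> N \<union> Z)" using h(6) by (rule independent_imp_finite)
  have l: "linear (b x)" for x using sb by (simp add: symmetric_bilinear_def)
  have "card (P \<union> N \<union> Z) = 2"
    using dim_eq_card_independent[OF h(6)] h(7) dim_span[of "P \<union> N \<union> Z"] by simp
  then have rs: "r + s + card Z = 2"
    using fin h(1-5) by (simp add: card_Un_disjoint Int_Un_distrib2)
  have "b z y = 0" if "z \<in> Z" for z y
  proof -
    have "y \<in> span (P \<union> N \<union> Z)" using h(7) by simp
    then show ?thesis
    proof (induction rule: span_induct_alt)
      case base show ?case by (simp add: linear_0[OF l])
    next
      case (step k x y)
      have "b z x = 0"
        using that step h(8,11) by (cases "x = z") (auto simp: pairwise_def)
      then show ?case using step by (simp add: linear_add[OF l] linear_cmul[OF l])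
    qed
  qed
  then have "Z = {}" if "nondegenerate b"
    using that h(6) dependent_zero[of "P \<union> N \<union> Z"] unfolding nondegenerate_def by (metis Un_iff equals0I)
  moreover have "nondegenerate b" if Z: "Z = {}"
    unfolding nondegenerate_def
  proof (intro allI impI)
    fix x assume x: "\<forall>y. b x y = 0"
    have "x \<in> span (P \<union> N)" using h(7) Z by simp
    moreover have fPN: "finite (P \<union> N)" using fin by simp
    ultimately obtain u where u: "x = (\<Sum>p\<in>P \<union> N. u p *\<^sub>R p)"
      unfolding span_finite[OF fPN] by auto
    have "u q = 0" if q: "q \<in> P \<union> N" for q
    proof -
      have "b q x = (\<Sum>p\<in>P \<union> N. u p * b q p)"
        unfolding u by (simp add: linear_sum[OF l] linear_cmul[OF l])
      also have "\<dots> = (\<Sum>p\<in>P \<union> N. if p = q then u q * b q q else 0)"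
        using h(8) q Z by (intro sum.cong refl) (auto simp: pairwise_def)
      also have "\<dots> = u q * b q q" using q fPN by (simp add: sum.delta)
      finally have "u q * b q q = 0" using x sb by (simp add: symmetric_bilinear_def)
      then show ?thesis using h(9,10) q by auto
    qed
    then show "x = 0" unfolding u by simp
  qed
  ultimately show ?thesis using rs fin by auto
qed

text \<open>Rows of equal norm that are orthogonal make, up to scale, an orthogonal matrix, so the columns
  have the same property.\<close>

lemma conformal_matrix_columns:
  fixes \<alpha> \<beta> \<gamma> \<delta> :: real
  assumes "\<alpha> * \<gamma> + \<beta> * \<delta> = 0" "\<alpha>\<^sup>2 + \<beta>\<^sup>2 = e" "\<gamma>\<^sup>2 + \<delta>\<^sup>2 = e" "e \<noteq> 0"
  shows "\<alpha>\<^sup>2 + \<gamma>\<^sup>2 = e" "\<beta>\<^sup>2 + \<delta>\<^sup>2 = e" "\<alpha> * \<beta> + \<gamma> * \<delta> = 0"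
proof -
  define d where "d = \<alpha> * \<delta> - \<beta> * \<gamma>"
  have g: "e * \<gamma> = - \<beta> * d" and dl: "e * \<delta> = \<alpha> * d"
    using assms(1,2) unfolding d_def by algebra+
  have d2: "d\<^sup>2 = e\<^sup>2" using assms(1-3) unfolding d_def by algebra
  have "e\<^sup>2 * \<gamma>\<^sup>2 = e\<^sup>2 * \<beta>\<^sup>2" using g d2 by algebra
  then have gb: "\<gamma>\<^sup>2 = \<beta>\<^sup>2" using assms(4) by simp
  then show "\<alpha>\<^sup>2 + \<gamma>\<^sup>2 = e" "\<beta>\<^sup>2 + \<delta>\<^sup>2 = e" using assms(2,3) by auto
  have "e\<^sup>2 * (\<alpha> * \<beta> + \<gamma> * \<delta>) = 0" using g dl d2 by algebra
  then show "\<alpha> * \<beta> + \<gamma> * \<delta> = 0" using assms(4) by simp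
qed

text \<open>\<open>k\<close> is the trace of \<open>b\<close> with respect to \<open>g\<close>,
  computed in the orthogonal frame X, Y. The matrix of a conformal frame in the normalized X, Y is
  orthogonal up to scale, so the trace comes out the same. Used with k = 0 for trace-free forms and
  with k = r1 + r2 for the second fundamental form.\<close>

lemma conformal_frame_trace:
  assumes g: "symmetric_bilinear g" and b: "symmetric_bilinear b"
    and XY: "\<And>Z. \<exists>p q. Z = p *\<^sub>R X + q *\<^sub>R Y" "g X Y = 0" "g X X > 0" "g Y Y > 0"
    and k: "b X X * g Y Y + b Y Y * g X X = k * g X X * g Y Y"
    and e: "conformal_frame g e1 e2"
  shows "b e1 e1 + b e2 e2 = k * g e1 e1"
proof -
  obtain \<alpha> \<beta> where e1: "e1 = \<alpha> *\<^sub>R X + \<beta> *\<^sub>R Y" using XY(1) by blast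
  obtain \<gamma> \<delta> where e2: "e2 = \<gamma> *\<^sub>R X + \<delta> *\<^sub>R Y" using XY(1) by blast
  define G H where "G = sqrt (g X X)" and "H = sqrt (g Y Y)"
  have GH: "G > 0" "H > 0" "g X X = G\<^sup>2" "g Y Y = H\<^sup>2" using XY by (simp_all add: G_def H_def)
  note ex = symmetric_bilinear_expand[OF g] and bx = symmetric_bilinear_expand[OF b]
  let ?e = "g e1 e1"
  have "(\<alpha> * G) * (\<gamma> * G) + (\<beta> * H) * (\<delta> * H) = 0" "(\<alpha> * G)\<^sup>2 + (\<beta> * H)\<^sup>2 = ?e"
    "(\<gamma> * G)\<^sup>2 + (\<delta> * H)\<^sup>2 = ?e" "?e \<noteq> 0"
    using e XY(2) GH unfolding conformal_frame_def e1 e2 ex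
    by (simp_all add: power2_eq_square algebra_simps)
  from conformal_matrix_columns[OF this]
  have c: "(\<alpha>\<^sup>2 + \<gamma>\<^sup>2) * G\<^sup>2 = ?e" "(\<beta>\<^sup>2 + \<delta>\<^sup>2) * H\<^sup>2 = ?e" "G * H * (\<alpha> * \<beta> + \<gamma> * \<delta>) = 0"
    by (simp_all add: power_mult_distrib algebra_simps)
  then have c3: "\<alpha> * \<beta> + \<gamma> * \<delta> = 0" using GH by simp
  have "b e1 e1 + b e2 e2 = (\<alpha>\<^sup>2 + \<gamma>\<^sup>2) * b X X + 2 * (\<alpha> * \<beta> + \<gamma> * \<delta>) * b X Y + (\<beta>\<^sup>2 + \<delta>\<^sup>2) * b Y Y"
    unfolding e1 e2 bx by (simp add: power2_eq_square algebra_simps)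
  then have "(b e1 e1 + b e2 e2) * (G\<^sup>2 * H\<^sup>2) =
      ((\<alpha>\<^sup>2 + \<gamma>\<^sup>2) * G\<^sup>2) * (b X X * H\<^sup>2) + ((\<beta>\<^sup>2 + \<delta>\<^sup>2) * H\<^sup>2) * (b Y Y * G\<^sup>2)"
    unfolding c3 by (simp add: algebra_simps)
  also have "\<dots> = ?e * (b X X * H\<^sup>2 + b Y Y * G\<^sup>2)" unfolding c by (simp add: algebra_simps)
  also have "\<dots> = (k * ?e) * (G\<^sup>2 * H\<^sup>2)" using k unfolding GH(3,4) by (simp add: algebra_simps)
  finally show ?thesis using GH by simp
qed

text \<open>\<open>trace_on\<close> sums over a basis picked by choice; this is the independence of
  the trace from that choice. Linearity is asked only on the plane, since the map inside
  \<open>gauge_quadratic\<close> is given by a choice of section through each vector of f.\<close>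

lemma trace_on_plane:
  fixes b1 b2 :: "'v::euclidean_space"
  assumes W: "W = span {b1, b2}" "dim W = 2"
    and T: "\<And>p q. T (p *\<^sub>R b1 + q *\<^sub>R b2) = p *\<^sub>R T b1 + q *\<^sub>R T b2"
    and c: "T b1 = t11 *\<^sub>R b1 + t12 *\<^sub>R b2" "T b2 = t21 *\<^sub>R b1 + t22 *\<^sub>R b2"
  shows "trace_on W T = t11 + t22"
proof -
  have ex: "\<exists>E. independent E \<and> span E = W"
  proof -
    have sW: "subspace W" by (simp add: W(1))
    obtain E where E: "E \<subseteq> W" "independent E" "W \<subseteq> span E" "card E = dim W" by (rule basis_exists)
    then have "independent E \<and> span E = W" using span_minimal[OF E(1) sW] by simp
    then show ?thesis ..
  qed
  define E where "E = (SOME E. independent E \<and> span E = W)"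
  have E: "independent E" "span E = W" using someI_ex[OF ex] by (auto simp: E_def)
  have "card E = 2" using dim_eq_card_independent[OF E(1)] E(2) W(2) by (metis dim_span)
  then obtain e1 e2 where e: "E = {e1, e2}" "e1 \<noteq> e2" by (auto simp: card_2_iff)
  have rep: "u = representation E u e1 *\<^sub>R e1 + representation E u e2 *\<^sub>R e2" if "u \<in> W" for u
    using sum_representation_eq[OF E(1), of u E] that E(2) e by (simp add: independent_imp_finite)
  have uniq: "p = p' \<and> q = q'" if "p *\<^sub>R b1 + q *\<^sub>R b2 = p' *\<^sub>R b1 + q' *\<^sub>R b2" for p q p' q'
  proof -
    have "b1 \<noteq> b2"
    proof
      assume "b1 = b2"
      then have "dim W \<le> 1" using W(1) dim_le_card[of "{b2}" "{b2}"] by (simp add: dim_span)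
      then show False using W(2) by simp
    qed
    then have ib: "independent {b1, b2}"
      using W by (intro card_le_dim_spanning[of _ W]) (auto intro: span_base)
    have "(p - p') *\<^sub>R b1 + (q - q') *\<^sub>R b2 = 0" using that by (simp add: algebra_simps)
    then have "(\<Sum>v\<in>{b1, b2}. (if v = b1 then p - p' else q - q') *\<^sub>R v) = 0" using \<open>b1 \<noteq> b2\<close> by simp
    from independentD[OF ib _ _ this, of b1] independentD[OF ib _ _ this, of b2] \<open>b1 \<noteq> b2\<close>
    show ?thesis by auto
  qed
  have eW: "e1 \<in> W" "e2 \<in> W" using E(2) e span_base by blast+
  obtain p q where e1: "e1 = p *\<^sub>R b1 + q *\<^sub>R b2" using eW(1) unfolding W(1) span_2 by blast
  obtain r s where e2: "e2 = r *\<^sub>R b1 + s *\<^sub>R b2" using eW(2) unfolding W(1) span_2 by blast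
  have TW: "T e1 \<in> W" "T e2 \<in> W"
    unfolding e1 e2 T c W(1) by (intro span_add span_scale span_base; simp)+
  define x11 x12 x21 x22 where x: "x11 = representation E (T e1) e1" "x12 = representation E (T e1) e2"
    "x21 = representation E (T e2) e1" "x22 = representation E (T e2) e2"
  have "T e1 = x11 *\<^sub>R e1 + x12 *\<^sub>R e2" "T e2 = x21 *\<^sub>R e1 + x22 *\<^sub>R e2"
    using rep[OF TW(1)] rep[OF TW(2)] by (simp_all add: x)
  then have "(p * t11 + q * t21) *\<^sub>R b1 + (p * t12 + q * t22) *\<^sub>R b2 =
        (x11 * p + x12 * r) *\<^sub>R b1 + (x11 * q + x12 * s) *\<^sub>R b2"
    "(r * t11 + s * t21) *\<^sub>R b1 + (r * t12 + s * t22) *\<^sub>R b2 =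
        (x21 * p + x22 * r) *\<^sub>R b1 + (x21 * q + x22 * s) *\<^sub>R b2"
    unfolding e1 e2 T c by (simp_all add: algebra_simps)
  from uniq[OF this(1)] uniq[OF this(2)]
  have eq: "p * t11 + q * t21 = x11 * p + x12 * r" "p * t12 + q * t22 = x11 * q + x12 * s"
    "r * t11 + s * t21 = x21 * p + x22 * r" "r * t12 + s * t22 = x21 * q + x22 * s" by auto
  \<comment> \<open>The determinant of the passage from \<open>b1\<close>, \<open>b2\<close> to the
    chosen basis.\<close>
  have D: "p * s - q * r \<noteq> 0"
  proof
    assume D0: "p * s - q * r = 0"
    have "s *\<^sub>R e1 - q *\<^sub>R e2 = 0" "r *\<^sub>R e1 - p *\<^sub>R e2 = 0"
      using D0 unfolding e1 e2 by (simp_all add: algebra_simps mult.commute flip: scaleR_add_left)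
    then have 1: "(\<Sum>v\<in>E. (if v = e1 then s else - q) *\<^sub>R v) = 0"
      "(\<Sum>v\<in>E. (if v = e1 then r else - p) *\<^sub>R v) = 0" using e by simp_all
    have "s = 0" "q = 0" "r = 0" "p = 0"
      using independentD[OF E(1) _ _ 1(1), of e1] independentD[OF E(1) _ _ 1(1), of e2]
        independentD[OF E(1) _ _ 1(2), of e1] independentD[OF E(1) _ _ 1(2), of e2] e by auto
    then have "e1 = 0" by (simp add: e1)
    then show False using E(1) e dependent_zero by blast
  qed
  have "x11 * (p * s - q * r) = (x11 * p + x12 * r) * s - (x11 * q + x12 * s) * r"
    "x22 * (p * s - q * r) = (x21 * q + x22 * s) * p - (x21 * p + x22 * r) * q"
    by (simp_all add: algebra_simps)
  then have "(x11 + x22) * (p * s - q * r) = (t11 + t22) * (p * s - q * r)"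
    unfolding eq[symmetric] by (simp add: algebra_simps)
  then have "x11 + x22 = t11 + t22" using D by simp
  then show ?thesis
    unfolding trace_on_def Let_def E_def[symmetric] using e by (simp add: x)
qed

section \<open>Legendre maps\<close>

context surface
begin

lemma local_sections_iff:
  "\<sigma> \<in> local_sections A W x \<longleftrightarrow> smooth_at A \<sigma> x \<and> eventually (\<lambda>y. \<sigma> y \<in> W y) (nhds x)"
proof
  assume "\<sigma> \<in> local_sections A W x"
  then obtain U where "open U" "x \<in> U" "smooth_map A U \<sigma>" "\<forall>y\<in>U. \<sigma> y \<in> W y"
    by (auto simp: local_sections_def sections_def)
  then show "smooth_at A \<sigma> x \<and> eventually (\<lambda>y. \<sigma> y \<in> W y) (nhds x)"
    by (auto simp: smooth_at_def eventually_nhds)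
next
  assume a: "smooth_at A \<sigma> x \<and> eventually (\<lambda>y. \<sigma> y \<in> W y) (nhds x)"
  then obtain U where U: "open U" "x \<in> U" "smooth_map A U \<sigma>" by (auto simp: smooth_at_def)
  from a obtain V where V: "open V" "x \<in> V" "\<forall>y\<in>V. \<sigma> y \<in> W y" by (auto simp: eventually_nhds)
  have "open (U \<inter> V)" "x \<in> U \<inter> V" "\<sigma> \<in> sections A W (U \<inter> V)"
    using U V by (auto simp: sections_def intro: smooth_map_subset)
  then show "\<sigma> \<in> local_sections A W x" by (auto simp: local_sections_def)
qed

lemma smooth_at_pd_field:
  assumes "smooth_at A g x" "smooth_at A Y x" "admissible_chart A c" "x \<in> fst c"
  shows "smooth_at A (\<lambda>y. pd c (Y y) g y) x"
proof -
  have "eventually (\<lambda>y. Y y $ 1 *\<^sub>R pd c (axis 1 1) g y + Y y $ 2 *\<^sub>R pd c (axis 2 1) g y = pd c (Y y) g y) (nhds x)"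
    using smooth_at_eventually[OF assms(1)] eventually_chart[OF assms(3,4)]
  proof eventually_elim
    case (elim y)
    note l = pd_linear[OF elim(1) assms(3) elim(2)]
    have "Y y = Y y $ 1 *\<^sub>R axis 1 1 + Y y $ 2 *\<^sub>R axis 2 1"
      by (simp add: vec_eq_iff forall_2 axis_def)
    then have "pd c (Y y) g y = pd c (Y y $ 1 *\<^sub>R axis 1 1 + Y y $ 2 *\<^sub>R axis 2 1) g y" by (rule arg_cong)
    then show ?case using linear_add[OF l] linear_cmul[OF l] by simp
  qed
  moreover have "smooth_at A (\<lambda>y. Y y $ 1 *\<^sub>R pd c (axis 1 1) g y + Y y $ 2 *\<^sub>R pd c (axis 2 1) g y) x"
    by (intro smooth_at_add smooth_at_scaleR smooth_at_vec_nth smooth_at_pd assms)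
  ultimately show ?thesis by (simp add: smooth_at_cong)
qed

lemma eventually_coefficient:
  fixes \<sigma> \<tau> :: "'m \<Rightarrow> 'w::real_inner"
  assumes "smooth_at A \<sigma> x" "smooth_at A \<tau> x"
    and "eventually (\<lambda>y. \<sigma> y \<noteq> 0) (nhds x)" "eventually (\<lambda>y. \<tau> y \<in> span {\<sigma> y}) (nhds x)"
  obtains h where "smooth_at A h x" "eventually (\<lambda>y. \<tau> y = h y *\<^sub>R \<sigma> y) (nhds x)"
proof -
  \<comment> \<open>The Euclidean inner product, because the sections to which this is applied are
    lightlike for \<open>B\<close>.\<close>
  define h where "h y = (\<tau> y \<bullet> \<sigma> y) * inverse (\<sigma> y \<bullet> \<sigma> y)" for y
  have "smooth_at A h x" unfolding h_def
    using eventually_nhds_x_imp_x[OF assms(3)]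
    by (intro smooth_at_mult smooth_at_inverse smooth_at_bilinear[OF bounded_bilinear_inner] assms) simp
  moreover have "eventually (\<lambda>y. \<tau> y = h y *\<^sub>R \<sigma> y) (nhds x)"
    using assms(3,4)
    by eventually_elim (auto simp: span_singleton h_def)
  ultimately show ?thesis by (rule that)
qed

text \<open>Rescaling \<open>\<sigma>\<close> and \<open>Y\<close> only changes the second derivative by terms in \<open>\<sigma>\<close> and its first
  derivative.\<close>

lemma lie_cyclide_frame:
  fixes \<sigma> :: "'m \<Rightarrow> 'w::euclidean_space"
  assumes c: "c \<in> A" "x \<in> fst c" and \<sigma>: "smooth_at A \<sigma> x" and Y: "smooth_at A Y x"
    and ev: "eventually (\<lambda>y. s y = span {\<sigma> y} \<and> \<sigma> y \<noteq> 0 \<and> Y y \<noteq> 0 \<and>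
      T y = range (\<lambda>k. coord_vec A c (k *\<^sub>R Y y) y)) (nhds x)"
  shows "lie_cyclide A s T x \<subseteq>
      span {\<sigma> x, pd c (Y x) \<sigma> x, pd c (Y x) (\<lambda>y. pd c (Y y) \<sigma> y) x}" (is "_ \<subseteq> ?S")
    and "\<sigma> x \<in> lie_cyclide A s T x" "pd c (Y x) \<sigma> x \<in> lie_cyclide A s T x"
proof -
  note ac = admissible_atlas[OF c(1)]
  define D where "D y = pd c (Y y) \<sigma> y" for y
  have D: "smooth_at A D x" unfolding D_def by (rule smooth_at_pd_field[OF \<sigma> Y ac c(2)])
  show "lie_cyclide A s T x \<subseteq> ?S"
    unfolding lie_cyclide_def
  proof (rule span_minimal[OF _ subspace_span], rule subsetI)
    fix v assume "v \<in> {v. \<exists>U \<sigma> Y. open U \<and> x \<in> U \<and> \<sigma> \<in> sections A s U \<and>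
      smooth_vector_field A U Y \<and> (\<forall>y\<in>U. Y y \<in> T y) \<and>
      (v = \<sigma> x \<or> v = dif A \<sigma> x (Y x) \<or> v = dif A (\<lambda>y. dif A \<sigma> y (Y y)) x (Y x))}"
    then obtain U \<tau> Z where U: "open U" "x \<in> U" and \<tau>: "smooth_map A U \<tau>" "\<forall>y\<in>U. \<tau> y \<in> s y"
      and Z: "smooth_vector_field A U Z" "\<forall>y\<in>U. Z y \<in> T y"
      and v: "v = \<tau> x \<or> v = dif A \<tau> x (Z x) \<or> v = dif A (\<lambda>y. dif A \<tau> y (Z y)) x (Z x)"
      by (auto simp: sections_def)
    have evU: "eventually (\<lambda>y. y \<in> U) (nhds x)" using U by (rule eventually_nhds_in_open)
    have evc: "eventually (\<lambda>y. y \<in> fst c) (nhds x)" by (rule eventually_chart[OF ac c(2)])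
    have \<tau>x: "smooth_at A \<tau> x" using U \<tau> by (auto intro: smooth_atI)
    define z where "z y = dif A (snd c) y (Z y)" for y
    have zx: "smooth_at A z x"
    proof (rule smooth_atI)
      show "open (U \<inter> fst c)" using U admissible_open[OF ac] by auto
      show "smooth_map A (U \<inter> fst c) z" unfolding z_def
        using Z(1) c(1) by (simp add: smooth_vector_field_def)
    qed (use U c in auto)
    have ev\<tau>: "eventually (\<lambda>y. \<tau> y \<in> span {\<sigma> y}) (nhds x)"
      using ev evU
    proof eventually_elim
      case (elim y)
      have "\<tau> y \<in> s y" using \<tau>(2) elim(2) by (rule bspec)
      then show ?case using elim(1) by simp
    qed
    have ev1: "eventually (\<lambda>y. \<sigma> y \<noteq> 0) (nhds x)" "eventually (\<lambda>y. Y y \<noteq> 0) (nhds x)"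
      using ev by (auto elim: eventually_mono)
    obtain h where h: "smooth_at A h x" "eventually (\<lambda>y. \<tau> y = h y *\<^sub>R \<sigma> y) (nhds x)"
      by (rule eventually_coefficient[OF \<sigma> \<tau>x ev1(1) ev\<tau>])
    have evz: "eventually (\<lambda>y. z y \<in> span {Y y}) (nhds x)"
      using ev evU evc
    proof eventually_elim
      case (elim y)
      have "Z y \<in> T y" using Z(2) elim(2) by (rule bspec)
      then have "Z y \<in> range (\<lambda>k. coord_vec A c (k *\<^sub>R Y y) y)" using elim(1) by simp
      then obtain k where "Z y = coord_vec A c (k *\<^sub>R Y y) y" by auto
      then have "z y = k *\<^sub>R Y y" using dif_snd_coord_vec[OF ac elim(3)] by (simp add: z_def)
      then show ?case by (auto simp: span_singleton)
    qed
    obtain k where k: "smooth_at A k x" "eventually (\<lambda>y. z y = k y *\<^sub>R Y y) (nhds x)"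
      by (rule eventually_coefficient[OF Y zx ev1(2) evz])
    have difZ: "dif A g y (Z y) = k y *\<^sub>R pd c (Y y) g y"
      if "smooth_at A g y" "z y = k y *\<^sub>R Y y" "y \<in> fst c" for g :: "'m \<Rightarrow> 'w" and y
    proof -
      have "dif A g y (Z y) = dif A g y (coord_vec A c (z y) y)"
        using coord_vec_dif_snd[OF ac that(3), of "Z y"] by (simp add: z_def)
      also have "\<dots> = pd c (k y *\<^sub>R Y y) g y" using dif_coord_vec[OF that(1) ac that(3)] that(2) by simp
      also have "\<dots> = k y *\<^sub>R pd c (Y y) g y" using linear_cmul[OF pd_linear[OF that(1) ac that(3)]] .
      finally show ?thesis .
    qed
    define h' where "h' y = pd c (Y y) h y" for y
    have h': "smooth_at A h' x" unfolding h'_def by (rule smooth_at_pd_field[OF h(1) Y ac c(2)])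
    have d1: "eventually (\<lambda>y. dif A \<tau> y (Z y) = k y *\<^sub>R (h y *\<^sub>R D y + h' y *\<^sub>R \<sigma> y)) (nhds x)"
      using k(2) evc smooth_at_eventually[OF \<tau>x] smooth_at_eventually[OF \<sigma>]
        smooth_at_eventually[OF h(1)] eventually_eventually[THEN iffD2, OF h(2)]
    proof eventually_elim
      case (elim y)
      have "dif A \<tau> y (Z y) = k y *\<^sub>R pd c (Y y) \<tau> y" by (rule difZ[OF elim(3,1,2)])
      also have "pd c (Y y) \<tau> y = pd c (Y y) (\<lambda>y. h y *\<^sub>R \<sigma> y) y" by (rule pd_cong[OF elim(6) ac elim(2)])
      also have "\<dots> = h y *\<^sub>R D y + h' y *\<^sub>R \<sigma> y"
        unfolding D_def h'_def by (rule pd_scaleR[OF elim(5,4) ac elim(2)])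
      finally show ?case .
    qed
    have sm: "smooth_at A (\<lambda>y. h y *\<^sub>R D y + h' y *\<^sub>R \<sigma> y) x"
      by (intro smooth_at_add smooth_at_scaleR h D h' \<sigma>)
    have sm2: "smooth_at A (\<lambda>y. k y *\<^sub>R (h y *\<^sub>R D y + h' y *\<^sub>R \<sigma> y)) x"
      by (intro smooth_at_scaleR k sm)
    have "dif A (\<lambda>y. dif A \<tau> y (Z y)) x (Z x) = dif A (\<lambda>y. k y *\<^sub>R (h y *\<^sub>R D y + h' y *\<^sub>R \<sigma> y)) x (Z x)"
      by (rule dif_cong[OF d1])
    also have "\<dots> = k x *\<^sub>R pd c (Y x) (\<lambda>y. k y *\<^sub>R (h y *\<^sub>R D y + h' y *\<^sub>R \<sigma> y)) x"
      by (rule difZ[OF sm2 eventually_nhds_x_imp_x[OF k(2)] c(2)])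
    also have "pd c (Y x) (\<lambda>y. k y *\<^sub>R (h y *\<^sub>R D y + h' y *\<^sub>R \<sigma> y)) x =
        k x *\<^sub>R (h x *\<^sub>R pd c (Y x) D x + h' x *\<^sub>R D x + (h' x *\<^sub>R D x + pd c (Y x) h' x *\<^sub>R \<sigma> x)) +
        pd c (Y x) k x *\<^sub>R (h x *\<^sub>R D x + h' x *\<^sub>R \<sigma> x)"
    proof -
      have "pd c (Y x) (\<lambda>y. h y *\<^sub>R D y + h' y *\<^sub>R \<sigma> y) x =
          h x *\<^sub>R pd c (Y x) D x + h' x *\<^sub>R D x + (h' x *\<^sub>R D x + pd c (Y x) h' x *\<^sub>R \<sigma> x)"
        unfolding pd_add[OF smooth_at_scaleR[OF h(1) D] smooth_at_scaleR[OF h' \<sigma>] ac c(2)]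
          pd_scaleR[OF h(1) D ac c(2)] pd_scaleR[OF h' \<sigma> ac c(2)]
        by (simp add: D_def h'_def)
      then show ?thesis unfolding pd_scaleR[OF k(1) sm ac c(2)] by simp
    qed
    finally have 3: "dif A (\<lambda>y. dif A \<tau> y (Z y)) x (Z x) \<in> span {\<sigma> x, D x, pd c (Y x) D x}"
      by (auto intro!: span_add span_scale intro: span_base)
    have 2: "dif A \<tau> x (Z x) \<in> span {\<sigma> x, D x, pd c (Y x) D x}"
      unfolding eventually_nhds_x_imp_x[OF d1]
      by (auto intro!: span_add span_scale intro: span_base)
    have 1: "\<tau> x \<in> span {\<sigma> x, D x, pd c (Y x) D x}"
      unfolding eventually_nhds_x_imp_x[OF h(2)] by (auto intro!: span_scale intro: span_base)
    have "D = (\<lambda>y. pd c (Y y) \<sigma> y)" by (simp add: D_def fun_eq_iff)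
    with v 1 2 3 show "v \<in> ?S" by auto
  qed
  \<comment> \<open>For the two memberships, \<sigma> and the field with components \<open>Y\<close>
    are themselves admissible choices after shrinking to a common neighbourhood.\<close>
  obtain V where V: "open V" "x \<in> V" "\<And>y. y \<in> V \<Longrightarrow> s y = span {\<sigma> y} \<and> \<sigma> y \<noteq> 0 \<and> Y y \<noteq> 0 \<and>
      T y = range (\<lambda>k. coord_vec A c (k *\<^sub>R Y y) y)"
    using ev unfolding eventually_nhds by auto
  obtain V1 where V1: "open V1" "x \<in> V1" "smooth_map A V1 \<sigma>" using \<sigma> by (auto simp: smooth_at_def)
  obtain V2 where V2: "open V2" "x \<in> V2" "smooth_map A V2 Y" using Y by (auto simp: smooth_at_def)
  define U where "U = V \<inter> V1 \<inter> V2 \<inter> fst c"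
  define Z where "Z y = coord_vec A c (Y y) y" for y
  have U: "open U" "x \<in> U" unfolding U_def using V V1 V2 admissible_open[OF ac] c by auto
  have sU: "\<sigma> \<in> sections A s U"
    using V V1 by (auto simp: sections_def U_def span_base intro: smooth_map_subset)
  have ZU: "smooth_vector_field A U Z"
    unfolding smooth_vector_field_def
  proof
    fix c' assume c': "c' \<in> A"
    note ac' = admissible_atlas[OF c']
    have o: "open (U \<inter> fst c')" using U admissible_open[OF ac'] by auto
    show "smooth_map A (U \<inter> fst c') (\<lambda>x. dif A (snd c') x (Z x))"
      unfolding smooth_map_iff_smooth_at[OF o]
    proof
      fix y assume y: "y \<in> U \<inter> fst c'"
      then have yc: "y \<in> fst c" "y \<in> fst c'" "y \<in> V2" by (auto simp: U_def)
      have "smooth_at A Y y" using V2 yc by (auto intro: smooth_atI)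
      then have "smooth_at A (\<lambda>y. pd c (Y y) (snd c') y) y"
        by (rule smooth_at_pd_field[OF smooth_at_snd_chart[OF ac' yc(2)] _ ac yc(1)])
      moreover have "eventually (\<lambda>y. pd c (Y y) (snd c') y = dif A (snd c') y (Z y)) (nhds y)"
        using eventually_chart[OF ac yc(1)] eventually_chart[OF ac' yc(2)]
        by eventually_elim (simp add: Z_def dif_coord_vec[OF smooth_at_snd_chart[OF ac'] ac])
      ultimately show "smooth_at A (\<lambda>x. dif A (snd c') x (Z x)) y" by (simp add: smooth_at_cong)
    qed
  qed
  have ZT: "\<forall>y\<in>U. Z y \<in> T y"
  proof
    fix y assume "y \<in> U"
    then have "T y = range (\<lambda>k. coord_vec A c (k *\<^sub>R Y y) y)" using V(3) by (simp add: U_def)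
    then show "Z y \<in> T y" by (auto simp: Z_def intro!: range_eqI[of _ _ 1])
  qed
  show "\<sigma> x \<in> lie_cyclide A s T x"
    unfolding lie_cyclide_def
    by (rule span_base, rule CollectI, rule exI[of _ U], rule exI[of _ \<sigma>], rule exI[of _ Z])
      (use U sU ZU ZT in auto)
  have "pd c (Y x) \<sigma> x = dif A \<sigma> x (Z x)" unfolding Z_def using dif_coord_vec[OF \<sigma> ac c(2)] by simp
  then show "pd c (Y x) \<sigma> x \<in> lie_cyclide A s T x"
    unfolding lie_cyclide_def
    by (intro span_base CollectI exI[of _ U] exI[of _ \<sigma>] exI[of _ Z])
      (use U sU ZU ZT in auto)
qed

end

locale legendre = surface A + lie_form B
  for A :: "'m::{t2_space, second_countable_topology} chart set"
    and B :: "'v::euclidean_space \<Rightarrow> 'v \<Rightarrow> real" +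
  fixes f :: "'m \<Rightarrow> 'v set"
  assumes legendre: "legendre_map A B f"
begin

definition section_at :: "('m \<Rightarrow> 'v) \<Rightarrow> 'm \<Rightarrow> bool" where
  "section_at \<sigma> x \<longleftrightarrow> smooth_at A \<sigma> x \<and> eventually (\<lambda>y. \<sigma> y \<in> f y) (nhds x)"

lemma section_at_iff: "section_at \<sigma> x \<longleftrightarrow> \<sigma> \<in> local_sections A f x"
  by (simp add: section_at_def local_sections_iff)

lemma section_at_smooth: "section_at \<sigma> x \<Longrightarrow> smooth_at A \<sigma> x"
  by (simp add: section_at_def)

lemma section_at_mem: "section_at \<sigma> x \<Longrightarrow> \<sigma> x \<in> f x"
  unfolding section_at_def using eventually_nhds_x_imp_x by fastforce

lemma section_at_eventually: "section_at \<sigma> x \<Longrightarrow> eventually (section_at \<sigma>) (nhds x)"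
  unfolding section_at_def
  using smooth_at_eventually eventually_eventually by (auto simp: eventually_conj_iff eventually_eventually)

lemma subspace_f: "subspace (f x)" and dim_f: "dim (f x) = 2"
  using legendre by (auto simp: legendre_map_def subbundle_def)

lemma isotropic: "v \<in> f x \<Longrightarrow> w \<in> f x \<Longrightarrow> B v w = 0"
  using legendre by (auto simp: legendre_map_def)

lemma mem_f_of_perp: "v \<in> perp B (f x) \<Longrightarrow> B v v \<le> 0 \<Longrightarrow> v \<in> f x"
  by (rule isotropic_plane_maximal[OF subspace_f dim_f isotropic])

lemma f_subset_perp: "v \<in> f x \<Longrightarrow> v \<in> perp B (f x)"
  by (auto simp: perp_def isotropic)

lemma perpD: "v \<in> perp B (f x) \<Longrightarrow> w \<in> f x \<Longrightarrow> B v w = 0"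
  unfolding perp_def by simp

lemma perpD': "v \<in> perp B (f x) \<Longrightarrow> w \<in> f x \<Longrightarrow> B w v = 0"
  using perpD sym by metis

lemma dif_perp: "section_at \<sigma> x \<Longrightarrow> dif A \<sigma> x X \<in> perp B (f x)"
proof -
  assume "section_at \<sigma> x"
  then have "dif A \<sigma> x X \<in> derived_bundle A f x"
    unfolding derived_bundle_def section_at_iff by (intro span_base) auto
  then show ?thesis using legendre by (auto simp: legendre_map_def)
qed

lemma section_at_lincomb:
  assumes "section_at \<sigma> x" "section_at \<tau> x" shows "section_at (\<lambda>y. p *\<^sub>R \<sigma> y + q *\<^sub>R \<tau> y) x"
  unfolding section_at_def
proof
  show "smooth_at A (\<lambda>y. p *\<^sub>R \<sigma> y + q *\<^sub>R \<tau> y) x"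
    using assms by (intro smooth_at_add smooth_at_scaleR smooth_at_const section_at_smooth)
  show "eventually (\<lambda>y. p *\<^sub>R \<sigma> y + q *\<^sub>R \<tau> y \<in> f y) (nhds x)"
    using section_at_eventually[OF assms(1)] section_at_eventually[OF assms(2)]
    by eventually_elim (auto intro!: subspace_add subspace_scale subspace_f dest: section_at_mem)
qed

lemma smooth_at_B: "smooth_at A g x \<Longrightarrow> smooth_at A h x \<Longrightarrow> smooth_at A (\<lambda>y. B (g y) (h y)) x"
  by (rule smooth_at_bilinear[OF B.bounded_bilinear_axioms])

lemmas pd_B = pd_bilinear[OF B.bounded_bilinear_axioms]
lemmas smooth_at_wedge = smooth_at_bilinear[OF bounded_bilinear_wedge]
lemmas pd_wedge = pd_bilinear[OF bounded_bilinear_wedge]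

context
  fixes c x assumes c: "admissible_chart A c" "x \<in> fst c"
begin

lemma pd_perp: "section_at \<sigma> x \<Longrightarrow> pd c v \<sigma> x \<in> perp B (f x)"
  using dif_perp[of \<sigma> x] dif_coord_vec[OF section_at_smooth c] by metis

lemma pd_zero_of_eventually:
  assumes "eventually (\<lambda>y. g y = 0) (nhds x)" shows "pd c v g x = 0"
  using pd_cong[OF assms c] by (simp add: pd_const)

lemma pd_B_zero:
  assumes g: "smooth_at A g x" "smooth_at A h x" "eventually (\<lambda>y. B (g y) (h y) = 0) (nhds x)"
  shows "B (g x) (pd c v h x) = - B (pd c v g x) (h x)"
  using pd_zero_of_eventually[OF g(3), of v] pd_B[OF g(1,2) c, of v] by simp

end

lemma eventually_B_section_pd:
  assumes "section_at \<tau> x" "section_at \<sigma> x" and c: "admissible_chart A c" "x \<in> fst c"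
  shows "eventually (\<lambda>y. B (\<tau> y) (pd c v \<sigma> y) = 0) (nhds x)"
  using section_at_eventually[OF assms(1)] section_at_eventually[OF assms(2)] eventually_chart[OF c]
  by eventually_elim (auto intro: perpD' pd_perp[OF c(1)] section_at_mem)

lemma eventually_B_section_pd_field:
  assumes "section_at \<tau> x" "section_at \<sigma> x" and c: "admissible_chart A c" "x \<in> fst c"
  shows "eventually (\<lambda>y. B (\<tau> y) (pd c (Y y) \<sigma> y) = 0) (nhds x)"
  using section_at_eventually[OF assms(1)] section_at_eventually[OF assms(2)] eventually_chart[OF c]
  by eventually_elim (auto intro: perpD' pd_perp[OF c(1)] section_at_mem)

context
  fixes c x assumes c: "admissible_chart A c" "x \<in> fst c"
begin

text \<open>The Legendre condition (\<tau>, d_v \<sigma>) = 0 holds on a neighbourhood and is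
  differentiated along \<open>w\<close>.\<close>

lemma B_section_pd_pd:
  assumes "section_at \<tau> x" "section_at \<sigma> x"
  shows "B (\<tau> x) (pd c w (pd c v \<sigma>) x) = - B (pd c w \<tau> x) (pd c v \<sigma> x)"
  by (rule pd_B_zero[OF c section_at_smooth[OF assms(1)] smooth_at_pd[OF section_at_smooth[OF assms(2)] c]
        eventually_B_section_pd[OF assms c]])

text \<open>By \<open>B_section_pd_pd\<close> both sides are minus the product of \<sigma> with a
  second derivative of \<tau>, and second derivatives commute. For the lifts of a surface this is
  the symmetry of the second fundamental form.\<close>

lemma B_pd_pd_commute:
  assumes "section_at \<sigma> x" "section_at \<tau> x"
  shows "B (pd c v \<sigma> x) (pd c w \<tau> x) = B (pd c w \<sigma> x) (pd c v \<tau> x)"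
  using B_section_pd_pd[OF assms, of v w] B_section_pd_pd[OF assms, of w v]
    pd_commute[OF section_at_smooth[OF assms(2)] c, of v w] by simp

text \<open>Tensoriality modulo f without a local frame: at a zero of \<sigma> the square (d_v
  \<sigma>, d_v \<sigma>) = - (\<sigma>, d_v d_v \<sigma>) is 0, and a null vector of f^perp lies in
  f.\<close>

lemma pd_section_vanishing:
  assumes "section_at \<sigma> x" "\<sigma> x = 0" shows "pd c v \<sigma> x \<in> f x"
proof (rule mem_f_of_perp[OF pd_perp[OF c assms(1)]])
  show "B (pd c v \<sigma> x) (pd c v \<sigma> x) \<le> 0"
    using B_section_pd_pd[OF assms(1,1), of v v] assms(2) by (simp add: expand)
qed

lemma pd_section_lincomb:
  assumes "section_at \<sigma> x" "section_at \<tau>1 x" "section_at \<tau>2 x" "\<sigma> x = p *\<^sub>R \<tau>1 x + q *\<^sub>R \<tau>2 x"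
  shows "pd c v \<sigma> x - (p *\<^sub>R pd c v \<tau>1 x + q *\<^sub>R pd c v \<tau>2 x) \<in> f x"
proof -
  have sec: "section_at (\<lambda>y. p *\<^sub>R \<tau>1 y + q *\<^sub>R \<tau>2 y) x"
    by (rule section_at_lincomb[OF assms(2,3)])
  have sec2: "section_at (\<lambda>y. 1 *\<^sub>R \<sigma> y + (-1) *\<^sub>R (p *\<^sub>R \<tau>1 y + q *\<^sub>R \<tau>2 y)) x"
    by (rule section_at_lincomb[OF assms(1) sec])
  have "pd c v (\<lambda>y. 1 *\<^sub>R \<sigma> y + (-1) *\<^sub>R (p *\<^sub>R \<tau>1 y + q *\<^sub>R \<tau>2 y)) x \<in> f x"
    by (rule pd_section_vanishing[OF sec2]) (simp add: assms(4))
  moreover have "pd c v (\<lambda>y. p *\<^sub>R \<tau>1 y + q *\<^sub>R \<tau>2 y) x = p *\<^sub>R pd c v \<tau>1 x + q *\<^sub>R pd c v \<tau>2 x"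
    using assms(2,3)[THEN section_at_smooth] c
    by (simp add: pd_add pd_scaleR pd_const smooth_at_scaleR smooth_at_const)
  moreover have "pd c v (\<lambda>y. 1 *\<^sub>R \<sigma> y + (-1) *\<^sub>R (p *\<^sub>R \<tau>1 y + q *\<^sub>R \<tau>2 y)) x =
     pd c v \<sigma> x - pd c v (\<lambda>y. p *\<^sub>R \<tau>1 y + q *\<^sub>R \<tau>2 y) x"
    using pd_diff[OF section_at_smooth[OF assms(1)] section_at_smooth[OF sec] c, of v]
    by (simp add: algebra_simps)
  ultimately show ?thesis by simp
qed

end

lemma dif_section_lincomb:
  assumes "section_at \<sigma> x" "section_at \<tau>1 x" "section_at \<tau>2 x" "\<sigma> x = p *\<^sub>R \<tau>1 x + q *\<^sub>R \<tau>2 x"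
  shows "dif A \<sigma> x X - (p *\<^sub>R dif A \<tau>1 x X + q *\<^sub>R dif A \<tau>2 x X) \<in> f x"
  unfolding dif_eq_pd by (rule pd_section_lincomb[OF admissible_chart_at chart_at(2) assms])

lemma curvature_space_section:
  assumes "section_at \<sigma> x" shows "curvature_space A f x (span {\<sigma> x}) = {X. dif A \<sigma> x X \<in> f x}"
proof (intro set_eqI iffI)
  fix X assume "X \<in> curvature_space A f x (span {\<sigma> x})"
  then show "X \<in> {X. dif A \<sigma> x X \<in> f x}"
    using assms by (auto simp: curvature_space_def section_at_iff span_base)
next
  fix X assume X: "X \<in> {X. dif A \<sigma> x X \<in> f x}"
  show "X \<in> curvature_space A f x (span {\<sigma> x})"
    unfolding curvature_space_def
  proof (intro CollectI ballI impI)
    fix \<tau> assume \<tau>: "\<tau> \<in> local_sections A f x" "\<tau> x \<in> span {\<sigma> x}"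
    then obtain k where k: "\<tau> x = k *\<^sub>R \<sigma> x + 0 *\<^sub>R \<sigma> x" by (auto simp: span_singleton)
    have "dif A \<tau> x X - k *\<^sub>R dif A \<sigma> x X \<in> f x"
      using dif_section_lincomb[of \<tau> x \<sigma> \<sigma> k 0 X, OF _ assms assms k] \<tau>(1)
      by (simp add: section_at_iff)
    moreover have "k *\<^sub>R dif A \<sigma> x X \<in> f x" using X by (auto intro: subspace_scale[OF subspace_f])
    ultimately show "dif A \<tau> x X \<in> f x" using subspace_add[OF subspace_f] by (metis diff_add_cancel)
  qed
qed

text \<open>The immersion condition quantifies over all sections; tensoriality reduces it to two
  that span f at the point.\<close>

lemma immersed:
  assumes "section_at \<sigma>1 x" "section_at \<sigma>2 x" "f x \<subseteq> span {\<sigma>1 x, \<sigma>2 x}"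
    and X: "dif A \<sigma>1 x X \<in> f x" "dif A \<sigma>2 x X \<in> f x"
  shows "X = 0"
proof -
  have "dif A \<tau> x X \<in> f x" if \<tau>: "section_at \<tau> x" for \<tau>
  proof -
    have "\<tau> x \<in> span {\<sigma>1 x, \<sigma>2 x}" using assms(3) section_at_mem[OF \<tau>] by auto
    then obtain p q where "\<tau> x = p *\<^sub>R \<sigma>1 x + q *\<^sub>R \<sigma>2 x" unfolding span_2 by auto
    from dif_section_lincomb[OF \<tau> assms(1,2) this, of X]
    have "dif A \<tau> x X - (p *\<^sub>R dif A \<sigma>1 x X + q *\<^sub>R dif A \<sigma>2 x X) \<in> f x" .
    moreover have "p *\<^sub>R dif A \<sigma>1 x X + q *\<^sub>R dif A \<sigma>2 x X \<in> f x"
      using X by (intro subspace_add subspace_scale subspace_f)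
    ultimately show ?thesis using subspace_add[OF subspace_f] by (metis diff_add_cancel)
  qed
  then have d: "\<forall>\<sigma>\<in>local_sections A f x. dif A \<sigma> x X \<in> f x" by (simp add: section_at_iff)
  have "\<forall>x X. (\<forall>\<sigma>\<in>local_sections A f x. dif A \<sigma> x X \<in> f x) \<longrightarrow> X = 0"
    using legendre unfolding legendre_map_def by (elim conjE)
  then show ?thesis using d by (elim allE impE)
qed

end

section \<open>The exterior squares of the Lie cyclides\<close>

context lie_form
begin

lemma wedge_space_3:
  assumes "\<alpha> \<in> wedge_space B S S" "S \<subseteq> span {a, d, y}"
  obtains k1 k2 k3 where "\<alpha> = k1 *\<^sub>R wedge B a d + k2 *\<^sub>R wedge B a y + k3 *\<^sub>R wedge B d y"
proof -
  have "\<exists>k1 k2 k3. \<alpha> = k1 *\<^sub>R wedge B a d + k2 *\<^sub>R wedge B a y + k3 *\<^sub>R wedge B d y"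
    using assms(1) unfolding wedge_space_def
  proof (induction rule: span_induct_alt)
    case base
    show ?case by (intro exI[of _ 0]) simp
  next
    case (step k u z)
    then obtain v w where u: "u = wedge B v w" "v \<in> span {a, d, y}" "w \<in> span {a, d, y}"
      using assms(2) by auto
    obtain p q r where v: "v = p *\<^sub>R a + q *\<^sub>R d + r *\<^sub>R y" using u(2) unfolding span_3 by auto
    obtain p' q' r' where w: "w = p' *\<^sub>R a + q' *\<^sub>R d + r' *\<^sub>R y" using u(3) unfolding span_3 by auto
    have "u = (p * q' - q * p') *\<^sub>R wedge B a d + (p * r' - r * p') *\<^sub>R wedge B a y
        + (q * r' - r * q') *\<^sub>R wedge B d y"
      unfolding u(1) v w
      by (simp add: wedge.add_left wedge.add_right wedge.scaleR_left wedge.scaleR_right wedge_self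
          wedge_swap[of d a] wedge_swap[of y a] wedge_swap[of y d] algebra_simps)
    moreover obtain k1 k2 k3 where "z = k1 *\<^sub>R wedge B a d + k2 *\<^sub>R wedge B a y + k3 *\<^sub>R wedge B d y"
      using step.IH by auto
    ultimately have "k *\<^sub>R u + z = (k * (p * q' - q * p') + k1) *\<^sub>R wedge B a d
      + (k * (p * r' - r * p') + k2) *\<^sub>R wedge B a y + (k * (q * r' - r * q') + k3) *\<^sub>R wedge B d y"
      by (simp only: scaleR_add_right scaleR_scaleR scaleR_add_left add_ac)
    then show ?case by blast
  qed
  then show ?thesis using that by blast
qed

lemma wedge_space_2:
  assumes "\<alpha> \<in> wedge_space B S S" "S \<subseteq> span {a, d}"
  obtains k where "\<alpha> = k *\<^sub>R wedge B a d"
proof -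
  have "S \<subseteq> span {a, d, 0}" using assms(2) by (simp add: insert_commute)
  from wedge_space_3[OF assms(1) this] show ?thesis using that by (auto simp: wedge.zero_right)
qed

text \<open>In \<open>\<Lambda>\<^sup>2 S\<^sub>1\<close> with \<open>S\<^sub>1 = \<langle>a, d, y\<rangle>\<close>, only the multiples of \<open>a \<and> d\<close> kill \<open>a\<close>.\<close>

lemma wedge_killing_first:
  assumes k: "blinfun_apply (k1 *\<^sub>R wedge B a d + k2 *\<^sub>R wedge B a y + k3 *\<^sub>R wedge B d y) a = 0"
    and a: "B a a = 0" "B a d = 0" "B a y \<noteq> 0" "B d d \<noteq> 0"
  shows "k2 = 0" "k3 = 0"
proof -
  have e: "B a y *\<^sub>R (k2 *\<^sub>R a + k3 *\<^sub>R d) = 0"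
    using k a sym[of d a] sym[of y a]
    by (simp add: blinfun.add_left blinfun.scaleR_left wedge_app algebra_simps add_eq_0_iff)
  then have e: "k2 *\<^sub>R a + k3 *\<^sub>R d = 0" using a(3) by simp
  have "B (k2 *\<^sub>R a + k3 *\<^sub>R d) d = 0" unfolding e by (simp add: expand)
  then show k3: "k3 = 0" using a by (simp add: expand)
  have "a \<noteq> 0" using a(3) by (auto simp: expand)
  then show "k2 = 0" using e k3 by simp
qed

text \<open>The vector \<open>a1\<close> is orthogonal to \<open>S2\<close> and \<open>a2\<close> to
  \<open>S1\<close>, so \<alpha>2 kills \<open>a1\<close>, \<alpha>1 kills \<open>a2\<close> and
  \<beta> kills both. What remains of the two conditions on \<zeta> is \<alpha>1 a1 = 0 and
  \<alpha>2 a2 = 0, and \<open>wedge_killing_first\<close> removes the terms with \<open>y1\<close>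
  and \<open>y2\<close>.\<close>

lemma middle_decomposition:
  assumes \<zeta>: "\<zeta> = \<alpha>1 + \<alpha>2 + \<beta>" "blinfun_apply \<zeta> a1 = 0" "blinfun_apply \<zeta> a2 = 0"
    and \<alpha>1: "\<alpha>1 \<in> wedge_space B S1 S1" "S1 \<subseteq> span {a1, d1, y1}"
    and \<alpha>2: "\<alpha>2 \<in> wedge_space B S2 S2" "S2 \<subseteq> span {a2, d2, y2}"
    and \<beta>: "\<beta> \<in> wedge_space B F F" "F \<subseteq> span {a1, a2}"
    and z: "B a1 a1 = 0" "B a1 a2 = 0" "B a2 a2 = 0" "B a1 d1 = 0" "B a1 d2 = 0" "B a2 d1 = 0" "B a2 d2 = 0"
      "B a1 y2 = 0" "B a2 y1 = 0"
    and nz: "B a1 y1 \<noteq> 0" "B d1 d1 \<noteq> 0" "B a2 y2 \<noteq> 0" "B d2 d2 \<noteq> 0"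
  obtains p q r where "\<zeta> = p *\<^sub>R wedge B a1 d1 + q *\<^sub>R wedge B a2 d2 + r *\<^sub>R wedge B a1 a2"
proof -
  obtain k1 k2 k3 where k: "\<alpha>1 = k1 *\<^sub>R wedge B a1 d1 + k2 *\<^sub>R wedge B a1 y1 + k3 *\<^sub>R wedge B d1 y1"
    using wedge_space_3[OF \<alpha>1] .
  obtain l1 l2 l3 where l: "\<alpha>2 = l1 *\<^sub>R wedge B a2 d2 + l2 *\<^sub>R wedge B a2 y2 + l3 *\<^sub>R wedge B d2 y2"
    using wedge_space_3[OF \<alpha>2] .
  obtain r where r: "\<beta> = r *\<^sub>R wedge B a1 a2"
    using wedge_space_2[OF \<beta>] .
  note sy = sym[of a2 a1] sym[of d1 a1] sym[of d2 a1] sym[of d1 a2] sym[of d2 a2] sym[of y2 a1] sym[of y1 a2]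
  have b: "blinfun_apply \<beta> a1 = 0" "blinfun_apply \<beta> a2 = 0" "blinfun_apply \<alpha>2 a1 = 0" "blinfun_apply \<alpha>1 a2 = 0"
    unfolding k l r using z sy by (simp_all add: wedge_app blinfun.add_left blinfun.scaleR_left)
  then have "blinfun_apply \<alpha>1 a1 = 0" "blinfun_apply \<alpha>2 a2 = 0"
    using \<zeta> by (simp_all add: blinfun.add_left)
  then have "k2 = 0" "k3 = 0" "l2 = 0" "l3 = 0"
    using wedge_killing_first[of k1 a1 d1 k2 y1 k3] wedge_killing_first[of l1 a2 d2 l2 y2 l3] z nz
    unfolding k l by auto
  then have "\<zeta> = k1 *\<^sub>R wedge B a1 d1 + l1 *\<^sub>R wedge B a2 d2 + r *\<^sub>R wedge B a1 a2"
    unfolding \<zeta>(1) k l r by simp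
  then show ?thesis by (rule that)
qed

end

section \<open>Curvature frames\<close>

context surface
begin

lemma line_bundle_section:
  fixes s :: "'m \<Rightarrow> 'w::euclidean_space set"
  assumes "subbundle A 1 s"
  obtains \<sigma> where "smooth_at A \<sigma> x" "eventually (\<lambda>y. s y = span {\<sigma> y} \<and> \<sigma> y \<noteq> 0) (nhds x)"
proof -
  from assms have d: "\<And>x. dim (s x) = 1" and ex: "\<exists>U t. open U \<and> x \<in> U \<and> (\<forall>i<1. smooth_map A U (t i)) \<and>
        (\<forall>y\<in>U. s y = span ((\<lambda>i. t i y) ` {..<1::nat}))"
    by (auto simp: subbundle_def)
  then obtain U t where U: "open U" "x \<in> U" "\<forall>i<1. smooth_map A U (t i)"
    "\<forall>y\<in>U. s y = span ((\<lambda>i. t i y) ` {..<1::nat})" by auto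
  have s: "s y = span {t 0 y}" if "y \<in> U" for y
    using U(4) that by (simp add: lessThan_Suc)
  have "t 0 y \<noteq> 0" if "y \<in> U" for y
  proof
    assume "t 0 y = 0"
    then have "dim (s y) = 0" using s[OF that] by simp
    then show False using d by simp
  qed
  with s U(1,2) have "eventually (\<lambda>y. s y = span {t 0 y} \<and> t 0 y \<noteq> 0) (nhds x)"
    unfolding eventually_nhds by auto
  moreover have "smooth_at A (t 0) x" using U by (auto intro: smooth_atI)
  ultimately show ?thesis using that by simp
qed

end

context legendre
begin

definition frame_at :: "('m \<Rightarrow> 'v set) \<Rightarrow> ('m \<Rightarrow> 'v set) \<Rightarrow> ('m \<Rightarrow> 'v) \<Rightarrow> ('m \<Rightarrow> 'v) \<Rightarrow> 'm \<Rightarrow> bool" where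
  "frame_at s1 s2 \<sigma>1 \<sigma>2 x \<longleftrightarrow> section_at \<sigma>1 x \<and> section_at \<sigma>2 x \<and> s1 x = span {\<sigma>1 x} \<and> s2 x = span {\<sigma>2 x} \<and>
    \<sigma>1 x \<noteq> 0 \<and> \<sigma>2 x \<noteq> 0 \<and> f x = span {\<sigma>1 x, \<sigma>2 x} \<and>
    (\<exists>X. X \<noteq> 0 \<and> dif A \<sigma>1 x X \<in> f x) \<and> (\<exists>X. X \<noteq> 0 \<and> dif A \<sigma>2 x X \<in> f x)"

lemma frame_at_swap: "frame_at s1 s2 \<sigma>1 \<sigma>2 x \<Longrightarrow> frame_at s2 s1 \<sigma>2 \<sigma>1 x"
  by (auto simp: frame_at_def insert_commute)

lemma frame_ex:
  assumes csb: "curvature_sphere_bundles A f s1 s2"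
  obtains \<sigma>1 \<sigma>2 where "eventually (frame_at s1 s2 \<sigma>1 \<sigma>2) (nhds x)"
proof -
  have sb: "subbundle A 1 s1" "subbundle A 1 s2" and ne: "\<And>x. s1 x \<noteq> s2 x"
    and cs: "\<And>x. {L. curvature_sphere A f x L} = {s1 x, s2 x}"
    using csb by (auto simp: curvature_sphere_bundles_def)
  obtain \<sigma>1 where \<sigma>1: "smooth_at A \<sigma>1 x" "eventually (\<lambda>y. s1 y = span {\<sigma>1 y} \<and> \<sigma>1 y \<noteq> 0) (nhds x)"
    using line_bundle_section[OF sb(1)] .
  obtain \<sigma>2 where \<sigma>2: "smooth_at A \<sigma>2 x" "eventually (\<lambda>y. s2 y = span {\<sigma>2 y} \<and> \<sigma>2 y \<noteq> 0) (nhds x)"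
    using line_bundle_section[OF sb(2)] .
  have cs1: "curvature_sphere A f y (s1 y)" "curvature_sphere A f y (s2 y)" for y
    using cs[of y] by auto
  then have sub: "s1 y \<subseteq> f y" "s2 y \<subseteq> f y" for y
    by (auto simp: curvature_sphere_def)
  have "eventually (\<lambda>y. \<sigma>1 y \<in> f y) (nhds x)" using \<sigma>1(2)
    by eventually_elim (use sub(1) span_base in blast)
  then have sec1: "section_at \<sigma>1 x" using \<sigma>1(1) by (simp add: section_at_def)
  have "eventually (\<lambda>y. \<sigma>2 y \<in> f y) (nhds x)" using \<sigma>2(2)
    by eventually_elim (use sub(2) span_base in blast)
  then have sec2: "section_at \<sigma>2 x" using \<sigma>2(1) by (simp add: section_at_def)
  from section_at_eventually[OF sec1] section_at_eventually[OF sec2] \<sigma>1(2) \<sigma>2(2)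
  have "eventually (frame_at s1 s2 \<sigma>1 \<sigma>2) (nhds x)"
  proof eventually_elim
    case (elim y)
    have nin: "\<sigma>2 y \<notin> span {\<sigma>1 y}"
    proof
      assume "\<sigma>2 y \<in> span {\<sigma>1 y}"
      then obtain k where k: "\<sigma>2 y = k *\<^sub>R \<sigma>1 y" by (auto simp: span_singleton)
      then have "k \<noteq> 0" using elim by auto
      then have "span {\<sigma>2 y} = span {\<sigma>1 y}" unfolding k by (intro span_image_scale[of "{\<sigma>1 y}" "\<lambda>_. k", simplified]) auto
      then show False using ne[of y] elim by simp
    qed
    have m: "\<sigma>1 y \<in> f y" "\<sigma>2 y \<in> f y" using elim section_at_mem by auto
    have "dim {\<sigma>2 y, \<sigma>1 y} = 2" using nin elim by (simp add: dim_insert)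
    then have "span {\<sigma>2 y, \<sigma>1 y} = span (f y)"
      using m dim_f[of y] by (intro dim_eq_span) auto
    then have fy: "f y = span {\<sigma>1 y, \<sigma>2 y}"
      using span_eq_iff[THEN iffD2, OF subspace_f[of y]] by (simp add: insert_commute)
    have "\<exists>X. X \<noteq> 0 \<and> dif A \<sigma> y X \<in> f y"
      if s: "section_at \<sigma> y" "curvature_sphere A f y (span {\<sigma> y})" for \<sigma>
      using s(2) unfolding curvature_sphere_def curvature_space_section[OF s(1)] by auto
    from this[of \<sigma>1] this[of \<sigma>2] show ?case
      unfolding frame_at_def using elim cs1[of y] fy by auto
  qed
  then show ?thesis by (rule that)
qed

lemma frame_at_independent:
  assumes "frame_at s1 s2 \<sigma>1 \<sigma>2 x" "p *\<^sub>R \<sigma>1 x + q *\<^sub>R \<sigma>2 x = 0"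
  shows "p = 0 \<and> q = 0"
proof (rule ccontr)
  assume a: "\<not> (p = 0 \<and> q = 0)"
  have fx: "f x = span {\<sigma>1 x, \<sigma>2 x}" using assms(1) by (simp add: frame_at_def)
  have "\<exists>u. f x \<subseteq> span {u}"
  proof (cases "p = 0")
    case False
    have "p *\<^sub>R (\<sigma>1 x + (q / p) *\<^sub>R \<sigma>2 x) = 0"
      using assms(2) False by (simp add: scaleR_add_right)
    then have "\<sigma>1 x = (- q / p) *\<^sub>R \<sigma>2 x"
      using False by (simp add: eq_neg_iff_add_eq_0)
    then have "\<sigma>1 x \<in> span {\<sigma>2 x}" by (simp only:) (intro span_scale span_base, simp)
    then have "f x \<subseteq> span {\<sigma>2 x}" unfolding fx by (intro span_minimal) (auto intro: span_base)
    then show ?thesis ..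
  next
    case True
    then have "\<sigma>2 x = 0" using a assms(2) by simp
    then show ?thesis using assms(1) by (simp add: frame_at_def)
  qed
  then obtain u where "f x \<subseteq> span {u}" ..
  then have "dim (f x) \<le> dim {u}" using dim_subset[of "f x" "span {u}"] by (simp add: dim_span)
  also have "\<dots> \<le> 1" by (simp add: dim_insert)
  finally show False by (simp add: dim_f)
qed

lemma frame_at_curvature_disjoint:
  assumes "frame_at s1 s2 \<sigma>1 \<sigma>2 x" "dif A \<sigma>1 x X \<in> f x" "dif A \<sigma>2 x X \<in> f x"
  shows "X = 0"
  using assms by (intro immersed[of \<sigma>1 x \<sigma>2]) (auto simp: frame_at_def)

text \<open>A non-positive square would put d_Y \<sigma>1 into f; then \<open>Y\<close> would be a
  curvature direction of both spheres, which the immersion condition forbids.\<close>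

lemma frame_at_positive:
  assumes fr: "frame_at s1 s2 \<sigma>1 \<sigma>2 x" and Y: "dif A \<sigma>2 x Y \<in> f x" "Y \<noteq> 0"
  shows "B (dif A \<sigma>1 x Y) (dif A \<sigma>1 x Y) > 0"
proof (rule ccontr)
  assume "\<not> ?thesis"
  then have "dif A \<sigma>1 x Y \<in> f x"
    using fr by (intro mem_f_of_perp dif_perp) (auto simp: frame_at_def)
  then show False using frame_at_curvature_disjoint[OF fr _ Y(1)] Y(2) by auto
qed

text \<open>Near \<open>x\<close> the curvature space of s1 is the kernel of the linear form w
  \<mapsto> (d_w \<sigma>1, g), where g = d_v \<sigma>1 for a fixed direction \<open>v\<close>. The
  form has smooth coefficients l1, l2, and (l2, - l1) spans its kernel.\<close>

lemma curvature_field: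
  assumes ev: "eventually (frame_at s1 s2 \<sigma>1 \<sigma>2) (nhds x)" and c: "admissible_chart A c" "x \<in> fst c"
  obtains X where "smooth_at A X x" "eventually (\<lambda>y. X y \<noteq> 0 \<and>
    curvature_space A f y (s1 y) = range (\<lambda>k. coord_vec A c (k *\<^sub>R X y) y)) (nhds x)"
proof -
  note fr = eventually_nhds_x_imp_x[OF ev]
  have \<sigma>1: "smooth_at A \<sigma>1 x" using fr by (simp add: frame_at_def section_at_def)
  \<comment> \<open>A curvature direction of the other sphere: along it the derivative of \<sigma>1
    has positive square.\<close>
  obtain Y0 where Y0: "Y0 \<noteq> 0" "dif A \<sigma>2 x Y0 \<in> f x" using fr by (auto simp: frame_at_def)
  define v where "v = dif A (snd c) x Y0"
  have vY: "coord_vec A c v x = Y0" unfolding v_def by (rule coord_vec_dif_snd[OF c])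
  define g where "g = pd c v \<sigma>1"
  define l1 where "l1 y = B (pd c (axis 1 1) \<sigma>1 y) (g y)" for y
  define l2 where "l2 y = B (pd c (axis 2 1) \<sigma>1 y) (g y)" for y
  define X :: "'m \<Rightarrow> real ^ 2" where "X y = l2 y *\<^sub>R axis 1 1 - l1 y *\<^sub>R axis 2 1" for y
  have g: "smooth_at A g x" unfolding g_def by (rule smooth_at_pd[OF \<sigma>1 c])
  have Xs: "smooth_at A X x" unfolding X_def l1_def l2_def
    by (intro smooth_at_diff smooth_at_scaleR smooth_at_const smooth_at_B smooth_at_pd \<sigma>1 c g)
  have "B (g x) (g x) > 0"
    using frame_at_positive[OF fr Y0(2,1)] dif_coord_vec[OF \<sigma>1 c, of v] by (simp add: g_def vY)
  then have evg: "eventually (\<lambda>y. B (g y) (g y) \<noteq> 0) (nhds x)"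
    by (intro smooth_at_nonzero smooth_at_B g) simp
  have "eventually (\<lambda>y. X y \<noteq> 0 \<and>
    curvature_space A f y (s1 y) = range (\<lambda>k. coord_vec A c (k *\<^sub>R X y) y)) (nhds x)"
    using ev evg eventually_chart[OF c]
  proof eventually_elim
    case (elim y)
    have sec: "section_at \<sigma>1 y" and s1: "s1 y = span {\<sigma>1 y}" using elim(1) by (simp_all add: frame_at_def)
    note sm = section_at_smooth[OF sec] and cy = c(1) elim(3)
    note l = pd_linear[OF sm cy]
    have ell: "B (pd c w \<sigma>1 y) (g y) = w $ 1 * l1 y + w $ 2 * l2 y" for w
    proof -
      have "w = w $ 1 *\<^sub>R axis 1 1 + w $ 2 *\<^sub>R axis 2 1"
        by (simp add: vec_eq_iff forall_2 axis_def)
      then have "pd c w \<sigma>1 y = pd c (w $ 1 *\<^sub>R axis 1 1 + w $ 2 *\<^sub>R axis 2 1) \<sigma>1 y" by (rule arg_cong)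
      then show ?thesis by (simp add: linear_add[OF l] linear_cmul[OF l] expand l1_def l2_def)
    qed
    \<comment> \<open>At \<open>v\<close> the linear form takes the value (g, g), which is not
      zero.\<close>
    have n: "(l1 y)\<^sup>2 + (l2 y)\<^sup>2 \<noteq> 0"
      using elim(2) ell[of v] by (auto simp: g_def)
    have Xc: "X y $ 1 = l2 y" "X y $ 2 = - l1 y" by (simp_all add: X_def axis_def)
    have X0: "X y \<noteq> 0" using n Xc by (metis power_zero_numeral zero_index add.right_neutral neg_equal_0_iff_equal)
    have sp: "curvature_space A f y (s1 y) = {X. dif A \<sigma>1 y X \<in> f y}"
      unfolding s1 by (rule curvature_space_section[OF sec])
    have ker: "\<exists>k. Z = coord_vec A c (k *\<^sub>R X y) y" if Z: "dif A \<sigma>1 y Z \<in> f y" for Z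
    proof -
      define w where "w = dif A (snd c) y Z"
      have Zw: "Z = coord_vec A c w y" unfolding w_def using coord_vec_dif_snd[OF cy] by simp
      have "pd c w \<sigma>1 y \<in> f y" using Z dif_coord_vec[OF sm cy] by (simp add: Zw)
      then have "B (pd c w \<sigma>1 y) (g y) = 0" unfolding g_def by (rule perpD'[OF pd_perp[OF cy sec]])
      then have 0: "w $ 1 * l1 y + w $ 2 * l2 y = 0" by (simp add: ell)
      \<comment> \<open>The coefficient of the projection of \<open>w\<close> onto
        \<open>X y\<close> for the standard inner product of the plane.\<close>
      define k where "k = (w $ 1 * l2 y - w $ 2 * l1 y) / ((l1 y)\<^sup>2 + (l2 y)\<^sup>2)"
      have "k * l2 y = w $ 1" "k * (- l1 y) = w $ 2"
        using n 0 unfolding k_def by (simp_all add: divide_simps) (algebra+)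
      then have "w = k *\<^sub>R X y" by (simp add: vec_eq_iff forall_2 Xc)
      then show ?thesis using Zw by auto
    qed
    \<comment> \<open>The curvature space lies in a line and contains a non-zero vector, so it is
      the whole line.\<close>
    have "range (\<lambda>k. coord_vec A c (k *\<^sub>R X y) y) \<subseteq> {X. dif A \<sigma>1 y X \<in> f y}"
    proof (intro subsetI, elim rangeE, intro CollectI)
      fix Z k assume Z: "Z = coord_vec A c (k *\<^sub>R X y) y"
      obtain Z0 where Z0: "Z0 \<noteq> 0" "dif A \<sigma>1 y Z0 \<in> f y" using elim(1) by (auto simp: frame_at_def)
      obtain k0 where k0: "Z0 = coord_vec A c (k0 *\<^sub>R X y) y" using ker[OF Z0(2)] ..
      have "k0 \<noteq> 0" using Z0(1) k0 coord_vec_eq_0_iff[OF cy] by auto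
      then have "Z = (k / k0) *\<^sub>R Z0"
        unfolding Z k0 using linear_cmul[OF coord_vec_linear[OF cy], of "k / k0" "k0 *\<^sub>R X y"] by simp
      then show "dif A \<sigma>1 y Z \<in> f y"
        using Z0(2) subspace_scale[OF subspace_f] linear_cmul[OF dif_linear[OF sm]] by auto
    qed
    moreover have "{X. dif A \<sigma>1 y X \<in> f y} \<subseteq> range (\<lambda>k. coord_vec A c (k *\<^sub>R X y) y)"
    proof
      fix Z assume "Z \<in> {X. dif A \<sigma>1 y X \<in> f y}"
      then obtain k where "Z = coord_vec A c (k *\<^sub>R X y) y" using ker[of Z] by auto
      then show "Z \<in> range (\<lambda>k. coord_vec A c (k *\<^sub>R X y) y)" by (rule range_eqI)
    qed
    ultimately have "{X. dif A \<sigma>1 y X \<in> f y} = range (\<lambda>k. coord_vec A c (k *\<^sub>R X y) y)"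
      by (rule equalityI[rotated])
    then show ?case using X0 sp by simp
  qed
  then show ?thesis using that[OF Xs] by simp
qed

end

locale curvature_frame = legendre A B f
  for A :: "'m::{t2_space, second_countable_topology} chart set"
    and B :: "'v::euclidean_space \<Rightarrow> 'v \<Rightarrow> real" and f :: "'m \<Rightarrow> 'v set" +
  fixes s1 s2 :: "'m \<Rightarrow> 'v set" and c :: "'m chart" and m :: 'm and \<sigma>1 \<sigma>2 :: "'m \<Rightarrow> 'v"
    and X Y :: "'m \<Rightarrow> real ^ 2"
  assumes c: "c \<in> A" "m \<in> fst c"
    and frame: "eventually (frame_at s1 s2 \<sigma>1 \<sigma>2) (nhds m)"
    and X: "smooth_at A X m" "eventually (\<lambda>y. X y \<noteq> 0 \<and>
      curvature_space A f y (s1 y) = range (\<lambda>k. coord_vec A c (k *\<^sub>R X y) y)) (nhds m)"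
    and Y: "smooth_at A Y m" "eventually (\<lambda>y. Y y \<noteq> 0 \<and>
      curvature_space A f y (s2 y) = range (\<lambda>k. coord_vec A c (k *\<^sub>R Y y) y)) (nhds m)"

lemma (in legendre) curvature_frame_ex:
  assumes csb: "curvature_sphere_bundles A f s1 s2"
  obtains c \<sigma>1 \<sigma>2 X Y where "curvature_frame A B f s1 s2 c m \<sigma>1 \<sigma>2 X Y"
proof -
  obtain c where c: "c \<in> A" "m \<in> fst c" by (rule atlas_cover)
  obtain \<sigma>1 \<sigma>2 where fr: "eventually (frame_at s1 s2 \<sigma>1 \<sigma>2) (nhds m)" using frame_ex[OF csb] .
  then have fr': "eventually (frame_at s2 s1 \<sigma>2 \<sigma>1) (nhds m)" by (auto elim: eventually_mono intro: frame_at_swap)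
  obtain X where X: "smooth_at A X m" "eventually (\<lambda>y. X y \<noteq> 0 \<and>
      curvature_space A f y (s1 y) = range (\<lambda>k. coord_vec A c (k *\<^sub>R X y) y)) (nhds m)"
    using curvature_field[OF fr admissible_atlas[OF c(1)] c(2)] .
  obtain Y where Y: "smooth_at A Y m" "eventually (\<lambda>y. Y y \<noteq> 0 \<and>
      curvature_space A f y (s2 y) = range (\<lambda>k. coord_vec A c (k *\<^sub>R Y y) y)) (nhds m)"
    using curvature_field[OF fr' admissible_atlas[OF c(1)] c(2)] .
  have "curvature_frame A B f s1 s2 c m \<sigma>1 \<sigma>2 X Y"
    by unfold_locales (use c fr X Y in auto)
  then show ?thesis by (rule that)
qed

context curvature_frame
begin

lemma swap: "curvature_frame A B f s2 s1 c m \<sigma>2 \<sigma>1 Y X"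
  by unfold_locales (use c X Y frame in \<open>auto elim: eventually_mono intro: frame_at_swap\<close>)

lemma ac: "admissible_chart A c"
  by (rule admissible_atlas[OF c(1)])

lemma frame_m: "frame_at s1 s2 \<sigma>1 \<sigma>2 m"
  by (rule eventually_nhds_x_imp_x[OF frame])

lemma \<sigma>1: "section_at \<sigma>1 m" and \<sigma>2: "section_at \<sigma>2 m" and f_m: "f m = span {\<sigma>1 m, \<sigma>2 m}"
  using frame_m by (simp_all add: frame_at_def)

lemma X0: "X m \<noteq> 0"
  using eventually_nhds_x_imp_x[OF X(2)] by simp

lemma eventually_dX: "eventually (\<lambda>y. pd c (X y) \<sigma>1 y \<in> f y) (nhds m)"
  using frame X(2) eventually_chart[OF ac c(2)]
proof eventually_elim
  case (elim y)
  have sec: "section_at \<sigma>1 y" and s1: "s1 y = span {\<sigma>1 y}" using elim(1) by (simp_all add: frame_at_def)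
  have "coord_vec A c (1 *\<^sub>R X y) y \<in> curvature_space A f y (s1 y)" using elim(2) by (auto simp del: scaleR_one)
  then have "dif A \<sigma>1 y (coord_vec A c (X y) y) \<in> f y"
    unfolding s1 curvature_space_section[OF sec] by simp
  then show ?case using dif_coord_vec[OF section_at_smooth[OF sec] ac elim(3)] by simp
qed

lemma dX: "pd c (X m) \<sigma>1 m \<in> f m"
  by (rule eventually_nhds_x_imp_x[OF eventually_dX])

text \<open>With \<open>\<sigma>2 m\<close> these are the generators of the cyclide S_2. The field
  \<open>X\<close> belongs to the curvature directions of s1, so it does not differentiate \<sigma>2
  into f.\<close>

definition "d2 = pd c (X m) \<sigma>2 m"
definition "y2 = pd c (X m) (\<lambda>y. pd c (X y) \<sigma>2 y) m"

lemma d2_pos: "B d2 d2 > 0"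
proof -
  have "dif A \<sigma>1 m (coord_vec A c (X m) m) \<in> f m"
    using dX dif_coord_vec[OF section_at_smooth[OF \<sigma>1] ac c(2)] by simp
  from frame_at_positive[OF frame_at_swap[OF frame_m] this] show ?thesis
    using coord_vec_eq_0_iff[OF ac c(2)] X0 dif_coord_vec[OF section_at_smooth[OF \<sigma>2] ac c(2)]
    by (simp add: d2_def)
qed

lemma d2_perp: "d2 \<in> perp B (f m)"
  unfolding d2_def by (rule pd_perp[OF ac c(2) \<sigma>2])

text \<open>Differentiate (\<tau>, d_X \<sigma>2) = 0 along X. For \<tau> = \<sigma>1 the remaining
  term vanishes because d_X \<sigma>1 lies in f. These are the orthogonality relations behind
  \<open>middle_decomposition\<close>.\<close>

lemma sigma_y2: "B (\<sigma>1 m) y2 = 0" "B (\<sigma>2 m) y2 = - B d2 d2"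
proof -
  have sm: "smooth_at A (\<lambda>y. pd c (X y) \<sigma>2 y) m"
    by (rule smooth_at_pd_field[OF section_at_smooth[OF \<sigma>2] X(1) ac c(2)])
  have e: "eventually (\<lambda>y. B (\<tau> y) (pd c (X y) \<sigma>2 y) = 0) (nhds m)" if "section_at \<tau> m" for \<tau>
    by (rule eventually_B_section_pd_field[OF that \<sigma>2 ac c(2)])
  show "B (\<sigma>2 m) y2 = - B d2 d2"
    using pd_B_zero[OF ac c(2) section_at_smooth[OF \<sigma>2] sm e[OF \<sigma>2]] by (simp add: d2_def y2_def)
  show "B (\<sigma>1 m) y2 = 0"
    using pd_B_zero[OF ac c(2) section_at_smooth[OF \<sigma>1] sm e[OF \<sigma>1]]
      perpD'[OF d2_perp dX] by (simp add: d2_def y2_def)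
qed

lemma cyclide2:
  "lie_cyclide A s2 (\<lambda>y. curvature_space A f y (s1 y)) m \<subseteq> span {\<sigma>2 m, d2, y2}"
  "\<sigma>2 m \<in> lie_cyclide A s2 (\<lambda>y. curvature_space A f y (s1 y)) m"
  "d2 \<in> lie_cyclide A s2 (\<lambda>y. curvature_space A f y (s1 y)) m"
proof -
  have ev: "eventually (\<lambda>y. s2 y = span {\<sigma>2 y} \<and> \<sigma>2 y \<noteq> 0 \<and> X y \<noteq> 0 \<and>
      curvature_space A f y (s1 y) = range (\<lambda>k. coord_vec A c (k *\<^sub>R X y) y)) (nhds m)"
    using frame X(2) by eventually_elim (simp add: frame_at_def)
  note L = lie_cyclide_frame[OF c section_at_smooth[OF \<sigma>2] X(1) ev]
  show "lie_cyclide A s2 (\<lambda>y. curvature_space A f y (s1 y)) m \<subseteq> span {\<sigma>2 m, d2, y2}"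
    "\<sigma>2 m \<in> lie_cyclide A s2 (\<lambda>y. curvature_space A f y (s1 y)) m"
    "d2 \<in> lie_cyclide A s2 (\<lambda>y. curvature_space A f y (s1 y)) m"
    using L by (simp_all add: d2_def y2_def)
qed

end

section \<open>Conserved quantities of the middle pencil\<close>

text \<open>\<open>dif_p1\<close> and \<open>\<zeta>_p1\<close> are the coefficients of \<open>t\<close> and \<open>t\<^sup>2\<close> in \<open>(d + t \<zeta>) (qinf + t p1) = 0\<close>.\<close>

locale conserved = legendre A B f
  for A :: "'m::{t2_space, second_countable_topology} chart set"
    and B :: "'v::euclidean_space \<Rightarrow> 'v \<Rightarrow> real" and f :: "'m \<Rightarrow> 'v set" +
  fixes s1 s2 :: "'m \<Rightarrow> 'v set" and \<zeta> :: "'m \<Rightarrow> real ^ 2 \<Rightarrow> ('v \<Rightarrow>\<^sub>L 'v)"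
    and p1 :: "'m \<Rightarrow> 'v" and qinf :: 'v
  assumes csb: "curvature_sphere_bundles A f s1 s2"
    and \<zeta>_smooth: "smooth_one_form A \<zeta>"
    and \<zeta>_f: "\<And>x X v. v \<in> f x \<Longrightarrow> blinfun_apply (\<zeta> x X) v = 0"
    and \<zeta>_middle: "\<And>x X. \<exists>\<alpha>1 \<alpha>2 \<beta>. \<zeta> x X = \<alpha>1 + \<alpha>2 + \<beta> \<and>
      \<alpha>1 \<in> wedge_space B (lie_cyclide A s1 (\<lambda>y. curvature_space A f y (s2 y)) x)
        (lie_cyclide A s1 (\<lambda>y. curvature_space A f y (s2 y)) x) \<and>
      \<alpha>2 \<in> wedge_space B (lie_cyclide A s2 (\<lambda>y. curvature_space A f y (s1 y)) x)
        (lie_cyclide A s2 (\<lambda>y. curvature_space A f y (s1 y)) x) \<and>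
      \<beta> \<in> wedge_space B (f x) (f x)"
    and \<zeta>_nondegenerate: "\<And>x \<sigma>1 \<sigma>2 Y. frame_at s1 s2 \<sigma>1 \<sigma>2 x \<Longrightarrow> Y \<noteq> 0 \<Longrightarrow>
      (dif A \<sigma>2 x Y \<in> f x \<longrightarrow> (\<exists>Z. blinfun_apply (\<zeta> x Z) (dif A \<sigma>1 x Y) \<noteq> 0)) \<and>
      (dif A \<sigma>1 x Y \<in> f x \<longrightarrow> (\<exists>Z. blinfun_apply (\<zeta> x Z) (dif A \<sigma>2 x Y) \<noteq> 0))"
    and p1_smooth: "\<And>x. smooth_at A p1 x"
    and dif_p1: "\<And>x X. dif A p1 x X = - blinfun_apply (\<zeta> x X) qinf"
    and \<zeta>_p1: "\<And>x X. blinfun_apply (\<zeta> x X) (p1 x) = 0"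
    and p1_p1: "\<And>x. B (p1 x) (p1 x) = 0" and p1_qinf: "\<And>x. B (p1 x) qinf = 0"
    and qinf: "qinf \<noteq> 0" "B qinf qinf = 0"

text \<open>The assumptions are symmetric in the two curvature spheres; each statement about the
  first one below is transferred to the second by this exchange.\<close>

lemma (in conserved) conserved_swap: "conserved A B f s2 s1 \<zeta> p1 qinf"
proof unfold_locales
  show "curvature_sphere_bundles A f s2 s1"
    using csb by (auto simp: curvature_sphere_bundles_def)
  show "\<exists>\<alpha>1 \<alpha>2 \<beta>. \<zeta> x X = \<alpha>1 + \<alpha>2 + \<beta> \<and>
      \<alpha>1 \<in> wedge_space B (lie_cyclide A s2 (\<lambda>y. curvature_space A f y (s1 y)) x)
        (lie_cyclide A s2 (\<lambda>y. curvature_space A f y (s1 y)) x) \<and>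
      \<alpha>2 \<in> wedge_space B (lie_cyclide A s1 (\<lambda>y. curvature_space A f y (s2 y)) x)
        (lie_cyclide A s1 (\<lambda>y. curvature_space A f y (s2 y)) x) \<and>
      \<beta> \<in> wedge_space B (f x) (f x)" for x X
  proof -
    obtain \<alpha>1 \<alpha>2 \<beta> where d: "\<zeta> x X = \<alpha>1 + \<alpha>2 + \<beta>"
      "\<alpha>1 \<in> wedge_space B (lie_cyclide A s1 (\<lambda>y. curvature_space A f y (s2 y)) x)
        (lie_cyclide A s1 (\<lambda>y. curvature_space A f y (s2 y)) x)"
      "\<alpha>2 \<in> wedge_space B (lie_cyclide A s2 (\<lambda>y. curvature_space A f y (s1 y)) x)
        (lie_cyclide A s2 (\<lambda>y. curvature_space A f y (s1 y)) x)"
      "\<beta> \<in> wedge_space B (f x) (f x)"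
      using \<zeta>_middle[of x X] by (elim exE conjE)
    show ?thesis
      by (intro exI conjI) (rule trans[OF d(1)], rule arg_cong[where f="\<lambda>u. u + \<beta>"], rule add.commute,
        rule d(3), rule d(2), rule d(4))
  qed
  show "(dif A \<sigma>2 x Y \<in> f x \<longrightarrow> (\<exists>Z. blinfun_apply (\<zeta> x Z) (dif A \<sigma>1 x Y) \<noteq> 0)) \<and>
      (dif A \<sigma>1 x Y \<in> f x \<longrightarrow> (\<exists>Z. blinfun_apply (\<zeta> x Z) (dif A \<sigma>2 x Y) \<noteq> 0))"
    if "frame_at s2 s1 \<sigma>1 \<sigma>2 x" "Y \<noteq> 0" for x \<sigma>1 \<sigma>2 Y
    using \<zeta>_nondegenerate[OF frame_at_swap[OF that(1)] that(2)] by auto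
qed (rule \<zeta>_smooth p1_smooth dif_p1 \<zeta>_p1 p1_p1 p1_qinf qinf | erule \<zeta>_f)+

locale conserved_frame =
  curvature_frame A B f s1 s2 c m \<sigma>1 \<sigma>2 X Y + conserved A B f s1 s2 \<zeta> p1 qinf
  for A :: "'m::{t2_space, second_countable_topology} chart set"
    and B :: "'v::euclidean_space \<Rightarrow> 'v \<Rightarrow> real" and f :: "'m \<Rightarrow> 'v set"
    and s1 s2 c m \<sigma>1 \<sigma>2 X Y \<zeta> p1 qinf

section \<open>Both curvature spheres at a point\<close>

context curvature_frame
begin

definition "d1 = pd c (Y m) \<sigma>1 m"
definition "y1 = pd c (Y m) (\<lambda>y. pd c (Y y) \<sigma>1 y) m"

lemma swap_d2: "curvature_frame.d2 c m \<sigma>1 Y = d1" and swap_y2: "curvature_frame.y2 c m \<sigma>1 Y = y1"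
  by (simp_all add: curvature_frame.d2_def[OF swap] d1_def curvature_frame.y2_def[OF swap] y1_def)

lemmas d1_pos = curvature_frame.d2_pos[OF swap, unfolded swap_d2]
lemmas d1_perp = curvature_frame.d2_perp[OF swap, unfolded swap_d2]
lemmas sigma_y1 = curvature_frame.sigma_y2[OF swap, unfolded swap_d2 swap_y2]
lemmas cyclide1 = curvature_frame.cyclide2[OF swap, unfolded swap_d2 swap_y2]
lemmas dY = curvature_frame.dX[OF swap]

text \<open>By \<open>B_pd_pd_commute\<close> the product equals (d_X \<sigma>1, d_Y \<sigma>2), and
  both of these vectors lie in the isotropic plane f.\<close>

lemma d1_d2: "B d1 d2 = 0"
  using B_pd_pd_commute[OF ac c(2) \<sigma>1 \<sigma>2, of "Y m" "X m"] perpD[OF pd_perp[OF ac c(2) \<sigma>1] dY] 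
    perpD'[OF pd_perp[OF ac c(2) \<sigma>2] dX] perpD'[OF f_subset_perp[OF dY] dX]
  by (simp add: d1_def d2_def)

lemma sigma_mem: "\<sigma>1 m \<in> f m" "\<sigma>2 m \<in> f m"
  using \<sigma>1 \<sigma>2 section_at_mem by auto

lemma sigma_zero: "B (\<sigma>1 m) (\<sigma>1 m) = 0" "B (\<sigma>1 m) (\<sigma>2 m) = 0" "B (\<sigma>2 m) (\<sigma>1 m) = 0"
  "B (\<sigma>2 m) (\<sigma>2 m) = 0"
  "B (\<sigma>1 m) d1 = 0" "B (\<sigma>1 m) d2 = 0" "B (\<sigma>2 m) d1 = 0" "B (\<sigma>2 m) d2 = 0"
  "B d1 (\<sigma>1 m) = 0" "B d2 (\<sigma>1 m) = 0" "B d1 (\<sigma>2 m) = 0" "B d2 (\<sigma>2 m) = 0"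
  using sigma_mem isotropic perpD[OF d1_perp] perpD[OF d2_perp] perpD'[OF d1_perp] perpD'[OF d2_perp]
  by auto

lemma dif_X: "dif A \<sigma>1 m (coord_vec A c (X m) m) \<in> f m" "dif A \<sigma>2 m (coord_vec A c (X m) m) = d2"
  "coord_vec A c (X m) m \<noteq> 0"
  using dX X0 dif_coord_vec[OF section_at_smooth[OF \<sigma>1] ac c(2)]
    dif_coord_vec[OF section_at_smooth[OF \<sigma>2] ac c(2)] coord_vec_eq_0_iff[OF ac c(2)]
  by (auto simp: d2_def)

lemma dif_Y: "dif A \<sigma>2 m (coord_vec A c (Y m) m) \<in> f m" "dif A \<sigma>1 m (coord_vec A c (Y m) m) = d1"
  "coord_vec A c (Y m) m \<noteq> 0"
  using curvature_frame.dif_X[OF swap] by (simp_all add: swap_d2)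

lemma XY_independent:
  assumes "p *\<^sub>R X m + q *\<^sub>R Y m = 0" shows "p = 0 \<and> q = 0"
proof -
  note l1 = pd_linear[OF section_at_smooth[OF \<sigma>1] ac c(2)]
  note l2 = pd_linear[OF section_at_smooth[OF \<sigma>2] ac c(2)]
  have "0 = pd c (p *\<^sub>R X m + q *\<^sub>R Y m) \<sigma>1 m" "0 = pd c (p *\<^sub>R X m + q *\<^sub>R Y m) \<sigma>2 m"
    unfolding assms using linear_0[OF l1] linear_0[OF l2] by simp_all
  then have e: "p *\<^sub>R pd c (X m) \<sigma>1 m + q *\<^sub>R d1 = 0" "p *\<^sub>R d2 + q *\<^sub>R pd c (Y m) \<sigma>2 m = 0"
    by (simp_all add: linear_add[OF l1] linear_cmul[OF l1] linear_add[OF l2] linear_cmul[OF l2] d1_def d2_def)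
  have "B (p *\<^sub>R pd c (X m) \<sigma>1 m + q *\<^sub>R d1) d1 = 0" "B (p *\<^sub>R d2 + q *\<^sub>R pd c (Y m) \<sigma>2 m) d2 = 0"
    unfolding e by (simp_all add: expand)
  then have "q * B d1 d1 = 0" "p * B d2 d2 = 0"
    using perpD'[OF d1_perp dX] perpD'[OF d2_perp dY] by (simp_all add: expand)
  then show ?thesis using d1_pos d2_pos by simp
qed

lemma tangent_decomposition:
  obtains p q where "Z = p *\<^sub>R coord_vec A c (X m) m + q *\<^sub>R coord_vec A c (Y m) m"
proof -
  obtain p q where "dif A (snd c) m Z = p *\<^sub>R X m + q *\<^sub>R Y m"
    by (rule real2_basis[OF XY_independent])
  then have "coord_vec A c (dif A (snd c) m Z) m = p *\<^sub>R coord_vec A c (X m) m + q *\<^sub>R coord_vec A c (Y m) m"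
    using coord_vec_linear[OF ac c(2)]
    by (simp add: linear_add[where f="\<lambda>v. coord_vec A c v m"] linear_cmul[where f="\<lambda>v. coord_vec A c v m"])
  then show ?thesis using that coord_vec_dif_snd[OF ac c(2), of Z] by simp
qed

end

section \<open>The middle potential at a point\<close>

context conserved_frame
begin

lemma swap_conserved: "conserved_frame A B f s2 s1 c m \<sigma>2 \<sigma>1 Y X \<zeta> p1 qinf"
  using swap conserved_swap by (simp add: conserved_frame_def)

lemma middle_form:
  obtains p q r where "\<zeta> m Z = p *\<^sub>R wedge B (\<sigma>1 m) d1 + q *\<^sub>R wedge B (\<sigma>2 m) d2 + r *\<^sub>R wedge B (\<sigma>1 m) (\<sigma>2 m)"
proof -
  obtain \<alpha>1 \<alpha>2 \<beta> where d: "\<zeta> m Z = \<alpha>1 + \<alpha>2 + \<beta>"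
    "\<alpha>1 \<in> wedge_space B (lie_cyclide A s1 (\<lambda>y. curvature_space A f y (s2 y)) m)
        (lie_cyclide A s1 (\<lambda>y. curvature_space A f y (s2 y)) m)"
    "\<alpha>2 \<in> wedge_space B (lie_cyclide A s2 (\<lambda>y. curvature_space A f y (s1 y)) m)
        (lie_cyclide A s2 (\<lambda>y. curvature_space A f y (s1 y)) m)"
    "\<beta> \<in> wedge_space B (f m) (f m)"
    using \<zeta>_middle[of m Z] by auto
  show ?thesis
  proof (rule middle_decomposition[OF d(1) _ _ d(2) cyclide1(1) d(3) cyclide2(1) d(4)])
    show "f m \<subseteq> span {\<sigma>1 m, \<sigma>2 m}" by (simp add: f_m)
  qed (use that sigma_mem \<zeta>_f sigma_zero sigma_y1 sigma_y2 d1_pos d2_pos in auto)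
qed

lemma \<zeta>_d1: obtains k where "blinfun_apply (\<zeta> m Z) d1 = k *\<^sub>R \<sigma>1 m"
proof -
  obtain p q r where "\<zeta> m Z = p *\<^sub>R wedge B (\<sigma>1 m) d1 + q *\<^sub>R wedge B (\<sigma>2 m) d2 + r *\<^sub>R wedge B (\<sigma>1 m) (\<sigma>2 m)"
    using middle_form[of Z] .
  then have "blinfun_apply (\<zeta> m Z) d1 = (- p * B d1 d1) *\<^sub>R \<sigma>1 m"
    using sigma_zero d1_d2 sym[of d2 d1] by (simp add: blinfun.add_left blinfun.scaleR_left wedge_app)
  then show ?thesis by (rule that)
qed

lemma \<zeta>_skew: "B (blinfun_apply (\<zeta> m Z) u) w = - B u (blinfun_apply (\<zeta> m Z) w)"
proof -
  obtain p q r where "\<zeta> m Z = p *\<^sub>R wedge B (\<sigma>1 m) d1 + q *\<^sub>R wedge B (\<sigma>2 m) d2 + r *\<^sub>R wedge B (\<sigma>1 m) (\<sigma>2 m)"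
    using middle_form[of Z] .
  then show ?thesis by (simp add: blinfun.add_left blinfun.scaleR_left expand wedge_skew)
qed

lemma \<zeta>_perp:
  assumes "w \<in> perp B (f m)" shows "blinfun_apply (\<zeta> m Z) w \<in> f m"
proof -
  obtain p q r where "\<zeta> m Z = p *\<^sub>R wedge B (\<sigma>1 m) d1 + q *\<^sub>R wedge B (\<sigma>2 m) d2 + r *\<^sub>R wedge B (\<sigma>1 m) (\<sigma>2 m)"
    using middle_form[of Z] .
  moreover have "B (\<sigma>1 m) w = 0" "B (\<sigma>2 m) w = 0" using perpD'[OF assms] sigma_mem by auto
  ultimately have "blinfun_apply (\<zeta> m Z) w = p *\<^sub>R (- B d1 w *\<^sub>R \<sigma>1 m) + q *\<^sub>R (- B d2 w *\<^sub>R \<sigma>2 m)"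
    by (simp add: blinfun.add_left blinfun.scaleR_left wedge_app)
  then show ?thesis
    by (simp only:) (intro subspace_add subspace_scale subspace_f sigma_mem)
qed

lemma \<zeta>_d1_nonzero: obtains Z k where "blinfun_apply (\<zeta> m Z) d1 = k *\<^sub>R \<sigma>1 m" "k \<noteq> 0"
proof -
  obtain Z where Z: "blinfun_apply (\<zeta> m Z) d1 \<noteq> 0"
    using \<zeta>_nondegenerate[OF frame_m dif_Y(3)] dif_Y(1,2) by auto
  obtain k where k: "blinfun_apply (\<zeta> m Z) d1 = k *\<^sub>R \<sigma>1 m" using \<zeta>_d1[of Z] .
  then show ?thesis using that Z by auto
qed

text \<open>By skewness 0 = (\<zeta> p1, d1) = - (p1, \<zeta> d1), and \<zeta> d1 is a non-zero
  multiple of \<sigma>1 for a suitable tangent vector.\<close>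

lemma p1_sigma1: "B (p1 m) (\<sigma>1 m) = 0"
proof -
  obtain Z k where k: "blinfun_apply (\<zeta> m Z) d1 = k *\<^sub>R \<sigma>1 m" "k \<noteq> 0" by (rule \<zeta>_d1_nonzero)
  have "B (p1 m) (k *\<^sub>R \<sigma>1 m) = 0"
    using \<zeta>_skew[of Z "p1 m" d1] \<zeta>_p1[of m Z] k(1) by (simp add: expand)
  then show ?thesis using k(2) by (simp add: expand)
qed

lemma p1_mem: "p1 m \<in> f m"
proof (rule mem_f_of_perp)
  have "B (p1 m) (\<sigma>1 m) = 0" "B (p1 m) (\<sigma>2 m) = 0"
    using p1_sigma1 conserved_frame.p1_sigma1[OF swap_conserved] by auto
  then show "p1 m \<in> perp B (f m)" unfolding perp_def f_m span_2 by (auto simp: expand)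
qed (simp add: p1_p1)

end

context conserved
begin

lemma conserved_frame_ex:
  obtains c \<sigma>1 \<sigma>2 X Y where "conserved_frame A B f s1 s2 c m \<sigma>1 \<sigma>2 X Y \<zeta> p1 qinf"
proof -
  obtain c \<sigma>1 \<sigma>2 X Y where "curvature_frame A B f s1 s2 c m \<sigma>1 \<sigma>2 X Y"
    using curvature_frame_ex[OF csb] .
  then have "conserved_frame A B f s1 s2 c m \<sigma>1 \<sigma>2 X Y \<zeta> p1 qinf"
    using conserved_axioms conserved_def legendre_axioms by (simp add: conserved_frame_def)
  then show ?thesis by (rule that)
qed

lemma p1_f: "p1 x \<in> f x"
proof -
  obtain c \<sigma>1 \<sigma>2 X Y where "conserved_frame A B f s1 s2 c x \<sigma>1 \<sigma>2 X Y \<zeta> p1 qinf"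
    by (rule conserved_frame_ex)
  then show ?thesis by (rule conserved_frame.p1_mem)
qed

lemma section_p1: "section_at p1 x"
  by (simp add: section_at_def p1_smooth p1_f)

lemma \<zeta>_perp_f: "w \<in> perp B (f x) \<Longrightarrow> blinfun_apply (\<zeta> x Z) w \<in> f x"
proof -
  assume w: "w \<in> perp B (f x)"
  obtain c \<sigma>1 \<sigma>2 X Y where "conserved_frame A B f s1 s2 c x \<sigma>1 \<sigma>2 X Y \<zeta> p1 qinf"
    by (rule conserved_frame_ex)
  then show ?thesis using w by (rule conserved_frame.\<zeta>_perp)
qed

lemma \<zeta>_skew_f: "B (blinfun_apply (\<zeta> x Z) u) w = - B u (blinfun_apply (\<zeta> x Z) w)"
proof -
  obtain c \<sigma>1 \<sigma>2 X Y where "conserved_frame A B f s1 s2 c x \<sigma>1 \<sigma>2 X Y \<zeta> p1 qinf"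
    by (rule conserved_frame_ex)
  then show ?thesis by (rule conserved_frame.\<zeta>_skew)
qed

lemma \<zeta>_linear: "linear (\<zeta> x)"
  using \<zeta>_smooth by (simp add: smooth_one_form_def)

definition zc :: "'m chart \<Rightarrow> real ^ 2 \<Rightarrow> 'm \<Rightarrow> ('v \<Rightarrow>\<^sub>L 'v)" where
  "zc c v y = \<zeta> y (coord_vec A c v y)"

lemma zc_smooth: "c \<in> A \<Longrightarrow> x \<in> fst c \<Longrightarrow> smooth_at A (zc c v) x"
  using \<zeta>_smooth admissible_open[OF admissible_atlas, of c]
  by (auto simp: smooth_one_form_def zc_def[abs_def] intro: smooth_atI)

lemmas smooth_at_apply = smooth_at_bilinear[OF bounded_bilinear_blinfun_apply]
lemmas pd_apply = pd_bilinear[OF bounded_bilinear_blinfun_apply]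

lemma pd_p1:
  assumes "c \<in> A" "x \<in> fst c" shows "pd c v p1 x = - blinfun_apply (zc c v x) qinf"
  using dif_coord_vec[OF p1_smooth admissible_atlas[OF assms(1)] assms(2)] dif_p1[of x]
  by (simp add: zc_def)

context
  fixes c m \<kappa> assumes c: "c \<in> A" "m \<in> fst c" and \<kappa>: "section_at \<kappa> m" "\<kappa> m = qinf"
begin

text \<open>Here \<kappa> is a section of f through qinf. Differentiating \<zeta> \<kappa> = 0
  expresses \<zeta>(d\<kappa>) at \<open>m\<close> by the derivative of \<zeta> applied to qinf,
  which up to sign is the second derivative of p1 because qinf is constant.\<close>

lemma hessian_p1: "pd c u (pd c v p1) m = blinfun_apply (zc c v m) (pd c u \<kappa> m)"
proof -
  note ac = admissible_atlas[OF c(1)]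
  note evc = eventually_chart[OF ac c(2)]
  have "eventually (\<lambda>y. blinfun_apply (zc c v y) (\<kappa> y) = 0) (nhds m)"
    using section_at_eventually[OF \<kappa>(1)]
    by eventually_elim (simp add: zc_def \<zeta>_f section_at_mem)
  from pd_zero_of_eventually[OF ac c(2) this, of u]
  have 1: "blinfun_apply (zc c v m) (pd c u \<kappa> m) = - blinfun_apply (pd c u (zc c v) m) qinf"
    using pd_apply[OF zc_smooth[OF c] section_at_smooth[OF \<kappa>(1)] ac c(2), of u v] \<kappa>(2)
    by (simp add: add_eq_0_iff)
  have "eventually (\<lambda>y. pd c v p1 y = - blinfun_apply (zc c v y) qinf) (nhds m)"
    using evc by eventually_elim (rule pd_p1[OF c(1)])
  then have "pd c u (pd c v p1) m = pd c u (\<lambda>y. - blinfun_apply (zc c v y) qinf) m"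
    by (rule pd_cong[OF _ ac c(2)])
  also have "\<dots> = - pd c u (\<lambda>y. blinfun_apply (zc c v y) qinf) m"
    by (intro pd_uminus smooth_at_apply zc_smooth smooth_at_const c ac)
  also have "pd c u (\<lambda>y. blinfun_apply (zc c v y) qinf) m = blinfun_apply (pd c u (zc c v) m) qinf"
    using pd_apply[OF zc_smooth[OF c] smooth_at_const ac c(2), of u v qinf] by (simp add: pd_const)
  finally show ?thesis using 1 by simp
qed

text \<open>If \<open>qinf\<close> lay in \<open>f m\<close>, then \<open>p1\<close> and \<open>dp1\<close> would vanish at \<open>m\<close>. The identity is obtained
  by differentiating \<open>(p1, d\<^sub>w d\<^sub>t \<sigma>) = - (d\<^sub>w p1, d\<^sub>t \<sigma>)\<close> twice at such a point.\<close>

lemma hessian_identity: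
  assumes p0: "p1 m = 0" and \<sigma>: "section_at \<sigma> m"
  shows "B (blinfun_apply (zc c v m) (pd c u \<kappa> m)) (pd c w (pd c t \<sigma>) m) =
    - B (blinfun_apply (zc c w m) (pd c t \<sigma> m)) (pd c v (pd c u \<kappa>) m)"
proof -
  note ac = admissible_atlas[OF c(1)]
  define \<psi> where "\<psi> y = blinfun_apply (zc c w y) (pd c t \<sigma> y)" for y
  have evc: "eventually (\<lambda>y. y \<in> fst c) (nhds m)" by (rule eventually_chart[OF ac c(2)])
  note s\<sigma> = section_at_smooth[OF \<sigma>]
  \<comment> \<open>A middle potential maps f^perp into f, and d_t \<sigma> has values in
    f^perp.\<close>
  have \<psi>: "section_at \<psi> m"
    unfolding section_at_def
  proof
    show "smooth_at A \<psi> m" unfolding \<psi>_def by (intro smooth_at_apply zc_smooth smooth_at_pd s\<sigma> ac c)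
    show "eventually (\<lambda>y. \<psi> y \<in> f y) (nhds m)"
      using section_at_eventually[OF \<sigma>] evc
      by eventually_elim (auto simp: \<psi>_def zc_def intro!: \<zeta>_perp_f pd_perp[OF ac])
  qed
  define D where "D = pd c w (pd c t \<sigma>)"
  have D: "smooth_at A D m" unfolding D_def by (intro smooth_at_pd s\<sigma> ac c)
  have main: "eventually (\<lambda>y. B (p1 y) (D y) + B qinf (\<psi> y) = 0) (nhds m)"
    using section_at_eventually[OF \<sigma>] evc
  proof eventually_elim
    case (elim y)
    have "B (p1 y) (D y) = - B (pd c w p1 y) (pd c t \<sigma> y)"
      unfolding D_def by (rule B_section_pd_pd[OF ac elim(2) section_p1 elim(1)])
    also have "\<dots> = - B qinf (\<psi> y)"
      unfolding pd_p1[OF c(1) elim(2)] \<psi>_def using \<zeta>_skew_f[of y _ qinf] by (simp add: zc_def expand)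
    finally show ?case by simp
  qed
  have dp0: "pd c v p1 m = 0" for v
    using pd_p1[OF c] \<zeta>_f[of qinf m] section_at_mem[OF \<kappa>(1)] \<kappa>(2) by (simp add: zc_def)
  note sp1 = p1_smooth and s\<psi> = section_at_smooth[OF \<psi>]
  have "eventually (\<lambda>y. B (p1 y) (pd c v D y) + B (pd c v p1 y) (D y) + B qinf (pd c v \<psi> y) = 0) (nhds m)"
    using eventually_eventually[THEN iffD2, OF main] evc smooth_at_eventually[OF D] smooth_at_eventually[OF s\<psi>]
  proof eventually_elim
    case (elim y)
    have "0 = pd c v (\<lambda>y. B (p1 y) (D y) + B qinf (\<psi> y)) y"
      by (rule pd_zero_of_eventually[OF ac elim(2,1), symmetric])
    also have "\<dots> = pd c v (\<lambda>y. B (p1 y) (D y)) y + pd c v (\<lambda>y. B qinf (\<psi> y)) y"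
      by (intro pd_add smooth_at_B sp1 smooth_at_const elim ac)
    finally show ?case
      using pd_B[OF sp1 elim(3) ac elim(2), of v] pd_B[OF smooth_at_const elim(4) ac elim(2), of v qinf]
      by (simp add: pd_const expand)
  qed
  from pd_zero_of_eventually[OF ac c(2) this, of u]
  have "0 = pd c u (\<lambda>y. B (p1 y) (pd c v D y) + B (pd c v p1 y) (D y) + B qinf (pd c v \<psi> y)) m" by simp
  also have "\<dots> = pd c u (\<lambda>y. B (p1 y) (pd c v D y)) m + pd c u (\<lambda>y. B (pd c v p1 y) (D y)) m
      + pd c u (\<lambda>y. B qinf (pd c v \<psi> y)) m"
    using smooth_at_B[OF sp1 smooth_at_pd[OF D ac c(2), of v]] smooth_at_B[OF smooth_at_pd[OF sp1 ac c(2), of v] D]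
      smooth_at_B[OF smooth_at_const smooth_at_pd[OF s\<psi> ac c(2), of v], of qinf]
    by (simp add: pd_add[OF smooth_at_add _ ac c(2)] pd_add[OF _ _ ac c(2)])
  also have "\<dots> = B (pd c u (pd c v p1) m) (D m) + B qinf (pd c u (pd c v \<psi>) m)"
    using pd_B[OF sp1 smooth_at_pd[OF D ac c(2), of v] ac c(2), of u]
      pd_B[OF smooth_at_pd[OF sp1 ac c(2), of v] D ac c(2), of u]
      pd_B[OF smooth_at_const smooth_at_pd[OF s\<psi> ac c(2), of v] ac c(2), of u qinf]
    by (simp add: pd_const expand p0 dp0)
  \<comment> \<open>Both sides are - (d_u \<kappa>, d_v \<psi>), since \<kappa> and \<psi> are
    sections of f and \<kappa> equals qinf at \<open>m\<close>.\<close>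
  also have "B qinf (pd c u (pd c v \<psi>) m) = B (\<psi> m) (pd c v (pd c u \<kappa>) m)"
    using B_section_pd_pd[OF ac c(2) \<kappa>(1) \<psi>, of u v] B_section_pd_pd[OF ac c(2) \<psi> \<kappa>(1), of v u]
      \<kappa>(2) sym[of "pd c u \<kappa> m"] by simp
  finally show ?thesis unfolding hessian_p1 D_def \<psi>_def by simp
qed

end

end

section \<open>The vector \<open>qinf\<close> lies in no contact element\<close>

context conserved_frame
begin

lemma pd_lincomb:
  "pd c v (\<lambda>y. k1 *\<^sub>R \<sigma>1 y + k2 *\<^sub>R \<sigma>2 y) m = k1 *\<^sub>R pd c v \<sigma>1 m + k2 *\<^sub>R pd c v \<sigma>2 m"
  using \<sigma>1 \<sigma>2 ac c(2)
  by (simp add: section_at_def pd_add pd_scaleR pd_const smooth_at_scaleR smooth_at_const)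

text \<open>If qinf is in f, then dp1 = - \<zeta> qinf vanishes at \<open>m\<close>. By tensoriality
  the combination of derivatives with the coefficients of p1 then lies in f along every direction;
  testing along \<open>Y\<close> against \<open>d1\<close> and along \<open>X\<close> against
  \<open>d2\<close> makes both coefficients zero.\<close>

lemma p1_zero_of_qinf:
  assumes "qinf \<in> f m" shows "p1 m = 0"
proof -
  have dp0: "pd c v p1 m = 0" for v
    using pd_p1[OF c] \<zeta>_f[OF assms] by (simp add: zc_def)
  have "p1 m \<in> span {\<sigma>1 m, \<sigma>2 m}" using p1_mem f_m by simp
  then obtain p q where pq: "p1 m = p *\<^sub>R \<sigma>1 m + q *\<^sub>R \<sigma>2 m" unfolding span_2 by auto
  have d: "p *\<^sub>R pd c v \<sigma>1 m + q *\<^sub>R pd c v \<sigma>2 m \<in> f m" for v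
    using subspace_neg[OF subspace_f pd_section_lincomb[OF ac c(2) section_p1 \<sigma>1 \<sigma>2 pq, of v]]
    unfolding dp0 by (simp add: add.commute)
  have "B d1 (p *\<^sub>R d1 + q *\<^sub>R pd c (Y m) \<sigma>2 m) = 0"
    using perpD[OF d1_perp d[of "Y m"]] by (simp add: d1_def)
  moreover have "B d2 (p *\<^sub>R pd c (X m) \<sigma>1 m + q *\<^sub>R d2) = 0"
    using perpD[OF d2_perp d[of "X m"]] by (simp add: d2_def)
  ultimately have "p = 0" "q = 0"
    using perpD[OF d1_perp dY] perpD[OF d2_perp dX] d1_pos d2_pos by (simp_all add: expand)
  then show ?thesis using pq by simp
qed

text \<open>If \<open>k1\<close> were not 0, then \<zeta> d1 would vanish along both curvature
  directions, contradicting \<open>\<zeta>_d1_nonzero\<close>. Along \<open>X\<close> this comes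
  from the symmetry of the second derivative of p1, along \<open>Y\<close> from
  \<open>hessian_identity\<close>.\<close>

lemma qinf_coefficient:
  assumes q: "qinf = k1 *\<^sub>R \<sigma>1 m + k2 *\<^sub>R \<sigma>2 m" shows "k1 = 0"
proof (rule ccontr)
  assume k1: "k1 \<noteq> 0"
  define \<kappa> where "\<kappa> y = k1 *\<^sub>R \<sigma>1 y + k2 *\<^sub>R \<sigma>2 y" for y
  have \<kappa>: "section_at \<kappa> m" "\<kappa> m = qinf"
    using section_at_lincomb[OF \<sigma>1 \<sigma>2] q by (simp_all add: \<kappa>_def[abs_def])
  have "qinf \<in> f m" using section_at_mem[OF \<kappa>(1)] \<kappa>(2) by simp
  note p0 = p1_zero_of_qinf[OF this]
  have dYk: "pd c (Y m) \<kappa> m = k1 *\<^sub>R d1 + k2 *\<^sub>R pd c (Y m) \<sigma>2 m"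
    and dXk: "pd c (X m) \<kappa> m = k1 *\<^sub>R pd c (X m) \<sigma>1 m + k2 *\<^sub>R d2"
    using pd_lincomb by (simp_all add: \<kappa>_def[abs_def] d1_def d2_def)
  have zY: "blinfun_apply (zc c v m) (pd c (Y m) \<kappa> m) = k1 *\<^sub>R blinfun_apply (zc c v m) d1"
    and zX: "blinfun_apply (zc c v m) (pd c (X m) \<kappa> m) = k2 *\<^sub>R blinfun_apply (zc c v m) d2" for v
    unfolding dYk dXk using \<zeta>_f[OF dY] \<zeta>_f[OF dX]
    by (simp_all add: zc_def blinfun.add_right blinfun.scaleR_right)
  obtain a1 where a1: "blinfun_apply (zc c (X m) m) d1 = a1 *\<^sub>R \<sigma>1 m"
    unfolding zc_def by (rule \<zeta>_d1)
  obtain a2 where a2: "blinfun_apply (zc c (Y m) m) d1 = a2 *\<^sub>R \<sigma>1 m"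
    unfolding zc_def by (rule \<zeta>_d1)
  obtain b2 where b2: "blinfun_apply (zc c (Y m) m) d2 = b2 *\<^sub>R \<sigma>2 m"
    unfolding zc_def by (rule conserved_frame.\<zeta>_d1[OF swap_conserved, unfolded curvature_frame.d1_def[OF swap] d2_def[symmetric]])
  \<comment> \<open>Symmetry of the second derivative of p1. The left side is a multiple of
    \<sigma>1 and the right side one of \<sigma>2, so both vanish.\<close>
  have "blinfun_apply (zc c (X m) m) (pd c (Y m) \<kappa> m) = blinfun_apply (zc c (Y m) m) (pd c (X m) \<kappa> m)"
    using hessian_p1[OF c \<kappa>, of "Y m" "X m"] hessian_p1[OF c \<kappa>, of "X m" "Y m"]
      pd_commute[OF p1_smooth ac c(2), of "X m" "Y m"] by simp
  then have "(k1 * a1) *\<^sub>R \<sigma>1 m + (- (k2 * b2)) *\<^sub>R \<sigma>2 m = 0"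
    unfolding zY zX a1 b2 by simp
  from frame_at_independent[OF frame_m this] have a1z: "a1 = 0" using k1 by simp
  have "B (\<sigma>1 m) (pd c (Y m) (pd c (Y m) \<kappa>) m) = - (k1 * B d1 d1)"
    using B_section_pd_pd[OF ac c(2) \<sigma>1 \<kappa>(1), of "Y m" "Y m"] perpD[OF d1_perp dY]
    unfolding dYk by (simp add: d1_def[symmetric] expand)
  \<comment> \<open>With \<sigma> = \<kappa> and all four directions equal to \<open>Y m\<close> the
    identity states that a number is its own negative.\<close>
  moreover have "B (blinfun_apply (zc c (Y m) m) (pd c (Y m) \<kappa> m)) (pd c (Y m) (pd c (Y m) \<kappa>) m) = 0"
    using hessian_identity[OF c \<kappa> p0 \<kappa>(1), of "Y m" "Y m" "Y m" "Y m"] by simp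
  ultimately have "k1 * a2 * (k1 * B d1 d1) = 0"
    unfolding zY a2 by (simp add: expand)
  then have a2z: "a2 = 0" using k1 d1_pos by simp
  obtain Z k where Z: "blinfun_apply (\<zeta> m Z) d1 = k *\<^sub>R \<sigma>1 m" "k \<noteq> 0" by (rule \<zeta>_d1_nonzero)
  obtain p q where "Z = p *\<^sub>R coord_vec A c (X m) m + q *\<^sub>R coord_vec A c (Y m) m"
    by (rule tangent_decomposition)
  then have "\<zeta> m Z = p *\<^sub>R zc c (X m) m + q *\<^sub>R zc c (Y m) m"
    by (simp add: linear_add[OF \<zeta>_linear] linear_cmul[OF \<zeta>_linear] zc_def)
  then have "blinfun_apply (\<zeta> m Z) d1 = 0"
    using a1 a2 a1z a2z by (simp add: blinfun.add_left blinfun.scaleR_left)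
  then show False using Z frame_m by (simp add: frame_at_def)
qed

end

lemma (in conserved) qinf_not_mem: "qinf \<notin> f m"
proof
  assume q: "qinf \<in> f m"
  obtain c \<sigma>1 \<sigma>2 X Y where F: "conserved_frame A B f s1 s2 c m \<sigma>1 \<sigma>2 X Y \<zeta> p1 qinf"
    by (rule conserved_frame_ex)
  have CF: "curvature_frame A B f s1 s2 c m \<sigma>1 \<sigma>2 X Y" using F by (simp add: conserved_frame_def)
  have "qinf \<in> span {\<sigma>1 m, \<sigma>2 m}" using q unfolding curvature_frame.f_m[OF CF] .
  then obtain k1 k2 where k: "qinf = k1 *\<^sub>R \<sigma>1 m + k2 *\<^sub>R \<sigma>2 m" unfolding span_2 by auto
  have "k1 = 0" using conserved_frame.qinf_coefficient[OF F k] .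
  moreover have "k2 = 0"
    using conserved_frame.qinf_coefficient[OF conserved_frame.swap_conserved[OF F], of k2 k1] k by (simp add: add.commute)
  ultimately show False using k qinf by simp
qed

section \<open>Gauge potentials\<close>

lemma linear_vec2:
  assumes "linear L" shows "L (w :: real ^ 2) = w $ 1 *\<^sub>R L (axis 1 1) + w $ 2 *\<^sub>R L (axis 2 1)"
proof -
  have "w = w $ 1 *\<^sub>R axis 1 1 + w $ 2 *\<^sub>R axis 2 1"
    by (simp add: vec_eq_iff forall_2 axis_def)
  then have "L w = L (w $ 1 *\<^sub>R axis 1 1 + w $ 2 *\<^sub>R axis 2 1)" by (rule arg_cong)
  then show ?thesis by (simp add: linear_add[OF assms] linear_cmul[OF assms])
qed

context surface
begin

lemma coord_vec_change:
  assumes "admissible_chart A c" "admissible_chart A c'" "y \<in> fst c" "y \<in> fst c'"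
  shows "coord_vec A c v y = coord_vec A c' (pd c v (snd c') y) y"
  using coord_vec_dif_snd[OF assms(2,4), of "coord_vec A c v y"]
    dif_coord_vec[OF smooth_at_snd_chart[OF assms(2,4)] assms(1,3)] by simp

text \<open>Closedness of a form on a surface is one equation in one chart. The components in
  \<open>c\<close> are combinations of those in \<open>c'\<close> whose coefficients are first
  derivatives of the transition map, so the additional Leibniz terms are symmetric. This carries
  equations found in a conformal chart to the charts of \<open>A\<close> and back.\<close>

lemma closed_change_chart:
  fixes \<omega> :: "'m \<Rightarrow> real ^ 2 \<Rightarrow> 'w::real_normed_vector"
  assumes l: "\<And>y. linear (\<omega> y)"
    and c: "admissible_chart A c" "x \<in> fst c" and c': "admissible_chart A c'" "x \<in> fst c'"
    and sm: "\<And>v. smooth_at A (\<lambda>y. \<omega> y (coord_vec A c' v y)) x"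
    and cl: "pd c' (axis 1 1) (\<lambda>y. \<omega> y (coord_vec A c' (axis 2 1) y)) x =
      pd c' (axis 2 1) (\<lambda>y. \<omega> y (coord_vec A c' (axis 1 1) y)) x"
  shows "pd c v (\<lambda>y. \<omega> y (coord_vec A c w y)) x = pd c w (\<lambda>y. \<omega> y (coord_vec A c v y)) x"
proof -
  define a where "a v i y = pd c v (snd c') y $ i" for v i y
  define \<omega>1 where "\<omega>1 y = \<omega> y (coord_vec A c' (axis 1 1) y)" for y
  define \<omega>2 where "\<omega>2 y = \<omega> y (coord_vec A c' (axis 2 1) y)" for y
  note s1 = sm[of "axis 1 1", folded \<omega>1_def] and s2 = sm[of "axis 2 1", folded \<omega>2_def]
  have sc: "smooth_at A (snd c') x" by (rule smooth_at_snd_chart[OF c'])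
  have sa: "smooth_at A (a v i) x" for v i
    unfolding a_def[abs_def] by (intro smooth_at_vec_nth smooth_at_pd sc c)
  have ev: "eventually (\<lambda>y. \<omega> y (coord_vec A c v y) = a v 1 y *\<^sub>R \<omega>1 y + a v 2 y *\<^sub>R \<omega>2 y) (nhds x)" for v
    using eventually_chart[OF c] eventually_chart[OF c']
  proof eventually_elim
    case (elim y)
    have "linear (\<lambda>v. \<omega> y (coord_vec A c' v y))"
      using linear_compose[OF coord_vec_linear[OF c'(1) elim(2)] l[of y]] by (simp add: o_def)
    from linear_vec2[OF this, of "pd c v (snd c') y"] show ?case
      using coord_vec_change[OF c(1) c'(1) elim] by (simp add: a_def \<omega>1_def \<omega>2_def)
  qed
  \<comment> \<open>Symmetry of the second derivatives of the transition map.\<close>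
  have da: "pd c w (a v i) x = pd c v (a w i) x" for v w i
    using pd_bounded_linear[OF bounded_linear_vec_nth[of i] smooth_at_pd[OF sc c] c, of w v]
      pd_bounded_linear[OF bounded_linear_vec_nth[of i] smooth_at_pd[OF sc c] c, of v w]
      pd_commute[OF sc c, of v w] by (simp add: a_def[abs_def])
  have dg: "pd c w g x = a w 1 x *\<^sub>R pd c' (axis 1 1) g x + a w 2 x *\<^sub>R pd c' (axis 2 1) g x"
    if "smooth_at A g x" for w and g :: "'m \<Rightarrow> 'w"
    using pd_chain[OF that c c', of w] linear_vec2[OF pd_linear[OF that c'], of "pd c w (snd c') x"]
    by (simp add: a_def)
  have main: "pd c w (\<lambda>y. \<omega> y (coord_vec A c v y)) x =
    a v 1 x *\<^sub>R (a w 1 x *\<^sub>R pd c' (axis 1 1) \<omega>1 x + a w 2 x *\<^sub>R pd c' (axis 2 1) \<omega>1 x) + pd c w (a v 1) x *\<^sub>R \<omega>1 x +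
    (a v 2 x *\<^sub>R (a w 1 x *\<^sub>R pd c' (axis 1 1) \<omega>2 x + a w 2 x *\<^sub>R pd c' (axis 2 1) \<omega>2 x) + pd c w (a v 2) x *\<^sub>R \<omega>2 x)"
    for v w
  proof -
    have "pd c w (\<lambda>y. \<omega> y (coord_vec A c v y)) x = pd c w (\<lambda>y. a v 1 y *\<^sub>R \<omega>1 y + a v 2 y *\<^sub>R \<omega>2 y) x"
      by (rule pd_cong[OF ev c])
    also have "\<dots> = a v 1 x *\<^sub>R pd c w \<omega>1 x + pd c w (a v 1) x *\<^sub>R \<omega>1 x +
       (a v 2 x *\<^sub>R pd c w \<omega>2 x + pd c w (a v 2) x *\<^sub>R \<omega>2 x)"
      using pd_add[OF smooth_at_scaleR[OF sa s1] smooth_at_scaleR[OF sa s2] c]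
        pd_scaleR[OF sa s1 c] pd_scaleR[OF sa s2 c] by simp
    finally show ?thesis unfolding dg[OF s1] dg[OF s2] .
  qed
  show ?thesis
    unfolding main da[of w v] cl[folded \<omega>1_def \<omega>2_def]
    by (simp add: algebra_simps)
qed

lemma closed_one_form_iff:
  fixes \<omega> :: "'m \<Rightarrow> real ^ 2 \<Rightarrow> 'w::real_normed_vector"
  assumes "\<And>c x v. c \<in> A \<Longrightarrow> x \<in> fst c \<Longrightarrow> smooth_at A (\<lambda>y. \<omega> y (coord_vec A c v y)) x"
  shows "closed_one_form A \<omega> \<longleftrightarrow> (\<forall>c\<in>A. \<forall>x\<in>fst c. \<forall>v w.
     pd c v (\<lambda>y. \<omega> y (coord_vec A c w y)) x = pd c w (\<lambda>y. \<omega> y (coord_vec A c v y)) x)"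
  unfolding closed_one_form_def
  using dif_coord_vec[OF assms admissible_atlas] by (intro ball_cong all_cong refl) simp

lemma smooth_one_form_iff:
  "smooth_one_form A \<omega> \<longleftrightarrow> (\<forall>x. linear (\<omega> x)) \<and>
    (\<forall>c\<in>A. \<forall>x\<in>fst c. \<forall>v. smooth_at A (\<lambda>y. \<omega> y (coord_vec A c v y)) x)"
proof -
  have "(\<forall>v. smooth_map A (fst c) (\<lambda>x. \<omega> x (coord_vec A c v x))) \<longleftrightarrow>
      (\<forall>x\<in>fst c. \<forall>v. smooth_at A (\<lambda>y. \<omega> y (coord_vec A c v y)) x)" if "c \<in> A" for c
    unfolding smooth_map_iff_smooth_at[OF admissible_open[OF admissible_atlas[OF that]]] by auto
  then show ?thesis unfolding smooth_one_form_def by (intro conj_cong refl ball_cong)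
qed

lemma smooth_at_coord_change:
  fixes \<omega> :: "'m \<Rightarrow> real ^ 2 \<Rightarrow> 'w::real_normed_vector"
  assumes l: "\<And>y. linear (\<omega> y)"
    and c: "admissible_chart A c" "x \<in> fst c" and c': "admissible_chart A c'" "x \<in> fst c'"
    and sm: "\<And>v. smooth_at A (\<lambda>y. \<omega> y (coord_vec A c' v y)) x"
  shows "smooth_at A (\<lambda>y. \<omega> y (coord_vec A c v y)) x"
proof -
  have "eventually (\<lambda>y. \<omega> y (coord_vec A c v y) =
     (pd c v (snd c') y $ 1) *\<^sub>R \<omega> y (coord_vec A c' (axis 1 1) y) +
     (pd c v (snd c') y $ 2) *\<^sub>R \<omega> y (coord_vec A c' (axis 2 1) y)) (nhds x)"
    using eventually_chart[OF c] eventually_chart[OF c']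
  proof eventually_elim
    case (elim y)
    have "linear (\<lambda>v. \<omega> y (coord_vec A c' v y))"
      using linear_compose[OF coord_vec_linear[OF c'(1) elim(2)] l[of y]] by (simp add: o_def)
    from linear_vec2[OF this, of "pd c v (snd c') y"] show ?case
      using coord_vec_change[OF c(1) c'(1) elim] by simp
  qed
  moreover have "smooth_at A (\<lambda>y. (pd c v (snd c') y $ 1) *\<^sub>R \<omega> y (coord_vec A c' (axis 1 1) y) +
     (pd c v (snd c') y $ 2) *\<^sub>R \<omega> y (coord_vec A c' (axis 2 1) y)) x"
    by (intro smooth_at_add smooth_at_scaleR smooth_at_vec_nth smooth_at_pd smooth_at_snd_chart c c' sm)
  ultimately show ?thesis by (simp add: smooth_at_cong)
qed

lemma smooth_at_apply: "smooth_at A T x \<Longrightarrow> smooth_at A g x \<Longrightarrow> smooth_at A (\<lambda>y. blinfun_apply (T y) (g y)) x"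
  by (rule smooth_at_bilinear[OF bounded_bilinear_blinfun_apply])

lemma pd_apply:
  assumes "smooth_at A T x" "smooth_at A g x" "admissible_chart A c" "x \<in> fst c"
  shows "pd c v (\<lambda>y. blinfun_apply (T y) (g y)) x =
    blinfun_apply (T x) (pd c v g x) + blinfun_apply (pd c v T x) (g x)"
  by (rule pd_bilinear[OF bounded_bilinear_blinfun_apply assms])

lemma pd_apply_const:
  assumes "smooth_at A T x" "admissible_chart A c" "x \<in> fst c"
  shows "pd c v (\<lambda>y. blinfun_apply (T y) u) x = blinfun_apply (pd c v T x) u"
  using pd_apply[OF assms(1) smooth_at_const assms(2,3)] by (simp add: pd_const)

end

lemma (in lie_form) wedge_space_kills:
  assumes "\<alpha> \<in> wedge_space B V W" "\<And>v. v \<in> V \<Longrightarrow> B v u = 0" "\<And>w. w \<in> W \<Longrightarrow> B w u = 0"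
  shows "blinfun_apply \<alpha> u = 0"
  using assms(1) unfolding wedge_space_def
  by (induction rule: span_induct_alt)
    (auto simp: blinfun.zero_left blinfun.add_left blinfun.scaleR_left wedge_app assms(2,3))

context legendre
begin

lemma section_through:
  assumes "v \<in> f x" obtains \<sigma> where "section_at \<sigma> x" "\<sigma> x = v"
proof -
  have "\<exists>U t. open U \<and> x \<in> U \<and> (\<forall>i<2. smooth_map A U (t i)) \<and>
        (\<forall>y\<in>U. f y = span ((\<lambda>i. t i y) ` {..<2::nat}))"
    using legendre unfolding legendre_map_def subbundle_def by simp
  then obtain U t where U: "open U" "x \<in> U" "\<forall>i<2. smooth_map A U (t i)"
    "\<forall>y\<in>U. f y = span ((\<lambda>i. t i y) ` {..<2::nat})" by auto
  have fy: "f y = span {t 0 y, t 1 y}" if "y \<in> U" for y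
    using U(4) that by (simp add: lessThan_Suc numeral_2_eq_2 insert_commute)
  have sec: "section_at (t i) x" if "i < 2" for i
    unfolding section_at_def
  proof
    show "smooth_at A (t i) x" using U that by (auto intro: smooth_atI)
    show "eventually (\<lambda>y. t i y \<in> f y) (nhds x)"
      using eventually_nhds_in_open[OF U(1,2)]
    proof eventually_elim
      case (elim y)
      then show ?case using that U(4) by (auto intro: span_base)
    qed
  qed
  have "v \<in> span {t 0 x, t 1 x}" using assms fy[OF U(2)] by simp
  then obtain p q where "v = p *\<^sub>R t 0 x + q *\<^sub>R t 1 x" unfolding span_2 by auto
  then show ?thesis
    using that[of "\<lambda>y. p *\<^sub>R t 0 y + q *\<^sub>R t 1 y"] section_at_lincomb[OF sec[of 0] sec[of 1], of p q] by simp
qed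

text \<open>Derivatives of two sections with the same value differ by a vector of f, which \<eta>
  kills. The trace can therefore be computed from any pair of spanning sections, whatever sections
  the definition selects.\<close>

lemma gauge_quadratic_eq:
  assumes kills: "\<And>v. v \<in> f x \<Longrightarrow> blinfun_apply (\<eta> x Z) v = 0"
    and \<sigma>: "section_at \<sigma>1 x" "section_at \<sigma>2 x" "f x = span {\<sigma>1 x, \<sigma>2 x}"
    and T: "blinfun_apply (\<eta> x Z) (dif A \<sigma>1 x Y) = t11 *\<^sub>R \<sigma>1 x + t12 *\<^sub>R \<sigma>2 x"
      "blinfun_apply (\<eta> x Z) (dif A \<sigma>2 x Y) = t21 *\<^sub>R \<sigma>1 x + t22 *\<^sub>R \<sigma>2 x"
  shows "gauge_quadratic A f \<eta> x Z Y = t11 + t22"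
proof -
  define T where "T v = blinfun_apply (\<eta> x Z) (dif A (SOME \<sigma>. \<sigma> \<in> local_sections A f x \<and> \<sigma> x = v) x Y)" for v
  have lin: "T (p *\<^sub>R \<sigma>1 x + q *\<^sub>R \<sigma>2 x) =
    p *\<^sub>R blinfun_apply (\<eta> x Z) (dif A \<sigma>1 x Y) + q *\<^sub>R blinfun_apply (\<eta> x Z) (dif A \<sigma>2 x Y)" for p q
  proof -
    define v where "v = p *\<^sub>R \<sigma>1 x + q *\<^sub>R \<sigma>2 x"
    have "\<exists>\<sigma>. \<sigma> \<in> local_sections A f x \<and> \<sigma> x = v"
      using section_at_lincomb[OF \<sigma>(1,2), of p q] unfolding section_at_iff v_def by (intro exI[of _ "\<lambda>y. p *\<^sub>R \<sigma>1 y + q *\<^sub>R \<sigma>2 y"]) simp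
    from someI_ex[OF this] obtain \<sigma> where s: "\<sigma> = (SOME \<sigma>. \<sigma> \<in> local_sections A f x \<and> \<sigma> x = v)"
      "section_at \<sigma> x" "\<sigma> x = p *\<^sub>R \<sigma>1 x + q *\<^sub>R \<sigma>2 x" by (simp add: section_at_iff v_def)
    have "blinfun_apply (\<eta> x Z) (dif A \<sigma> x Y - (p *\<^sub>R dif A \<sigma>1 x Y + q *\<^sub>R dif A \<sigma>2 x Y)) = 0"
      by (rule kills[OF dif_section_lincomb[OF s(2) \<sigma>(1,2) s(3)]])
    then show ?thesis
      unfolding T_def s(1)[unfolded v_def, symmetric]
      by (simp add: blinfun.diff_right blinfun.add_right blinfun.scaleR_right)
  qed
  have T1: "T (\<sigma>1 x) = t11 *\<^sub>R \<sigma>1 x + t12 *\<^sub>R \<sigma>2 x" using lin[of 1 0] T by simp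
  have T2: "T (\<sigma>2 x) = t21 *\<^sub>R \<sigma>1 x + t22 *\<^sub>R \<sigma>2 x" using lin[of 0 1] T by simp
  have "trace_on (f x) T = t11 + t22"
  proof (rule trace_on_plane[OF \<sigma>(3) dim_f _ T1 T2])
    show "T (p *\<^sub>R \<sigma>1 x + q *\<^sub>R \<sigma>2 x) = p *\<^sub>R T (\<sigma>1 x) + q *\<^sub>R T (\<sigma>2 x)" for p q
      unfolding lin T1 T2 T ..
  qed
  then show ?thesis by (simp add: gauge_quadratic_def T_def[abs_def])
qed

end

locale gauge = legendre A B f
  for A :: "'m::{t2_space, second_countable_topology} chart set"
    and B :: "'v::euclidean_space \<Rightarrow> 'v \<Rightarrow> real" and f :: "'m \<Rightarrow> 'v set" +
  fixes \<eta> :: "'m \<Rightarrow> real ^ 2 \<Rightarrow> ('v \<Rightarrow>\<^sub>L 'v)" and \<tau> :: "'m \<Rightarrow> ('v \<Rightarrow>\<^sub>L 'v)"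
  assumes Omega: "Omega_surface A B f \<eta>"
    and \<tau>: "\<tau> \<in> sections A (\<lambda>x. wedge_space B (f x) (f x)) UNIV"
begin

lemma \<eta>_smooth: "smooth_one_form A \<eta>" and \<eta>_closed: "closed_one_form A \<eta>"
  and \<eta>_wedge: "\<eta> x X \<in> wedge_space B (f x) (perp B (f x))"
  using Omega by (simp_all add: Omega_surface_def gauge_potential_def)

lemma \<tau>_smooth: "smooth_at A \<tau> x" and \<tau>_wedge: "\<tau> x \<in> wedge_space B (f x) (f x)"
  using \<tau> by (auto simp: sections_def intro: smooth_atI[of UNIV])

lemma \<eta>_f: "v \<in> f x \<Longrightarrow> blinfun_apply (\<eta> x X) v = 0"
  by (rule wedge_space_kills[OF \<eta>_wedge]) (auto intro: isotropic perpD)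

lemma \<tau>_perp: "v \<in> perp B (f x) \<Longrightarrow> blinfun_apply (\<tau> x) v = 0"
  by (rule wedge_space_kills[OF \<tau>_wedge]) (auto intro: perpD')

text \<open>Differentiate \<tau> \<sigma> = 0 for a section \<sigma> through \<open>v\<close>; the
  derivative of \<sigma> lies in f^perp, which \<tau> kills.\<close>

lemma d\<tau>_f: assumes "v \<in> f x" shows "blinfun_apply (dif A \<tau> x X) v = 0"
proof -
  obtain \<sigma> where \<sigma>: "section_at \<sigma> x" "\<sigma> x = v" using section_through[OF assms] .
  note ac = admissible_chart_at and cx = chart_at(2)
  have "eventually (\<lambda>y. blinfun_apply (\<tau> y) (\<sigma> y) = 0) (nhds x)"
    using section_at_eventually[OF \<sigma>(1)] by eventually_elim (intro \<tau>_perp f_subset_perp section_at_mem)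
  from pd_zero_of_eventually[OF ac cx this]
  have "blinfun_apply (pd (chart_at A x) X \<tau> x) v = 0"
    using pd_apply[OF \<tau>_smooth section_at_smooth[OF \<sigma>(1)] ac cx, of X] \<sigma>(2)
      \<tau>_perp[OF pd_perp[OF ac cx \<sigma>(1)]] by simp
  then show ?thesis by (simp add: dif_eq_pd)
qed

definition \<zeta> where "\<zeta> x X = \<eta> x X - dif A \<tau> x X"

lemma \<zeta>_f: "v \<in> f x \<Longrightarrow> blinfun_apply (\<zeta> x X) v = 0"
  by (simp add: \<zeta>_def blinfun.diff_left \<eta>_f d\<tau>_f)

lemma \<eta>_coord_smooth: "c \<in> A \<Longrightarrow> x \<in> fst c \<Longrightarrow> smooth_at A (\<lambda>y. \<eta> y (coord_vec A c v y)) x"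
  using \<eta>_smooth by (simp add: smooth_one_form_iff)

lemma \<tau>_coord:
  "c \<in> A \<Longrightarrow> x \<in> fst c \<Longrightarrow> eventually (\<lambda>y. pd c v \<tau> y = dif A \<tau> y (coord_vec A c v y)) (nhds x)"
  using eventually_chart[OF admissible_atlas, of c x]
  by (auto elim!: eventually_mono simp: dif_coord_vec[OF \<tau>_smooth admissible_atlas])

lemma \<tau>_coord_smooth:
  assumes "c \<in> A" "x \<in> fst c" shows "smooth_at A (\<lambda>y. dif A \<tau> y (coord_vec A c v y)) x"
  using smooth_at_cong[OF \<tau>_coord[OF assms, of v]] smooth_at_pd[OF \<tau>_smooth admissible_atlas[OF assms(1)] assms(2)]
  by simp

lemma \<zeta>_smooth: "smooth_one_form A \<zeta>"
  unfolding smooth_one_form_iff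
proof (intro conjI allI ballI)
  show "linear (\<zeta> x)" for x
    unfolding \<zeta>_def[abs_def] using \<eta>_smooth dif_linear[OF \<tau>_smooth, of x]
    by (intro linear_compose_sub) (auto simp: smooth_one_form_def)
  show "smooth_at A (\<lambda>y. \<zeta> y (coord_vec A c v y)) x" if "c \<in> A" "x \<in> fst c" for c x v
    unfolding \<zeta>_def by (intro smooth_at_diff \<eta>_coord_smooth \<tau>_coord_smooth that)
qed

text \<open>Applied to a fixed vector \<open>u\<close>, the potential is the closed form \<eta> u
  minus the exact form d(\<tau> u). Evaluation at \<open>u\<close> makes the values Euclidean
  vectors, to which \<open>pd_commute\<close> applies.\<close>

lemma \<zeta>_closed: "closed_one_form A (\<lambda>x X. blinfun_apply (\<zeta> x X) u)"
proof -
  have sm: "smooth_at A (\<lambda>y. blinfun_apply (\<zeta> y (coord_vec A c v y)) u) x" if "c \<in> A" "x \<in> fst c" for c x v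
    using \<zeta>_smooth that by (intro smooth_at_apply smooth_at_const) (simp add: smooth_one_form_iff)
  show ?thesis
  proof (subst closed_one_form_iff, erule sm, assumption, intro ballI allI)
    fix c x v w assume c: "c \<in> A" "x \<in> fst c"
    note ac = admissible_atlas[OF c(1)]
    have e: "pd c v (\<lambda>y. blinfun_apply (\<zeta> y (coord_vec A c w y)) u) x =
        blinfun_apply (pd c v (\<lambda>y. \<eta> y (coord_vec A c w y)) x) u - pd c v (pd c w (\<lambda>y. blinfun_apply (\<tau> y) u)) x"
      for v w
    proof -
      have "eventually (\<lambda>y. blinfun_apply (\<zeta> y (coord_vec A c w y)) u =
          blinfun_apply (\<eta> y (coord_vec A c w y)) u - pd c w (\<lambda>y. blinfun_apply (\<tau> y) u) y) (nhds x)"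
        using \<tau>_coord[OF c, of w] eventually_chart[OF ac c(2)]
        by eventually_elim (simp add: \<zeta>_def blinfun.diff_left pd_apply_const[OF \<tau>_smooth ac])
      then have "pd c v (\<lambda>y. blinfun_apply (\<zeta> y (coord_vec A c w y)) u) x =
        pd c v (\<lambda>y. blinfun_apply (\<eta> y (coord_vec A c w y)) u - pd c w (\<lambda>y. blinfun_apply (\<tau> y) u) y) x"
        by (rule pd_cong[OF _ ac c(2)])
      also have "\<dots> = pd c v (\<lambda>y. blinfun_apply (\<eta> y (coord_vec A c w y)) u) x -
          pd c v (pd c w (\<lambda>y. blinfun_apply (\<tau> y) u)) x"
        by (intro pd_diff smooth_at_apply smooth_at_pd \<eta>_coord_smooth smooth_at_const \<tau>_smooth c ac)
      finally show ?thesis by (simp add: pd_apply_const[OF \<eta>_coord_smooth[OF c] ac c(2)])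
    qed
    have "pd c v (\<lambda>y. \<eta> y (coord_vec A c w y)) x = pd c w (\<lambda>y. \<eta> y (coord_vec A c v y)) x"
      using \<eta>_closed c by (simp add: closed_one_form_iff[where \<omega>=\<eta>, OF \<eta>_coord_smooth])
    moreover have "pd c v (pd c w (\<lambda>y. blinfun_apply (\<tau> y) u)) x = pd c w (pd c v (\<lambda>y. blinfun_apply (\<tau> y) u)) x"
      by (intro pd_commute smooth_at_apply \<tau>_smooth smooth_at_const ac c)
    ultimately show "pd c v (\<lambda>y. blinfun_apply (\<zeta> y (coord_vec A c w y)) u) x =
      pd c w (\<lambda>y. blinfun_apply (\<zeta> y (coord_vec A c v y)) u) x" unfolding e by simp
  qed
qed

text \<open>A dense set is non-empty, so q is non-degenerate somewhere. This fixes r + s = 2, and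
  the constant signature gives non-degeneracy everywhere.\<close>

lemma q_nondegenerate: "nondegenerate (gauge_quadratic A f \<eta> x)"
  and q_symmetric: "gauge_quadratic A f \<eta> x X Y = gauge_quadratic A f \<eta> x Y X"
proof -
  obtain D where D: "closure D = UNIV" "\<forall>x\<in>D. nondegenerate (gauge_quadratic A f \<eta> x)"
    using Omega by (auto simp: Omega_surface_def)
  obtain r s where rs: "\<And>x. has_signature (gauge_quadratic A f \<eta> x) r s"
    using Omega by (auto simp: Omega_surface_def)
  have "D \<noteq> {}" using D(1) by auto
  then obtain z where "z \<in> D" by auto
  then have "r + s = 2" using D(2) nondegenerate_iff_no_null[OF rs] by blast
  then show "nondegenerate (gauge_quadratic A f \<eta> x)" using nondegenerate_iff_no_null[OF rs] by blast
  show "gauge_quadratic A f \<eta> x X Y = gauge_quadratic A f \<eta> x Y X"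
    using rs[of x] by (simp add: has_signature_def symmetric_bilinear_def)
qed

text \<open>If \<zeta> d_Y \<sigma>1 vanished identically, \<eta> would act on it through d\<tau>
  alone. That produces only a multiple of \<sigma>2 and no diagonal entry, so q(Z, Y) = 0 for all
  \<open>Z\<close>, although \<open>Y\<close> is not zero.\<close>

lemma \<zeta>_nondegenerate:
  assumes fr: "frame_at s1 s2 \<sigma>1 \<sigma>2 x" and Y: "Y \<noteq> 0" "dif A \<sigma>2 x Y \<in> f x"
  shows "\<exists>Z. blinfun_apply (\<zeta> x Z) (dif A \<sigma>1 x Y) \<noteq> 0"
proof (rule ccontr)
  assume "\<not> ?thesis"
  then have z: "blinfun_apply (\<zeta> x Z) (dif A \<sigma>1 x Y) = 0" for Z by simp
  have \<sigma>: "section_at \<sigma>1 x" "section_at \<sigma>2 x" "f x = span {\<sigma>1 x, \<sigma>2 x}"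
    using fr by (simp_all add: frame_at_def)
  define c where "c = chart_at A x"
  note ac = admissible_chart_at[of x, folded c_def] and cx = chart_at(2)[of x, folded c_def]
  have "gauge_quadratic A f \<eta> x Z Y = 0" for Z
  proof -
    obtain g where g: "\<tau> x = g *\<^sub>R wedge B (\<sigma>1 x) (\<sigma>2 x)"
      using wedge_space_2[OF \<tau>_wedge, of x] \<sigma>(3) by auto
    have "eventually (\<lambda>y. blinfun_apply (\<tau> y) (pd c Y \<sigma>1 y) = 0) (nhds x)"
      using section_at_eventually[OF \<sigma>(1)] eventually_chart[OF ac cx]
      by eventually_elim (intro \<tau>_perp pd_perp[OF ac])
    from pd_zero_of_eventually[OF ac cx this, of Z]
    have 1: "blinfun_apply (pd c Z \<tau> x) (pd c Y \<sigma>1 x) = - blinfun_apply (\<tau> x) (pd c Z (pd c Y \<sigma>1) x)"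
      using pd_apply[OF \<tau>_smooth smooth_at_pd[OF section_at_smooth[OF \<sigma>(1)] ac cx] ac cx, of Z Y]
      by (simp add: add_eq_0_iff)
    \<comment> \<open>This product is the coefficient of \<sigma>1 in d\<tau>(Z) d_Y \<sigma>1, up
      to a factor. It vanishes because d_Y \<sigma>2 lies in f.\<close>
    have "B (\<sigma>2 x) (pd c Z (pd c Y \<sigma>1) x) = - B (pd c Y \<sigma>2 x) (pd c Z \<sigma>1 x)"
      using B_section_pd_pd[OF ac cx \<sigma>(2,1), of Z Y] B_pd_pd_commute[OF ac cx \<sigma>(2,1), of Z Y] by simp
    also have "\<dots> = 0"
      using Y(2) perpD'[OF pd_perp[OF ac cx \<sigma>(1)]] by (simp add: dif_eq_pd c_def)
    finally have "blinfun_apply (dif A \<tau> x Z) (dif A \<sigma>1 x Y) =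
        0 *\<^sub>R \<sigma>1 x + (- g * B (\<sigma>1 x) (pd c Z (pd c Y \<sigma>1) x)) *\<^sub>R \<sigma>2 x"
      using 1 g by (simp add: dif_eq_pd c_def blinfun.scaleR_left wedge_app)
    moreover have "\<eta> x Z = \<zeta> x Z + dif A \<tau> x Z" by (simp add: \<zeta>_def)
    ultimately have T1: "blinfun_apply (\<eta> x Z) (dif A \<sigma>1 x Y) =
        0 *\<^sub>R \<sigma>1 x + (- g * B (\<sigma>1 x) (pd c Z (pd c Y \<sigma>1) x)) *\<^sub>R \<sigma>2 x"
      using z[of Z] by (simp add: blinfun.add_left)
    have T2: "blinfun_apply (\<eta> x Z) (dif A \<sigma>2 x Y) = 0 *\<^sub>R \<sigma>1 x + 0 *\<^sub>R \<sigma>2 x"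
      using \<eta>_f[OF Y(2)] by simp
    show ?thesis using gauge_quadratic_eq[of x \<eta> Z, OF \<eta>_f \<sigma> T1 T2] by simp
  qed
  then have "gauge_quadratic A f \<eta> x Y Z = 0" for Z using q_symmetric[of x Y Z] by simp
  then show False using q_nondegenerate[of x] Y(1) unfolding nondegenerate_def by blast
qed

end

section \<open>Charts from local diffeomorphisms\<close>

context surface
begin

text \<open>Read in the chart \<open>c0\<close>, the map \<Phi> is a local diffeomorphism. Its
  restriction becomes the coordinate map of the new chart, so that derivatives of \<Phi> in that
  chart are known by \<open>pd_snd_chart\<close>.\<close>

lemma chart_from_map:
  fixes \<Phi> :: "'m \<Rightarrow> real ^ 2"
  assumes W: "open W" "m \<in> W" "smooth_map A W \<Phi>"
    and c0: "admissible_chart A c0" "m \<in> fst c0" and inj: "\<And>v. pd c0 v \<Phi> m = 0 \<Longrightarrow> v = 0"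
  obtains c where "admissible_chart A c" "m \<in> fst c" "snd c = \<Phi>" "fst c \<subseteq> W"
proof -
  note ic0 = admissible_is_chart[OF c0(1)]
  define h where "h = \<Phi> \<circ> chart_inv c0"
  define S where "S = snd c0 ` (fst c0 \<inter> W)"
  have S: "open S" "snd c0 m \<in> S" unfolding S_def using chart_image_open[OF ic0 W(1)] c0(2) W(2) by auto
  have hS: "smooth_on S h" unfolding h_def S_def by (rule smooth_map_imp_chart[OF c0(1) W(1,3)])
  have "frechet_derivative h (at (snd c0 m)) v = pd c0 v \<Phi> m" for v by (simp add: pd_def h_def)
  then obtain U V g where U: "open U" "U \<subseteq> S" "snd c0 m \<in> U" "open V" "homeomorphism U V h g" "smooth_on V g"
    by (rule_tac smooth_inverse_function[OF S hS]) (auto intro: inj)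
  define D where "D = chart_inv c0 ` U"
  define c where "c = (D, \<Phi>)"
  have hom0: "homeomorphism (fst c0) (snd c0 ` fst c0) (snd c0) (chart_inv c0)"
    using ic0 by (simp add: is_chart_def)
  have US: "U \<subseteq> snd c0 ` fst c0" using U(2) by (auto simp: S_def)
  have D0: "D \<subseteq> fst c0 \<inter> W" using U(2) by (auto simp: D_def S_def chart_inv_left[OF ic0])
  have sD: "snd c0 ` D = U" using US by (force simp: D_def chart_inv_left[OF ic0] image_iff subset_iff)
  have mD: "m \<in> D" using U(3) c0(2) by (auto simp: D_def chart_inv_left[OF ic0] intro!: image_eqI[of _ _ "snd c0 m"])
  have homD: "homeomorphism D U (snd c0) (chart_inv c0)"
    using homeomorphism_of_subsets[OF hom0, of D U] D0 sD US by auto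
  have Dv: "D = (snd c0) -` U \<inter> fst c0"
    using D0 sD by (auto simp: D_def chart_inv_left[OF ic0] intro!: image_eqI[where f="chart_inv c0"])
  have oD: "open D"
  proof -
    have "continuous_on (fst c0) (snd c0)" using hom0 by (simp add: homeomorphism_def)
    then show ?thesis
      unfolding Dv using admissible_open[OF c0(1)] U(1) by (simp add: continuous_on_open_vimage)
  qed
  have \<Phi>D: "\<Phi> y = h (snd c0 y)" if "y \<in> D" for y
    using that D0 by (auto simp: h_def chart_inv_left[OF ic0])
  have hom: "homeomorphism D V \<Phi> (chart_inv c0 \<circ> g)"
    by (rule homeomorphism_cong[OF homeomorphism_compose[OF homD U(5)]]) (auto simp: \<Phi>D)
  have im: "\<Phi> ` D = V" using hom by (simp add: homeomorphism_def)
  have ci: "chart_inv c y = chart_inv c0 (g y)" if y: "y \<in> V" for y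
  proof -
    have a: "chart_inv c0 (g y) \<in> D" "\<Phi> (chart_inv c0 (g y)) = y"
      using hom y by (auto simp: homeomorphism_def)
    have "inj_on \<Phi> D" using hom by (metis homeomorphism_def inj_on_inverseI)
    then show ?thesis using a inv_into_f_f[of \<Phi> D "chart_inv c0 (g y)"] by (simp add: chart_inv_def c_def)
  qed
  have isc: "is_chart c"
    unfolding is_chart_def using oD U(4) im
    by (simp add: c_def) (rule homeomorphism_cong[OF hom], auto simp: ci[unfolded c_def])
  have "admissible_chart A c"
    unfolding admissible_chart_def
  proof (intro conjI isc ballI)
    fix c' assume c': "c' \<in> A"
    note ic' = admissible_is_chart[OF admissible_atlas[OF c']]
    show "compatible c c'"
      unfolding compatible_def
    proof
      have "smooth_on (snd c' ` (fst c' \<inter> D)) (\<Phi> \<circ> chart_inv c')"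
        using smooth_map_subset[OF W(3), of D] D0 c' by (auto simp: smooth_map_def)
      then show "smooth_on (snd c' ` (fst c \<inter> fst c')) (snd c \<circ> chart_inv c')"
        by (simp add: c_def Int_commute)
      let ?T = "snd c ` (fst c \<inter> fst c')"
      have T: "open ?T" using chart_image_open[OF isc, of "fst c'"] ic' by (simp add: is_chart_def)
      have TV: "?T \<subseteq> V" using im by (auto simp: c_def)
      have tr: "smooth_on (snd c0 ` (fst c0 \<inter> fst c')) (snd c' \<circ> chart_inv c0)"
        using c0(1) c' by (auto simp: admissible_chart_def compatible_def)
      have "smooth_on ?T (\<lambda>y. (snd c' \<circ> chart_inv c0) (g y))"
      proof (rule smooth_on_compose[OF T _ tr smooth_on_subset[OF U(6) TV]], safe)
        fix x assume x: "x \<in> fst c" "x \<in> fst c'"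
        then have xD: "x \<in> D" by (simp add: c_def)
        then have "g (\<Phi> x) = snd c0 x" using homD U(5) \<Phi>D[OF xD] by (auto simp: homeomorphism_def)
        then show "g (snd c x) \<in> snd c0 ` (fst c0 \<inter> fst c')" using xD x D0 by (auto simp: c_def)
      qed
      then show "smooth_on ?T (snd c' \<circ> chart_inv c)"
        by (rule smooth_on_cong[OF T, THEN iffD1, rotated]) (use TV ci in auto)
    qed
  qed
  then show ?thesis using that[of c] mD D0 by (auto simp: c_def)
qed

end

section \<open>Expansion of the form in a Laguerre basis\<close>

context lie_form
begin

text \<open>Vectors separated by dual vectors are independent, and six of them span the space; then
  \<open>a\<close> is orthogonal to everything.\<close>

lemma zero_of_dual_basis:
  assumes S: "finite S" "card S = 6" and d: "\<And>v. v \<in> S \<Longrightarrow> \<exists>w. B v w \<noteq> 0 \<and> (\<forall>u\<in>S - {v}. B u w = 0)"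
    and a: "\<And>v. v \<in> S \<Longrightarrow> B a v = 0"
  shows "a = 0"
proof -
  have ind: "independent S"
  proof (rule independent_if_scalars_zero[OF S(1)])
    fix k v assume s: "(\<Sum>x\<in>S. k x *\<^sub>R x) = 0" and v: "v \<in> S"
    obtain w where w: "B v w \<noteq> 0" "\<forall>u\<in>S - {v}. B u w = 0" using d[OF v] by auto
    have "0 = B (\<Sum>x\<in>S. k x *\<^sub>R x) w" by (simp add: s expand)
    also have "\<dots> = (\<Sum>x\<in>S. k x * B x w)" by (simp add: B.sum_left expand)
    also have "\<dots> = (\<Sum>x\<in>S. if x = v then k v * B v w else 0)" using w by (intro sum.cong) auto
    also have "\<dots> = k v * B v w" using v S(1) by (simp add: sum.delta)
    finally show "k v = 0" using w by simp
  qed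
  then have "dim S = 6" using dim_eq_card_independent[OF ind] S by simp
  then have sp: "span S = UNIV" using form by (intro dim_eq_full[THEN iffD1]) (simp add: lie_sphere_form_def)
  show ?thesis
  proof (rule nondegenerate)
    fix y have "y \<in> span S" by (simp add: sp)
    then show "B a y = 0" by (induction rule: span_induct_alt) (auto simp: expand a)
  qed
qed

text \<open>\<open>e0, e1, e2, pp\<close> together with the hyperbolic pair \<open>q0, qinf\<close> make a basis, in which
  \<open>B\<close> is expanded on \<open>qinf\<^sup>\<perp>\<close>.\<close>

lemma expansion_perp_qinf:
  assumes l: "laguerre_frame B qinf q0 pp" "B qinf qinf = 0"
    and e: "B e0 e0 = 1" "B e1 e1 = 1" "B e2 e2 = 1" "B e0 e1 = 0" "B e0 e2 = 0" "B e1 e2 = 0"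
      "\<And>e. e \<in> {e0, e1, e2} \<Longrightarrow> B e q0 = 0 \<and> B e qinf = 0 \<and> B e pp = 0"
    and a: "B a qinf = 0" "B b qinf = 0"
  shows "B a b = B a e0 * B b e0 + B a e1 * B b e1 + B a e2 * B b e2 - B a pp * B b pp"
proof -
  have ez: "B e0 q0 = 0" "B e0 qinf = 0" "B e0 pp = 0" "B e1 q0 = 0" "B e1 qinf = 0" "B e1 pp = 0"
    "B e2 q0 = 0" "B e2 qinf = 0" "B e2 pp = 0" using e(7) by auto
  have lz: "B q0 q0 = 0" "B q0 qinf = -1" "B pp q0 = 0" "B pp qinf = 0" "B pp pp = -1"
    using l(1) by (auto simp: laguerre_frame_def)
  note z = e(1-6) ez lz l(2)
  have zs: "B e1 e0 = 0" "B e2 e0 = 0" "B e2 e1 = 0" "B q0 e0 = 0" "B qinf e0 = 0" "B pp e0 = 0"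
    "B q0 e1 = 0" "B qinf e1 = 0" "B pp e1 = 0" "B q0 e2 = 0" "B qinf e2 = 0" "B pp e2 = 0"
    "B qinf q0 = -1" "B q0 pp = 0" "B qinf pp = 0"
    using z by (simp_all add: sym)
  \<comment> \<open>The vector \<open>a\<close> minus its expansion. The signs are those of (pp, pp)
    = (q0, qinf) = -1, and \<open>q0\<close> is absent because its coefficient would be - (a, qinf)
    = 0.\<close>
  define a' where "a' = a - (B a e0 *\<^sub>R e0 + B a e1 *\<^sub>R e1 + B a e2 *\<^sub>R e2) + B a pp *\<^sub>R pp + B a q0 *\<^sub>R qinf"
  have ne: "e0 \<noteq> e1" "e0 \<noteq> e2" "e1 \<noteq> e2" "pp \<noteq> e0" "pp \<noteq> e1" "pp \<noteq> e2" "q0 \<noteq> e0" "q0 \<noteq> e1" "q0 \<noteq> e2"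
    "qinf \<noteq> e0" "qinf \<noteq> e1" "qinf \<noteq> e2" "q0 \<noteq> pp" "qinf \<noteq> pp" "q0 \<noteq> qinf"
    using z by auto
  have "a' = 0"
  proof (rule zero_of_dual_basis[of "{e0, e1, e2, pp, q0, qinf}"])
    show "card {e0, e1, e2, pp, q0, qinf} = 6" using ne ne[symmetric] by simp
    show "\<exists>w. B v w \<noteq> 0 \<and> (\<forall>u\<in>{e0, e1, e2, pp, q0, qinf} - {v}. B u w = 0)"
      if "v \<in> {e0, e1, e2, pp, q0, qinf}" for v
    proof -
      consider "v = e0" | "v = e1" | "v = e2" | "v = pp" | "v = q0" | "v = qinf" using \<open>v \<in> _\<close> by blast
      then show ?thesis
      proof cases
        case 1 then show ?thesis by (intro exI[of _ e0]) (auto simp: z zs)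
      next
        case 2 then show ?thesis by (intro exI[of _ e1]) (auto simp: z zs)
      next
        case 3 then show ?thesis by (intro exI[of _ e2]) (auto simp: z zs)
      next
        case 4 then show ?thesis by (intro exI[of _ pp]) (auto simp: z zs)
      next
        case 5 then show ?thesis by (intro exI[of _ qinf]) (auto simp: z zs)
      next
        case 6 then show ?thesis by (intro exI[of _ q0]) (auto simp: z zs)
      qed
    qed
    show "B a' v = 0" if "v \<in> {e0, e1, e2, pp, q0, qinf}" for v
      using that a by (auto simp: a'_def expand z zs)
  qed simp
  then have "B a' b = 0" by (simp add: expand)
  then show ?thesis
    using a sym[of qinf b] sym[of e0 b] sym[of e1 b] sym[of e2 b] sym[of pp b]
    by (simp add: a'_def expand algebra_simps)
qed

end

section \<open>Laguerre lifts\<close>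

text \<open>\<open>F\<close> and \<open>t\<close> are the sections \<open>\<ff>\<close> and \<open>\<tt>\<close> of the paper.\<close>

locale lift = legendre A B f
  for A :: "'m::{t2_space, second_countable_topology} chart set"
    and B :: "'v::euclidean_space \<Rightarrow> 'v \<Rightarrow> real" and f :: "'m \<Rightarrow> 'v set" +
  fixes qinf q0 pp :: 'v and F t :: "'m \<Rightarrow> 'v"
  assumes laguerre: "laguerre_frame B qinf q0 pp"
    and qinf: "qinf \<noteq> 0" "B qinf qinf = 0"
    and F_smooth: "\<And>x. smooth_at A F x" and t_smooth: "\<And>x. smooth_at A t x"
    and f_eq: "\<And>x. f x = span {F x, t x}"
    and F: "\<And>x. B (F x) qinf = -1" "\<And>x. B (F x) pp = 0"
    and t: "\<And>x. B (t x) qinf = 0" "\<And>x. B (t x) pp = -1"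
begin

lemma laguerreD: "B q0 q0 = 0" "B q0 qinf = -1" "B pp q0 = 0" "B pp qinf = 0" "B pp pp = -1"
  "B qinf q0 = -1" "B q0 pp = 0" "B qinf pp = 0"
  using laguerre by (auto simp: laguerre_frame_def sym)

lemma F_mem: "F x \<in> f x" and t_mem: "t x \<in> f x"
  unfolding f_eq by (auto intro: span_base)

lemma section_F: "section_at F x" and section_t: "section_at t x"
  by (simp_all add: section_at_def F_smooth t_smooth F_mem t_mem)

text \<open>The functionals - (., qinf) and - (., pp) are the coordinates of f in the basis F, t.
  The lemma turns membership in f into equations between vectors.\<close>

lemma mem_f_zero: "v \<in> f x \<Longrightarrow> B v qinf = 0 \<Longrightarrow> B v pp = 0 \<Longrightarrow> v = 0"
  unfolding f_eq span_2 using F[of x] t[of x] by (auto simp: expand)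

context
  fixes c x assumes c: "admissible_chart A c" "x \<in> fst c"
begin

lemma pd_B_const:
  assumes "\<And>y. B (g y) u = k" "smooth_at A g x" shows "B (pd c v g x) u = 0"
proof -
  have "pd c v (\<lambda>y. B (g y) u) x = 0" unfolding assms(1) by (rule pd_const)
  then show ?thesis using pd_B[OF assms(2) smooth_at_const c, of v u] by (simp add: pd_const expand)
qed

lemma pd_F_t: "B (pd c v F x) qinf = 0" "B (pd c v F x) pp = 0" "B (pd c v t x) qinf = 0" "B (pd c v t x) pp = 0"
  using pd_B_const[OF F(1) F_smooth] pd_B_const[OF F(2) F_smooth] pd_B_const[OF t(1) t_smooth]
    pd_B_const[OF t(2) t_smooth] by auto

end

lemma dif_F_t: "B (dif A F x X) qinf = 0" "B (dif A F x X) pp = 0" "B (dif A t x X) qinf = 0" "B (dif A t x X) pp = 0"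
  unfolding dif_eq_pd using pd_F_t[OF admissible_chart_at chart_at(2)] by auto

lemma dif_F_t': "B qinf (dif A F x X) = 0" "B pp (dif A F x X) = 0" "B qinf (dif A t x X) = 0" "B pp (dif A t x X) = 0"
  using dif_F_t[of x X] by (metis sym)+

lemma F_t': "B qinf (F x) = -1" "B pp (F x) = 0" "B qinf (t x) = 0" "B pp (t x) = -1"
  using F[of x] t[of x] by (metis sym)+

lemma dt_perp: "dif A t x X \<in> perp B (f x)" and dF_perp: "dif A F x X \<in> perp B (f x)"
  by (rule dif_perp[OF section_t], rule dif_perp[OF section_F])

text \<open>The vectors of f^perp orthogonal to qinf and pp form a complement of f in f^perp, on
  which \<open>B\<close> is positive definite.\<close>

lemma perp_nonpos_zero:
  assumes "w \<in> perp B (f x)" "B w qinf = 0" "B w pp = 0" "B w w \<le> 0" shows "w = 0"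
  by (rule mem_f_zero[OF mem_f_of_perp]) (use assms in auto)

lemma third_positive: "dif A t x X \<noteq> 0 \<Longrightarrow> B (dif A t x X) (dif A t x X) > 0"
  using perp_nonpos_zero[OF dt_perp dif_F_t(3,4)] by force

lemma dF_dt_commute: "B (dif A F x X) (dif A t x Y) = B (dif A F x Y) (dif A t x X)"
  unfolding dif_eq_pd by (rule B_pd_pd_commute[OF admissible_chart_at chart_at(2) section_F section_t])

text \<open>The equation F = x + q0 + (x, x)/2 qinf solved for x, with (F, q0) = - (x, x)/2;
  likewise (t, q0) = - (n, x) for the normal.\<close>

definition point_map :: "'m \<Rightarrow> 'v" where "point_map x = F x - q0 + B (F x) q0 *\<^sub>R qinf"
definition normal_map :: "'m \<Rightarrow> 'v" where "normal_map x = t x - pp + B (t x) q0 *\<^sub>R qinf"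

lemma dif_project:
  assumes g: "\<And>x. smooth_at A g x"
  shows "dif A (\<lambda>x. g x - k + B (g x) q0 *\<^sub>R qinf) x X = dif A g x X + B (dif A g x X) q0 *\<^sub>R qinf"
proof -
  have b: "smooth_at A (\<lambda>y. B (g y) q0) x" by (intro smooth_at_B g smooth_at_const)
  have "dif A (\<lambda>x. g x - k + B (g x) q0 *\<^sub>R qinf) x X =
      dif A (\<lambda>x. g x - k) x X + dif A (\<lambda>x. B (g x) q0 *\<^sub>R qinf) x X"
    by (intro dif_add smooth_at_diff smooth_at_scaleR g b smooth_at_const)
  also have "dif A (\<lambda>x. g x - k) x X = dif A g x X - dif A (\<lambda>_. k) x X"
    by (intro dif_diff g smooth_at_const)
  also have "dif A (\<lambda>x. B (g x) q0 *\<^sub>R qinf) x X =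
      B (g x) q0 *\<^sub>R dif A (\<lambda>_. qinf) x X + dif A (\<lambda>y. B (g y) q0) x X *\<^sub>R qinf"
    by (intro dif_scaleR b smooth_at_const)
  also have "dif A (\<lambda>y. B (g y) q0) x X = B (g x) (dif A (\<lambda>_. q0) x X) + B (dif A g x X) q0"
    by (intro dif_bilinear[OF B.bounded_bilinear_axioms] g smooth_at_const)
  finally show ?thesis by (simp add: dif_const expand)
qed

lemma dif_point_map: "dif A point_map x X = dif A F x X + B (dif A F x X) q0 *\<^sub>R qinf"
  unfolding point_map_def[abs_def] by (rule dif_project[OF F_smooth])

lemma dif_normal_map: "dif A normal_map x X = dif A t x X + B (dif A t x X) q0 *\<^sub>R qinf"
  unfolding normal_map_def[abs_def] by (rule dif_project[OF t_smooth])

text \<open>The derivatives of n and t differ by a multiple of qinf, which is null and orthogonal to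
  dF and dt. The fundamental forms can therefore be computed on the lifts.\<close>

lemma third_ff_eq: "third_ff A B normal_map x X Y = B (dif A t x X) (dif A t x Y)"
  using dif_F_t[of x X] dif_F_t[of x Y] dif_F_t'[of x X] dif_F_t'[of x Y] qinf
  by (simp add: third_ff_def dif_normal_map expand)

lemma second_ff_eq: "second_ff A B point_map normal_map x X Y = - B (dif A F x X) (dif A t x Y)"
  using dif_F_t[of x X] dif_F_t[of x Y] dif_F_t'[of x X] dif_F_t'[of x Y] qinf
  by (simp add: second_ff_def dif_normal_map dif_point_map expand)

lemma projects: "projects_to A B qinf q0 pp f point_map normal_map"
  unfolding projects_to_def
proof (intro conjI allI)
  show "smooth_map A UNIV point_map"
    unfolding smooth_map_iff_smooth_at[OF open_UNIV] point_map_def[abs_def]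
    by (intro ballI smooth_at_add smooth_at_diff smooth_at_scaleR smooth_at_B F_smooth smooth_at_const)
  show "smooth_map A UNIV normal_map"
    unfolding smooth_map_iff_smooth_at[OF open_UNIV] normal_map_def[abs_def]
    by (intro ballI smooth_at_add smooth_at_diff smooth_at_scaleR smooth_at_B t_smooth smooth_at_const)
  fix m
  note z = laguerreD qinf(2) F[of m] t[of m] isotropic[OF F_mem F_mem, of m] isotropic[OF t_mem t_mem, of m]
    isotropic[OF F_mem t_mem, of m] isotropic[OF t_mem F_mem, of m]
    F_t'[of m] sym[of q0 "F m"] sym[of q0 "t m"]
  show "point_map m \<in> perp B {q0, qinf, pp}" by (simp add: perp_def point_map_def expand z)
  show "normal_map m \<in> perp B {q0, qinf, pp}" by (simp add: perp_def normal_map_def expand z)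
  show "B (normal_map m) (normal_map m) = 1" by (simp add: normal_map_def expand z)
  show "B (dif A point_map m X) (normal_map m) = 0" for X
    using dif_F_t[of m X] perpD[OF dF_perp t_mem, of m X]
    by (simp add: dif_point_map normal_map_def expand z)
  have "B (point_map m) (point_map m) = - 2 * B (F m) q0"
    by (simp add: point_map_def expand z)
  then have 1: "point_map m + q0 + (B (point_map m) (point_map m) / 2) *\<^sub>R qinf = F m"
    by (simp add: point_map_def)
  have "B (normal_map m) (point_map m) = - B (t m) q0"
    by (simp add: point_map_def normal_map_def expand z)
  then have 2: "normal_map m + pp + B (normal_map m) (point_map m) *\<^sub>R qinf = t m"
    by (simp add: normal_map_def)
  show "f m = span {point_map m + q0 + (B (point_map m) (point_map m) / 2) *\<^sub>R qinf,
      normal_map m + pp + B (normal_map m) (point_map m) *\<^sub>R qinf}"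
    unfolding 1 2 by (rule f_eq)
qed

text \<open>By dimension f^perp is spanned by F, t, \<open>a\<close>, \<open>b\<close>, and the
  products with qinf and pp force the coefficients of F and t to vanish.\<close>

lemma conformal_expansion:
  assumes u: "a \<in> perp B (f x)" "B a qinf = 0" "B a pp = 0" and v: "b \<in> perp B (f x)" "B b qinf = 0" "B b pp = 0"
    and ab: "B a b = 0" "B a a = E" "B b b = E'" "E \<noteq> 0" "E' \<noteq> 0"
    and w: "w \<in> perp B (f x)" "B w qinf = 0" "B w pp = 0"
  shows "w = (B w a / E) *\<^sub>R a + (B w b / E') *\<^sub>R b"
proof -
  have ba: "B b a = 0" using ab(1) sym[of b a] by simp
  obtain k l p q where z: "w = k *\<^sub>R F x + l *\<^sub>R t x + p *\<^sub>R a + q *\<^sub>R b"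
  proof (rule perp_eq_span[OF f_eq dim_f u(1) v(1) _ isotropic w(1)])
    fix p q assume pq: "p *\<^sub>R a + q *\<^sub>R b \<in> f x"
    then have "B a (p *\<^sub>R a + q *\<^sub>R b) = 0" "B b (p *\<^sub>R a + q *\<^sub>R b) = 0"
      using perpD[OF u(1) pq] perpD[OF v(1) pq] by auto
    then show "p = 0 \<and> q = 0" using ab ba by (simp add: expand)
  qed (use that in auto)
  have "k = 0" "l = 0" using w(2,3) u v F[of x] t[of x] by (auto simp: z expand)
  moreover have "B w a = p * E" "B w b = q * E'"
    using ab ba \<open>k = 0\<close> \<open>l = 0\<close> by (simp_all add: z expand)
  ultimately show ?thesis using ab(4,5) by (simp add: z)
qed

text \<open>The exterior derivative of a \<open>V\<close>-valued form, trace-free and symmetric with respect to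
  \<open>dt\<close>, is tested against the Cauchy-Riemann equations in a conformal chart.\<close>

lemma codazzi_conformal:
  assumes c: "admissible_chart A c" "x \<in> fst c"
    and tu: "\<And>y. tu y = pd c (axis 1 1) t y" and tv: "\<And>y. tv y = pd c (axis 2 1) t y"
    and conf: "eventually (\<lambda>y. B (tu y) (tv y) = 0 \<and> B (tu y) (tu y) = B (tv y) (tv y)) (nhds x)"
      "B (tu x) (tu x) \<noteq> 0"
    and P: "smooth_at A Pu x" "smooth_at A Pv x"
      "eventually (\<lambda>y. B (Pu y) (tv y) = B (Pv y) (tu y) \<and> B (Pu y) (tu y) = - B (Pv y) (tv y)) (nhds x)"
    and Px: "Pu x \<in> perp B (f x)" "B (Pu x) qinf = 0" "B (Pu x) pp = 0"
      "Pv x \<in> perp B (f x)" "B (Pv x) qinf = 0" "B (Pv x) pp = 0"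
  shows "B (pd c (axis 2 1) Pu x - pd c (axis 1 1) Pv x) (tu x) =
      pd c (axis 2 1) (\<lambda>y. B (Pu y) (tu y)) x - pd c (axis 1 1) (\<lambda>y. B (Pu y) (tv y)) x"
    and "B (pd c (axis 2 1) Pu x - pd c (axis 1 1) Pv x) (tv x) =
      pd c (axis 2 1) (\<lambda>y. B (Pu y) (tv y)) x + pd c (axis 1 1) (\<lambda>y. B (Pu y) (tu y)) x"
proof -
  have tud: "tu = pd c (axis 1 1) t" and tvd: "tv = pd c (axis 2 1) t" using tu tv by auto
  have s: "smooth_at A tu x" "smooth_at A tv x"
    unfolding tud tvd by (intro smooth_at_pd t_smooth c)+
  have st: "pd c (axis 1 1) tv x = pd c (axis 2 1) tu x"
    unfolding tud tvd by (rule pd_commute[OF t_smooth c])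
  define E where "E y = B (tu y) (tu y)" for y
  define Eu Ev where "Eu = pd c (axis 1 1) E x" and "Ev = pd c (axis 2 1) E x"
  define tuu tuv tvv where "tuu = pd c (axis 1 1) tu x" and "tuv = pd c (axis 2 1) tu x"
    and "tvv = pd c (axis 2 1) tv x"
  have bw: "pd c v (\<lambda>y. B (g y) (h y)) x = B (g x) (pd c v h x) + B (pd c v g x) (h x)"
    if "smooth_at A g x" "smooth_at A h x" for g h v by (rule pd_B[OF that c])
  have E1: "pd c v E x = 2 * B (tu x) (pd c v tu x)" for v
    unfolding E_def[abs_def] bw[OF s(1) s(1)] using sym by simp
  have "eventually (\<lambda>y. E y = B (tv y) (tv y)) (nhds x)"
    using conf(1) by eventually_elim (simp add: E_def)
  then have E2: "pd c v E x = 2 * B (tv x) (pd c v tv x)" for v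
    using pd_cong[OF _ c, of E "\<lambda>y. B (tv y) (tv y)" v] bw[OF s(2) s(2), of v] sym by simp
  have "eventually (\<lambda>y. B (tu y) (tv y) = 0) (nhds x)" using conf(1) by eventually_elim simp
  then have E3: "B (tu x) (pd c v tv x) + B (pd c v tu x) (tv x) = 0" for v
    using pd_zero_of_eventually[OF c, of "\<lambda>y. B (tu y) (tv y)" v] bw[OF s, of v] by simp
  \<comment> \<open>The Christoffel symbols of the conformal metric E (du^2 + dv^2).\<close>
  have r: "2 * B (tu x) tuu = Eu" "2 * B (tu x) tuv = Ev" "2 * B (tv x) tuv = Eu" "2 * B (tv x) tvv = Ev"
    "2 * B (tv x) tuu = - Ev" "2 * B (tu x) tvv = - Eu"
    using E1[of "axis 1 1"] E1[of "axis 2 1"] E2[of "axis 1 1"] E2[of "axis 2 1"]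
      E3[of "axis 1 1"] E3[of "axis 2 1"] st sym[of "pd c (axis 1 1) tu x" "tv x"] sym[of "pd c (axis 2 1) tu x" "tv x"]
    unfolding Eu_def Ev_def tuu_def tuv_def tvv_def by auto
  have cx: "B (tu x) (tv x) = 0" "B (tv x) (tv x) = E x" "B (tu x) (tu x) = E x"
    using eventually_nhds_x_imp_x[OF conf(1)] by (auto simp: E_def)
  have E0: "E x \<noteq> 0" using conf(2) by (simp add: E_def)
  have Pc: "B (Pu x) (tv x) = B (Pv x) (tu x)" "B (Pu x) (tu x) = - B (Pv x) (tv x)"
    using eventually_nhds_x_imp_x[OF P(3)] by auto
  define q11 q12 where "q11 = B (Pu x) (tu x)" and "q12 = B (Pu x) (tv x)"
  have tp: "tu x \<in> perp B (f x)" "B (tu x) qinf = 0" "B (tu x) pp = 0"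
    "tv x \<in> perp B (f x)" "B (tv x) qinf = 0" "B (tv x) pp = 0"
    using pd_perp[OF c section_t] pd_F_t[OF c] by (auto simp: tu tv)
  have Pu: "Pu x = (q11 / E x) *\<^sub>R tu x + (q12 / E x) *\<^sub>R tv x"
    using conformal_expansion[OF tp cx(1,3,2) E0 E0 Px(1-3)] by (simp add: q11_def q12_def)
  have Pv: "Pv x = (q12 / E x) *\<^sub>R tu x + (- q11 / E x) *\<^sub>R tv x"
    using conformal_expansion[OF tp cx(1,3,2) E0 E0 Px(4-6)] Pc by (simp add: q11_def q12_def)
  \<comment> \<open>With these Christoffel symbols the terms containing second derivatives of t
    cancel exactly for symmetric trace-free pairs; only derivatives of the products remain.\<close>
  have k: "B (Pu x) tuv = B (Pv x) tuu" "B (Pu x) tvv = B (Pv x) tuv"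
  proof -
    have "2 * E x * B (Pu x) tuv = q11 * (2 * B (tu x) tuv) + q12 * (2 * B (tv x) tuv)"
      "2 * E x * B (Pv x) tuu = q12 * (2 * B (tu x) tuu) - q11 * (2 * B (tv x) tuu)"
      "2 * E x * B (Pu x) tvv = q11 * (2 * B (tu x) tvv) + q12 * (2 * B (tv x) tvv)"
      "2 * E x * B (Pv x) tuv = q12 * (2 * B (tu x) tuv) - q11 * (2 * B (tv x) tuv)"
      using E0 by (simp_all add: Pu Pv expand field_simps)
    then have "2 * E x * B (Pu x) tuv = 2 * E x * B (Pv x) tuu" "2 * E x * B (Pu x) tvv = 2 * E x * B (Pv x) tuv"
      unfolding r by simp_all
    then show "B (Pu x) tuv = B (Pv x) tuu" "B (Pu x) tvv = B (Pv x) tuv" using E0 by simp_all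
  qed
  have e1: "pd c v (\<lambda>y. B (Pu y) (tv y)) x = pd c v (\<lambda>y. B (Pv y) (tu y)) x" for v
    by (rule pd_cong[OF _ c]) (use P(3) in \<open>auto elim: eventually_mono\<close>)
  have e2: "pd c v (\<lambda>y. B (Pu y) (tu y)) x = - pd c v (\<lambda>y. B (Pv y) (tv y)) x" for v
  proof -
    have "pd c v (\<lambda>y. B (Pu y) (tu y)) x = pd c v (\<lambda>y. - B (Pv y) (tv y)) x"
      by (rule pd_cong[OF _ c]) (use P(3) in \<open>auto elim: eventually_mono\<close>)
    then show ?thesis using pd_uminus[OF smooth_at_B[OF P(2) s(2)] c, of v] by simp
  qed
  show "B (pd c (axis 2 1) Pu x - pd c (axis 1 1) Pv x) (tu x) =
      pd c (axis 2 1) (\<lambda>y. B (Pu y) (tu y)) x - pd c (axis 1 1) (\<lambda>y. B (Pu y) (tv y)) x"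
    unfolding e1 bw[OF P(1) s(1)] bw[OF P(2) s(1)] using k(1) by (simp add: expand tuv_def tuu_def)
  show "B (pd c (axis 2 1) Pu x - pd c (axis 1 1) Pv x) (tv x) =
      pd c (axis 2 1) (\<lambda>y. B (Pu y) (tv y)) x + pd c (axis 1 1) (\<lambda>y. B (Pu y) (tu y)) x"
    unfolding e2 bw[OF P(1) s(2)] bw[OF P(2) s(2)] using k(2) st by (simp add: expand tuv_def tvv_def)
qed

text \<open>Stereographic projection of the normal from \<open>- normal_map m\<close> is conformal.\<close>

lemma conformal_chart_ex:
  assumes nd: "\<And>x X. X \<noteq> 0 \<Longrightarrow> dif A t x X \<noteq> 0"
  obtains c where "m \<in> fst c" "conformal_chart A (third_ff A B normal_map) c"
proof -
  define c0 where "c0 = chart_at A m"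
  note ac0 = admissible_chart_at[of m, folded c0_def] and cm = chart_at(2)[of m, folded c0_def]
  define e0 where "e0 = normal_map m"
  define n1 where "n1 = dif A normal_map m (axis 1 1)"
  define n2 where "n2 = dif A normal_map m (axis 2 1)"
  have pr: "normal_map m \<in> perp B {q0, qinf, pp}" "B (normal_map m) (normal_map m) = 1"
    using projects by (auto simp: projects_to_def)
  have nz: "B e0 q0 = 0" "B e0 qinf = 0" "B e0 pp = 0" "B e0 e0 = 1"
    using pr by (auto simp: perp_def e0_def)
  have dn: "B (dif A normal_map m X) q0 = 0" "B (dif A normal_map m X) qinf = 0"
    "B (dif A normal_map m X) pp = 0" "B (dif A normal_map m X) e0 = 0" for X
    using dif_F_t[of m X] perpD[OF dt_perp t_mem, of m X] laguerreD qinf F_t'[of m] dif_F_t'[of m X] t[of m]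
      sym[of q0 "t m"]
    by (simp_all add: dif_normal_map expand e0_def normal_map_def)
  have dnn: "B (dif A normal_map m X) (dif A normal_map m Y) = B (dif A t m X) (dif A t m Y)" for X Y
    using third_ff_eq[of m X Y] by (simp add: third_ff_def)
  have ax: "axis 1 1 \<noteq> (0::real^2)" "axis 2 1 \<noteq> (0::real^2)" by (simp_all add: axis_eq_0_iff)
  have n11: "B n1 n1 > 0" unfolding n1_def dnn by (rule third_positive[OF nd[OF ax(1)]])
  \<comment> \<open>Gram-Schmidt in the tangent plane of the sphere at \<open>e0\<close>. Both
    lengths are positive because dt is injective.\<close>
  define r1 where "r1 = sqrt (B n1 n1)"
  have r1: "r1 > 0" "r1 * r1 = B n1 n1" using n11 by (simp_all add: r1_def)
  define e1 where "e1 = (1 / r1) *\<^sub>R n1"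
  define w2 where "w2 = n2 - B n2 e1 *\<^sub>R e1"
  have e11: "B e1 e1 = 1" using r1(1) by (simp add: e1_def expand r1(2)[symmetric])
  have w2e1: "B w2 e1 = 0" by (simp add: w2_def expand e11)
  have w2d: "w2 = dif A normal_map m (axis 2 1 - (B n2 e1 / r1) *\<^sub>R axis 1 1)"
  proof -
    have "smooth_at A normal_map m"
      unfolding normal_map_def[abs_def]
      by (intro smooth_at_add smooth_at_diff smooth_at_scaleR smooth_at_B t_smooth smooth_at_const)
    note l = dif_linear[OF this]
    show ?thesis unfolding linear_diff[OF l] linear_cmul[OF l] w2_def e1_def n1_def n2_def by simp
  qed
  have "axis 2 1 - (B n2 e1 / r1) *\<^sub>R axis 1 1 \<noteq> (0::real^2)"
    by (auto simp: vec_eq_iff forall_2 axis_def)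
  then have w22: "B w2 w2 > 0" unfolding w2d dnn by (intro third_positive nd)
  define r2 where "r2 = sqrt (B w2 w2)"
  have r2: "r2 > 0" "r2 * r2 = B w2 w2" using w22 by (simp_all add: r2_def)
  define e2 where "e2 = (1 / r2) *\<^sub>R w2"
  have e22: "B e2 e2 = 1" using r2(1) by (simp add: e2_def expand r2(2)[symmetric])
  have e12: "B e1 e2 = 0" using w2e1 sym[of e1 w2] by (simp add: e2_def expand)
  have ez: "B e q0 = 0 \<and> B e qinf = 0 \<and> B e pp = 0" if "e \<in> {e0, e1, e2}" for e
    using that nz dn by (auto simp: e2_def e1_def n1_def w2d expand)
  have e0z: "B e0 e1 = 0" "B e0 e2 = 0"
    using dn(4) sym[of e0 "dif A normal_map m X" for X] by (simp_all add: e2_def e1_def n1_def w2d expand)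
  have ex: "B a b = B a e0 * B b e0 + B a e1 * B b e1 + B a e2 * B b e2 - B a pp * B b pp"
    if "B a qinf = 0" "B b qinf = 0" for a b
    by (rule expansion_perp_qinf[OF laguerre qinf(2) nz(4) e11 e22 e0z e12 _ that]) (rule ez)
  \<comment> \<open>Coordinates of the unit normal in the orthonormal basis whose first vector is
    the normal at \<open>m\<close>. So \<nu>0 is 1 at \<open>m\<close>, and the denominator 1 +
    \<nu>0 has no zeros nearby.\<close>
  define \<nu>0 where "\<nu>0 y = B (t y) e0" for y
  define \<nu>1 where "\<nu>1 y = B (t y) e1" for y
  define \<nu>2 where "\<nu>2 y = B (t y) e2" for y
  have \<nu>s: "smooth_at A \<nu>0 x" "smooth_at A \<nu>1 x" "smooth_at A \<nu>2 x" for x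
    unfolding \<nu>0_def[abs_def] \<nu>1_def[abs_def] \<nu>2_def[abs_def] by (intro smooth_at_B t_smooth smooth_at_const)+
  define \<Phi> :: "'m \<Rightarrow> real ^ 2" where "\<Phi> y = (\<nu>1 y * inverse (1 + \<nu>0 y)) *\<^sub>R axis 1 1 + (\<nu>2 y * inverse (1 + \<nu>0 y)) *\<^sub>R axis 2 1" for y
  have \<Phi>c: "\<Phi> y $ 1 = \<nu>1 y * inverse (1 + \<nu>0 y)" "\<Phi> y $ 2 = \<nu>2 y * inverse (1 + \<nu>0 y)" for y
    by (simp_all add: \<Phi>_def axis_def)
  have s0: "smooth_at A (\<lambda>y. 1 + \<nu>0 y) x" for x by (intro smooth_at_add smooth_at_const \<nu>s)
  have "\<nu>0 m = 1"
    using nz isotropic[OF t_mem t_mem, of m] t[of m] F_t'[of m]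
    unfolding \<nu>0_def e0_def normal_map_def by (simp add: expand)
  then have "eventually (\<lambda>y. 1 + \<nu>0 y \<noteq> 0) (nhds m)"
    by (intro smooth_at_nonzero s0) simp
  then obtain W where W: "open W" "m \<in> W" "\<And>y. y \<in> W \<Longrightarrow> 1 + \<nu>0 y \<noteq> 0"
    unfolding eventually_nhds by auto
  have \<Phi>W: "smooth_map A W \<Phi>"
    unfolding smooth_map_iff_smooth_at[OF W(1)] \<Phi>_def[abs_def]
    by (intro ballI smooth_at_add smooth_at_scaleR smooth_at_mult smooth_at_inverse smooth_at_const \<nu>s W(3))
  have key: "((1 + \<nu>0 y))\<^sup>2 * ((pd c v \<Phi> y $ 1)\<^sup>2 + (pd c v \<Phi> y $ 2)\<^sup>2) = B (pd c v t y) (pd c v t y)"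
    if yW: "y \<in> W" and c: "admissible_chart A c" "y \<in> fst c" for c v y
  proof -
    define w where "w = pd c v t y"
    have s\<Phi>: "smooth_at A \<Phi> y" using \<Phi>W yW by (simp add: smooth_map_iff_smooth_at[OF W(1)])
    have d\<nu>: "pd c v (\<lambda>y. B (t y) e) y = B w e" for e
      using pd_B[OF t_smooth smooth_at_const c, of v e] by (simp add: pd_const expand w_def)
    have evW: "eventually (\<lambda>y. y \<in> W) (nhds y)" by (rule eventually_nhds_in_open[OF W(1) yW])
    \<comment> \<open>Differentiating the product (1 + \<nu>0) \<Phi>_i = \<nu>_i in place of the
      quotient keeps the computation polynomial.\<close>
    have d: "(1 + \<nu>0 y) * (pd c v \<Phi> y $ i) + B w e0 * \<Phi> y $ i = B w e"
      if e: "\<And>y. y \<in> W \<Longrightarrow> (1 + \<nu>0 y) * \<Phi> y $ i = B (t y) e" for i e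
    proof -
      have "eventually (\<lambda>y. (1 + \<nu>0 y) * \<Phi> y $ i = B (t y) e) (nhds y)"
        using evW by eventually_elim (rule e)
      then have "pd c v (\<lambda>y. (1 + \<nu>0 y) * \<Phi> y $ i) y = B w e"
        unfolding d\<nu>[symmetric] by (rule pd_cong[OF _ c])
      moreover have "pd c v (\<lambda>y. (1 + \<nu>0 y) * \<Phi> y $ i) y =
          (1 + \<nu>0 y) * pd c v \<Phi> y $ i + pd c v (\<lambda>y. 1 + \<nu>0 y) y * \<Phi> y $ i"
        using pd_mult[OF s0 smooth_at_vec_nth[OF s\<Phi>] c, of v i]
          pd_bounded_linear[OF bounded_linear_vec_nth s\<Phi> c, of v i] by simp
      moreover have "pd c v (\<lambda>y. 1 + \<nu>0 y) y = B w e0"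
        using pd_add[OF smooth_at_const \<nu>s(1) c, of v 1] d\<nu>[of e0] by (simp add: pd_const \<nu>0_def[abs_def])
      ultimately show ?thesis by simp
    qed
    have n: "1 + \<nu>0 y \<noteq> 0" by (rule W(3)[OF yW])
    have f1: "(1 + \<nu>0 y) * \<Phi> y $ 1 = \<nu>1 y" "(1 + \<nu>0 y) * \<Phi> y $ 2 = \<nu>2 y" if "y \<in> W" for y
      using W(3)[OF that] by (simp_all add: \<Phi>c)
    have d1: "(1 + \<nu>0 y) * (pd c v \<Phi> y $ 1) + B w e0 * \<Phi> y $ 1 = B w e1"
      by (rule d) (use f1 in \<open>simp add: \<nu>1_def\<close>)
    have d2: "(1 + \<nu>0 y) * (pd c v \<Phi> y $ 2) + B w e0 * \<Phi> y $ 2 = B w e2"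
      by (rule d) (use f1 in \<open>simp add: \<nu>2_def\<close>)
    have wq: "B w qinf = 0" "B w pp = 0" using pd_F_t[OF c] by (auto simp: w_def)
    have tt: "\<nu>0 y * \<nu>0 y + \<nu>1 y * \<nu>1 y + \<nu>2 y * \<nu>2 y = 1"
      using ex[OF t(1) t(1), of y y] isotropic[OF t_mem t_mem, of y] t(2)[of y] by (simp add: \<nu>0_def \<nu>1_def \<nu>2_def)
    have tw: "\<nu>0 y * B w e0 + \<nu>1 y * B w e1 + \<nu>2 y * B w e2 = 0"
      using ex[OF t(1) wq(1), of y] perpD'[OF pd_perp[OF c section_t] t_mem, of v] wq
      by (simp add: \<nu>0_def \<nu>1_def \<nu>2_def w_def)
    have ww: "B w w = B w e0 * B w e0 + B w e1 * B w e1 + B w e2 * B w e2"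
      using ex[OF wq(1) wq(1)] wq by simp
    show ?thesis
    proof -
      define s u1 u2 p1 p2 \<omega> where "s = 1 + \<nu>0 y" and "u1 = pd c v \<Phi> y $ 1" and "u2 = pd c v \<Phi> y $ 2"
        and "p1 = \<Phi> y $ 1" and "p2 = \<Phi> y $ 2" and "\<omega> = B w e0"
      have a: "s * u1 = B w e1 - \<omega> * p1" "s * u2 = B w e2 - \<omega> * p2"
        using d1 d2 by (simp_all add: s_def u1_def u2_def p1_def p2_def \<omega>_def)
      have b: "s * p1 = \<nu>1 y" "s * p2 = \<nu>2 y" "\<nu>0 y = s - 1" using f1[OF yW] by (simp_all add: s_def p1_def p2_def)
      have s: "s \<noteq> 0" using n by (simp add: s_def)
      have "s * (s * (p1 * p1 + p2 * p2)) = s * (2 - s)"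
        using tt unfolding b(3) b(1,2)[symmetric] by (simp add: algebra_simps)
      then have c1: "s * (p1 * p1 + p2 * p2) = 2 - s" using s by simp
      have c2: "s * (p1 * B w e1 + p2 * B w e2) = - (s - 1) * \<omega>"
        using tw unfolding b(3) b(1,2)[symmetric] \<omega>_def by (simp add: algebra_simps)
      have "s * ((s * u1)\<^sup>2 + (s * u2)\<^sup>2) = s * (B w e1 * B w e1 + B w e2 * B w e2)
          - 2 * \<omega> * (s * (p1 * B w e1 + p2 * B w e2)) + \<omega> * \<omega> * (s * (p1 * p1 + p2 * p2))"
        unfolding a by (simp add: power2_eq_square algebra_simps)
      also have "\<dots> = s * (B w e1 * B w e1 + B w e2 * B w e2) + 2 * \<omega> * ((s - 1) * \<omega>) + \<omega> * \<omega> * (2 - s)"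
        unfolding c1 c2 by (simp add: algebra_simps)
      also have "\<dots> = s * B w w" unfolding ww \<omega>_def[symmetric] by (simp add: algebra_simps)
      finally have "(s * u1)\<^sup>2 + (s * u2)\<^sup>2 = B w w" using s by simp
      then show ?thesis
        unfolding s_def[symmetric] u1_def[symmetric] u2_def[symmetric] w_def[symmetric]
        by (simp add: power_mult_distrib algebra_simps)
    qed
  qed
  obtain c where c: "admissible_chart A c" "m \<in> fst c" "snd c = \<Phi>" "fst c \<subseteq> W"
  proof (rule chart_from_map[OF W(1,2) \<Phi>W ac0 cm])
    fix v assume "pd c0 v \<Phi> m = 0"
    then have "B (pd c0 v t m) (pd c0 v t m) = 0" using key[OF W(2) ac0 cm, of v] by simp
    then have "dif A t m v = 0" using third_positive[of m v] by (force simp: dif_eq_pd c0_def)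
    then show "v = 0" using nd by blast
  qed (use that in auto)
  have III: "third_ff A B normal_map y (coord_vec A c v y) (coord_vec A c w y) = B (pd c v t y) (pd c w t y)"
    if "y \<in> fst c" for v w y
    using dif_coord_vec[OF t_smooth c(1) that] by (simp add: third_ff_eq)
  have sq: "B (pd c v t y) (pd c v t y) = (1 + \<nu>0 y)\<^sup>2 * ((v $ 1)\<^sup>2 + (v $ 2)\<^sup>2)" if "y \<in> fst c" for v y
    using key[of y c v] that c(1,4) pd_snd_chart[OF c(1) that, of v] c(3) by auto
  have "conformal_chart A (third_ff A B normal_map) c"
    unfolding conformal_chart_def
  proof (intro conjI c(1) ballI)
    fix y assume y: "y \<in> fst c"
    have l: "linear (\<lambda>v. pd c v t y)" by (rule pd_linear[OF t_smooth c(1) y])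
    have n: "1 + \<nu>0 y \<noteq> 0" using W(3) c(4) y by auto
    \<comment> \<open>Polarization: \<open>sq\<close> gives all squares, and the square of the sum
      of the unit vectors yields their orthogonality.\<close>
    have "B (pd c (axis 1 1 + axis 2 1) t y) (pd c (axis 1 1 + axis 2 1) t y) = (1 + \<nu>0 y)\<^sup>2 * 2"
      using sq[OF y, of "axis 1 1 + axis 2 1"] by (simp add: axis_def)
    then have "B (pd c (axis 1 1) t y) (pd c (axis 1 1) t y) + 2 * B (pd c (axis 1 1) t y) (pd c (axis 2 1) t y)
       + B (pd c (axis 2 1) t y) (pd c (axis 2 1) t y) = (1 + \<nu>0 y)\<^sup>2 * 2"
      unfolding linear_add[OF l] by (simp add: expand sym[of "pd c (axis 2 1) t y" "pd c (axis 1 1) t y"])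
    moreover have "B (pd c (axis 1 1) t y) (pd c (axis 1 1) t y) = (1 + \<nu>0 y)\<^sup>2"
      "B (pd c (axis 2 1) t y) (pd c (axis 2 1) t y) = (1 + \<nu>0 y)\<^sup>2"
      using sq[OF y] by (simp_all add: axis_def)
    ultimately show "conformal_frame (third_ff A B normal_map y) (coord_vec A c (axis 1 1) y) (coord_vec A c (axis 2 1) y)"
      unfolding conformal_frame_def III[OF y] using n by simp
  qed
  then show ?thesis using that c(2) by blast
qed

end

section \<open>Principal frames and the \<open>L\<close>-isothermic condition\<close>

context lift
begin

text \<open>Rodrigues' equations for the lifts: \<open>r1\<close> and \<open>r2\<close> are the
  principal radii, and they differ because there are no umbilics.\<close>

definition principal :: "'m \<Rightarrow> real ^ 2 \<Rightarrow> real ^ 2 \<Rightarrow> real \<Rightarrow> real \<Rightarrow> bool" where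
  "principal x X Y r1 r2 \<longleftrightarrow> dif A t x X \<noteq> 0 \<and> dif A t x Y \<noteq> 0 \<and> B (dif A t x X) (dif A t x Y) = 0 \<and>
     dif A F x X = - r1 *\<^sub>R dif A t x X \<and> dif A F x Y = - r2 *\<^sub>R dif A t x Y \<and> r1 \<noteq> r2"

lemma dt_linear: "linear (dif A t x)" and dF_linear: "linear (dif A F x)"
  by (rule dif_linear[OF t_smooth], rule dif_linear[OF F_smooth])

lemma principal_swap: "principal x X Y r1 r2 \<Longrightarrow> principal x Y X r2 r1"
  by (auto simp: principal_def sym)

lemma principal_span:
  assumes "principal x X Y r1 r2" obtains p q where "Z = p *\<^sub>R X + q *\<^sub>R Y"
proof (rule real2_basis[of X Y Z])
  fix p q assume "p *\<^sub>R X + q *\<^sub>R Y = 0"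
  then have "dif A t x (p *\<^sub>R X + q *\<^sub>R Y) = 0" using linear_0[OF dt_linear] by simp
  then have e: "p *\<^sub>R dif A t x X + q *\<^sub>R dif A t x Y = 0"
    by (simp add: linear_add[OF dt_linear] linear_cmul[OF dt_linear])
  have "B (p *\<^sub>R dif A t x X + q *\<^sub>R dif A t x Y) (dif A t x X) = 0"
    "B (p *\<^sub>R dif A t x X + q *\<^sub>R dif A t x Y) (dif A t x Y) = 0" unfolding e by (simp_all add: expand)
  then show "p = 0 \<and> q = 0"
    using assms third_positive[of x X] third_positive[of x Y] sym[of "dif A t x Y" "dif A t x X"]
    by (auto simp: principal_def expand)
qed (use that in auto)

lemma principal_nondegenerate:
  assumes "principal x X Y r1 r2" "Z \<noteq> 0" shows "dif A t x Z \<noteq> 0"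
proof
  assume z: "dif A t x Z = 0"
  obtain p q where Z: "Z = p *\<^sub>R X + q *\<^sub>R Y" using principal_span[OF assms(1)] .
  have e: "p *\<^sub>R dif A t x X + q *\<^sub>R dif A t x Y = 0"
    using z unfolding Z by (simp add: linear_add[OF dt_linear] linear_cmul[OF dt_linear])
  have "B (p *\<^sub>R dif A t x X + q *\<^sub>R dif A t x Y) (dif A t x X) = 0"
    "B (p *\<^sub>R dif A t x X + q *\<^sub>R dif A t x Y) (dif A t x Y) = 0" unfolding e by (simp_all add: expand)
  then have "p = 0" "q = 0"
    using assms third_positive[of x X] third_positive[of x Y] sym[of "dif A t x Y" "dif A t x X"]
    by (auto simp: principal_def expand)
  then show False using Z assms(2) by simp
qed

text \<open>A curvature sphere with (\<sigma>, qinf) not zero has a component in F and is a multiple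
  of F + r t. The condition d\<sigma>(X) in f then becomes dF(X) + r dt(X) = 0, as this vector is
  orthogonal to qinf and pp.\<close>

lemma principal_of_frame:
  assumes fr: "frame_at s1 s2 \<sigma>1 \<sigma>2 x" and X: "X \<noteq> 0" "dif A \<sigma>1 x X \<in> f x" and Y: "Y \<noteq> 0" "dif A \<sigma>2 x Y \<in> f x"
    and g: "B (\<sigma>1 x) qinf \<noteq> 0" "B (\<sigma>2 x) qinf \<noteq> 0"
  obtains r1 r2 g1 g2 where "principal x X Y r1 r2" "\<sigma>1 x = g1 *\<^sub>R (F x + r1 *\<^sub>R t x)" "\<sigma>2 x = g2 *\<^sub>R (F x + r2 *\<^sub>R t x)"
    "g1 \<noteq> 0" "g2 \<noteq> 0"
proof -
  have half: "\<exists>r g. dif A F x X = - r *\<^sub>R dif A t x X \<and> dif A t x X \<noteq> 0 \<and> \<sigma> x = g *\<^sub>R (F x + r *\<^sub>R t x) \<and> g \<noteq> 0"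
    if s: "section_at \<sigma> x" and X: "X \<noteq> 0" "dif A \<sigma> x X \<in> f x" and g: "B (\<sigma> x) qinf \<noteq> 0" for \<sigma> X
  proof -
    have "\<sigma> x \<in> span {F x, t x}" using section_at_mem[OF s] f_eq by simp
    then obtain k h where k: "\<sigma> x = k *\<^sub>R F x + h *\<^sub>R t x" unfolding span_2 by auto
    have k0: "k \<noteq> 0" using g F[of x] t[of x] by (auto simp: k expand)
    have "dif A \<sigma> x X - (k *\<^sub>R dif A F x X + h *\<^sub>R dif A t x X) \<in> f x"
      by (rule dif_section_lincomb[OF s section_F section_t k])
    from subspace_diff[OF subspace_f X(2) this]
    have "k *\<^sub>R dif A F x X + h *\<^sub>R dif A t x X \<in> f x" by (simp add: add.commute)
    then have z: "k *\<^sub>R dif A F x X + h *\<^sub>R dif A t x X = 0"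
      by (rule mem_f_zero) (simp_all add: expand dif_F_t)
    have "k *\<^sub>R (dif A F x X + (h / k) *\<^sub>R dif A t x X) = 0"
      using z k0 by (simp add: scaleR_add_right)
    then have r: "dif A F x X = - (h / k) *\<^sub>R dif A t x X"
      using k0 by (simp add: eq_neg_iff_add_eq_0)
    have "dif A t x X \<noteq> 0"
    proof
      assume "dif A t x X = 0"
      then have "dif A F x X \<in> f x" "dif A t x X \<in> f x" using r subspace_0[OF subspace_f] by auto
      then have "X = 0" using f_eq by (intro immersed[OF section_F section_t]) auto
      then show False using X by simp
    qed
    moreover have "\<sigma> x = k *\<^sub>R (F x + (h / k) *\<^sub>R t x)" using k k0 by (simp add: scaleR_add_right)
    ultimately show ?thesis using r k0 by blast
  qed
  have s: "section_at \<sigma>1 x" "section_at \<sigma>2 x" using fr by (simp_all add: frame_at_def)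
  obtain r1 g1 where 1: "dif A F x X = - r1 *\<^sub>R dif A t x X" "dif A t x X \<noteq> 0" "\<sigma>1 x = g1 *\<^sub>R (F x + r1 *\<^sub>R t x)" "g1 \<noteq> 0"
    using half[OF s(1) X g(1)] by auto
  obtain r2 g2 where 2: "dif A F x Y = - r2 *\<^sub>R dif A t x Y" "dif A t x Y \<noteq> 0" "\<sigma>2 x = g2 *\<^sub>R (F x + r2 *\<^sub>R t x)" "g2 \<noteq> 0"
    using half[OF s(2) Y g(2)] by auto
  have r: "r1 \<noteq> r2"
  proof
    assume "r1 = r2"
    then have "g2 *\<^sub>R \<sigma>1 x + (- g1) *\<^sub>R \<sigma>2 x = 0" unfolding 1(3) 2(3) by simp
    from frame_at_independent[OF fr this] show False using 2(4) by simp
  qed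
  \<comment> \<open>Symmetry of (dF, dt): as for a symmetric matrix, different eigenvalues give
    orthogonal directions.\<close>
  have "- r1 * B (dif A t x X) (dif A t x Y) = - r2 * B (dif A t x X) (dif A t x Y)"
    using dF_dt_commute[of x X Y] unfolding 1(1) 2(1) by (simp add: expand sym[of "dif A t x Y"])
  then have "B (dif A t x X) (dif A t x Y) = 0" using r by simp
  then have "principal x X Y r1 r2" using 1 2 r by (simp add: principal_def)
  then show ?thesis using 1 2 that by blast
qed

lemma third_symmetric_bilinear: "symmetric_bilinear (third_ff A B normal_map x)"
proof -
  have l: "linear (\<lambda>Y. B a (dif A t x Y))" for a
    by (rule linearI) (simp_all add: linear_add[OF dt_linear] linear_cmul[OF dt_linear] expand)
  have r: "linear (\<lambda>X. B (dif A t x X) a)" for a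
    by (rule linearI) (simp_all add: linear_add[OF dt_linear] linear_cmul[OF dt_linear] expand)
  show ?thesis using l r sym by (simp add: symmetric_bilinear_def third_ff_eq[abs_def])
qed

text \<open>The differential is q(X, Y) = (\<Psi> X, dt Y). By \<open>struct\<close> it is diagonal
  in the principal directions with opposite eigenvalues k (r2 - r1) and k (r1 - r2) with respect to
  III. This already gives symmetry, vanishing trace and commutation with II; closedness of \<Psi>
  serves holomorphy.\<close>

lemma L_isothermicI:
  fixes \<Psi> :: "'m \<Rightarrow> real ^ 2 \<Rightarrow> 'v"
  assumes lin: "\<And>x. linear (\<Psi> x)"
    and sm: "\<And>c x v. c \<in> A \<Longrightarrow> x \<in> fst c \<Longrightarrow> smooth_at A (\<lambda>y. \<Psi> y (coord_vec A c v y)) x"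
    and cl: "closed_one_form A \<Psi>"
    and pp: "\<And>x X. \<Psi> x X \<in> perp B (f x)" "\<And>x X. B (\<Psi> x X) qinf = 0" "\<And>x X. B (\<Psi> x X) pp = 0"
    and struct: "\<And>x. \<exists>X Y r1 r2 k. principal x X Y r1 r2 \<and> k \<noteq> 0 \<and>
      (\<forall>Z. B (\<Psi> x Z) (dif A t x X) = k * (r2 - r1) * B (dif A t x Z) (dif A t x X)) \<and>
      (\<forall>Z. B (\<Psi> x Z) (dif A t x Y) = k * (r1 - r2) * B (dif A t x Z) (dif A t x Y))"
  shows "L_isothermic A B point_map normal_map"
proof -
  define q where "q x X Y = B (\<Psi> x X) (dif A t x Y)" for x X Y
  let ?g = "third_ff A B normal_map"
  have nd: "dif A t x X \<noteq> 0" if "X \<noteq> 0" for x X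
    using struct[of x] principal_nondegenerate that by blast
  have qlin: "linear (\<lambda>Y. q x X Y)" "linear (\<lambda>X. q x X Y)" for x X Y
    by (rule linearI; simp add: q_def linear_add[OF dt_linear] linear_cmul[OF dt_linear]
        linear_add[OF lin] linear_cmul[OF lin] expand)+
  have qsym: "q x Z W = q x W Z" for x Z W
  proof -
    obtain X Y r1 r2 k where s: "principal x X Y r1 r2"
      "\<And>Z. q x Z X = k * (r2 - r1) * B (dif A t x Z) (dif A t x X)"
      "\<And>Z. q x Z Y = k * (r1 - r2) * B (dif A t x Z) (dif A t x Y)"
      using struct[of x] unfolding q_def by blast
    obtain a b where W: "W = a *\<^sub>R X + b *\<^sub>R Y" by (rule principal_span[OF s(1)])
    obtain a' b' where Z: "Z = a' *\<^sub>R X + b' *\<^sub>R Y" by (rule principal_span[OF s(1)])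
    have "q x X Y = 0" "q x Y X = 0"
      using s(1,2,3) sym[of "dif A t x Y" "dif A t x X"] by (auto simp: principal_def)
    then show ?thesis
      unfolding W Z by (simp add: linear_add[OF qlin(1)] linear_cmul[OF qlin(1)] linear_add[OF qlin(2)] linear_cmul[OF qlin(2)])
  qed
  have qbil: "symmetric_bilinear (q x)" for x
    using qlin qsym by (auto simp: symmetric_bilinear_def)
  have tf: "trace_free (?g x) (q x)" for x
    unfolding trace_free_def
  proof (intro allI impI)
    fix e1 e2 assume e: "conformal_frame (?g x) e1 e2"
    obtain X Y r1 r2 k where s: "principal x X Y r1 r2"
      "\<And>Z. q x Z X = k * (r2 - r1) * B (dif A t x Z) (dif A t x X)"
      "\<And>Z. q x Z Y = k * (r1 - r2) * B (dif A t x Z) (dif A t x Y)"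
      using struct[of x] unfolding q_def by blast
    have "q x e1 e1 + q x e2 e2 = 0 * ?g x e1 e1"
    proof (rule conformal_frame_trace[OF third_symmetric_bilinear qbil _ _ _ _ _ e])
      show "\<exists>p q. Z = p *\<^sub>R X + q *\<^sub>R Y" for Z
        by (rule principal_span[OF s(1), of Z]) blast
      show "?g x X Y = 0" "?g x X X > 0" "?g x Y Y > 0"
        using s(1) third_positive by (auto simp: third_ff_eq principal_def)
      show "q x X X * ?g x Y Y + q x Y Y * ?g x X X = 0 * ?g x X X * ?g x Y Y"
        by (simp add: s(2,3) third_ff_eq algebra_simps)
    qed
    then show "q x e1 e1 + q x e2 e2 = 0" by simp
  qed
  have hol: "\<exists>c. m \<in> fst c \<and> conformal_chart A ?g c \<and>
        (\<lambda>z. let y = chart_inv c (of_complex_vec z)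
              in part20 (q y) (coord_vec A c (axis 1 1) y) (coord_vec A c (axis 2 1) y))
          holomorphic_on to_complex ` snd c ` fst c" for m
  proof -
    obtain c where c: "m \<in> fst c" "conformal_chart A ?g c" using conformal_chart_ex[OF nd] by blast
    have ac: "admissible_chart A c" using c(2) by (simp add: conformal_chart_def)
    have cf: "conformal_frame (?g y) (coord_vec A c (axis 1 1) y) (coord_vec A c (axis 2 1) y)" if "y \<in> fst c" for y
      using c(2) that by (simp add: conformal_chart_def)
    define Pu where "Pu y = \<Psi> y (coord_vec A c (axis 1 1) y)" for y
    define Pv where "Pv y = \<Psi> y (coord_vec A c (axis 2 1) y)" for y
    define tu where "tu y = pd c (axis 1 1) t y" for y
    define tv where "tv y = pd c (axis 2 1) t y" for y
    define \<phi> where "\<phi> y = part20 (q y) (coord_vec A c (axis 1 1) y) (coord_vec A c (axis 2 1) y)" for y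
    have tuv: "dif A t y (coord_vec A c (axis 1 1) y) = tu y" "dif A t y (coord_vec A c (axis 2 1) y) = tv y"
      if "y \<in> fst c" for y
      using dif_coord_vec[OF t_smooth ac that] by (simp_all add: tu_def tv_def)
    have conf: "B (tu y) (tv y) = 0" "B (tu y) (tu y) = B (tv y) (tv y)" "B (tu y) (tu y) \<noteq> 0" if "y \<in> fst c" for y
      using cf[OF that] tuv[OF that] by (simp_all add: conformal_frame_def third_ff_eq)
    have Pq: "B (Pu y) (tv y) = B (Pv y) (tu y)" "B (Pu y) (tu y) = - B (Pv y) (tv y)" if "y \<in> fst c" for y
      using qsym[of y "coord_vec A c (axis 1 1) y" "coord_vec A c (axis 2 1) y"]
        tf[of y, unfolded trace_free_def, rule_format, OF cf[OF that]] tuv[OF that]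
      by (simp_all add: q_def Pu_def Pv_def)
    \<comment> \<open>The hypotheses concern the charts of \<open>A\<close>, whereas
      \<open>c\<close> is a conformal chart.\<close>
    have smc: "smooth_at A (\<lambda>y. \<Psi> y (coord_vec A c v y)) y" if y: "y \<in> fst c" for v y
    proof -
      obtain c' where c': "c' \<in> A" "y \<in> fst c'" by (rule atlas_cover)
      show ?thesis
        by (rule smooth_at_coord_change[OF lin ac y admissible_atlas[OF c'(1)] c'(2) sm[OF c']])
    qed
    have Ps: "smooth_at A Pu y" "smooth_at A Pv y" if "y \<in> fst c" for y
      using smc[OF that] by (simp_all add: Pu_def[abs_def] Pv_def[abs_def])
    have clc: "pd c (axis 2 1) Pu y = pd c (axis 1 1) Pv y" if y: "y \<in> fst c" for y
    proof -
      obtain c' where c': "c' \<in> A" "y \<in> fst c'" by (rule atlas_cover)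
      have "pd c' (axis 1 1) (\<lambda>y. \<Psi> y (coord_vec A c' (axis 2 1) y)) y =
          pd c' (axis 2 1) (\<lambda>y. \<Psi> y (coord_vec A c' (axis 1 1) y)) y"
        using cl[unfolded closed_one_form_def, rule_format, OF c', of "axis 2 1" "axis 1 1"]
          dif_coord_vec[OF sm[OF c'] admissible_atlas[OF c'(1)] c'(2)] by simp
      from closed_change_chart[OF lin ac y admissible_atlas[OF c'(1)] c'(2) sm[OF c'] this, of "axis 2 1" "axis 1 1"]
      show ?thesis by (simp add: Pu_def[abs_def] Pv_def[abs_def])
    qed
    define q11 where "q11 y = B (Pu y) (tu y)" for y
    define q12 where "q12 y = B (Pu y) (tv y)" for y
    have ts: "smooth_at A tu y" "smooth_at A tv y" if "y \<in> fst c" for y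
      unfolding tu_def[abs_def] tv_def[abs_def] by (intro smooth_at_pd t_smooth ac that)+
    have qs: "smooth_at A q11 y" "smooth_at A q12 y" if "y \<in> fst c" for y
      unfolding q11_def[abs_def] q12_def[abs_def] by (intro smooth_at_B Ps ts that)+
    \<comment> \<open>As q has trace zero, (q11 - q22)/4 is q11/2.\<close>
    have \<phi>: "\<phi> y = q11 y *\<^sub>R (1 / 2) + q12 y *\<^sub>R (- \<i> / 2)" if "y \<in> fst c" for y
      using Pq[OF that] tuv[OF that]
      by (simp add: \<phi>_def part20_def q_def q11_def q12_def complex_eq_iff flip: Pu_def Pv_def)
    have CR: "pd c (axis 2 1) q11 y = pd c (axis 1 1) q12 y" "pd c (axis 2 1) q12 y = - pd c (axis 1 1) q11 y"
      if y: "y \<in> fst c" for y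
    proof -
      have ev: "eventually (\<lambda>y. y \<in> fst c) (nhds y)" by (rule eventually_chart[OF ac y])
      have e1: "eventually (\<lambda>y. B (tu y) (tv y) = 0 \<and> B (tu y) (tu y) = B (tv y) (tv y)) (nhds y)"
        using ev by eventually_elim (use conf in auto)
      have e2: "eventually (\<lambda>y. B (Pu y) (tv y) = B (Pv y) (tu y) \<and> B (Pu y) (tu y) = - B (Pv y) (tv y)) (nhds y)"
        using ev by eventually_elim (use Pq in auto)
      have px: "Pu y \<in> perp B (f y)" "B (Pu y) qinf = 0" "B (Pu y) pp = 0"
        "Pv y \<in> perp B (f y)" "B (Pv y) qinf = 0" "B (Pv y) pp = 0"
        using pp by (auto simp: Pu_def Pv_def)
      note cod = codazzi_conformal[OF ac y tu_def tv_def e1 conf(3)[OF y] Ps[OF y] e2 px]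
      show "pd c (axis 2 1) q11 y = pd c (axis 1 1) q12 y" "pd c (axis 2 1) q12 y = - pd c (axis 1 1) q11 y"
        using cod unfolding clc[OF y] by (simp_all add: expand q11_def[abs_def] q12_def[abs_def])
    qed
    have ic: "is_chart c" by (rule admissible_is_chart[OF ac])
    have \<phi>ev: "eventually (\<lambda>y. q11 y *\<^sub>R (1 / 2) + q12 y *\<^sub>R (- \<i> / 2) = \<phi> y) (nhds y)" if "y \<in> fst c" for y
      using eventually_chart[OF ac that] by eventually_elim (simp add: \<phi>)
    have \<phi>s: "smooth_at A \<phi> y" if "y \<in> fst c" for y
    proof -
      have "smooth_at A (\<lambda>y. q11 y *\<^sub>R (1 / 2) + q12 y *\<^sub>R (- \<i> / 2)) y"
        by (intro smooth_at_add smooth_at_scaleR qs that smooth_at_const)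
      then show ?thesis using smooth_at_cong[OF \<phi>ev[OF that]] by simp
    qed
    have \<phi>d: "pd c v \<phi> y = pd c v q11 y *\<^sub>R (1 / 2) + pd c v q12 y *\<^sub>R (- \<i> / 2)" if y: "y \<in> fst c" for v y
    proof -
      have "pd c v \<phi> y = pd c v (\<lambda>y. q11 y *\<^sub>R (1 / 2) + q12 y *\<^sub>R (- \<i> / 2)) y"
        by (rule pd_cong[OF \<phi>ev[OF y] ac y, symmetric])
      also have "\<dots> = pd c v (\<lambda>y. q11 y *\<^sub>R (1 / 2)) y + pd c v (\<lambda>y. q12 y *\<^sub>R (- \<i> / 2)) y"
        by (intro pd_add smooth_at_scaleR qs y smooth_at_const ac)
      also have "pd c v (\<lambda>y. q11 y *\<^sub>R (1 / 2 :: complex)) y = q11 y *\<^sub>R pd c v (\<lambda>_. 1 / 2) y + pd c v q11 y *\<^sub>R (1 / 2)"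
        by (intro pd_scaleR qs y smooth_at_const ac)
      also have "pd c v (\<lambda>y. q12 y *\<^sub>R (- \<i> / 2)) y = q12 y *\<^sub>R pd c v (\<lambda>_. - \<i> / 2) y + pd c v q12 y *\<^sub>R (- \<i> / 2)"
        by (intro pd_scaleR qs y smooth_at_const ac)
      finally show ?thesis by (simp add: pd_const)
    qed
    have "(\<lambda>z. (\<phi> \<circ> chart_inv c) (of_complex_vec z)) holomorphic_on to_complex ` (snd c ` fst c)"
    proof (rule holomorphic_on_CauchyRiemann)
      show "open (snd c ` fst c)" using ic by (simp add: is_chart_def)
      fix v assume "v \<in> snd c ` fst c"
      then obtain y where y: "y \<in> fst c" "v = snd c y" by auto
      show "(\<phi> \<circ> chart_inv c) differentiable at v"
        unfolding y(2) by (rule smooth_at_differentiable[OF \<phi>s[OF y(1)] ac y(1)])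
      have "pd c (axis 2 1) \<phi> y = \<i> * pd c (axis 1 1) \<phi> y"
        unfolding \<phi>d[OF y(1)] CR[OF y(1)] by (simp add: complex_eq_iff)
      then show "frechet_derivative (\<phi> \<circ> chart_inv c) (at v) (axis 2 1) =
          \<i> * frechet_derivative (\<phi> \<circ> chart_inv c) (at v) (axis 1 1)"
        by (simp add: pd_def y(2))
    qed
    then have "(\<lambda>z. let y = chart_inv c (of_complex_vec z)
              in part20 (q y) (coord_vec A c (axis 1 1) y) (coord_vec A c (axis 2 1) y))
          holomorphic_on to_complex ` snd c ` fst c"
      by (simp add: \<phi>_def Let_def)
    then show ?thesis using c by blast
  qed
  have nz: "\<exists>m X Y. q m X Y \<noteq> 0"
  proof -
    \<comment> \<open>Types are inhabited, so the surface has a point.\<close>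
    obtain x :: 'm where "x = undefined" by simp
    obtain X Y r1 r2 k where s: "principal x X Y r1 r2" "k \<noteq> 0"
      "q x X X = k * (r2 - r1) * B (dif A t x X) (dif A t x X)"
      using struct[of x] unfolding q_def by blast
    have "q x X X \<noteq> 0" using s third_positive[of x X] by (simp add: principal_def)
    then show ?thesis by blast
  qed
  have "\<exists>\<mu>. \<forall>e1 e2. conformal_frame (?g x) e1 e2 \<longrightarrow>
      part20 (second_ff A B point_map normal_map x) e1 e2 = of_real \<mu> * part20 (q x) e1 e2" for x
  proof -
    obtain X Y r1 r2 k where s: "principal x X Y r1 r2" "k \<noteq> 0"
      "\<And>Z. q x Z X = k * (r2 - r1) * B (dif A t x Z) (dif A t x X)"
      "\<And>Z. q x Z Y = k * (r1 - r2) * B (dif A t x Z) (dif A t x Y)"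
      using struct[of x] unfolding q_def by blast
    \<comment> \<open>The radii r1, r2 are their mean plus and minus (r1 - r2)/2, and q has
      eigenvalues \<plusminus>k (r2 - r1); hence the factor - 1/(2 k).\<close>
    have II: "second_ff A B point_map normal_map x Z W = (r1 + r2) / 2 * ?g x Z W + (- 1 / (2 * k)) * q x Z W" for Z W
    proof -
      obtain a b where W: "W = a *\<^sub>R X + b *\<^sub>R Y" by (rule principal_span[OF s(1)])
      have 1: "second_ff A B point_map normal_map x Z X = r1 * ?g x Z X" "second_ff A B point_map normal_map x Z Y = r2 * ?g x Z Y"
        using s(1) dF_dt_commute[of x Z X] dF_dt_commute[of x Z Y] sym[of _ "dif A t x Z"]
        by (simp_all add: second_ff_eq third_ff_eq principal_def expand)
      have 2: "second_ff A B point_map normal_map x Z W = a * second_ff A B point_map normal_map x Z X + b * second_ff A B point_map normal_map x Z Y"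
        "?g x Z W = a * ?g x Z X + b * ?g x Z Y" "q x Z W = a * q x Z X + b * q x Z Y"
        unfolding W by (simp_all add: second_ff_eq third_ff_eq q_def linear_add[OF dt_linear] linear_cmul[OF dt_linear] expand algebra_simps)
      show ?thesis unfolding 2 1 s(3,4) using s(2) by (simp add: third_ff_eq field_simps)
    qed
    \<comment> \<open>The (2,0)-part of III vanishes on a conformal frame, so only the term with q
      survives.\<close>
    have "part20 (second_ff A B point_map normal_map x) e1 e2 = of_real (- 1 / (2 * k)) * part20 (q x) e1 e2"
      if "conformal_frame (?g x) e1 e2" for e1 e2
    proof -
      have "?g x e1 e2 = 0" "?g x e1 e1 = ?g x e2 e2" using that by (auto simp: conformal_frame_def)
      then show ?thesis unfolding part20_def II by (simp add: complex_eq_iff algebra_simps diff_divide_distrib)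
    qed
    then show ?thesis by blast
  qed
  then have "\<exists>\<mu>. \<forall>x e1 e2. conformal_frame (?g x) e1 e2 \<longrightarrow>
      part20 (second_ff A B point_map normal_map x) e1 e2 = of_real (\<mu> x) * part20 (q x) e1 e2"
    by (intro choice allI)
  moreover have "nondegenerate (?g x)" for x
    unfolding nondegenerate_def
  proof (intro allI impI)
    fix X assume "\<forall>Y. ?g x X Y = 0"
    then have "B (dif A t x X) (dif A t x X) = 0" by (simp add: third_ff_eq)
    then show "X = 0" using third_positive[of x X] nd[of X x] by force
  qed
  ultimately show ?thesis
    unfolding L_isothermic_def holomorphic_quadratic_differential_def
    using qbil tf hol nz by (intro conjI allI exI[of _ q]) auto
qed

end

section \<open>From conserved quantities to \<open>L\<close>-isothermic surfaces\<close>

locale isothermic_frame =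
  conserved_frame A B f s1 s2 c m \<sigma>1 \<sigma>2 X Y \<zeta> p1 qinf + lift A B f qinf q0 pp F t
  for A :: "'m::{t2_space, second_countable_topology} chart set"
    and B :: "'v::euclidean_space \<Rightarrow> 'v \<Rightarrow> real" and f :: "'m \<Rightarrow> 'v set"
    and s1 s2 c m \<sigma>1 \<sigma>2 X Y \<zeta> p1 qinf q0 pp F t

locale conserved_lift =
  conserved A B f s1 s2 \<zeta> p1 qinf + lift A B f qinf q0 pp F t
  for A :: "'m::{t2_space, second_countable_topology} chart set"
    and B :: "'v::euclidean_space \<Rightarrow> 'v \<Rightarrow> real" and f :: "'m \<Rightarrow> 'v set"
    and s1 s2 \<zeta> p1 qinf q0 pp F t

section \<open>The closed form obtained from a conserved quantity\<close>

context conserved_lift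
begin

definition lam :: "'m \<Rightarrow> real" where "lam x = - B (p1 x) pp"

lemma lam_smooth: "smooth_at A lam x"
  unfolding lam_def[abs_def]
  using smooth_at_uminus[OF smooth_at_B[OF p1_smooth smooth_at_const]] by simp

lemma p1_eq: "p1 x = lam x *\<^sub>R t x"
proof -
  have "p1 x - lam x *\<^sub>R t x = 0"
    by (rule mem_f_zero[of _ x])
      (auto intro!: subspace_add subspace_neg subspace_diff subspace_scale subspace_f p1_f t_mem simp: expand p1_qinf t lam_def)
  then show ?thesis by simp
qed

lemma dif_p1_eq: "dif A p1 x Z = lam x *\<^sub>R dif A t x Z + dif A lam x Z *\<^sub>R t x"
proof -
  have "dif A p1 x Z = dif A (\<lambda>y. lam y *\<^sub>R t y) x Z"
    by (rule dif_cong) (simp add: p1_eq)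
  then show ?thesis using dif_scaleR[OF lam_smooth t_smooth] by simp
qed

lemma \<zeta>_qinf: "blinfun_apply (\<zeta> x Z) qinf = - (lam x *\<^sub>R dif A t x Z + dif A lam x Z *\<^sub>R t x)"
  using dif_p1[of x Z] dif_p1_eq[of x Z] by simp

text \<open>\<open>Psi\<close> is \<open>lam (dF + H dt)\<close>, where \<open>H\<close> is the mean of the principal radii \<open>r1, r2\<close>. In the form below
  it is visibly closed.\<close>

definition Psi :: "'m \<Rightarrow> real ^ 2 \<Rightarrow> 'v" where
  "Psi x Z = (1 / 2) *\<^sub>R (dif A (\<lambda>y. lam y *\<^sub>R F y) x Z - blinfun_apply (\<zeta> x Z) pp)"

lemma lamF_smooth: "smooth_at A (\<lambda>y. lam y *\<^sub>R F y) x"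
  by (intro smooth_at_scaleR lam_smooth F_smooth)

lemma dif_lamF: "dif A (\<lambda>y. lam y *\<^sub>R F y) x Z = lam x *\<^sub>R dif A F x Z + dif A lam x Z *\<^sub>R F x"
  by (rule dif_scaleR[OF lam_smooth F_smooth])

lemma Psi_linear: "linear (Psi x)"
proof -
  note l = dif_linear[OF lamF_smooth, of x]
  show ?thesis unfolding Psi_def[abs_def]
    by (rule linearI) (simp_all add: linear_add[OF l] linear_cmul[OF l] linear_add[OF \<zeta>_linear]
        linear_cmul[OF \<zeta>_linear] blinfun.add_left blinfun.scaleR_left algebra_simps)
qed

text \<open>The products with qinf cancel: (\<zeta> pp, qinf) = - (pp, \<zeta> qinf) = (pp, dp1) = -
  d lam, which is also (d(lam F), qinf).\<close>

lemma Psi_perp: "Psi x Z \<in> perp B (f x)" "B (Psi x Z) qinf = 0" "B (Psi x Z) pp = 0"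
proof -
  have 1: "dif A (\<lambda>y. lam y *\<^sub>R F y) x Z \<in> perp B (f x)"
    unfolding dif_lamF by (intro subspace_add subspace_scale subspace_perp dF_perp f_subset_perp F_mem)
  have 2: "blinfun_apply (\<zeta> x Z) pp \<in> perp B (f x)"
    unfolding perp_def using \<zeta>_skew_f[of x Z pp] \<zeta>_f by (auto simp: expand)
  show "Psi x Z \<in> perp B (f x)" unfolding Psi_def
    by (intro subspace_scale subspace_diff subspace_perp 1 2)
  have "B (blinfun_apply (\<zeta> x Z) pp) qinf = - dif A lam x Z"
    using \<zeta>_skew_f[of x Z pp qinf] dif_F_t'[of x Z] F_t'[of x] by (simp add: \<zeta>_qinf expand)
  then show "B (Psi x Z) qinf = 0" using dif_F_t[of x Z] F[of x] by (simp add: Psi_def dif_lamF expand)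
  have "B (blinfun_apply (\<zeta> x Z) pp) pp = 0"
    using \<zeta>_skew_f[of x Z pp pp] sym[of pp "blinfun_apply (\<zeta> x Z) pp"] by simp
  then show "B (Psi x Z) pp = 0" using dif_F_t[of x Z] F[of x] by (simp add: Psi_def dif_lamF expand)
qed

lemma Psi_smooth:
  assumes "c \<in> A" "x \<in> fst c" shows "smooth_at A (\<lambda>y. Psi y (coord_vec A c v y)) x"
proof -
  note ac = admissible_atlas[OF assms(1)]
  have "smooth_at A (\<lambda>y. (1 / 2) *\<^sub>R (pd c v (\<lambda>y. lam y *\<^sub>R F y) y - blinfun_apply (zc c v y) pp)) x"
    by (intro smooth_at_scaleR smooth_at_const smooth_at_diff smooth_at_pd lamF_smooth ac assms(2)
        smooth_at_apply zc_smooth assms(1))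
  moreover have "eventually (\<lambda>y. (1 / 2) *\<^sub>R (pd c v (\<lambda>y. lam y *\<^sub>R F y) y - blinfun_apply (zc c v y) pp) =
      Psi y (coord_vec A c v y)) (nhds x)"
    using eventually_chart[OF ac assms(2)]
    by eventually_elim (simp add: Psi_def dif_coord_vec[OF lamF_smooth ac] zc_def)
  ultimately show ?thesis by (simp add: smooth_at_cong)
qed

lemma Psi_closed:
  assumes cl: "closed_one_form A (\<lambda>x X. blinfun_apply (\<zeta> x X) pp)"
  shows "closed_one_form A Psi"
proof (subst closed_one_form_iff, erule Psi_smooth, assumption, intro ballI allI)
  fix c x v w assume c: "c \<in> A" "x \<in> fst c"
  note ac = admissible_atlas[OF c(1)]
  have zs: "smooth_at A (\<lambda>y. blinfun_apply (zc c w y) pp) x" for w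
    by (intro smooth_at_apply zc_smooth smooth_at_const c)
  have "dif A (\<lambda>y. blinfun_apply (\<zeta> y (coord_vec A c w y)) pp) x (coord_vec A c v x) =
     dif A (\<lambda>y. blinfun_apply (\<zeta> y (coord_vec A c v y)) pp) x (coord_vec A c w x)"
    using cl c unfolding closed_one_form_def by blast
  then have z: "pd c v (\<lambda>y. blinfun_apply (zc c w y) pp) x = pd c w (\<lambda>y. blinfun_apply (zc c v y) pp) x"
    using dif_coord_vec[OF zs ac c(2)] by (simp add: zc_def)
  have e: "pd c v (\<lambda>y. Psi y (coord_vec A c w y)) x =
    (1 / 2) *\<^sub>R (pd c v (pd c w (\<lambda>y. lam y *\<^sub>R F y)) x - pd c v (\<lambda>y. blinfun_apply (zc c w y) pp) x)" for v w
  proof -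
    note s1 = smooth_at_pd[OF lamF_smooth ac c(2), of w]
    have "eventually (\<lambda>y. Psi y (coord_vec A c w y) =
       (1 / 2) *\<^sub>R (pd c w (\<lambda>y. lam y *\<^sub>R F y) y - blinfun_apply (zc c w y) pp)) (nhds x)"
      using eventually_chart[OF ac c(2)]
      by eventually_elim (simp add: Psi_def dif_coord_vec[OF lamF_smooth ac] zc_def)
    then have "pd c v (\<lambda>y. Psi y (coord_vec A c w y)) x =
       pd c v (\<lambda>y. (1 / 2) *\<^sub>R (pd c w (\<lambda>y. lam y *\<^sub>R F y) y - blinfun_apply (zc c w y) pp)) x"
      by (rule pd_cong[OF _ ac c(2)])
    also have "\<dots> = (1 / 2) *\<^sub>R pd c v (\<lambda>y. pd c w (\<lambda>y. lam y *\<^sub>R F y) y - blinfun_apply (zc c w y) pp) x"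
      by (intro pd_bounded_linear bounded_linear_scaleR_right smooth_at_diff s1 zs ac c)
    also have "pd c v (\<lambda>y. pd c w (\<lambda>y. lam y *\<^sub>R F y) y - blinfun_apply (zc c w y) pp) x =
       pd c v (pd c w (\<lambda>y. lam y *\<^sub>R F y)) x - pd c v (\<lambda>y. blinfun_apply (zc c w y) pp) x"
      by (intro pd_diff s1 zs ac c)
    finally show ?thesis .
  qed
  show "pd c v (\<lambda>y. Psi y (coord_vec A c w y)) x = pd c w (\<lambda>y. Psi y (coord_vec A c v y)) x"
    unfolding e z pd_commute[OF lamF_smooth ac c(2), of v w] ..
qed

end

sublocale isothermic_frame \<subseteq> conserved_lift
  by unfold_locales

context isothermic_frame
begin

lemma swap_isothermic: "isothermic_frame A B f s2 s1 c m \<sigma>2 \<sigma>1 Y X \<zeta> p1 qinf q0 pp F t"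
  using swap_conserved lift_axioms lift_def legendre_axioms by (simp add: isothermic_frame_def)

abbreviation "XX \<equiv> coord_vec A c (X m) m"
abbreviation "YY \<equiv> coord_vec A c (Y m) m"

text \<open>Pair \<zeta> d1 with qinf and move \<zeta> to the other side, where \<zeta> qinf = -
  dp1; the term with t drops out because \<open>d1\<close> is orthogonal to f.\<close>

lemma lam_d1:
  assumes "blinfun_apply (\<zeta> m Z) d1 = k *\<^sub>R \<sigma>1 m"
  shows "lam m * B (dif A t m Z) d1 = k * B (\<sigma>1 m) qinf"
  using \<zeta>_skew[of Z qinf d1] assms perpD'[OF d1_perp t_mem] sym[of qinf "\<sigma>1 m"]
  by (simp add: \<zeta>_qinf expand)

text \<open>If (\<sigma>1, qinf) = 0, then \<sigma>1 = h t, so \<open>lam_d1\<close> along the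
  direction \<open>YY\<close> forces lam = 0. The exchanged form of \<open>lam_d1\<close> then gives
  (\<sigma>2, qinf) = 0 as well, and all of f would be orthogonal to qinf, against (F, qinf) =
  -1.\<close>

lemma sigma1_qinf: "B (\<sigma>1 m) qinf \<noteq> 0"
proof
  assume g: "B (\<sigma>1 m) qinf = 0"
  define h where "h = - B (\<sigma>1 m) pp"
  have "\<sigma>1 m - h *\<^sub>R t m = 0"
    by (rule mem_f_zero[of _ m])
      (auto intro!: subspace_add subspace_neg subspace_diff subspace_scale subspace_f sigma_mem t_mem simp: expand g t h_def)
  then have s: "\<sigma>1 m = h *\<^sub>R t m + 0 *\<^sub>R t m" by simp
  have "d1 - h *\<^sub>R dif A t m YY \<in> f m"
    using dif_section_lincomb[OF \<sigma>1 section_t section_t s, of YY] dif_Y(2) by simp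
  then have "B d1 (d1 - h *\<^sub>R dif A t m YY) = 0" using perpD[OF d1_perp] by blast
  then have h: "h * B (dif A t m YY) d1 = B d1 d1" using sym[of d1 "dif A t m YY"] by (simp add: expand)
  obtain k where k: "blinfun_apply (\<zeta> m YY) d1 = k *\<^sub>R \<sigma>1 m" by (rule \<zeta>_d1)
  have l0: "lam m = 0" using lam_d1[OF k] g h d1_pos by auto
  obtain Z l where l: "blinfun_apply (\<zeta> m Z) d2 = l *\<^sub>R \<sigma>2 m" "l \<noteq> 0"
    by (rule conserved_frame.\<zeta>_d1_nonzero[OF swap_conserved, unfolded curvature_frame.d1_def[OF swap] d2_def[symmetric]])
  have "B (\<sigma>2 m) qinf = 0"
    using isothermic_frame.lam_d1[OF swap_isothermic, unfolded curvature_frame.d1_def[OF swap] d2_def[symmetric], OF l(1)]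
      l0 l(2) by simp
  moreover have "F m \<in> span {\<sigma>1 m, \<sigma>2 m}" using F_mem[of m] f_m by simp
  then obtain p q where "F m = p *\<^sub>R \<sigma>1 m + q *\<^sub>R \<sigma>2 m" unfolding span_2 by auto
  ultimately show False using g F(1)[of m] by (simp add: expand)
qed

lemma lam_nonzero: "lam m \<noteq> 0"
proof
  assume l: "lam m = 0"
  obtain Z k where k: "blinfun_apply (\<zeta> m Z) d1 = k *\<^sub>R \<sigma>1 m" "k \<noteq> 0" by (rule \<zeta>_d1_nonzero)
  show False using lam_d1[OF k(1)] l k(2) sigma1_qinf by simp
qed

text \<open>Modulo f, \<open>d1\<close> is g1 (r1 - r2) dt(YY). So \<zeta> d1 = k \<sigma>1
  determines \<zeta> on dt(YY), \<open>lam_d1\<close> determines \<open>k\<close>, and skewness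
  transfers the result to \<zeta> pp.\<close>

lemma Psi_principal_Y:
  assumes p: "principal m XX YY r1 r2" and s: "\<sigma>1 m = g1 *\<^sub>R (F m + r1 *\<^sub>R t m)" "g1 \<noteq> 0"
  shows "B (Psi m Z) (dif A t m YY) = lam m / 2 * (r1 - r2) * B (dif A t m Z) (dif A t m YY)"
proof -
  have s': "\<sigma>1 m = g1 *\<^sub>R F m + (g1 * r1) *\<^sub>R t m" using s(1) by (simp add: scaleR_add_right)
  have dF: "dif A F m YY = - r2 *\<^sub>R dif A t m YY" and r: "r1 \<noteq> r2" using p by (auto simp: principal_def)
  have mem: "d1 - (g1 * (r1 - r2)) *\<^sub>R dif A t m YY \<in> f m"
    using dif_section_lincomb[OF \<sigma>1 section_F section_t s', of YY] dif_Y(2)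
    unfolding dF by (simp add: algebra_simps)
  obtain k where k: "blinfun_apply (\<zeta> m Z) d1 = k *\<^sub>R \<sigma>1 m" by (rule \<zeta>_d1)
  have "blinfun_apply (\<zeta> m Z) (d1 - (g1 * (r1 - r2)) *\<^sub>R dif A t m YY) = 0" by (rule \<zeta>_f[OF mem])
  then have e: "(g1 * (r1 - r2)) *\<^sub>R blinfun_apply (\<zeta> m Z) (dif A t m YY) = (k * g1) *\<^sub>R (F m + r1 *\<^sub>R t m)"
    using k s(1) by (simp add: blinfun.diff_right blinfun.scaleR_right)
  have "B (dif A t m Z) (d1 - (g1 * (r1 - r2)) *\<^sub>R dif A t m YY) = 0"
    using perpD[OF dt_perp mem] .
  then have "B (dif A t m Z) d1 = g1 * (r1 - r2) * B (dif A t m Z) (dif A t m YY)" by (simp add: expand)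
  then have "lam m * (g1 * (r1 - r2) * B (dif A t m Z) (dif A t m YY)) = - k * g1"
    using lam_d1[OF k] F(1)[of m] t(1)[of m] by (simp add: s(1) expand)
  then have "g1 * (lam m * (r1 - r2) * B (dif A t m Z) (dif A t m YY) + k) = 0"
    by (simp add: algebra_simps)
  then have "lam m * (r1 - r2) * B (dif A t m Z) (dif A t m YY) + k = 0" using s(2) by simp
  then have k': "k = - lam m * (r1 - r2) * B (dif A t m Z) (dif A t m YY)" by simp
  have "(g1 * (r1 - r2)) * B pp (blinfun_apply (\<zeta> m Z) (dif A t m YY)) = (k * g1) * (- r1)"
    using arg_cong[OF e, of "B pp"] F_t'[of m] by (simp add: expand)
  then have "(g1 * (r1 - r2)) * B pp (blinfun_apply (\<zeta> m Z) (dif A t m YY)) =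
      (g1 * (r1 - r2)) * (lam m * r1 * B (dif A t m Z) (dif A t m YY))"
    unfolding k' by (simp add: algebra_simps)
  then have pz: "B pp (blinfun_apply (\<zeta> m Z) (dif A t m YY)) = lam m * r1 * B (dif A t m Z) (dif A t m YY)"
    using s(2) r by simp
  \<comment> \<open>The term lam dF contributes - r2 and the term with \<zeta> pp contributes r1;
    together with the factor 1/2 this is the stated coefficient.\<close>
  have "B (dif A F m Z) (dif A t m YY) = - r2 * B (dif A t m Z) (dif A t m YY)"
    using dF_dt_commute[of m Z YY] sym[of "dif A t m YY" "dif A t m Z"] unfolding dF by (simp add: expand)
  then show ?thesis
    using \<zeta>_skew[of Z pp "dif A t m YY"] pz perpD'[OF dt_perp F_mem, of m YY]
    by (simp add: Psi_def dif_lamF expand algebra_simps)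
qed

lemma Psi_structure:
  "\<exists>X Y r1 r2 k. principal m X Y r1 r2 \<and> k \<noteq> 0 \<and>
      (\<forall>Z. B (Psi m Z) (dif A t m X) = k * (r2 - r1) * B (dif A t m Z) (dif A t m X)) \<and>
      (\<forall>Z. B (Psi m Z) (dif A t m Y) = k * (r1 - r2) * B (dif A t m Z) (dif A t m Y))"
proof -
  have g2: "B (\<sigma>2 m) qinf \<noteq> 0" by (rule isothermic_frame.sigma1_qinf[OF swap_isothermic])
  obtain r1 r2 g1 g2 where p: "principal m XX YY r1 r2" "\<sigma>1 m = g1 *\<^sub>R (F m + r1 *\<^sub>R t m)"
    "\<sigma>2 m = g2 *\<^sub>R (F m + r2 *\<^sub>R t m)" "g1 \<noteq> 0" "g2 \<noteq> 0"
    by (rule principal_of_frame[OF frame_m dif_X(3,1) dif_Y(3,1) sigma1_qinf g2])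
  have "B (Psi m Z) (dif A t m YY) = lam m / 2 * (r1 - r2) * B (dif A t m Z) (dif A t m YY)" for Z
    by (rule Psi_principal_Y[OF p(1,2,4)])
  moreover have "B (Psi m Z) (dif A t m XX) = lam m / 2 * (r2 - r1) * B (dif A t m Z) (dif A t m XX)" for Z
    by (rule isothermic_frame.Psi_principal_Y[OF swap_isothermic principal_swap[OF p(1)] p(3,5)])
  ultimately show ?thesis using p(1) lam_nonzero
    by (intro exI[of _ XX] exI[of _ YY] exI[of _ r1] exI[of _ r2] exI[of _ "lam m / 2"]) simp
qed

end

lemma (in conserved_lift) L_isothermic:
  assumes "closed_one_form A (\<lambda>x X. blinfun_apply (\<zeta> x X) pp)"
  shows "L_isothermic A B point_map normal_map"
proof (rule L_isothermicI[OF Psi_linear Psi_smooth Psi_closed[OF assms] Psi_perp])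
  fix x
  obtain c \<sigma>1 \<sigma>2 X Y where "conserved_frame A B f s1 s2 c x \<sigma>1 \<sigma>2 X Y \<zeta> p1 qinf"
    by (rule conserved_frame_ex)
  then have F: "isothermic_frame A B f s1 s2 c x \<sigma>1 \<sigma>2 X Y \<zeta> p1 qinf q0 pp F t"
    using lift_axioms lift_def legendre_axioms by (simp add: isothermic_frame_def)
  show "\<exists>X Y r1 r2 k. principal x X Y r1 r2 \<and> k \<noteq> 0 \<and>
      (\<forall>Z. B (Psi x Z) (dif A t x X) = k * (r2 - r1) * B (dif A t x Z) (dif A t x X)) \<and>
      (\<forall>Z. B (Psi x Z) (dif A t x Y) = k * (r1 - r2) * B (dif A t x Z) (dif A t x Y))"
    by (rule isothermic_frame.Psi_structure[OF F])
qed

text \<open>Two linear functionals without common kernel in \<open>f\<close> determine the lifts by Cramer's rule.\<close>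

lemma (in conserved) lift_ex:
  assumes l: "laguerre_frame B qinf q0 pp"
  obtains F t where "conserved_lift A B f s1 s2 \<zeta> p1 qinf q0 pp F t"
proof -
  have lz: "B pp qinf = 0" "B pp pp = -1" "B qinf pp = 0" using l sym[of qinf pp] by (auto simp: laguerre_frame_def)
  \<comment> \<open>By signature such a vector is a multiple of qinf, which does not lie in
    f.\<close>
  have ker: "v = 0" if v: "v \<in> f x" "B v qinf = 0" "B v pp = 0" for v x
  proof (rule ccontr)
    assume "v \<noteq> 0"
    have "v \<in> span {qinf}"
      by (rule lightlike_in_span[OF isotropic[OF v(1) v(1)] v(2,3) lz(2) qinf(2) lz(3) qinf(1)])
    then obtain k where k: "v = k *\<^sub>R qinf" by (auto simp: span_singleton)
    then have "k \<noteq> 0" using \<open>v \<noteq> 0\<close> by auto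
    then have "qinf = (1 / k) *\<^sub>R v" by (simp add: k)
    then have "qinf \<in> f x" using subspace_scale[OF subspace_f v(1)] by metis
    then show False using qinf_not_mem by simp
  qed
  \<comment> \<open>Unique description makes F and t global at once; smoothness is a local matter
    and follows from Cramer's formulas in a curvature frame.\<close>
  define F where "F x = (THE v. v \<in> f x \<and> B v qinf = -1 \<and> B v pp = 0)" for x
  define t where "t x = (THE v. v \<in> f x \<and> B v qinf = 0 \<and> B v pp = -1)" for x
  have the: "(THE v. v \<in> f x \<and> B v qinf = a \<and> B v pp = b) = v" if "v \<in> f x" "B v qinf = a" "B v pp = b" for a b v x
  proof (rule the_equality)
    fix w assume "w \<in> f x \<and> B w qinf = a \<and> B w pp = b"
    then have "w - v = 0" using that
      by (intro ker[of _ x]) (auto intro: subspace_diff[OF subspace_f] simp: expand)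
    then show "w = v" by simp
  qed (use that in auto)
  have main: "\<exists>F' t'. smooth_at A F' x \<and> smooth_at A t' x \<and> eventually (\<lambda>y. F' y \<in> f y \<and> B (F' y) qinf = -1 \<and>
      B (F' y) pp = 0 \<and> t' y \<in> f y \<and> B (t' y) qinf = 0 \<and> B (t' y) pp = -1) (nhds x)" for x
  proof -
    obtain \<sigma>1 \<sigma>2 where fr: "eventually (frame_at s1 s2 \<sigma>1 \<sigma>2) (nhds x)" using frame_ex[OF csb] .
    define D where "D y = B (\<sigma>1 y) qinf * B (\<sigma>2 y) pp - B (\<sigma>2 y) qinf * B (\<sigma>1 y) pp" for y
    have s: "smooth_at A \<sigma>1 x" "smooth_at A \<sigma>2 x"
      using eventually_nhds_x_imp_x[OF fr] by (auto simp: frame_at_def section_at_def)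
    have D0: "D y \<noteq> 0" if fr: "frame_at s1 s2 \<sigma>1 \<sigma>2 y" for y
    proof
      assume z: "D y = 0"
      have m: "\<sigma>1 y \<in> f y" "\<sigma>2 y \<in> f y" using fr section_at_mem by (auto simp: frame_at_def)
      have "B (\<sigma>2 y) qinf *\<^sub>R \<sigma>1 y + (- B (\<sigma>1 y) qinf) *\<^sub>R \<sigma>2 y = 0"
        by (rule ker[of _ y]) (use z in \<open>auto intro!: subspace_add subspace_neg subspace_scale subspace_diff subspace_f m simp: expand D_def\<close>)
      from frame_at_independent[OF fr this] have q: "B (\<sigma>2 y) qinf = 0" "B (\<sigma>1 y) qinf = 0" by auto
      have "B (\<sigma>2 y) pp *\<^sub>R \<sigma>1 y + (- B (\<sigma>1 y) pp) *\<^sub>R \<sigma>2 y = 0"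
        by (rule ker[of _ y]) (use q in \<open>auto intro!: subspace_add subspace_neg subspace_scale subspace_diff subspace_f m simp: expand\<close>)
      from frame_at_independent[OF fr this] have "B (\<sigma>1 y) pp = 0" by auto
      then have "\<sigma>1 y = 0" using q m by (intro ker[of _ y]) auto
      then show False using fr by (simp add: frame_at_def)
    qed
    define F' where "F' y = inverse (D y) *\<^sub>R (B (\<sigma>1 y) pp *\<^sub>R \<sigma>2 y - B (\<sigma>2 y) pp *\<^sub>R \<sigma>1 y)" for y
    define t' where "t' y = inverse (D y) *\<^sub>R (B (\<sigma>2 y) qinf *\<^sub>R \<sigma>1 y - B (\<sigma>1 y) qinf *\<^sub>R \<sigma>2 y)" for y
    have Ds: "smooth_at A (\<lambda>y. inverse (D y)) x"
      using D0[OF eventually_nhds_x_imp_x[OF fr]] unfolding D_def[abs_def]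
      by (intro smooth_at_inverse smooth_at_diff smooth_at_mult smooth_at_B s smooth_at_const)
    have "smooth_at A F' x" "smooth_at A t' x"
      unfolding F'_def[abs_def] t'_def[abs_def]
      by (intro smooth_at_scaleR smooth_at_diff smooth_at_B s smooth_at_const Ds)+
    moreover have "eventually (\<lambda>y. F' y \<in> f y \<and> B (F' y) qinf = -1 \<and>
      B (F' y) pp = 0 \<and> t' y \<in> f y \<and> B (t' y) qinf = 0 \<and> B (t' y) pp = -1) (nhds x)"
      using fr
    proof eventually_elim
      case (elim y)
      have m: "\<sigma>1 y \<in> f y" "\<sigma>2 y \<in> f y" using elim section_at_mem by (auto simp: frame_at_def)
      have F'm: "F' y \<in> f y" and t'm: "t' y \<in> f y"
        unfolding F'_def t'_def by (intro subspace_scale subspace_diff subspace_f m)+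
      have i: "inverse (D y) * D y = 1" using D0[OF elim] by simp
      have "B (F' y) qinf = - (inverse (D y) * D y)" "B (t' y) pp = - (inverse (D y) * D y)"
        by (simp_all add: F'_def t'_def expand D_def algebra_simps)
      moreover have "B (F' y) pp = 0" "B (t' y) qinf = 0" by (simp_all add: F'_def t'_def expand)
      ultimately show ?case using F'm t'm unfolding i by simp
    qed
    ultimately show ?thesis by blast
  qed
  have props: "smooth_at A F x \<and> smooth_at A t x \<and> F x \<in> f x \<and> B (F x) qinf = -1 \<and> B (F x) pp = 0 \<and>
     t x \<in> f x \<and> B (t x) qinf = 0 \<and> B (t x) pp = -1" for x
  proof -
    obtain F' t' where 1: "smooth_at A F' x" "smooth_at A t' x" and 2: "eventually (\<lambda>y. F' y \<in> f y \<and> B (F' y) qinf = -1 \<and>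
      B (F' y) pp = 0 \<and> t' y \<in> f y \<and> B (t' y) qinf = 0 \<and> B (t' y) pp = -1) (nhds x)"
      using main[of x] by auto
    have "eventually (\<lambda>y. F' y = F y) (nhds x)" using 2
      by eventually_elim (auto simp: F_def the)
    moreover have "eventually (\<lambda>y. t' y = t y) (nhds x)" using 2
      by eventually_elim (auto simp: t_def the)
    moreover note eventually_nhds_x_imp_x[OF 2]
    ultimately show ?thesis
      using 1 smooth_at_cong[of F' F x] smooth_at_cong[of t' t x] eventually_nhds_x_imp_x by fastforce
  qed
  have fspan: "f x = span {F x, t x}" for x
  proof
    show "span {F x, t x} \<subseteq> f x" using props[of x] by (intro span_minimal subspace_f) auto
    show "f x \<subseteq> span {F x, t x}"
    proof
      fix v assume v: "v \<in> f x"
      have "v - ((- B v qinf) *\<^sub>R F x + (- B v pp) *\<^sub>R t x) = 0"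
        by (rule ker[of _ x]) (use props[of x] v in \<open>auto intro!: subspace_add subspace_neg subspace_scale subspace_diff subspace_f simp: expand\<close>)
      then have "v = (- B v qinf) *\<^sub>R F x + (- B v pp) *\<^sub>R t x" by simp
      then show "v \<in> span {F x, t x}" unfolding span_2 by blast
    qed
  qed
  have "lift A B f qinf q0 pp F t"
    by unfold_locales (use l qinf props fspan in auto)
  then have "conserved_lift A B f s1 s2 \<zeta> p1 qinf q0 pp F t"
    using conserved_axioms by (simp add: conserved_lift_def)
  then show ?thesis by (rule that)
qed

section \<open>From \<open>L\<close>-isothermic surfaces to conserved quantities\<close>

context lie_form
begin

text \<open>Since the second factors are orthogonal to the null plane of \<open>F\<close> and
  \<open>t\<close>, the commutator is a multiple of their wedge product, with coefficient (A1, C2) -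
  (C1, A2) up to sign.\<close>

lemma wedge_pairs_commute:
  assumes z: "B F F = 0" "B F t = 0" "B t t = 0"
    and p: "\<And>v. v \<in> {A1, C1, A2, C2} \<Longrightarrow> B v F = 0 \<and> B v t = 0"
    and s: "B A1 C2 = B C1 A2"
  shows "(wedge B F A1 + wedge B t C1) o\<^sub>L (wedge B F A2 + wedge B t C2) -
    (wedge B F A2 + wedge B t C2) o\<^sub>L (wedge B F A1 + wedge B t C1) = 0"
proof -
  have q: "B A1 F = 0" "B A1 t = 0" "B C1 F = 0" "B C1 t = 0" "B A2 F = 0" "B A2 t = 0" "B C2 F = 0" "B C2 t = 0"
    using p by auto
  have q': "B F A1 = 0" "B t A1 = 0" "B F C1 = 0" "B t C1 = 0" "B F A2 = 0" "B t A2 = 0" "B F C2 = 0" "B t C2 = 0"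
    using q by (simp_all add: sym)
  have "B t F = 0" using z sym by simp
  note zz = z this q q' s sym[of A2 A1] sym[of C2 C1] sym[of C2 A1] sym[of A2 C1]
  show ?thesis
    by (rule blinfun_eqI)
      (simp add: blinfun.diff_left blinfun.add_left wedge_app expand zz algebra_simps)
qed

end

locale iso_lift = lift A B f qinf q0 pp F t
  for A :: "'m::{t2_space, second_countable_topology} chart set"
    and B :: "'v::euclidean_space \<Rightarrow> 'v \<Rightarrow> real" and f :: "'m \<Rightarrow> 'v set"
    and qinf q0 pp F t +
  fixes s1 s2 :: "'m \<Rightarrow> 'v set" and q :: "'m \<Rightarrow> real ^ 2 \<Rightarrow> real ^ 2 \<Rightarrow> real" and \<mu> :: "'m \<Rightarrow> real"
  assumes csb: "curvature_sphere_bundles A f s1 s2"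
    and third_nondegenerate: "\<And>x. nondegenerate (third_ff A B normal_map x)"
    and q_hol: "holomorphic_quadratic_differential A (third_ff A B normal_map) q"
    and q_nz: "\<exists>m X Y. q m X Y \<noteq> 0"
    and q_comm: "\<And>m e1 e2. conformal_frame (third_ff A B normal_map m) e1 e2 \<Longrightarrow>
          part20 (second_ff A B point_map normal_map m) e1 e2 = of_real (\<mu> m) * part20 (q m) e1 e2"
begin

abbreviation "III \<equiv> third_ff A B normal_map"
abbreviation "II \<equiv> second_ff A B point_map normal_map"

lemma dt_nonzero: "X \<noteq> 0 \<Longrightarrow> dif A t x X \<noteq> 0"
  using third_nondegenerate[of x] by (auto simp: nondegenerate_def third_ff_eq expand)

lemma second_symmetric_bilinear: "symmetric_bilinear (II x)"
proof -
  have l: "linear (\<lambda>Y. - B a (dif A t x Y))" for a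
    by (rule linearI) (simp_all add: linear_add[OF dt_linear] linear_cmul[OF dt_linear] expand)
  have r: "linear (\<lambda>X. - B (dif A F x X) a)" for a
    by (rule linearI) (simp_all add: linear_add[OF dF_linear] linear_cmul[OF dF_linear] expand)
  show ?thesis
    using l r dF_dt_commute by (simp add: symmetric_bilinear_def second_ff_eq[abs_def])
qed

text \<open>Otherwise \<sigma> would be a multiple of t at the point, and its curvature direction
  would be killed by dt, contrary to the non-degeneracy of III.\<close>

lemma sigma_qinf:
  assumes s: "section_at \<sigma> x" "\<sigma> x \<noteq> 0" and X: "X \<noteq> 0" "dif A \<sigma> x X \<in> f x"
  shows "B (\<sigma> x) qinf \<noteq> 0"
proof
  assume g: "B (\<sigma> x) qinf = 0"
  define h where "h = - B (\<sigma> x) pp"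
  have "\<sigma> x - h *\<^sub>R t x = 0"
    by (rule mem_f_zero[of _ x])
      (auto intro!: subspace_add subspace_neg subspace_diff subspace_scale subspace_f section_at_mem[OF s(1)] t_mem simp: expand g t h_def)
  then have k: "\<sigma> x = h *\<^sub>R t x + 0 *\<^sub>R t x" by simp
  have "dif A \<sigma> x X - (h *\<^sub>R dif A t x X + 0 *\<^sub>R dif A t x X) \<in> f x"
    by (rule dif_section_lincomb[OF s(1) section_t section_t k])
  from subspace_diff[OF subspace_f X(2) this] have "h *\<^sub>R dif A t x X \<in> f x" by simp
  then have "h *\<^sub>R dif A t x X = 0" by (rule mem_f_zero) (simp_all add: expand dif_F_t)
  then show False using dt_nonzero[OF X(1)] k s(2) by auto
qed

lemma principal_frame:
  assumes fr: "frame_at s1 s2 \<sigma>1 \<sigma>2 x" and X: "X \<noteq> 0" "dif A \<sigma>1 x X \<in> f x" and Y: "Y \<noteq> 0" "dif A \<sigma>2 x Y \<in> f x"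
  obtains r1 r2 g1 g2 where "principal x X Y r1 r2" "\<sigma>1 x = g1 *\<^sub>R (F x + r1 *\<^sub>R t x)" "\<sigma>2 x = g2 *\<^sub>R (F x + r2 *\<^sub>R t x)"
    "g1 \<noteq> 0" "g2 \<noteq> 0"
proof -
  have s: "section_at \<sigma>1 x" "\<sigma>1 x \<noteq> 0" "section_at \<sigma>2 x" "\<sigma>2 x \<noteq> 0" using fr by (auto simp: frame_at_def)
  show ?thesis
    by (rule principal_of_frame[OF fr X Y sigma_qinf[OF s(1,2) X] sigma_qinf[OF s(3,4) Y]]) (rule that)
qed

lemma principal_ex: "\<exists>X Y r1 r2. principal x X Y r1 r2"
proof -
  obtain \<sigma>1 \<sigma>2 where "eventually (frame_at s1 s2 \<sigma>1 \<sigma>2) (nhds x)" using frame_ex[OF csb] .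
  then have fr: "frame_at s1 s2 \<sigma>1 \<sigma>2 x" by (rule eventually_nhds_x_imp_x)
  then obtain X Y where "X \<noteq> 0" "dif A \<sigma>1 x X \<in> f x" "Y \<noteq> 0" "dif A \<sigma>2 x Y \<in> f x"
    by (auto simp: frame_at_def)
  from principal_frame[OF fr this] show ?thesis by blast
qed

text \<open>The choice is immaterial: half the trace of \<open>II\<close> with respect to \<open>III\<close>.\<close>

definition H :: "'m \<Rightarrow> real" where "H x = (SOME h. \<exists>X Y r1 r2. principal x X Y r1 r2 \<and> h = (r1 + r2) / 2)"

lemma II_principal:
  assumes "principal x X Y r1 r2"
  shows "II x Z X = r1 * III x Z X" "II x Z Y = r2 * III x Z Y"
  using assms dF_dt_commute[of x Z X] dF_dt_commute[of x Z Y]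
    sym[of "dif A t x X" "dif A t x Z"] sym[of "dif A t x Y" "dif A t x Z"]
  by (simp_all add: second_ff_eq third_ff_eq principal_def expand)

lemma II_trace:
  assumes p: "principal x X Y r1 r2" and e: "conformal_frame (III x) e1 e2"
  shows "II x e1 e1 + II x e2 e2 = (r1 + r2) * III x e1 e1"
proof (rule conformal_frame_trace[OF third_symmetric_bilinear second_symmetric_bilinear _ _ _ _ _ e])
  show "\<exists>p q. Z = p *\<^sub>R X + q *\<^sub>R Y" for Z
    by (rule principal_span[OF p, of Z]) blast
  show "III x X Y = 0" "III x X X > 0" "III x Y Y > 0"
    using p third_positive by (auto simp: third_ff_eq principal_def)
  show "II x X X * III x Y Y + II x Y Y * III x X X = (r1 + r2) * III x X X * III x Y Y"
    by (simp add: II_principal[OF p] algebra_simps)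
qed

section \<open>Isothermal charts, and the smoothness of \<open>H\<close> and
  \<open>lam\<close>\<close>

definition isothermal :: "'m chart \<Rightarrow> bool" where
  "isothermal c \<longleftrightarrow> admissible_chart A c \<and>
     (\<forall>y\<in>fst c. conformal_frame (III y) (coord_vec A c (axis 1 1) y) (coord_vec A c (axis 2 1) y)) \<and>
     (\<lambda>z. let y = chart_inv c (of_complex_vec z)
              in part20 (q y) (coord_vec A c (axis 1 1) y) (coord_vec A c (axis 2 1) y))
          holomorphic_on to_complex ` snd c ` fst c"

lemma isothermal_ex: obtains c where "x \<in> fst c" "isothermal c"
proof -
  have "\<exists>c. x \<in> fst c \<and> conformal_chart A III c \<and>
    (\<lambda>z. let y = chart_inv c (of_complex_vec z)
              in part20 (q y) (coord_vec A c (axis 1 1) y) (coord_vec A c (axis 2 1) y))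
          holomorphic_on to_complex ` snd c ` fst c"
    using q_hol unfolding holomorphic_quadratic_differential_def by (elim conjE allE[of _ x])
  then show ?thesis using that unfolding isothermal_def conformal_chart_def by auto
qed

lemma isothermalD:
  assumes "isothermal c"
  shows "admissible_chart A c"
    and "y \<in> fst c \<Longrightarrow> conformal_frame (III y) (coord_vec A c (axis 1 1) y) (coord_vec A c (axis 2 1) y)"
  using assms by (simp_all add: isothermal_def)

text \<open>In a conformal frame the trace of II relative to III is r1 + r2 for every principal
  frame, so all choices agree.\<close>

lemma H_principal:
  assumes p: "principal x X Y r1 r2" shows "r1 + r2 = 2 * H x"
proof -
  have "\<exists>h X Y r1 r2. principal x X Y r1 r2 \<and> h = (r1 + r2) / 2" using p by blast
  then have "\<exists>X Y r1 r2. principal x X Y r1 r2 \<and> H x = (r1 + r2) / 2"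
    unfolding H_def by (rule someI_ex)
  then obtain X' Y' r1' r2' where p': "principal x X' Y' r1' r2'" "H x = (r1' + r2') / 2" by auto
  obtain c where c: "x \<in> fst c" "isothermal c" by (rule isothermal_ex)
  note e = isothermalD(2)[OF c(2,1)]
  then show ?thesis
    using II_trace[OF p e] II_trace[OF p'(1) e] p'(2) by (simp add: conformal_frame_def)
qed

lemma conformal_trace:
  assumes "conformal_frame (III x) e1 e2" shows "II x e1 e1 + II x e2 e2 = 2 * H x * III x e1 e1"
proof -
  obtain X Y r1 r2 where p: "principal x X Y r1 r2" using principal_ex by blast
  show ?thesis using II_trace[OF p assms] H_principal[OF p] by simp
qed

lemma conformal_frame_span:
  assumes e: "conformal_frame (III x) e1 e2"
  obtains a b where "Z = a *\<^sub>R e1 + b *\<^sub>R e2"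
proof (rule real2_basis[of e1 e2 Z])
  fix p q assume pq: "p *\<^sub>R e1 + q *\<^sub>R e2 = 0"
  have l: "linear (\<lambda>X. III x X Y)" for Y
    using third_symmetric_bilinear[of x] by (simp add: symmetric_bilinear_def)
  have "III x e2 e1 = 0" using e third_symmetric_bilinear[of x] by (simp add: conformal_frame_def symmetric_bilinear_def)
  moreover have "III x (p *\<^sub>R e1 + q *\<^sub>R e2) e1 = 0" "III x (p *\<^sub>R e1 + q *\<^sub>R e2) e2 = 0"
    unfolding pq using linear_0[OF l] by auto
  ultimately show "p = 0 \<and> q = 0"
    using e by (simp add: linear_add[OF l] linear_cmul[OF l] conformal_frame_def)
qed (use that in auto)

text \<open>A vanishing (2,0)-part would make II a multiple of III and hence r1 = r2.\<close>

lemma part20_II_nonzero: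
  assumes e: "conformal_frame (III x) e1 e2" shows "part20 (II x) e1 e2 \<noteq> 0"
proof
  assume "part20 (II x) e1 e2 = 0"
  then have z: "II x e1 e1 = II x e2 e2" "II x e1 e2 = 0" by (auto simp: part20_def complex_eq_iff)
  obtain X Y r1 r2 where p: "principal x X Y r1 r2" using principal_ex by blast
  note e' = e[unfolded conformal_frame_def]
  define k where "k = II x e1 e1 / III x e1 e1"
  have kk: "II x Z Z = k * III x Z Z" for Z
  proof -
    obtain a b where Z: "Z = a *\<^sub>R e1 + b *\<^sub>R e2" by (rule conformal_frame_span[OF e])
    show ?thesis
      unfolding Z symmetric_bilinear_expand[OF second_symmetric_bilinear]
        symmetric_bilinear_expand[OF third_symmetric_bilinear]
      using z e' by (simp add: k_def field_simps)
  qed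
  have "r1 * III x X X = k * III x X X" "r2 * III x Y Y = k * III x Y Y"
    by (rule trans[OF II_principal(1)[OF p, of X, symmetric] kk[of X]],
        rule trans[OF II_principal(2)[OF p, of Y, symmetric] kk[of Y]])
  moreover have "III x X X \<noteq> 0" "III x Y Y \<noteq> 0"
    using p third_positive[of x X] third_positive[of x Y] by (auto simp: third_ff_eq principal_def)
  ultimately show False using p by (simp add: principal_def)
qed

definition lam :: "'m \<Rightarrow> real" where "lam x = inverse (\<mu> x)"

text \<open>Absence of umbilics: the (2,0)-part of II, which is \<mu> times that of q, has no
  zeros.\<close>

lemma mu_nonzero: "\<mu> x \<noteq> 0" and lam_nonzero: "lam x \<noteq> 0"
proof -
  obtain c where c: "x \<in> fst c" "isothermal c" by (rule isothermal_ex)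
  note e = isothermalD(2)[OF c(2,1)]
  show "\<mu> x \<noteq> 0" using part20_II_nonzero[OF e] q_comm[OF e] by auto
  then show "lam x \<noteq> 0" by (simp add: lam_def)
qed

lemma part20_q:
  assumes e: "conformal_frame (III x) e1 e2" shows "part20 (q x) e1 e2 = of_real (lam x) * part20 (II x) e1 e2"
  using q_comm[OF e] mu_nonzero[of x] by (simp add: lam_def)

context
  fixes x c
  assumes x: "x \<in> fst c" and ok: "isothermal c"
begin

private lemmas ac = isothermalD(1)[OF ok]
private lemmas cf = isothermalD(2)[OF ok]

definition phi where "phi y = part20 (q y) (coord_vec A c (axis 1 1) y) (coord_vec A c (axis 2 1) y)"
definition psi where "psi y = part20 (II y) (coord_vec A c (axis 1 1) y) (coord_vec A c (axis 2 1) y)"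

text \<open>In the chart, \<open>phi\<close> is a holomorphic function of the complex coordinate, so
  its derivative is multiplication by a complex number.\<close>

lemma phi_smooth: "smooth_at A phi x" and phi_CR: "pd c (axis 2 1) phi x = \<i> * pd c (axis 1 1) phi x"
proof -
  note ic = admissible_is_chart[OF ac]
  define \<Phi> where "\<Phi> z = phi (chart_inv c (of_complex_vec z))" for z
  have h: "\<Phi> holomorphic_on to_complex ` snd c ` fst c" using ok by (simp add: isothermal_def \<Phi>_def[abs_def] phi_def Let_def)
  have oS: "open (snd c ` fst c)" using ic by (simp add: is_chart_def)
  have sm: "smooth_on (snd c ` fst c) (\<lambda>v. \<Phi> (to_complex v))" by (rule smooth_on_holomorphic[OF oS h])
  have xs: "snd c x \<in> snd c ` fst c" using x by simp
  have ev: "eventually (\<lambda>y. \<Phi> (to_complex (snd c y)) = phi y) (nhds x)"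
    using eventually_chart[OF ac x] by eventually_elim (simp add: \<Phi>_def chart_inv_left[OF ic])
  show "smooth_at A phi x"
    using smooth_at_cong[OF ev] smooth_at_compose_chart(1)[OF ac x oS xs sm] by simp
  have "((\<lambda>v. \<Phi> (to_complex v)) has_derivative (\<lambda>w. deriv \<Phi> (to_complex (snd c x)) * to_complex w)) (at (snd c x))"
  proof -
    have "(\<Phi> has_field_derivative deriv \<Phi> (to_complex (snd c x))) (at (to_complex (snd c x)))"
      using h open_to_complex_image[OF oS] x by (intro holomorphic_derivI) auto
    from diff_chain_at[OF bounded_linear_imp_has_derivative[OF bounded_linear_to_complex]
        this[unfolded has_field_derivative_def]]
    show ?thesis by (simp add: o_def)
  qed
  from frechet_derivative_at[OF this, symmetric]
  have d: "pd c w phi x = deriv \<Phi> (to_complex (snd c x)) * to_complex w" for w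
    using pd_cong[OF ev ac x, of w] smooth_at_compose_chart(2)[OF ac x oS xs sm, of w] by simp
  have "to_complex (axis 2 1) = \<i> * to_complex (axis 1 1)"
    by (simp add: to_complex_def axis_def complex_eq_iff)
  then show "pd c (axis 2 1) phi x = \<i> * pd c (axis 1 1) phi x" unfolding d by simp
qed

definition "tu = pd c (axis 1 1) t"
definition "tv = pd c (axis 2 1) t"
definition "Fu = pd c (axis 1 1) F"
definition "Fv = pd c (axis 2 1) F"

lemma tF_smooth: "smooth_at A tu x" "smooth_at A tv x" "smooth_at A Fu x" "smooth_at A Fv x"
  unfolding tu_def tv_def Fu_def Fv_def by (intro smooth_at_pd t_smooth F_smooth ac x)+

lemma dif_coord: "y \<in> fst c \<Longrightarrow> dif A t y (coord_vec A c (axis 1 1) y) = tu y"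
  "y \<in> fst c \<Longrightarrow> dif A t y (coord_vec A c (axis 2 1) y) = tv y"
  "y \<in> fst c \<Longrightarrow> dif A F y (coord_vec A c (axis 1 1) y) = Fu y"
  "y \<in> fst c \<Longrightarrow> dif A F y (coord_vec A c (axis 2 1) y) = Fv y"
  using dif_coord_vec[OF t_smooth ac] dif_coord_vec[OF F_smooth ac]
  by (simp_all add: tu_def tv_def Fu_def Fv_def)

lemma conformal_t:
  assumes "y \<in> fst c"
  shows "B (tu y) (tv y) = 0" "B (tv y) (tv y) = B (tu y) (tu y)" "B (tu y) (tu y) \<noteq> 0"
    "B (Fu y) (tv y) = B (Fv y) (tu y)"
    "- B (Fu y) (tu y) - B (Fv y) (tv y) = 2 * H y * B (tu y) (tu y)"
    "phi y = of_real (lam y) * psi y" "psi y \<noteq> 0"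
    "psi y = Complex ((B (Fv y) (tv y) - B (Fu y) (tu y)) / 4) (B (Fu y) (tv y) / 2)"
  using cf[OF assms] dif_coord[OF assms] conformal_trace[OF cf[OF assms]]
    dF_dt_commute[of y "coord_vec A c (axis 1 1) y" "coord_vec A c (axis 2 1) y"]
    part20_q[OF cf[OF assms]] part20_II_nonzero[OF cf[OF assms]]
  by (simp_all add: conformal_frame_def third_ff_eq second_ff_eq phi_def psi_def)
    (simp add: part20_def second_ff_eq)

lemma H_smooth_chart: "smooth_at A H x"
proof -
  have "smooth_at A (\<lambda>y. (- B (Fu y) (tu y) - B (Fv y) (tv y)) * inverse (2 * B (tu y) (tu y))) x"
    using conformal_t(3)[OF x]
    by (intro smooth_at_mult smooth_at_diff smooth_at_uminus smooth_at_inverse smooth_at_B tF_smooth smooth_at_const) simp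
  moreover have "eventually (\<lambda>y. (- B (Fu y) (tu y) - B (Fv y) (tv y)) * inverse (2 * B (tu y) (tu y)) = H y) (nhds x)"
    using eventually_chart[OF ac x]
    by eventually_elim (simp add: conformal_t)
  ultimately show ?thesis by (simp add: smooth_at_cong)
qed

text \<open>No regularity of \<mu> is given. From phi = lam psi with lam real, lam is Re (phi cnj
  psi) / |psi|^2, a quotient of smooth functions.\<close>

lemma lam_smooth_chart: "smooth_at A lam x"
proof -
  define a where "a y = (B (Fv y) (tv y) - B (Fu y) (tu y)) * (1 / 4)" for y
  define b where "b y = B (Fu y) (tv y) * (1 / 2)" for y
  have ab: "smooth_at A a x" "smooth_at A b x" unfolding a_def[abs_def] b_def[abs_def]
    by (intro smooth_at_mult smooth_at_diff smooth_at_B tF_smooth smooth_at_const)+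
  have psi: "psi y = Complex (a y) (b y)" if "y \<in> fst c" for y
    using conformal_t(8)[OF that] by (simp add: a_def b_def)
  have n: "a y * a y + b y * b y \<noteq> 0" if "y \<in> fst c" for y
    using conformal_t(7)[OF that] psi[OF that] by (auto simp: complex_eq_iff sum_squares_eq_zero_iff)
  have r: "smooth_at A (\<lambda>y. Re (phi y)) x" "smooth_at A (\<lambda>y. Im (phi y)) x"
    by (rule smooth_at_bounded_linear[OF bounded_linear_Re phi_smooth],
        rule smooth_at_bounded_linear[OF bounded_linear_Im phi_smooth])
  have "smooth_at A (\<lambda>y. (Re (phi y) * a y + Im (phi y) * b y) * inverse (a y * a y + b y * b y)) x"
    using n[OF x] by (intro smooth_at_mult smooth_at_add smooth_at_inverse ab r) simp
  moreover have "eventually (\<lambda>y. (Re (phi y) * a y + Im (phi y) * b y) * inverse (a y * a y + b y * b y) = lam y) (nhds x)"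
    using eventually_chart[OF ac x]
  proof eventually_elim
    case (elim y)
    have "Re (phi y) * a y + Im (phi y) * b y = lam y * (a y * a y + b y * b y)"
      using conformal_t(6)[OF elim] psi[OF elim] by (simp add: algebra_simps)
    then show ?case using n[OF elim] by simp
  qed
  ultimately show ?thesis by (simp add: smooth_at_cong)
qed

end

lemma H_smooth: "smooth_at A H x" and lam_smooth: "smooth_at A lam x"
proof -
  obtain c where c: "x \<in> fst c" "isothermal c" by (rule isothermal_ex)
  show "smooth_at A H x" by (rule H_smooth_chart[OF c])
  show "smooth_at A lam x" by (rule lam_smooth_chart[OF c])
qed

section \<open>The middle potential of an L-isothermic surface\<close>

definition p1 :: "'m \<Rightarrow> 'v" where "p1 x = lam x *\<^sub>R t x"

lemma p1_smooth: "smooth_at A p1 x"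
  unfolding p1_def[abs_def] by (intro smooth_at_scaleR lam_smooth t_smooth)

lemma p1_mem: "p1 x \<in> f x"
  unfolding p1_def by (intro subspace_scale subspace_f t_mem)

lemma section_p1: "section_at p1 x"
  by (simp add: section_at_def p1_smooth p1_mem)

lemma dif_p1: "dif A p1 x Z = lam x *\<^sub>R dif A t x Z + dif A lam x Z *\<^sub>R t x"
  unfolding p1_def[abs_def] by (rule dif_scaleR[OF lam_smooth t_smooth])

definition Psi :: "'m \<Rightarrow> real ^ 2 \<Rightarrow> 'v" where
  "Psi x Z = lam x *\<^sub>R (dif A F x Z + H x *\<^sub>R dif A t x Z)"

text \<open>The middle potential has to satisfy \<open>\<zeta> qinf = - dp1\<close>, \<open>\<zeta> p1 = 0\<close> and \<open>\<zeta> pp = d(lam F) - 2 Psi\<close>, the last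
  one by the definition of \<open>Psi\<close> in the other direction. This leaves only the following formula.\<close>

definition \<zeta> :: "'m \<Rightarrow> real ^ 2 \<Rightarrow> ('v \<Rightarrow>\<^sub>L 'v)" where
  "\<zeta> x Z = wedge B (F x) (dif A p1 x Z) - wedge B (p1 x) (dif A F x Z) + 2 *\<^sub>R wedge B (t x) (Psi x Z)"

text \<open>The shape in which F and t are wedged with vectors of f^perp; the wedge, commutator and
  trace conditions are read off from it.\<close>

lemma \<zeta>_eq: "\<zeta> x Z = wedge B (F x) (dif A p1 x Z) +
    wedge B (t x) (lam x *\<^sub>R (dif A F x Z + (2 * H x) *\<^sub>R dif A t x Z))"
  by (simp add: \<zeta>_def Psi_def p1_def wedge.scaleR_left wedge.scaleR_right wedge.add_right algebra_simps)
    (simp flip: scaleR_left_distrib)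

lemma \<zeta>_linear: "linear (\<zeta> x)"
proof -
  note l = dif_linear[OF p1_smooth, of x]
  show ?thesis unfolding \<zeta>_eq[abs_def]
    by (rule linearI) (simp_all add: linear_add[OF l] linear_cmul[OF l] linear_add[OF dt_linear] linear_cmul[OF dt_linear]
        linear_add[OF dF_linear] linear_cmul[OF dF_linear] wedge.scaleR_right wedge.add_right algebra_simps)
qed

definition zc where "zc c v y = wedge B (F y) (pd c v p1 y) +
    wedge B (t y) (lam y *\<^sub>R (pd c v F y + (2 * H y) *\<^sub>R pd c v t y))"

lemma zc: "admissible_chart A c \<Longrightarrow> y \<in> fst c \<Longrightarrow> \<zeta> y (coord_vec A c v y) = zc c v y"
  by (simp add: zc_def \<zeta>_eq dif_coord_vec[OF p1_smooth] dif_coord_vec[OF F_smooth] dif_coord_vec[OF t_smooth])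

lemma \<zeta>_coord_smooth:
  assumes "admissible_chart A c" "x \<in> fst c" shows "smooth_at A (\<lambda>y. \<zeta> y (coord_vec A c v y)) x"
proof -
  have "smooth_at A (zc c v) x" unfolding zc_def[abs_def]
    by (intro smooth_at_add smooth_at_wedge smooth_at_scaleR smooth_at_mult smooth_at_const smooth_at_pd
        F_smooth t_smooth p1_smooth lam_smooth H_smooth assms)
  moreover have "eventually (\<lambda>y. zc c v y = \<zeta> y (coord_vec A c v y)) (nhds x)"
    using eventually_chart[OF assms] by eventually_elim (simp add: zc[OF assms(1)])
  ultimately show ?thesis by (simp add: smooth_at_cong)
qed

lemma \<zeta>_smooth: "smooth_one_form A \<zeta>"
  unfolding smooth_one_form_iff using \<zeta>_linear \<zeta>_coord_smooth admissible_atlas by auto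

lemma Psi_perp: "Psi x Z \<in> perp B (f x)" "B (Psi x Z) qinf = 0" "B (Psi x Z) pp = 0"
proof -
  show "Psi x Z \<in> perp B (f x)" unfolding Psi_def
    by (intro subspace_scale subspace_add subspace_perp dF_perp dt_perp)
qed (simp_all add: Psi_def expand dif_F_t)

context
  fixes x c
  assumes x: "x \<in> fst c" and ok: "isothermal c"
begin

private lemmas ac2 = isothermalD(1)[OF ok]

definition "Pu y = lam y *\<^sub>R (Fu c y + H y *\<^sub>R tu c y)"
definition "Pv y = lam y *\<^sub>R (Fv c y + H y *\<^sub>R tv c y)"

lemma Pu: "y \<in> fst c \<Longrightarrow> Psi y (coord_vec A c (axis 1 1) y) = Pu y"
  and Pv: "y \<in> fst c \<Longrightarrow> Psi y (coord_vec A c (axis 2 1) y) = Pv y"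
  using dif_coord[OF x ok] by (simp_all add: Psi_def Pu_def Pv_def)

lemma P_smooth: "smooth_at A Pu x" "smooth_at A Pv x"
proof -
  note s = tF_smooth[OF x ok]
  show "smooth_at A Pu x" unfolding Pu_def[abs_def]
    by (rule smooth_at_scaleR[OF lam_smooth smooth_at_add[OF s(3) smooth_at_scaleR[OF H_smooth s(1)]]])
  show "smooth_at A Pv x" unfolding Pv_def[abs_def]
    by (rule smooth_at_scaleR[OF lam_smooth smooth_at_add[OF s(4) smooth_at_scaleR[OF H_smooth s(2)]]])
qed

text \<open>The differential q is lam (II - H III), because it is trace-free and its (2,0)-part is
  lam times that of II. As II = - (dF, dt), this means (Psi, dt) = - q, whence the signs of the last
  two equations.\<close>

lemma P_pairing:
  assumes y: "y \<in> fst c"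
  shows "B (Pu y) (tv c y) = B (Pv y) (tu c y)" "B (Pu y) (tu c y) = - B (Pv y) (tv c y)"
    "B (Pu y) (tu c y) = - 2 * Re (phi c y)" "B (Pu y) (tv c y) = 2 * Im (phi c y)"
proof -
  note ct = conformal_t[OF x ok y]
  have vt: "B (tv c y) (tu c y) = 0" using ct(1) sym by metis
  show "B (Pu y) (tv c y) = B (Pv y) (tu c y)" using ct vt by (simp add: Pu_def Pv_def expand)
  have h: "H y * B (tu c y) (tu c y) = (- B (Fu c y) (tu c y) - B (Fv c y) (tv c y)) / 2" using ct(5) by simp
  have 1: "B (Pu y) (tu c y) = lam y * (B (Fu c y) (tu c y) + H y * B (tu c y) (tu c y))"
    "B (Pv y) (tv c y) = lam y * (B (Fv c y) (tv c y) + H y * B (tu c y) (tu c y))"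
    using ct(2) by (simp_all add: Pu_def Pv_def expand)
  show "B (Pu y) (tu c y) = - B (Pv y) (tv c y)" unfolding 1 h by (simp add: field_simps)
  have ph: "Re (phi c y) = lam y * ((B (Fv c y) (tv c y) - B (Fu c y) (tu c y)) / 4)"
    "Im (phi c y) = lam y * (B (Fu c y) (tv c y) / 2)"
    using ct(6,8) by simp_all
  show "B (Pu y) (tu c y) = - 2 * Re (phi c y)" unfolding 1 h ph by (simp add: field_simps)
  show "B (Pu y) (tv c y) = 2 * Im (phi c y)" unfolding ph using ct(1) by (simp add: Pu_def expand)
qed

lemma P_perp:
  assumes y: "y \<in> fst c"
  shows "Pu y \<in> perp B (f y)" "B (Pu y) qinf = 0" "B (Pu y) pp = 0"
    "Pv y \<in> perp B (f y)" "B (Pv y) qinf = 0" "B (Pv y) pp = 0"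
  unfolding Pu[OF y, symmetric] Pv[OF y, symmetric] using Psi_perp by auto

lemma t_perp:
  assumes y: "y \<in> fst c"
  shows "tu c y \<in> perp B (f y)" "B (tu c y) qinf = 0" "B (tu c y) pp = 0"
    "tv c y \<in> perp B (f y)" "B (tv c y) qinf = 0" "B (tv c y) pp = 0"
  unfolding dif_coord(1,2)[OF x ok y, symmetric] using dt_perp dif_F_t by auto

text \<open>The defect of closedness is tested on tu, tv, t, F, qinf and pp. The first two products
  are the Cauchy-Riemann equations of \<open>phi\<close>; the others follow by differentiating
  orthogonality relations of Psi.\<close>

lemma P_closed: "pd c (axis 2 1) Pu x = pd c (axis 1 1) Pv x"
proof -
  define w where "w = pd c (axis 2 1) Pu x - pd c (axis 1 1) Pv x"
  note evc = eventually_chart[OF ac2 x]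
  note ct = conformal_t[OF x ok]
  have e1: "eventually (\<lambda>y. B (tu c y) (tv c y) = 0 \<and> B (tu c y) (tu c y) = B (tv c y) (tv c y)) (nhds x)"
    using evc by eventually_elim (use ct in auto)
  have e2: "eventually (\<lambda>y. B (Pu y) (tv c y) = B (Pv y) (tu c y) \<and> B (Pu y) (tu c y) = - B (Pv y) (tv c y)) (nhds x)"
    using evc by eventually_elim (use P_pairing in auto)
  have tud: "tu c y = pd c (axis 1 1) t y" "tv c y = pd c (axis 2 1) t y" for y
    by (simp_all add: tu_def[OF x ok] tv_def[OF x ok])
  note cod = codazzi_conformal[OF ac2 x tud e1 ct(3)[OF x] P_smooth e2 P_perp[OF x]]
  note ph = phi_smooth[OF x ok]
  have q11: "pd c v (\<lambda>y. B (Pu y) (tu c y)) x = - 2 * Re (pd c v (phi c) x)" for v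
  proof -
    have "pd c v (\<lambda>y. B (Pu y) (tu c y)) x = pd c v (\<lambda>y. (\<lambda>z. - 2 * Re z) (phi c y)) x"
      by (rule pd_cong[OF _ ac2 x]) (use evc in \<open>eventually_elim; simp add: P_pairing(3)\<close>)
    also have "\<dots> = - 2 * Re (pd c v (phi c) x)"
      by (rule pd_bounded_linear[OF _ ph ac2 x]) (intro bounded_linear_const_mult bounded_linear_Re)
    finally show ?thesis .
  qed
  have q12: "pd c v (\<lambda>y. B (Pu y) (tv c y)) x = 2 * Im (pd c v (phi c) x)" for v
  proof -
    have "pd c v (\<lambda>y. B (Pu y) (tv c y)) x = pd c v (\<lambda>y. (\<lambda>z. 2 * Im z) (phi c y)) x"
      by (rule pd_cong[OF _ ac2 x]) (use evc in \<open>eventually_elim; simp add: P_pairing(4)\<close>)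
    also have "\<dots> = 2 * Im (pd c v (phi c) x)"
      by (rule pd_bounded_linear[OF _ ph ac2 x]) (intro bounded_linear_const_mult bounded_linear_Im)
    finally show ?thesis .
  qed
  have wt: "B w (tu c x) = 0" "B w (tv c x) = 0"
    using cod unfolding q11 q12 w_def phi_CR[OF x ok] by simp_all
  \<comment> \<open>Leibniz for (Pu, g) = (Pv, g) = 0; applied to t, F and the constants qinf and
    pp.\<close>
  have wg: "B w (g x) = B (Pv x) (pd c (axis 1 1) g x) - B (Pu x) (pd c (axis 2 1) g x)"
    if g: "smooth_at A g x" and 0: "\<And>y. y \<in> fst c \<Longrightarrow> B (Pu y) (g y) = 0 \<and> B (Pv y) (g y) = 0" for g
  proof -
    have "eventually (\<lambda>y. B (Pu y) (g y) = 0) (nhds x)" "eventually (\<lambda>y. B (Pv y) (g y) = 0) (nhds x)"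
      using evc by (auto elim!: eventually_mono simp: 0)
    from pd_B_zero[OF ac2 x P_smooth(1) g this(1), of "axis 2 1"] pd_B_zero[OF ac2 x P_smooth(2) g this(2), of "axis 1 1"]
    show ?thesis by (simp add: w_def expand)
  qed
  have "B w (t x) = 0"
  proof -
    have "B (Pu y) (t y) = 0 \<and> B (Pv y) (t y) = 0" if "y \<in> fst c" for y
      using perpD[OF P_perp(1)[OF that] t_mem] perpD[OF P_perp(4)[OF that] t_mem] by simp
    from wg[OF t_smooth this] show ?thesis using P_pairing(1)[OF x] by (simp add: tud[symmetric])
  qed
  moreover have "B w (F x) = 0"
  proof -
    have "B w (F x) = B (Pv x) (Fu c x) - B (Pu x) (Fv c x)"
    proof -
      have "B (Pu y) (F y) = 0 \<and> B (Pv y) (F y) = 0" if "y \<in> fst c" for y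
        using perpD[OF P_perp(1)[OF that] F_mem] perpD[OF P_perp(4)[OF that] F_mem] by simp
      from wg[OF F_smooth this] show ?thesis by (simp add: Fu_def[OF x ok] Fv_def[OF x ok])
    qed
    also have "\<dots> = 0"
      using conformal_t(4)[OF x ok x] sym[of "Fv c x" "Fu c x"] sym[of "tv c x" "Fu c x"] sym[of "tu c x" "Fv c x"]
      by (simp add: Pu_def Pv_def expand)
    finally show ?thesis .
  qed
  ultimately have "w \<in> perp B (f x)" unfolding f_eq perp_def span_2 by (auto simp: expand)
  moreover have "B w qinf = 0" "B w pp = 0"
  proof -
    have "B (Pu y) qinf = 0 \<and> B (Pv y) qinf = 0" if "y \<in> fst c" for y
      using P_perp(2,5)[OF that] by simp
    from wg[OF smooth_at_const this] show "B w qinf = 0" by (simp add: pd_const expand)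
    have "B (Pu y) pp = 0 \<and> B (Pv y) pp = 0" if "y \<in> fst c" for y
      using P_perp(3,6)[OF that] by simp
    from wg[OF smooth_at_const this] show "B w pp = 0" by (simp add: pd_const expand)
  qed
  ultimately have "w = (B w (tu c x) / B (tu c x) (tu c x)) *\<^sub>R tu c x + (B w (tv c x) / B (tu c x) (tu c x)) *\<^sub>R tv c x"
    using ct[OF x] by (intro conformal_expansion[OF t_perp[OF x]]) auto
  then have "w = 0" using wt by simp
  then show ?thesis by (simp add: w_def)
qed

text \<open>The products of first derivatives cancel by symmetry in the two directions: for F \<and>
  dp1 - p1 \<and> dF because both terms contribute the same wedge products with the directions
  exchanged, for t \<and> Psi because Psi is trace-free with respect to dt. Closedness of Psi
  settles the second derivatives.\<close>

lemma \<zeta>_closed_chart: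
  "pd c (axis 1 1) (\<lambda>y. \<zeta> y (coord_vec A c (axis 2 1) y)) x = pd c (axis 2 1) (\<lambda>y. \<zeta> y (coord_vec A c (axis 1 1) y)) x"
proof -
  note evc = eventually_chart[OF ac2 x]
  note ct = conformal_t[OF x ok x]
  let ?p = "\<lambda>v. pd c v p1" and ?F = "\<lambda>v. pd c v F"
  have sm: "smooth_at A (?p v) x" "smooth_at A (?F v) x" for v
    by (intro smooth_at_pd p1_smooth F_smooth ac2 x)+
  have d: "pd c w (\<lambda>y. wedge B (F y) (?p v y) - wedge B (p1 y) (?F v y) + 2 *\<^sub>R wedge B (t y) (P y)) x =
      wedge B (F x) (pd c w (?p v) x) + wedge B (?F w x) (?p v x) -
      (wedge B (p1 x) (pd c w (?F v) x) + wedge B (?p w x) (?F v x)) +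
      2 *\<^sub>R (wedge B (t x) (pd c w P x) + wedge B (pd c w t x) (P x))" if P: "smooth_at A P x" for v w P
  proof -
    have "pd c w (\<lambda>y. wedge B (F y) (?p v y) - wedge B (p1 y) (?F v y) + 2 *\<^sub>R wedge B (t y) (P y)) x =
      pd c w (\<lambda>y. wedge B (F y) (?p v y) - wedge B (p1 y) (?F v y)) x + pd c w (\<lambda>y. 2 *\<^sub>R wedge B (t y) (P y)) x"
      by (intro pd_add smooth_at_diff smooth_at_scaleR smooth_at_const smooth_at_wedge F_smooth p1_smooth t_smooth sm P ac2 x)
    also have "pd c w (\<lambda>y. wedge B (F y) (?p v y) - wedge B (p1 y) (?F v y)) x =
      pd c w (\<lambda>y. wedge B (F y) (?p v y)) x - pd c w (\<lambda>y. wedge B (p1 y) (?F v y)) x"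
      by (intro pd_diff smooth_at_wedge F_smooth p1_smooth sm ac2 x)
    also have "pd c w (\<lambda>y. 2 *\<^sub>R wedge B (t y) (P y)) x = 2 *\<^sub>R pd c w (\<lambda>y. wedge B (t y) (P y)) x"
      by (intro pd_bounded_linear bounded_linear_scaleR_right smooth_at_wedge t_smooth P ac2 x)
    finally show ?thesis
      unfolding pd_wedge[OF F_smooth sm(1) ac2 x] pd_wedge[OF p1_smooth sm(2) ac2 x] pd_wedge[OF t_smooth P ac2 x] .
  qed
  have "eventually (\<lambda>y. \<zeta> y (coord_vec A c (axis 1 1) y) =
      wedge B (F y) (?p (axis 1 1) y) - wedge B (p1 y) (?F (axis 1 1) y) + 2 *\<^sub>R wedge B (t y) (Pu y)) (nhds x)"
    using evc by eventually_elim
      (simp add: \<zeta>_def Pu dif_coord_vec[OF p1_smooth ac2] dif_coord_vec[OF F_smooth ac2])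
  note u = pd_cong[OF this ac2 x, of "axis 2 1"]
  have "eventually (\<lambda>y. \<zeta> y (coord_vec A c (axis 2 1) y) =
      wedge B (F y) (?p (axis 2 1) y) - wedge B (p1 y) (?F (axis 2 1) y) + 2 *\<^sub>R wedge B (t y) (Pv y)) (nhds x)"
    using evc by eventually_elim
      (simp add: \<zeta>_def Pv dif_coord_vec[OF p1_smooth ac2] dif_coord_vec[OF F_smooth ac2])
  note v = pd_cong[OF this ac2 x, of "axis 1 1"]
  have tt: "pd c (axis 1 1) t x = tu c x" "pd c (axis 2 1) t x = tv c x"
    by (simp_all add: tu_def[OF x ok] tv_def[OF x ok])
  define E where "E = B (tu c x) (tu c x)"
  have Pe: "Pu x = (B (Pu x) (tu c x) / E) *\<^sub>R tu c x + (B (Pu x) (tv c x) / E) *\<^sub>R tv c x"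
    "Pv x = (B (Pv x) (tu c x) / E) *\<^sub>R tu c x + (B (Pv x) (tv c x) / E) *\<^sub>R tv c x"
    using conformal_expansion[OF t_perp[OF x] ct(1) _ ct(2)[folded E_def] _ _ P_perp(1-3)[OF x]]
      conformal_expansion[OF t_perp[OF x] ct(1) _ ct(2)[folded E_def] _ _ P_perp(4-6)[OF x]] ct(3)
    by (simp_all add: E_def)
  have "wedge B (tv c x) (Pu x) = (B (Pu x) (tu c x) / E) *\<^sub>R wedge B (tv c x) (tu c x)"
    by (subst Pe(1)) (simp add: wedge.add_right wedge.scaleR_right wedge_self)
  moreover have "wedge B (tu c x) (Pv x) = (B (Pv x) (tv c x) / E) *\<^sub>R wedge B (tu c x) (tv c x)"
    by (subst Pe(2)) (simp add: wedge.add_right wedge.scaleR_right wedge_self)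
  ultimately have tP: "wedge B (tv c x) (Pu x) = wedge B (tu c x) (Pv x)"
    using P_pairing(2)[OF x] wedge_swap[of "tv c x" "tu c x"] by simp
  show ?thesis
    unfolding u v d[OF P_smooth(1)] d[OF P_smooth(2)] tt tP P_closed
      pd_commute[OF p1_smooth ac2 x, of "axis 2 1" "axis 1 1"] pd_commute[OF F_smooth ac2 x, of "axis 2 1" "axis 1 1"]
    using wedge_swap[of "?F (axis 1 1) x" "?p (axis 2 1) x"] wedge_swap[of "?F (axis 2 1) x" "?p (axis 1 1) x"]
    by simp
qed

end

lemma \<zeta>_closed: "closed_one_form A \<zeta>"
proof (subst closed_one_form_iff, rule \<zeta>_coord_smooth, erule admissible_atlas, assumption, intro ballI allI)
  fix c x v w assume c: "c \<in> A" "x \<in> fst c"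
  obtain c' where c': "x \<in> fst c'" "isothermal c'" by (rule isothermal_ex)
  note ac' = isothermalD(1)[OF c'(2)]
  show "pd c v (\<lambda>y. \<zeta> y (coord_vec A c w y)) x = pd c w (\<lambda>y. \<zeta> y (coord_vec A c v y)) x"
    by (rule closed_change_chart[OF \<zeta>_linear admissible_atlas[OF c(1)] c(2) ac' c'(1) \<zeta>_coord_smooth[OF ac' c'(1)]
          \<zeta>_closed_chart[OF c']])
qed

lemma dp1_perp: "dif A p1 x Z \<in> perp B (f x)"
  by (rule dif_perp[OF section_p1])

lemma C_perp: "lam x *\<^sub>R (dif A F x Z + (2 * H x) *\<^sub>R dif A t x Z) \<in> perp B (f x)"
  by (intro subspace_scale subspace_add subspace_perp dF_perp dt_perp)

lemma \<zeta>_wedge: "\<zeta> x Z \<in> wedge_space B (f x) (perp B (f x))"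
  unfolding \<zeta>_eq
  by (intro subspace_add subspace_wedge_space wedge_space_memI F_mem t_mem dp1_perp C_perp)

lemma \<zeta>_f: "v \<in> f x \<Longrightarrow> blinfun_apply (\<zeta> x Z) v = 0"
  by (rule wedge_space_kills[OF \<zeta>_wedge]) (auto intro: isotropic perpD)

lemma \<zeta>_commute: "\<zeta> x Z o\<^sub>L \<zeta> x W - \<zeta> x W o\<^sub>L \<zeta> x Z = 0"
  unfolding \<zeta>_eq
proof (rule wedge_pairs_commute)
  show "B (F x) (F x) = 0" "B (F x) (t x) = 0" "B (t x) (t x) = 0"
    by (auto intro: isotropic F_mem t_mem)
  show "B v (F x) = 0 \<and> B v (t x) = 0"
    if "v \<in> {dif A p1 x Z, lam x *\<^sub>R (dif A F x Z + (2 * H x) *\<^sub>R dif A t x Z), dif A p1 x W,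
      lam x *\<^sub>R (dif A F x W + (2 * H x) *\<^sub>R dif A t x W)}" for v
  proof -
    have "v \<in> perp B (f x)" using that dp1_perp C_perp by auto
    then show ?thesis using perpD F_mem t_mem by auto
  qed
  have z: "B (t x) (dif A F x W) = 0" "B (t x) (dif A t x W) = 0" "B (dif A F x Z) (t x) = 0" "B (dif A t x Z) (t x) = 0"
    using perpD'[OF dF_perp t_mem] perpD'[OF dt_perp t_mem] perpD[OF dF_perp t_mem] perpD[OF dt_perp t_mem] by auto
  show "B (dif A p1 x Z) (lam x *\<^sub>R (dif A F x W + (2 * H x) *\<^sub>R dif A t x W)) =
    B (lam x *\<^sub>R (dif A F x Z + (2 * H x) *\<^sub>R dif A t x Z)) (dif A p1 x W)"
    using dF_dt_commute[of x Z W] sym[of "dif A F x W" "dif A t x Z"]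
    by (simp add: dif_p1 expand z algebra_simps)
qed

text \<open>The trace, computed in the basis F, t, is 2 lam times the trace-free part of II, that
  is, twice the given differential q.\<close>

lemma gauge_quadratic_\<zeta>: "gauge_quadratic A f \<zeta> x Z W = 2 * lam x * (II x Z W - H x * III x Z W)"
proof -
  have z: "B (F x) (dif A F x W) = 0" "B (F x) (dif A t x W) = 0" "B (t x) (dif A F x W) = 0" "B (t x) (dif A t x W) = 0"
    using perpD'[OF dF_perp F_mem] perpD'[OF dt_perp F_mem] perpD'[OF dF_perp t_mem] perpD'[OF dt_perp t_mem] by auto
  define C where "C = lam x *\<^sub>R (dif A F x Z + (2 * H x) *\<^sub>R dif A t x Z)"
  have 1: "blinfun_apply (\<zeta> x Z) (dif A F x W) = (- B (dif A p1 x Z) (dif A F x W)) *\<^sub>R F x + (- B C (dif A F x W)) *\<^sub>R t x"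
    "blinfun_apply (\<zeta> x Z) (dif A t x W) = (- B (dif A p1 x Z) (dif A t x W)) *\<^sub>R F x + (- B C (dif A t x W)) *\<^sub>R t x"
    by (simp_all add: \<zeta>_eq C_def[symmetric] blinfun.add_left wedge_app z)
  have "gauge_quadratic A f \<zeta> x Z W = - B (dif A p1 x Z) (dif A F x W) + - B C (dif A t x W)"
    by (rule gauge_quadratic_eq[where ?\<eta>=\<zeta> and ?x=x and ?Z=Z and ?Y=W and ?\<sigma>1.0=F and ?\<sigma>2.0=t, OF \<zeta>_f section_F section_t f_eq 1])
  then show ?thesis
    using dF_dt_commute[of x Z W] sym[of "dif A t x Z" "dif A F x W"]
    by (simp add: C_def dif_p1 expand z second_ff_eq third_ff_eq algebra_simps)
qed

text \<open>Here II - H III is diagonal with eigenvalues \<plusminus>(r1 - r2)/2, so the signature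
  is (1, 1) at every point.\<close>

lemma gauge_quadratic_principal:
  assumes p: "principal x X Y r1 r2"
  shows "gauge_quadratic A f \<zeta> x X Y = 0"
    and "gauge_quadratic A f \<zeta> x X X * gauge_quadratic A f \<zeta> x Y Y < 0"
proof -
  have 0: "III x X Y = 0" and pos: "III x X X > 0" "III x Y Y > 0"
    using p third_positive by (auto simp: third_ff_eq principal_def)
  show "gauge_quadratic A f \<zeta> x X Y = 0"
    by (simp add: gauge_quadratic_\<zeta> II_principal[OF p] 0)
  have h: "H x = (r1 + r2) / 2" using H_principal[OF p] by simp
  have "gauge_quadratic A f \<zeta> x X X = lam x * (r1 - r2) * III x X X"
    "gauge_quadratic A f \<zeta> x Y Y = - (lam x * (r1 - r2)) * III x Y Y"
    unfolding gauge_quadratic_\<zeta> II_principal[OF p] h by (simp_all add: field_simps)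
  then have "gauge_quadratic A f \<zeta> x X X * gauge_quadratic A f \<zeta> x Y Y =
      - ((lam x * (r1 - r2))\<^sup>2 * (III x X X * III x Y Y))"
    by (simp add: power2_eq_square)
  moreover have "(lam x * (r1 - r2))\<^sup>2 > 0"
    using lam_nonzero[of x] p by (simp add: principal_def)
  ultimately show "gauge_quadratic A f \<zeta> x X X * gauge_quadratic A f \<zeta> x Y Y < 0"
    using mult_pos_pos pos by simp
qed

lemma gauge_quadratic_signature: "has_signature (gauge_quadratic A f \<zeta> x) 1 1"
proof -
  obtain X Y r1 r2 where p: "principal x X Y r1 r2" using principal_ex by blast
  have "symmetric_bilinear (gauge_quadratic A f \<zeta> x)"
  proof -
    have l: "linear (II x Z)" "linear (\<lambda>X. II x X Z)" "linear (III x Z)" "linear (\<lambda>X. III x X Z)"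
      and s: "II x Z W = II x W Z" "III x Z W = III x W Z" for Z W
      using second_symmetric_bilinear[of x] third_symmetric_bilinear[of x] by (auto simp: symmetric_bilinear_def)
    have "linear (\<lambda>W. 2 * lam x * (II x Z W - H x * III x Z W))" "linear (\<lambda>Z. 2 * lam x * (II x Z W - H x * III x Z W))" for Z W
      by (rule linearI; simp add: linear_add[OF l(1)] linear_cmul[OF l(1)] linear_add[OF l(2)] linear_cmul[OF l(2)]
          linear_add[OF l(3)] linear_cmul[OF l(3)] linear_add[OF l(4)] linear_cmul[OF l(4)] algebra_simps)+
    then show ?thesis using s by (simp add: symmetric_bilinear_def gauge_quadratic_\<zeta>[abs_def])
  qed
  from signature_1_1[OF this gauge_quadratic_principal[OF p]] show ?thesis .
qed

lemma Omega: "Omega_surface A B f \<zeta>"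
proof -
  have nd: "nondegenerate (gauge_quadratic A f \<zeta> x)" for x
    using nondegenerate_iff_no_null[OF gauge_quadratic_signature] by simp
  have nz: "\<exists>x X Y. gauge_quadratic A f \<zeta> x X Y \<noteq> 0"
  proof -
    fix x :: 'm
    obtain X Y r1 r2 where p: "principal x X Y r1 r2" using principal_ex by blast
    have "gauge_quadratic A f \<zeta> x X X \<noteq> 0" using gauge_quadratic_principal(2)[OF p] by auto
    then show ?thesis by blast
  qed
  have "gauge_potential A B f \<zeta>"
    unfolding gauge_potential_def using \<zeta>_smooth \<zeta>_wedge \<zeta>_closed \<zeta>_commute nz by auto
  moreover have "\<exists>D. open D \<and> closure D = UNIV \<and> (\<forall>x\<in>D. nondegenerate (gauge_quadratic A f \<zeta> x))"
    by (intro exI[of _ UNIV]) (simp add: nd)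
  moreover have "\<exists>r s. \<forall>x. has_signature (gauge_quadratic A f \<zeta> x) r s"
    using gauge_quadratic_signature by blast
  ultimately show ?thesis unfolding Omega_surface_def using legendre by simp
qed

text \<open>Along \<open>X\<close> one has dF = - r1 dt, so the choice 2 H = r1 + r2 leaves exactly
  r2 in the t-term: modulo the exterior square of f, \<zeta> is lam (F + r2 t) \<and> dt, and F + r2
  t is a multiple of \<sigma>2. This is what makes \<zeta> its own middle potential.\<close>

lemma \<zeta>_principal:
  assumes p: "principal x X Y r1 r2" and s: "\<sigma>2 x = g2 *\<^sub>R (F x + r2 *\<^sub>R t x)" "g2 \<noteq> 0" and sec: "section_at \<sigma>2 x"
  obtains k where "\<zeta> x X - k *\<^sub>R wedge B (\<sigma>2 x) (dif A \<sigma>2 x X) \<in> wedge_space B (f x) (f x)"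
proof -
  have s': "\<sigma>2 x = g2 *\<^sub>R F x + (g2 * r2) *\<^sub>R t x" using s(1) by (simp add: scaleR_add_right)
  have dF: "dif A F x X = - r1 *\<^sub>R dif A t x X" and r: "r1 \<noteq> r2" using p by (auto simp: principal_def)
  define w where "w = dif A \<sigma>2 x X - (g2 * (r2 - r1)) *\<^sub>R dif A t x X"
  have w: "w \<in> f x"
    using dif_section_lincomb[OF sec section_F section_t s', of X]
    unfolding dF w_def by (simp add: algebra_simps)
  \<comment> \<open>One factor g2 comes from \<sigma>2 = g2 (F + r2 t), the factor g2 (r2 - r1) from
    its derivative modulo f.\<close>
  define k where "k = lam x / (g2 * g2 * (r2 - r1))"
  have h: "2 * H x = r1 + r2" using H_principal[OF p] by simp
  have d: "dif A \<sigma>2 x X = (g2 * (r2 - r1)) *\<^sub>R dif A t x X + w" by (simp add: w_def)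
  have kk: "k * (g2 * (g2 * (r2 - r1))) = lam x" using s(2) r by (simp add: k_def)
  have "k *\<^sub>R wedge B (\<sigma>2 x) (dif A \<sigma>2 x X) =
      lam x *\<^sub>R wedge B (F x + r2 *\<^sub>R t x) (dif A t x X) + k *\<^sub>R wedge B (\<sigma>2 x) w"
    unfolding d wedge.add_right wedge.scaleR_right s(1) wedge.scaleR_left kk[symmetric]
    by (simp add: scaleR_add_right mult.assoc)
  moreover have "\<zeta> x X = lam x *\<^sub>R wedge B (F x + r2 *\<^sub>R t x) (dif A t x X) + dif A lam x X *\<^sub>R wedge B (F x) (t x)"
    unfolding \<zeta>_eq h dif_p1 dF
    by (simp add: wedge.add_right wedge.add_left wedge.scaleR_right wedge.scaleR_left algebra_simps)
  ultimately have "\<zeta> x X - k *\<^sub>R wedge B (\<sigma>2 x) (dif A \<sigma>2 x X) =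
      dif A lam x X *\<^sub>R wedge B (F x) (t x) + (- k) *\<^sub>R wedge B (\<sigma>2 x) w" by simp
  moreover have "\<dots> \<in> wedge_space B (f x) (f x)"
    by (intro subspace_add subspace_scale subspace_wedge_space wedge_space_memI F_mem t_mem section_at_mem sec w)
  ultimately show ?thesis using that[of k] by simp
qed

lemma middle_decomposition_\<zeta>:
  "\<exists>\<alpha>1 \<alpha>2 \<beta>. \<zeta> x Z = \<alpha>1 + \<alpha>2 + \<beta> \<and>
    \<alpha>1 \<in> wedge_space B (lie_cyclide A s1 (\<lambda>y. curvature_space A f y (s2 y)) x) (lie_cyclide A s1 (\<lambda>y. curvature_space A f y (s2 y)) x) \<and>
    \<alpha>2 \<in> wedge_space B (lie_cyclide A s2 (\<lambda>y. curvature_space A f y (s1 y)) x) (lie_cyclide A s2 (\<lambda>y. curvature_space A f y (s1 y)) x) \<and>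
    \<beta> \<in> wedge_space B (lie_cyclide A s1 (\<lambda>y. curvature_space A f y (s2 y)) x) (lie_cyclide A s2 (\<lambda>y. curvature_space A f y (s1 y)) x) \<and> \<beta> \<in> wedge_space B (f x) (f x)"
proof -
  obtain c \<sigma>1 \<sigma>2 X Y where C: "curvature_frame A B f s1 s2 c x \<sigma>1 \<sigma>2 X Y"
    using curvature_frame_ex[OF csb] .
  interpret C: curvature_frame A B f s1 s2 c x \<sigma>1 \<sigma>2 X Y by (rule C)
  define XX where "XX = coord_vec A c (X x) x"
  define YY where "YY = coord_vec A c (Y x) x"
  note dX = C.dif_X[folded XX_def] and dY = C.dif_Y[folded YY_def]
  obtain r1 r2 g1 g2 where p: "principal x XX YY r1 r2" "\<sigma>1 x = g1 *\<^sub>R (F x + r1 *\<^sub>R t x)"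
    "\<sigma>2 x = g2 *\<^sub>R (F x + r2 *\<^sub>R t x)" "g1 \<noteq> 0" "g2 \<noteq> 0"
    by (rule principal_frame[OF C.frame_m dX(3,1) dY(3,1)])
  obtain k where k: "\<zeta> x XX - k *\<^sub>R wedge B (\<sigma>2 x) C.d2 \<in> wedge_space B (f x) (f x)"
    by (rule \<zeta>_principal[OF p(1,3,5) C.\<sigma>2, unfolded dX(2)])
  obtain l where l: "\<zeta> x YY - l *\<^sub>R wedge B (\<sigma>1 x) C.d1 \<in> wedge_space B (f x) (f x)"
    by (rule \<zeta>_principal[OF principal_swap[OF p(1)] p(2,4) C.\<sigma>1, unfolded dY(2)])
  obtain a b where Z: "Z = a *\<^sub>R XX + b *\<^sub>R YY" by (rule principal_span[OF p(1)])
  define \<beta> where "\<beta> = a *\<^sub>R (\<zeta> x XX - k *\<^sub>R wedge B (\<sigma>2 x) C.d2) + b *\<^sub>R (\<zeta> x YY - l *\<^sub>R wedge B (\<sigma>1 x) C.d1)"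
  have \<beta>: "\<beta> \<in> wedge_space B (f x) (f x)"
    unfolding \<beta>_def by (intro subspace_add subspace_scale subspace_wedge_space k l)
  \<comment> \<open>The exterior square of f is the line of \<sigma>1 \<and> \<sigma>2, which lies
    in the mixed component because \<sigma>1 is in S_1 and \<sigma>2 in S_2.\<close>
  obtain g where g: "\<beta> = g *\<^sub>R wedge B (\<sigma>1 x) (\<sigma>2 x)" using wedge_space_2[OF \<beta>, of "\<sigma>1 x" "\<sigma>2 x"] C.f_m by auto
  let ?S1 = "lie_cyclide A s1 (\<lambda>y. curvature_space A f y (s2 y)) x"
  let ?S2 = "lie_cyclide A s2 (\<lambda>y. curvature_space A f y (s1 y)) x"
  have "\<zeta> x Z = (b * l) *\<^sub>R wedge B (\<sigma>1 x) C.d1 + (a * k) *\<^sub>R wedge B (\<sigma>2 x) C.d2 + \<beta>"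
    unfolding \<beta>_def Z by (simp add: linear_add[OF \<zeta>_linear] linear_cmul[OF \<zeta>_linear] algebra_simps)
  moreover have "(b * l) *\<^sub>R wedge B (\<sigma>1 x) C.d1 \<in> wedge_space B ?S1 ?S1"
    by (intro subspace_scale subspace_wedge_space wedge_space_memI C.cyclide1)
  moreover have "(a * k) *\<^sub>R wedge B (\<sigma>2 x) C.d2 \<in> wedge_space B ?S2 ?S2"
    by (intro subspace_scale subspace_wedge_space wedge_space_memI C.cyclide2)
  moreover have "\<beta> \<in> wedge_space B ?S1 ?S2"
    unfolding g by (intro subspace_scale subspace_wedge_space wedge_space_memI C.cyclide1 C.cyclide2)
  ultimately show ?thesis using \<beta> by blast
qed

lemma middle_\<zeta>: "middle_potential A B f \<zeta> \<zeta>"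
  unfolding middle_potential_def Let_def
proof (rule conjI)
  have "(\<lambda>_. 0) \<in> sections A (\<lambda>x. wedge_space B (f x) (f x)) UNIV"
    using smooth_map_iff_smooth_at[OF open_UNIV] smooth_at_const subspace_0[OF subspace_wedge_space]
    by (auto simp: sections_def)
  moreover have "\<zeta> = (\<lambda>x X. \<zeta> x X - dif A (\<lambda>_. 0) x X)" by (simp add: dif_const)
  ultimately show "\<zeta> \<in> gauge_orbit A B f \<zeta>" unfolding gauge_orbit_def by blast
  show "\<exists>s1 s2. curvature_sphere_bundles A f s1 s2 \<and>
      (\<forall>x X. \<exists>\<alpha>1 \<alpha>2 \<beta>. \<zeta> x X = \<alpha>1 + \<alpha>2 + \<beta> \<and>
        \<alpha>1 \<in> wedge_space B (lie_cyclide A s1 (\<lambda>y. curvature_space A f y (s2 y)) x) (lie_cyclide A s1 (\<lambda>y. curvature_space A f y (s2 y)) x) \<and>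
        \<alpha>2 \<in> wedge_space B (lie_cyclide A s2 (\<lambda>y. curvature_space A f y (s1 y)) x) (lie_cyclide A s2 (\<lambda>y. curvature_space A f y (s1 y)) x) \<and>
        \<beta> \<in> wedge_space B (lie_cyclide A s1 (\<lambda>y. curvature_space A f y (s2 y)) x) (lie_cyclide A s2 (\<lambda>y. curvature_space A f y (s1 y)) x) \<and>
        \<beta> \<in> wedge_space B (f x) (f x))"
    by (rule exI[of _ s1], rule exI[of _ s2]) (intro conjI[OF csb] allI middle_decomposition_\<zeta>)
qed

section \<open>The polynomial conserved quantity\<close>

definition pcoef :: "nat \<Rightarrow> 'm \<Rightarrow> 'v" where
  "pcoef k = (if k = 0 then (\<lambda>_. qinf) else if k = 1 then p1 else (\<lambda>_. 0))"

lemma poly_pcoef: "poly_section pcoef 1 r x = qinf + r *\<^sub>R p1 x"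
  by (simp add: poly_section_def pcoef_def atMost_Suc)

lemma conserved_pcoef: "conserved_quantity A \<zeta> 1 pcoef"
  unfolding conserved_quantity_def
proof (intro conjI allI impI)
  show "smooth_map A UNIV (pcoef k)" for k
    unfolding smooth_map_iff_smooth_at[OF open_UNIV] pcoef_def using p1_smooth smooth_at_const by auto
  show "pcoef 1 \<noteq> (\<lambda>_. 0)"
  proof
    assume a: "pcoef 1 = (\<lambda>_. 0)"
    fix x :: 'm
    have "lam x *\<^sub>R t x = 0" using fun_cong[OF a, of x] by (simp add: pcoef_def p1_def)
    then have "t x = 0" using lam_nonzero by simp
    then show False using t(2)[of x] by (simp add: expand)
  qed
  show "pcoef k = (\<lambda>_. 0)" if "1 < k" for k using that by (simp add: pcoef_def)
  fix r x X
  have "dif A (poly_section pcoef 1 r) x X = dif A (\<lambda>x. qinf + r *\<^sub>R p1 x) x X"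
    by (rule dif_cong) (simp only: poly_pcoef always_eventually simp_thms)
  also have "\<dots> = dif A (\<lambda>_. qinf) x X + dif A (\<lambda>x. r *\<^sub>R p1 x) x X"
    by (intro dif_add smooth_at_const smooth_at_scaleR p1_smooth)
  also have "dif A (\<lambda>x. r *\<^sub>R p1 x) x X = r *\<^sub>R dif A p1 x X"
    by (intro dif_bounded_linear bounded_linear_scaleR_right p1_smooth)
  finally have 1: "dif A (poly_section pcoef 1 r) x X = r *\<^sub>R dif A p1 x X" by (simp add: dif_const)
  have "blinfun_apply (\<zeta> x X) qinf = - dif A p1 x X"
    using F(1)[of x] t(1)[of x] dif_F_t[of x X]
    by (simp add: \<zeta>_eq blinfun.add_left wedge_app expand dif_p1)
  then have "blinfun_apply (\<zeta> x X) (poly_section pcoef 1 r x) = - dif A p1 x X"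
    using \<zeta>_f[OF p1_mem] unfolding poly_pcoef by (simp add: blinfun.add_right blinfun.scaleR_right)
  then show "dif A (poly_section pcoef 1 r) x X + r *\<^sub>R blinfun_apply (\<zeta> x X) (poly_section pcoef 1 r x) = 0"
    using 1 by simp
qed

lemma poly_null: "B (poly_section pcoef 1 r x) (poly_section pcoef 1 r x) = 0"
  using qinf t(1)[of x] F_t'(3)[of x] isotropic[OF t_mem t_mem, of x]
  unfolding poly_pcoef by (simp add: p1_def expand)

lemma middle_conserved: "middle_conserved_quantity A B f \<zeta> 1 pcoef"
  unfolding middle_conserved_quantity_def using middle_\<zeta> conserved_pcoef by blast

lemma special: "special_Omega_surface A B f \<zeta> 1"
  unfolding special_Omega_surface_def umbilic_free_def using csb Omega middle_conserved by blast

end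

section \<open>Assembly of the two implications\<close>

lemma poly_section_1: "poly_section p 1 r x = p 0 x + r *\<^sub>R p 1 x"
  by (simp add: poly_section_def atMost_Suc)

lemma (in gauge) conserved:
  assumes csb: "curvature_sphere_bundles A f s1 s2"
    and middle: "\<And>x X. \<exists>\<alpha>1 \<alpha>2 \<beta>. \<zeta> x X = \<alpha>1 + \<alpha>2 + \<beta> \<and>
      \<alpha>1 \<in> wedge_space B (lie_cyclide A s1 (\<lambda>y. curvature_space A f y (s2 y)) x)
        (lie_cyclide A s1 (\<lambda>y. curvature_space A f y (s2 y)) x) \<and>
      \<alpha>2 \<in> wedge_space B (lie_cyclide A s2 (\<lambda>y. curvature_space A f y (s1 y)) x)
        (lie_cyclide A s2 (\<lambda>y. curvature_space A f y (s1 y)) x) \<and>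
      \<beta> \<in> wedge_space B (f x) (f x)"
    and cq: "conserved_quantity A \<zeta> 1 p"
    and p0: "\<And>x. poly_section p 1 0 x = qinf"
    and null: "\<And>r x. B (poly_section p 1 r x) (poly_section p 1 r x) = 0"
    and qinf: "qinf \<noteq> 0" "B qinf qinf = 0"
  shows "conserved A B f s1 s2 \<zeta> (p 1) qinf"
proof unfold_locales
  have p_eq: "poly_section p 1 r x = qinf + r *\<^sub>R p 1 x" for r x
    using p0[of x] by (simp add: poly_section_1[unfolded One_nat_def])
  have sm: "smooth_at A (p 1) x" for x
    using cq by (simp add: conserved_quantity_def smooth_map_iff_smooth_at[OF open_UNIV])
  have n: "2 * r * B (p 1 x) qinf + r * r * B (p 1 x) (p 1 x) = 0" for r x
    using null[of r x] qinf(2) sym[of qinf "p 1 x"] unfolding p_eq by (simp add: expand algebra_simps)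
  have e: "r *\<^sub>R dif A (p 1) x X + r *\<^sub>R (blinfun_apply (\<zeta> x X) qinf + r *\<^sub>R blinfun_apply (\<zeta> x X) (p 1 x)) = 0"
    for r x X
  proof -
    have "dif A (poly_section p 1 r) x X = dif A (\<lambda>x. qinf + r *\<^sub>R p 1 x) x X"
      by (rule dif_cong) (simp only: p_eq always_eventually simp_thms)
    also have "\<dots> = dif A (\<lambda>_. qinf) x X + dif A (\<lambda>x. r *\<^sub>R p 1 x) x X"
      by (intro dif_add smooth_at_const smooth_at_scaleR sm)
    also have "dif A (\<lambda>x. r *\<^sub>R p 1 x) x X = r *\<^sub>R dif A (p 1) x X"
      by (intro dif_bounded_linear bounded_linear_scaleR_right sm)
    finally have d: "dif A (poly_section p 1 r) x X = r *\<^sub>R dif A (p 1) x X" by (simp add: dif_const)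
    have "dif A (poly_section p 1 r) x X + r *\<^sub>R blinfun_apply (\<zeta> x X) (poly_section p 1 r x) = 0"
      using cq by (simp add: conserved_quantity_def)
    then show ?thesis unfolding d p_eq by (simp only: blinfun.add_right blinfun.scaleR_right)
  qed
  \<comment> \<open>The values 1 and -1 of the parameter separate the coefficients of r and
    r^2.\<close>
  have s: "dif A (p 1) x X + blinfun_apply (\<zeta> x X) qinf + blinfun_apply (\<zeta> x X) (p 1 x) = 0"
    "blinfun_apply (\<zeta> x X) (p 1 x) = dif A (p 1) x X + blinfun_apply (\<zeta> x X) qinf" for x X
    using e[of 1 x X] e[of "-1" x X] by (simp_all add: algebra_simps)
  have "2 *\<^sub>R blinfun_apply (\<zeta> x X) (p 1 x) = 0" for x X
    using s[of x X] unfolding scaleR_2 by simp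
  then show z: "blinfun_apply (\<zeta> x X) (p 1 x) = 0" for x X by simp
  show "dif A (p 1) x X = - blinfun_apply (\<zeta> x X) qinf" for x X
    using s(1)[of x X] unfolding z by (simp add: eq_neg_iff_add_eq_0)
  show "B (p 1 x) (p 1 x) = 0" "B (p 1 x) qinf = 0" for x
    using n[of 1 x] n[of "-1" x] by simp_all
  show "(dif A \<sigma>2 x Y \<in> f x \<longrightarrow> (\<exists>Z. blinfun_apply (\<zeta> x Z) (dif A \<sigma>1 x Y) \<noteq> 0)) \<and>
      (dif A \<sigma>1 x Y \<in> f x \<longrightarrow> (\<exists>Z. blinfun_apply (\<zeta> x Z) (dif A \<sigma>2 x Y) \<noteq> 0))"
    if "frame_at s1 s2 \<sigma>1 \<sigma>2 x" "Y \<noteq> 0" for x \<sigma>1 \<sigma>2 Y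
    using \<zeta>_nondegenerate[OF that] \<zeta>_nondegenerate[OF frame_at_swap[OF that(1)] that(2)] by (intro conjI impI)
  show "smooth_at A (p 1) x" for x by (rule sm)
qed (rule csb \<zeta>_smooth middle qinf | erule \<zeta>_f)+

lemma (in legendre) L_isothermic_of_conserved:
  assumes Omega: "Omega_surface A B f \<eta>" and mcq: "middle_conserved_quantity A B f \<eta> 1 p"
    and p0: "\<And>x. poly_section p 1 0 x = qinf"
    and null: "\<And>r x. B (poly_section p 1 r x) (poly_section p 1 r x) = 0"
    and qinf: "qinf \<noteq> 0" "B qinf qinf = 0"
    and l: "laguerre_frame B qinf q0 pp"
  shows "\<exists>x n. projects_to A B qinf q0 pp f x n \<and> L_isothermic A B x n"
proof -
  obtain \<zeta> where mp: "middle_potential A B f \<eta> \<zeta>" and cq: "conserved_quantity A \<zeta> 1 p"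
    using mcq unfolding middle_conserved_quantity_def by (elim exE conjE)
  obtain \<tau> where \<tau>: "\<tau> \<in> sections A (\<lambda>x. wedge_space B (f x) (f x)) UNIV"
    and \<zeta>: "\<zeta> = (\<lambda>x X. \<eta> x X - dif A \<tau> x X)"
    using mp unfolding middle_potential_def gauge_orbit_def mem_Collect_eq by (elim exE conjE)
  interpret G: gauge A B f \<eta> \<tau> by unfold_locales (rule Omega \<tau>)+
  have \<zeta>_eq: "\<zeta> = G.\<zeta>" unfolding \<zeta> by (intro ext) (simp add: G.\<zeta>_def)
  obtain s1 s2 where csb: "curvature_sphere_bundles A f s1 s2"
    and mid: "\<forall>x X. \<exists>\<alpha>1 \<alpha>2 \<beta>. \<zeta> x X = \<alpha>1 + \<alpha>2 + \<beta> \<and>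
      \<alpha>1 \<in> wedge_space B (lie_cyclide A s1 (\<lambda>y. curvature_space A f y (s2 y)) x)
        (lie_cyclide A s1 (\<lambda>y. curvature_space A f y (s2 y)) x) \<and>
      \<alpha>2 \<in> wedge_space B (lie_cyclide A s2 (\<lambda>y. curvature_space A f y (s1 y)) x)
        (lie_cyclide A s2 (\<lambda>y. curvature_space A f y (s1 y)) x) \<and>
      \<beta> \<in> wedge_space B (lie_cyclide A s1 (\<lambda>y. curvature_space A f y (s2 y)) x)
        (lie_cyclide A s2 (\<lambda>y. curvature_space A f y (s1 y)) x) \<and> \<beta> \<in> wedge_space B (f x) (f x)"
    using mp unfolding middle_potential_def Let_def by (elim exE conjE)
  have C: "conserved A B f s1 s2 G.\<zeta> (p 1) qinf"
  proof (rule G.conserved[OF csb _ cq[unfolded \<zeta>_eq] p0 null qinf])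
    fix x X
    show "\<exists>\<alpha>1 \<alpha>2 \<beta>. G.\<zeta> x X = \<alpha>1 + \<alpha>2 + \<beta> \<and>
      \<alpha>1 \<in> wedge_space B (lie_cyclide A s1 (\<lambda>y. curvature_space A f y (s2 y)) x)
        (lie_cyclide A s1 (\<lambda>y. curvature_space A f y (s2 y)) x) \<and>
      \<alpha>2 \<in> wedge_space B (lie_cyclide A s2 (\<lambda>y. curvature_space A f y (s1 y)) x)
        (lie_cyclide A s2 (\<lambda>y. curvature_space A f y (s1 y)) x) \<and>
      \<beta> \<in> wedge_space B (f x) (f x)"
      using mid[rule_format, of x X] unfolding \<zeta>_eq by (elim exE conjE) (intro exI conjI)
  qed
  obtain F t where L: "conserved_lift A B f s1 s2 G.\<zeta> (p 1) qinf q0 pp F t"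
    by (rule conserved.lift_ex[OF C l])
  interpret L: conserved_lift A B f s1 s2 G.\<zeta> "p 1" qinf q0 pp F t by (rule L)
  show ?thesis
    by (intro exI conjI) (rule L.projects, rule L.L_isothermic[OF G.\<zeta>_closed])
qed

text \<open>The lifts are the two spanning sections named in \<open>projects_to\<close>; projecting
  them back recovers the given x and n, so the hypotheses on these become statements about
  \<open>point_map\<close> and \<open>normal_map\<close>.\<close>

lemma (in legendre) projection_lift:
  assumes l: "laguerre_frame B qinf q0 pp" and p: "projects_to A B qinf q0 pp f x n"
    and qinf: "qinf \<noteq> 0" "B qinf qinf = 0"
  obtains F t where "lift A B f qinf q0 pp F t" "lift.point_map B qinf q0 F = x"
    "lift.normal_map B qinf q0 pp t = n"
proof -
  have L: "B q0 q0 = 0" "B q0 qinf = -1" "B pp q0 = 0" "B pp qinf = 0" "B pp pp = -1"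
    "B qinf q0 = -1" "B q0 pp = 0" "B qinf pp = 0"
    using l sym[of q0 qinf] sym[of q0 pp] sym[of qinf pp] by (auto simp: laguerre_frame_def)
  have xn: "B (x m) q0 = 0" "B (x m) qinf = 0" "B (x m) pp = 0" "B (n m) q0 = 0" "B (n m) qinf = 0" "B (n m) pp = 0" for m
    using p by (auto simp: projects_to_def perp_def)
  have sm: "smooth_at A x m" "smooth_at A n m" for m
    using p by (simp_all add: projects_to_def smooth_map_iff_smooth_at[OF open_UNIV])
  define F where "F m = x m + q0 + (B (x m) (x m) / 2) *\<^sub>R qinf" for m
  define t where "t m = n m + pp + B (n m) (x m) *\<^sub>R qinf" for m
  have lift: "lift A B f qinf q0 pp F t"
  proof unfold_locales
    have h: "F = (\<lambda>m. x m + q0 + (inverse 2 * B (x m) (x m)) *\<^sub>R qinf)" by (intro ext) (simp add: F_def field_simps)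
    show "smooth_at A F m" for m
      unfolding h by (intro smooth_at_add smooth_at_scaleR smooth_at_B smooth_at_mult smooth_at_const sm)
    show "smooth_at A t m" for m
      unfolding t_def[abs_def] by (intro smooth_at_add smooth_at_scaleR smooth_at_B smooth_at_const sm)
    show "f m = span {F m, t m}" for m using p by (simp add: projects_to_def F_def t_def)
    show "B (F m) qinf = -1" "B (F m) pp = 0" "B (t m) qinf = 0" "B (t m) pp = -1" for m
      by (simp_all add: F_def t_def expand xn L qinf)
  qed (rule l qinf)+
  have "lift.point_map B qinf q0 F = x"
    by (rule ext) (simp add: lift.point_map_def[OF lift], simp add: F_def expand xn L)
  moreover have "lift.normal_map B qinf q0 pp t = n"
    by (rule ext) (simp add: lift.normal_map_def[OF lift], simp add: t_def expand xn L)
  ultimately show ?thesis by (rule that[OF lift])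
qed

lemma (in legendre) special_of_L_isothermic:
  assumes uf: "umbilic_free A f" and l: "laguerre_frame B qinf q0 pp" and p: "projects_to A B qinf q0 pp f x n"
    and iso: "L_isothermic A B x n" and qinf: "qinf \<noteq> 0" "B qinf qinf = 0"
  shows "\<exists>\<eta> p. special_Omega_surface A B f \<eta> 1 \<and> middle_conserved_quantity A B f \<eta> 1 p \<and>
    (\<forall>x. poly_section p 1 0 x = qinf) \<and> (\<forall>t x. B (poly_section p 1 t x) (poly_section p 1 t x) = 0)"
proof -
  obtain F t where lift: "lift A B f qinf q0 pp F t" and x: "lift.point_map B qinf q0 F = x"
    and n: "lift.normal_map B qinf q0 pp t = n"
    by (rule projection_lift[OF l p qinf])
  interpret lift A B f qinf q0 pp F t by (rule lift)
  obtain s1 s2 where csb: "curvature_sphere_bundles A f s1 s2"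
    using uf unfolding umbilic_free_def by (elim exE)
  from iso obtain q \<mu> where nd: "\<forall>m. nondegenerate (third_ff A B n m)"
    and q: "holomorphic_quadratic_differential A (third_ff A B n) q" "\<exists>m X Y. q m X Y \<noteq> 0"
    and c: "\<forall>m e1 e2. conformal_frame (third_ff A B n m) e1 e2 \<longrightarrow>
      part20 (second_ff A B x n m) e1 e2 = of_real (\<mu> m) * part20 (q m) e1 e2"
    unfolding L_isothermic_def
    by (elim exE conjE) (rule that, assumption, assumption, rule exI, rule exI, rule exI, assumption, assumption)
  interpret iso_lift A B f qinf q0 pp F t s1 s2 q \<mu>
  proof unfold_locales
    show "curvature_sphere_bundles A f s1 s2" by (rule csb)
    show "nondegenerate (third_ff A B normal_map m)" for m unfolding n using nd by (rule spec)
    show "holomorphic_quadratic_differential A (third_ff A B normal_map) q" unfolding n by (rule q)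
    show "\<exists>m X Y. q m X Y \<noteq> 0" by (rule q)
    show "part20 (second_ff A B point_map normal_map m) e1 e2 = of_real (\<mu> m) * part20 (q m) e1 e2"
      if "conformal_frame (third_ff A B normal_map m) e1 e2" for m e1 e2
      unfolding x n by (rule c[rule_format, OF that[unfolded n]])
  qed
  show ?thesis
  proof (rule exI[of _ \<zeta>], rule exI[of _ pcoef], intro conjI allI)
    show "poly_section pcoef 1 0 x = qinf" for x unfolding poly_pcoef by simp
  qed (rule special middle_conserved poly_null)+
qed

theorem theorem5p11:
  fixes A :: "'m::{t2_space, second_countable_topology} chart set"
    and B :: "'v::euclidean_space \<Rightarrow> 'v \<Rightarrow> real"
    and f :: "'m \<Rightarrow> 'v set"
    and qinf :: 'v
  assumes "smooth_surface A"
    and "lie_sphere_form B"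
    and "legendre_map A B f"
    and "umbilic_free A f"
    and "qinf \<noteq> 0"
    and "B qinf qinf = 0"
  shows
    "((\<exists>\<eta> p. special_Omega_surface A B f \<eta> 1 \<and> middle_conserved_quantity A B f \<eta> 1 p \<and>
         (\<forall>x. poly_section p 1 0 x = qinf) \<and>
         (\<forall>t x. B (poly_section p 1 t x) (poly_section p 1 t x) = 0))
       \<longrightarrow> (\<forall>q0 pp. laguerre_frame B qinf q0 pp \<longrightarrow>
             (\<exists>x n. projects_to A B qinf q0 pp f x n \<and> L_isothermic A B x n))) \<and>
     ((\<exists>q0 pp x n. laguerre_frame B qinf q0 pp \<and>
         projects_to A B qinf q0 pp f x n \<and> L_isothermic A B x n)
       \<longrightarrow> (\<exists>\<eta> p. special_Omega_surface A B f \<eta> 1 \<and> middle_conserved_quantity A B f \<eta> 1 p \<and>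
             (\<forall>x. poly_section p 1 0 x = qinf) \<and>
             (\<forall>t x. B (poly_section p 1 t x) (poly_section p 1 t x) = 0)))"
proof -
  interpret legendre A B f by unfold_locales (rule assms)+
  show ?thesis
  proof (intro conjI impI allI; elim exE conjE)
    fix q0 pp \<eta> p
    assume l: "laguerre_frame B qinf q0 pp" and s: "special_Omega_surface A B f \<eta> 1"
      and m: "middle_conserved_quantity A B f \<eta> 1 p" and p0: "\<forall>x. poly_section p 1 0 x = qinf"
      and null: "\<forall>t x. B (poly_section p 1 t x) (poly_section p 1 t x) = 0"
    have "Omega_surface A B f \<eta>" using s by (simp add: special_Omega_surface_def)
    then show "\<exists>x n. projects_to A B qinf q0 pp f x n \<and> L_isothermic A B x n"
      by (rule L_isothermic_of_conserved[OF _ m p0[rule_format] null[rule_format] assms(5,6) l])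
  next
    fix q0 pp x n
    assume "laguerre_frame B qinf q0 pp" "projects_to A B qinf q0 pp f x n" "L_isothermic A B x n"
    then show "\<exists>\<eta> p. special_Omega_surface A B f \<eta> 1 \<and> middle_conserved_quantity A B f \<eta> 1 p \<and>
        (\<forall>x. poly_section p 1 0 x = qinf) \<and> (\<forall>t x. B (poly_section p 1 t x) (poly_section p 1 t x) = 0)"
      by (rule special_of_L_isothermic[OF assms(4) _ _ _ assms(5,6)])
  qed
qed

end
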